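(* Let $X=H^1_{\mathrm{per}}([0,2\pi],\mathbb{C})$. Let $W:\mathbb{R}\to\mathbb{C}$ be a solution of $$W_{xx}(x)+W(x)-|W(x)|^2W(x)=0,\qquad x\in\mathbb{R},$$ of the form $W(x)=e^{ipx}Q_{\mathrm{per}}(2kx)$ with $p\in\mathbb{R}$, $k>0$ and $Q_{\mathrm{per}}\in X$, where, if $|W|$ is not constant, $k=\pi/T$ with $T>0$ the minimal period of $|W|$. Then there exist $C_0>0$ and $\epsilon_0>0$ such that, for all $R\in X$ with $\|R\|_X\le\epsilon_0$, the solution $U(x,t)=e^{i(px-t)}Q(2kx,t)$ of the defocusing nonlinear Schrödinger equation $$iU_t(x,t)+U_{xx}(x,t)-|U(x,t)|^2U(x,t)=0,\qquad x\in\mathbb{R},\ t\in\mathbb{R},$$ with initial data $U(x,0)=e^{ipx}\bigl(Q_{\mathrm{per}}(2kx)+R(2kx)\bigr)$ satisfies, for all $t\in\mathbb{R}$, $$\inf_{\phi,\xi\in[0,2\pi]}\bigl\|Q(\cdot,t)-e^{i\phi}Q_{\mathrm{per}}(\cdot-\xi)\bigr\|_X\le C_0\|R\|_X .$$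
   Context: $X=H^1_{\mathrm{per}}([0,2\pi],\mathbb{C})=\{Q\in H^1_{\mathrm{loc}}(\mathbb{R},\mathbb{C})\mid Q(z)=Q(z+2\pi)\text{ for all }z\in\mathbb{R}\}$, with norm $\|u\|_X^2=\int_0^{2\pi}(|u(z)|^2+|u_z(z)|^2)\,dz$. Writing $U(x,t)=e^{i(px-t)}Q(2kx,t)$, the Schrödinger equation becomes $iQ_t+4ipkQ_z+4k^2Q_{zz}+(1-p^2)Q-|Q|^2Q=0$, whose Cauchy problem is globally well-posed in $X$; "the solution" means the one for which $Q(\cdot,t)\in X$ is this unique global solution with $Q(\cdot,0)=Q_{\mathrm{per}}+R$. *)

theory Defs
  imports "HOL-Analysis.Analysis"
begin

definition L2_loc :: "(real \<Rightarrow> complex) set" where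
  "L2_loc = {g \<in> borel_measurable lborel.
     \<forall>a b. set_integrable lborel {a..b} (\<lambda>x. (cmod (g x))\<^sup>2)}"

(* Weak derivatives are taken against C^1 functions with compact support; phi' is the
   (continuous) derivative of the test function phi.  Real test functions suffice for
   complex-valued u, by linearity. *)
definition has_weak_derivative :: "(real \<Rightarrow> complex) \<Rightarrow> (real \<Rightarrow> complex) \<Rightarrow> bool" where
  "has_weak_derivative u g \<longleftrightarrow>
     (\<forall>\<phi> \<phi>' :: real \<Rightarrow> real.
        (\<forall>x. (\<phi> has_real_derivative \<phi>' x) (at x)) \<and> continuous_on UNIV \<phi>' \<and>
        (\<exists>a b. \<forall>x. x \<notin> {a..b} \<longrightarrow> \<phi> x = 0) \<longrightarrow>
        (LBINT x. \<phi>' x *\<^sub>R u x) = - (LBINT x. \<phi> x *\<^sub>R g x))"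

(* A class in H^1_loc is represented by its unique continuous representative, which is
   automatically locally square integrable. *)
definition H1_loc :: "(real \<Rightarrow> complex) set" where
  "H1_loc = {u. continuous_on UNIV u \<and> (\<exists>g\<in>L2_loc. has_weak_derivative u g)}"

(* Determined up to a null set for u in H^1_loc; it is only used under integrals. *)
definition weak_deriv :: "(real \<Rightarrow> complex) \<Rightarrow> real \<Rightarrow> complex" where
  "weak_deriv u = (SOME g. g \<in> L2_loc \<and> has_weak_derivative u g)"

definition H1_per :: "(real \<Rightarrow> complex) set" where
  "H1_per = {u \<in> H1_loc. \<forall>z. u (z + 2 * pi) = u z}"

definition norm_X :: "(real \<Rightarrow> complex) \<Rightarrow> real" where
  "norm_X u = sqrt (LBINT z:{0..2*pi}. (cmod (u z))\<^sup>2 + (cmod (weak_deriv u z))\<^sup>2)"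

definition inner_per :: "(real \<Rightarrow> complex) \<Rightarrow> (real \<Rightarrow> complex) \<Rightarrow> complex" where
  "inner_per u v = (LBINT z:{0..2*pi}. u z * cnj (v z))"

(* W'' + W - |W|^2 W = 0 in the classical sense. *)
definition stationary_NLS :: "(real \<Rightarrow> complex) \<Rightarrow> bool" where
  "stationary_NLS W \<longleftrightarrow>
     (\<exists>W' W''. \<forall>x. (W has_vector_derivative W' x) (at x) \<and>
        (W' has_vector_derivative W'' x) (at x) \<and>
        W'' x + W x - of_real ((cmod (W x))\<^sup>2) * W x = 0)"

definition minimal_period :: "(real \<Rightarrow> 'a) \<Rightarrow> real \<Rightarrow> bool" where
  "minimal_period f T \<longleftrightarrow>
     T > 0 \<and> (\<forall>x. f (x + T) = f x) \<and> (\<forall>S. 0 < S \<and> S < T \<longrightarrow> \<not> (\<forall>x. f (x + S) = f x))"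

(* Q t is the function Q(.,t).  Substituting U(x,t) = exp(i(px-t)) Q(2kx,t) into
   i U_t + U_xx - |U|^2 U = 0 gives
     i Q_t + 4ipk Q_z + 4k^2 Q_zz + (1-p^2) Q - |Q|^2 Q = 0.
   A global solution in X is a curve in C(R,X) that satisfies this equation in the dual of X
   at every time, i.e. after pairing with every v in X; in the Q_zz term one derivative is
   moved to v, without boundary terms by periodicity. *)
definition solves_NLS_in_X :: "real \<Rightarrow> real \<Rightarrow> (real \<Rightarrow> real \<Rightarrow> complex) \<Rightarrow> bool" where
  "solves_NLS_in_X p k Q \<longleftrightarrow>
     (\<forall>t. Q t \<in> H1_per) \<and>
     (\<forall>t. ((\<lambda>s. norm_X (\<lambda>z. Q s z - Q t z)) \<longlongrightarrow> 0) (at t)) \<and>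
     (\<forall>v\<in>H1_per. \<forall>t. \<exists>D.
        ((\<lambda>s. inner_per (Q s) v) has_vector_derivative D) (at t) \<and>
        \<i> * D
        + 4 * \<i> * of_real (p * k) * inner_per (weak_deriv (Q t)) v
        - 4 * of_real (k\<^sup>2) * inner_per (weak_deriv (Q t)) (weak_deriv v)
        + of_real (1 - p\<^sup>2) * inner_per (Q t) v
        - inner_per (\<lambda>z. of_real ((cmod (Q t z))\<^sup>2) * Q t z) v = 0)"

end

theory Submission
  imports Defs
begin

text \<open>
  Mass, momentum and energy are conserved, and \<open>Qper\<close> is a critical point of a linear combination
  of them. If its second variation is coercive on the perturbations that are tangent to the level sets
  of mass and momentum, modulo the tangent space of the orbit under rotations and translations, then
  the deviation of the conserved quantities controls the squared distance to the orbit as long as that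
  distance is small, and by continuity in time it remains small.

  For a wave of constant modulus coercivity is elementary. Otherwise let \<open>T\<close> be the period of
  \<open>s = |W|\<^sup>2\<close> and write perturbations as \<open>W (A + \<i> \<Theta>)\<close>. The Hessian is a sum of squares in \<open>\<Theta>\<close> plus
  a quadratic form in \<open>A\<close> with an explicit zero mode; Jacobi's factorisation by this mode gives
  positivity when \<open>A\<close> vanishes at two suitable points \<open>\<plusminus>x0\<close> and \<open>\<Theta>\<close> at one
  (for \<open>J = 0\<close>, where \<open>W\<close> has zeros, a weighted Poincare inequality does this). So the Hessian is positive
  on a subspace of codimension three. The tangent space of the orbit takes up two of these dimensions
  and one explicit negative direction the third. That the constraints exclude the negative direction
  amounts to the sign of two determinants in the mean of \<open>s\<close> and the roots of the cubic
  \<open>s'\<^sup>2 = 2 s\<^sup>3 - 4 s\<^sup>2 + 8 E s - 4 J\<^sup>2\<close>.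

  A solution is differentiable in time only in the dual of \<open>X\<close>. Its correlation with its own
  translate by \<open>h\<close> is nevertheless differentiable, with an explicit derivative in which the linear
  terms of the equation cancel, and the orders 0, 1 and 2 in \<open>h\<close> give the three conservation laws.
\<close>

section \<open>Calculus\<close>

text \<open>Coercivity is drawn from ordinary differential equations, without spectral theory.
  Jacobi's factorisation needs a zero mode without zeros, but for \<open>J \<noteq> 0\<close> none
  serves a whole period: \<open>ds\<close> is itself a zero mode, and every independent one vanishes
  between its zeros 0 and \<open>T / 2\<close>. Hence two modes, even about 0 and about
  \<open>T / 2\<close>, are joined at \<open>\<plusminus>x0\<close>, which is the origin of the
  point conditions. The fields on which the constraints are tested come from two nonlocal
  symmetries; their secular terms are cancelled by those of scaling and Galilean boost, so that the
  combinations have the multiplier of the wave. In the time-dependent part there are no modulation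
  equations. The nearest point of the orbit exists by compactness, and by convexity of the norm it
  stays nearest when the orbit is replaced by its tangent space; thus coercivity modulo tangent
  vectors becomes coercivity. Weak derivatives are arbitrary representatives, so calculus is done on
  pairs of a function and a derivative linked by integration.\<close>

lemma discriminant_nonpos:
  fixes F G K :: real
  assumes pos: "\<And>t. F - 2 * t * K + t\<^sup>2 * G \<ge> 0" and G0: "G \<ge> 0"
  shows "K\<^sup>2 \<le> F * G"
proof (cases "G = 0")
  case True
  have "K = 0"
  proof (rule ccontr)
    assume "K \<noteq> 0"
    then have "F - 2 * ((F + 1) / (2 * K)) * K = - 1" by (simp add: field_simps)
    with pos[of "(F + 1) / (2 * K)"] True show False by simp
  qed
  then show ?thesis using True by simp
next
  case False
  then have "G > 0" using G0 by simp
  have "F - 2 * (K / G) * K + (K / G)\<^sup>2 * G = F - K\<^sup>2 / G"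
    using False by (simp add: power2_eq_square field_simps)
  then have "K\<^sup>2 / G \<le> F" using pos[of "K / G"] by linarith
  then show ?thesis using \<open>G > 0\<close> by (simp add: pos_divide_le_eq)
qed

lemma Cauchy_Schwarz_integral:
  fixes f g :: "real \<Rightarrow> real"
  assumes "continuous_on {a..b} f" "continuous_on {a..b} g"
  shows "(integral {a..b} (\<lambda>x. f x * g x))\<^sup>2
    \<le> integral {a..b} (\<lambda>x. (f x)\<^sup>2) * integral {a..b} (\<lambda>x. (g x)\<^sup>2)"
proof -
  define F G K where "F = integral {a..b} (\<lambda>x. (f x)\<^sup>2)" and "G = integral {a..b} (\<lambda>x. (g x)\<^sup>2)"
    and "K = integral {a..b} (\<lambda>x. f x * g x)"
  have int: "(\<lambda>x. (f x)\<^sup>2) integrable_on {a..b}" "(\<lambda>x. (g x)\<^sup>2) integrable_on {a..b}"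
    "(\<lambda>x. f x * g x) integrable_on {a..b}"
    by (intro integrable_continuous_real continuous_intros assms)+
  have pos: "F - 2 * t * K + t\<^sup>2 * G \<ge> 0" for t
  proof -
    have "((\<lambda>x. ((f x)\<^sup>2 - (2 * t) * (f x * g x)) + t\<^sup>2 * (g x)\<^sup>2) has_integral (F - 2 * t * K) + t\<^sup>2 * G) {a..b}"
      unfolding F_def G_def K_def
      by (intro has_integral_add has_integral_diff has_integral_mult_right integrable_integral int)
    moreover have "0 \<le> ((f x)\<^sup>2 - (2 * t) * (f x * g x)) + t\<^sup>2 * (g x)\<^sup>2" for x
    proof -
      have "((f x)\<^sup>2 - (2 * t) * (f x * g x)) + t\<^sup>2 * (g x)\<^sup>2 = (f x - t * g x)\<^sup>2"
        by (simp add: power2_eq_square algebra_simps)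
      then show ?thesis by simp
    qed
    ultimately show ?thesis using has_integral_nonneg by blast
  qed
  have G0: "G \<ge> 0" unfolding G_def by (rule integral_nonneg[OF int(2)]) simp
  from discriminant_nonpos[OF pos G0] show ?thesis by (simp add: F_def G_def K_def)
qed

text \<open>Gronwall's inequality for \<open>|f|\<^sup>2 + |f'|\<^sup>2\<close>, whose derivative is
  at most \<open>1 + |K|\<close> times itself. The hypothesis is an inequality and not a linear
  equation, so that \<open>f\<close> may be the difference of two solutions of a nonlinear
  equation.\<close>

lemma second_order_zero_right:
  fixes f f' :: "real \<Rightarrow> 'a::real_inner"
  assumes f: "\<And>x. (f has_vector_derivative f' x) (at x)"
    and f': "\<And>x. (f' has_vector_derivative f'' x) (at x)"
    and bd: "\<And>x. norm (f'' x) \<le> K * norm (f x)"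
    and z: "f 0 = 0" "f' 0 = 0" and x: "x \<ge> 0"
  shows "f x = 0"
proof -
  define M where "M = 1 + \<bar>K\<bar>"
  define g where "g = (\<lambda>x. (f x \<bullet> f x + f' x \<bullet> f' x) * exp (- M * x))"
  have ff: "((\<lambda>x. f x \<bullet> f x) has_real_derivative (f x \<bullet> f' x + f' x \<bullet> f x)) (at x)" for x
    using bounded_bilinear.has_vector_derivative[OF bounded_bilinear_inner f f]
    by (simp add: has_real_derivative_iff_has_vector_derivative)
  have gg: "((\<lambda>x. f' x \<bullet> f' x) has_real_derivative (f' x \<bullet> f'' x + f'' x \<bullet> f' x)) (at x)" for x
    using bounded_bilinear.has_vector_derivative[OF bounded_bilinear_inner f' f']
    by (simp add: has_real_derivative_iff_has_vector_derivative)
  have dg: "(g has_real_derivative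
      ((2 * (f x \<bullet> f' x) + 2 * (f' x \<bullet> f'' x)) - M * (f x \<bullet> f x + f' x \<bullet> f' x)) * exp (- M * x)) (at x)" for x
    unfolding g_def
    by (rule derivative_eq_intros ff gg refl | simp)+ (simp add: algebra_simps inner_commute)
  have neg: "(2 * (f x \<bullet> f' x) + 2 * (f' x \<bullet> f'' x)) - M * (f x \<bullet> f x + f' x \<bullet> f' x) \<le> 0" for x
  proof -
    have 1: "f x \<bullet> f' x \<le> norm (f x) * norm (f' x)" by (rule norm_cauchy_schwarz)
    have "f' x \<bullet> f'' x \<le> norm (f' x) * norm (f'' x)" by (rule norm_cauchy_schwarz)
    also have "\<dots> \<le> norm (f' x) * (\<bar>K\<bar> * norm (f x))"
      by (intro mult_left_mono order_trans[OF bd] mult_right_mono) auto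
    finally have 2: "f' x \<bullet> f'' x \<le> \<bar>K\<bar> * (norm (f x) * norm (f' x))" by (simp add: algebra_simps)
    have "2 * (norm (f x) * norm (f' x)) \<le> (norm (f x))\<^sup>2 + (norm (f' x))\<^sup>2"
      using sum_squares_bound[of "norm (f x)" "norm (f' x)"] by (simp add: algebra_simps)
    then have "M * (2 * (norm (f x) * norm (f' x))) \<le> M * (f x \<bullet> f x + f' x \<bullet> f' x)"
      by (intro mult_left_mono) (auto simp: M_def power2_norm_eq_inner)
    then show ?thesis using 1 2 by (simp add: M_def algebra_simps)
  qed
  have "g x \<le> g 0"
    by (rule DERIV_nonpos_imp_nonincreasing[OF x]) (use dg neg in \<open>auto simp: mult_le_0_iff intro!: exI\<close>)
  then have "(f x \<bullet> f x + f' x \<bullet> f' x) * exp (- M * x) \<le> 0" by (simp add: g_def z)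
  then have "f x \<bullet> f x + f' x \<bullet> f' x \<le> 0" by (simp add: mult_le_0_iff)
  moreover have "f' x \<bullet> f' x \<ge> 0" by simp
  ultimately have "f x \<bullet> f x \<le> 0" by linarith
  then have "f x \<bullet> f x = 0" using inner_ge_zero[of "f x"] by linarith
  then show ?thesis by simp
qed

lemma has_vector_derivative_shift:
  assumes "(f has_vector_derivative f') (at (x + a))"
  shows "((\<lambda>x. f (x + a)) has_vector_derivative f') (at (x::real))"
proof -
  have "((\<lambda>x. x + a) has_vector_derivative 1) (at x)"
    by (auto intro!: derivative_eq_intros)
  from vector_diff_chain_at[OF this, of f f'] assms show ?thesis by (simp add: o_def)
qed

lemma has_vector_derivative_reflect:
  assumes "(f has_vector_derivative f') (at (a - x))"
  shows "((\<lambda>x. f (a - x)) has_vector_derivative - f') (at (x::real))"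
proof -
  have "((\<lambda>x. a - x) has_vector_derivative - 1) (at x)"
    by (auto intro!: derivative_eq_intros)
  from vector_diff_chain_at[OF this, of f f'] assms show ?thesis by (simp add: o_def)
qed

lemma second_order_zero:
  fixes f f' :: "real \<Rightarrow> 'a::real_inner"
  assumes f: "\<And>x. (f has_vector_derivative f' x) (at x)"
    and f': "\<And>x. (f' has_vector_derivative f'' x) (at x)"
    and bd: "\<And>x. norm (f'' x) \<le> K * norm (f x)"
    and z: "f a = 0" "f' a = 0"
  shows "f x = 0"
proof (cases "x \<ge> a")
  case True
  have "(\<lambda>x. f (x + a)) (x - a) = 0"
    by (rule second_order_zero_right[where K = K and f = "\<lambda>x. f (x + a)" and f' = "\<lambda>x. f' (x + a)" and f'' = "\<lambda>x. f'' (x + a)"])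
      (simp_all add: has_vector_derivative_shift[OF f] has_vector_derivative_shift[OF f'] bd z True)
  then show ?thesis by simp
next
  case False
  have d: "((\<lambda>x. - f' (a - x)) has_vector_derivative f'' (a - x)) (at x)" for x
    using has_vector_derivative_minus[OF has_vector_derivative_reflect[OF f']] by simp
  have "(\<lambda>x. f (a - x)) (a - x) = 0"
    by (rule second_order_zero_right[where K = K and f = "\<lambda>x. f (a - x)" and f' = "\<lambda>x. - f' (a - x)" and f'' = "\<lambda>x. f'' (a - x)"])
      (use False in \<open>simp_all add: has_vector_derivative_reflect[OF f] d bd z\<close>)
  then show ?thesis by simp
qed

text \<open>Periodicity is required of the integrals only, so that the lemma also covers functions
  that are periodic almost everywhere, as weak derivatives are.\<close>

lemma integral_period_shift:
  fixes f :: "real \<Rightarrow> 'a::euclidean_space"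
  assumes per: "\<And>c d. integral {c + T..d + T} f = integral {c..d} f" and T: "T > 0"
    and int: "\<And>c d. f integrable_on {c..d}"
  shows "integral {a..a+T} f = integral {0..T} f"
proof -
  have "integral {a..a+T} f + integral {a..b} f = integral {b..b+T} f + integral {a..b} f" if "a \<le> b" for a b
    using Henstock_Kurzweil_Integration.integral_combine[of a "a + T" "b + T" f]
      Henstock_Kurzweil_Integration.integral_combine[of a b "b + T" f] per[of a b] that T int by (simp add: add.commute)
  from this[of a 0] this[of 0 a] show ?thesis by (cases "a \<le> 0") auto
qed

lemma continuous_antiderivative:
  fixes f :: "real \<Rightarrow> 'a::banach"
  assumes f: "continuous_on UNIV f"
  obtains F where "F 0 = 0" "\<And>x. (F has_vector_derivative f x) (at x)"
proof -
  define F where "F = (\<lambda>x. integral {0..x} f - integral {x..0} f)"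
  have int: "f integrable_on {a..b}" for a b
    by (intro integrable_continuous_real continuous_on_subset[OF f]) auto
  have 0: "F 0 = 0" by (simp add: F_def)
  have "(F has_vector_derivative f x) (at x)" for x
  proof -
    define n where "n = \<bar>x\<bar> + 1"
    have F: "F y = integral {-n..y} f - integral {-n..0} f" if "y \<in> {-n<..<n}" for y
    proof (cases "y \<ge> 0")
      case True
      then show ?thesis
        using Henstock_Kurzweil_Integration.integral_combine[of "-n" 0 y f] int that
        by (cases "y = 0") (auto simp: F_def n_def algebra_simps)
    next
      case False
      then show ?thesis
        using Henstock_Kurzweil_Integration.integral_combine[of "-n" y 0 f] int that
        by (auto simp: F_def n_def algebra_simps)
    qed
    have "((\<lambda>y. integral {-n..y} f) has_vector_derivative f x) (at x within {-n..n})"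
      by (rule integral_has_vector_derivative) (auto intro: continuous_on_subset[OF f] simp: n_def)
    then have "((\<lambda>y. integral {-n..y} f) has_vector_derivative f x) (at x)"
      by (subst (asm) at_within_interior) (auto simp: n_def)
    then have "((\<lambda>y. integral {-n..y} f - integral {-n..0} f) has_vector_derivative f x) (at x)"
      by (auto intro!: derivative_eq_intros)
    then show ?thesis
      by (rule has_vector_derivative_transform_within_open[where S = "{-n<..<n}"])
        (auto simp: F n_def)
  qed
  with 0 show thesis by (rule that)
qed

lemma has_real_derivative_inner:
  fixes f g :: "real \<Rightarrow> 'a::real_inner"
  assumes "(f has_vector_derivative f') (at x)" "(g has_vector_derivative g') (at x)"
  shows "((\<lambda>x. f x \<bullet> g x) has_real_derivative (f x \<bullet> g' + f' \<bullet> g x)) (at x)"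
  using bounded_bilinear.has_vector_derivative[OF bounded_bilinear_inner assms]
  by (simp add: has_real_derivative_iff_has_vector_derivative)

lemma has_vector_derivative_i:
  assumes "(f has_vector_derivative f') F"
  shows "((\<lambda>x. \<i> * f x) has_vector_derivative \<i> * f') F"
  using has_vector_derivative_mult_right[OF assms, of "\<i>"] by simp

lemma has_vector_derivative_scaleR_real:
  assumes "(g has_real_derivative g') (at x)" "(f has_vector_derivative f') (at x)"
  shows "((\<lambda>x. g x *\<^sub>R f x) has_vector_derivative (g x *\<^sub>R f' + g' *\<^sub>R f x)) (at x)"
  using has_vector_derivative_scaleR[of g g' x UNIV f f'] assms
  by (simp add: has_real_derivative_iff_has_vector_derivative[symmetric])

section \<open>The second variation at an oscillating wave\<close>

locale wave =
  fixes W W' :: "real \<Rightarrow> complex"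
  assumes dW: "\<And>x. (W has_vector_derivative W' x) (at x)"
    and dW': "\<And>x. (W' has_vector_derivative ((cmod (W x))\<^sup>2 - 1) *\<^sub>R W x) (at x)"
begin

definition s where "s x = (cmod (W x))\<^sup>2"
definition ds where "ds x = 2 * (W x \<bullet> W' x)"
text \<open>\<open>J\<close> is the angular momentum \<open>Im (cnj W * W')\<close> and
  \<open>E\<close> the energy of the profile equation, read as motion in a central potential. Both
  are evaluated at 0; \<open>J_eq\<close> and \<open>E_eq\<close> show that they are
  constant.\<close>

definition J where "J = (\<i> * W 0) \<bullet> W' 0"
definition E where "E = (cmod (W' 0))\<^sup>2 / 2 + s 0 / 2 - (s 0)\<^sup>2 / 4"

lemma s_inner: "s x = W x \<bullet> W x"
  by (simp add: s_def power2_norm_eq_inner)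

lemma s_nonneg: "s x \<ge> 0"
  by (simp add: s_def)

lemma dW'_s: "(W' has_vector_derivative (s x - 1) *\<^sub>R W x) (at x)"
  using dW'[of x] by (simp add: s_def)

lemma ds: "(s has_real_derivative ds x) (at x)"
proof -
  have "((\<lambda>x. W x \<bullet> W x) has_real_derivative (W x \<bullet> W' x + W' x \<bullet> W x)) (at x)"
    by (rule has_real_derivative_inner[OF dW dW])
  moreover have "s = (\<lambda>x. W x \<bullet> W x)" by (auto simp: s_inner)
  ultimately show ?thesis by (simp add: ds_def inner_commute)
qed

lemma J_eq: "(\<i> * W x) \<bullet> W' x = J"
proof -
  have "((\<lambda>x. (\<i> * W x) \<bullet> W' x) has_real_derivative 0) (at x)" for x
  proof -
    have "((\<lambda>x. (\<i> * W x) \<bullet> W' x) has_real_derivative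
        ((\<i> * W x) \<bullet> ((s x - 1) *\<^sub>R W x) + (\<i> * W' x) \<bullet> W' x)) (at x)"
      by (rule has_real_derivative_inner[OF has_vector_derivative_i[OF dW] dW'_s])
    moreover have "(\<i> * W x) \<bullet> ((s x - 1) *\<^sub>R W x) + (\<i> * W' x) \<bullet> W' x = 0"
      by (simp add: inner_complex_def)
    ultimately show ?thesis by simp
  qed
  then show ?thesis unfolding J_def using DERIV_isconst_all by blast
qed

lemma E_eq: "W' x \<bullet> W' x = 2 * E - s x + (s x)\<^sup>2 / 2"
proof -
  have "((\<lambda>x. W' x \<bullet> W' x / 2 + s x / 2 - (s x)\<^sup>2 / 4) has_real_derivative 0) (at x)" for x
  proof -
    have "((\<lambda>x. W' x \<bullet> W' x) has_real_derivative
        (W' x \<bullet> ((s x - 1) *\<^sub>R W x) + ((s x - 1) *\<^sub>R W x) \<bullet> W' x)) (at x)"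
      by (rule has_real_derivative_inner[OF dW'_s dW'_s])
    then show ?thesis
      by - ((rule derivative_eq_intros ds refl | simp)+,
         simp add: ds_def inner_commute field_simps)
  qed
  then have "W' x \<bullet> W' x / 2 + s x / 2 - (s x)\<^sup>2 / 4 = E"
    unfolding E_def power2_norm_eq_inner
    using DERIV_isconst_all[of "\<lambda>x. W' x \<bullet> W' x / 2 + s x / 2 - (s x)\<^sup>2 / 4"] by blast
  then show ?thesis by simp
qed

lemma dds: "(ds has_real_derivative 3 * (s x)\<^sup>2 - 4 * s x + 4 * E) (at x)"
proof -
  have "((\<lambda>x. W x \<bullet> W' x) has_real_derivative (W x \<bullet> ((s x - 1) *\<^sub>R W x) + W' x \<bullet> W' x)) (at x)"
    by (rule has_real_derivative_inner[OF dW dW'_s])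
  then have "((\<lambda>x. 2 * (W x \<bullet> W' x)) has_real_derivative 2 * ((s x - 1) * s x + (2 * E - s x + (s x)\<^sup>2 / 2))) (at x)"
    unfolding E_eq s_inner[symmetric] inner_scaleR_right by (rule DERIV_cmult)
  moreover have "ds = (\<lambda>x. 2 * (W x \<bullet> W' x))" by (auto simp: ds_def)
  ultimately show ?thesis by (simp add: power2_eq_square algebra_simps)
qed

text \<open>\<open>|W|\<^sup>2 |W'|\<^sup>2\<close> splits into the squares of the radial and the angular part.\<close>

lemma ds_sq: "(ds x)\<^sup>2 = 2 * (s x)^3 - 4 * (s x)\<^sup>2 + 8 * E * s x - 4 * J\<^sup>2"
proof -
  have "(W x \<bullet> W' x)\<^sup>2 + ((\<i> * W x) \<bullet> W' x)\<^sup>2 = (W x \<bullet> W x) * (W' x \<bullet> W' x)"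
    by (simp add: inner_complex_def power2_eq_square algebra_simps)
  then have "(W x \<bullet> W' x)\<^sup>2 + J\<^sup>2 = s x * (2 * E - s x + (s x)\<^sup>2 / 2)"
    by (simp only: J_eq E_eq s_inner[symmetric])
  then show ?thesis
    by (simp add: ds_def power2_eq_square power3_eq_cube algebra_simps)
qed

text \<open>The expansion of \<open>W\<close> in the orthogonal vectors \<open>W'\<close> and
  \<open>\<i> * W'\<close>, multiplied by \<open>|W'|\<^sup>2\<close> so that it remains true where
  \<open>W'\<close> vanishes. It eliminates the term with \<open>ds\<close> and \<open>W'\<close>
  from the Hessian image of \<open>Phi\<close>.\<close>

lemma ds_W': "ds x *\<^sub>R W' x = (4 * E - 2 * s x + (s x)\<^sup>2) *\<^sub>R W x + (2 * J) *\<^sub>R (\<i> * W' x)"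
proof -
  have "(2 * (W x \<bullet> W' x)) *\<^sub>R W' x
      = (2 * (W' x \<bullet> W' x)) *\<^sub>R W x + (2 * ((\<i> * W x) \<bullet> W' x)) *\<^sub>R (\<i> * W' x)"
    by (simp add: complex_eq_iff inner_complex_def algebra_simps)
  then show ?thesis unfolding J_eq E_eq ds_def by (simp add: algebra_simps)
qed

lemma cont_W: "continuous_on A W" and cont_W': "continuous_on A W'"
  and cont_s: "continuous_on A s" and cont_ds: "continuous_on A ds"
proof -
  show W: "continuous_on A W" "continuous_on A W'"
    using dW dW' by (auto intro!: continuous_at_imp_continuous_on has_vector_derivative_continuous)
  have "s = (\<lambda>x. W x \<bullet> W x)" "ds = (\<lambda>x. 2 * (W x \<bullet> W' x))" by (auto simp: s_inner ds_def)
  then show "continuous_on A s" "continuous_on A ds" by (auto intro!: continuous_intros W)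
qed

end

section \<open>The Hessian on quasi-periodic perturbations and mean values over a period\<close>

lemma inner_mult_unit:
  fixes l a b :: complex
  assumes "cmod l = 1"
  shows "(l * a) \<bullet> (l * b) = a \<bullet> b"
proof -
  have "(l * a) \<bullet> (l * b) = ((Re l)\<^sup>2 + (Im l)\<^sup>2) * (a \<bullet> b)"
    by (simp add: inner_complex_def power2_eq_square algebra_simps)
  also have "(Re l)\<^sup>2 + (Im l)\<^sup>2 = 1" using assms by (simp add: cmod_def)
  finally show ?thesis by simp
qed

lemma quasiperiodic_derivative:
  fixes v v' :: "real \<Rightarrow> complex"
  assumes v: "\<And>x. (v has_vector_derivative v' x) (at x)" and q: "\<And>x. v (x + T) = l * v x"
  shows "v' (x + T) = l * v' x"
proof (rule vector_derivative_unique_at)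
  show "((\<lambda>x. v (x + T)) has_vector_derivative v' (x + T)) (at x)"
    by (rule has_vector_derivative_shift[OF v])
  show "((\<lambda>x. v (x + T)) has_vector_derivative l * v' x) (at x)"
    unfolding q by (rule has_vector_derivative_mult_right[OF v])
qed

lemma integral_derivative_periodic:
  fixes F :: "real \<Rightarrow> real"
  assumes "T \<ge> 0" "\<And>x. (F has_real_derivative f x) (at x)" "F T = F 0"
  shows "integral {0..T} f = 0"
  using fundamental_theorem_of_calculus[of 0 T F f] assms
  by (auto simp: has_real_derivative_iff_has_vector_derivative[symmetric]
      intro: has_field_derivative_at_within dest!: integral_unique)

locale periodic_wave = wave +
  fixes T :: real and lam :: complex
  assumes T: "T > 0" and lam: "cmod lam = 1" and W_qper: "\<And>x. W (x + T) = lam * W x"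
begin

text \<open>Perturbations carry the multiplier of \<open>W\<close>. As it is unimodular, all real
  inner products among them, \<open>W\<close> and \<open>W'\<close> are \<open>T\<close>-periodic,
  and boundary terms over a period cancel.\<close>

definition C1q where "C1q v v' \<longleftrightarrow> (\<forall>x. (v has_vector_derivative v' x) (at x)) \<and>
  continuous_on UNIV v' \<and> (\<forall>x. v (x + T) = lam * v x)"

text \<open>The polarised second variation at \<open>W\<close> of the integral of
  \<open>|u'|\<^sup>2 / 2 + (1 - |u|\<^sup>2)\<^sup>2 / 4\<close>.\<close>

definition Hb :: "(real \<Rightarrow> complex) \<Rightarrow> (real \<Rightarrow> complex) \<Rightarrow> (real \<Rightarrow> complex) \<Rightarrow> (real \<Rightarrow> complex) \<Rightarrow> real"
  where "Hb f f' v v' = integral {0..T} (\<lambda>x. f' x \<bullet> v' x + (s x - 1) * (f x \<bullet> v x)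
  + 2 * (W x \<bullet> f x) * (W x \<bullet> v x))"

text \<open>\<open>N1\<close> and \<open>M2\<close> are the derivatives at \<open>W\<close> of half
  the integrals of \<open>|u|\<^sup>2\<close> and of \<open>(\<i> * u') \<bullet> u\<close>. Their
  common kernel is tangent to the level sets of mass and momentum.\<close>

definition N1 where "N1 v = integral {0..T} (\<lambda>x. W x \<bullet> v x)"
definition M2 where "M2 v = integral {0..T} (\<lambda>x. (\<i> * W' x) \<bullet> v x)"
definition nrm2 :: "(real \<Rightarrow> complex) \<Rightarrow> (real \<Rightarrow> complex) \<Rightarrow> real"
  where "nrm2 v v' = integral {0..T} (\<lambda>x. v x \<bullet> v x + v' x \<bullet> v' x)"

lemma C1qD:
  assumes "C1q v v'"
  shows "(v has_vector_derivative v' x) (at x)" "continuous_on A v'" "continuous_on A v"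
    "v (x + T) = lam * v x" "v' (x + T) = lam * v' x"
  using assms quasiperiodic_derivative[of v v' T lam x] continuous_on_subset[of UNIV v' A]
  by (auto simp: C1q_def intro!: continuous_at_imp_continuous_on has_vector_derivative_continuous)

lemma cint: "continuous_on {0..T} f \<Longrightarrow> (f :: real \<Rightarrow> real) integrable_on {0..T}"
  by (rule integrable_continuous_real)

lemma W'_qper: "W' (x + T) = lam * W' x"
  by (rule quasiperiodic_derivative[OF dW W_qper])

lemma s_per: "s (x + T) = s x" and ds_per: "ds (x + T) = ds x"
  by (simp_all add: s_inner ds_def W_qper W'_qper inner_mult_unit lam)

lemma C1q_diff:
  "C1q v v' \<Longrightarrow> C1q f f' \<Longrightarrow> C1q (\<lambda>x. v x - f x) (\<lambda>x. v' x - f' x)"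
  by (auto simp: C1q_def algebra_simps intro!: derivative_intros continuous_intros)

lemma Hb_by_parts:
  assumes f: "C1q f f'" and v: "C1q v v'"
    and f': "\<And>x. (f' has_vector_derivative f'' x) (at x)" and f'': "continuous_on UNIV f''"
    and eq: "\<And>x. - f'' x + (s x - 1) *\<^sub>R f x + (2 * (W x \<bullet> f x)) *\<^sub>R W x = \<alpha> *\<^sub>R W x + \<beta> *\<^sub>R (\<i> * W' x)"
  shows "Hb f f' v v' = \<alpha> * N1 v + \<beta> * M2 v"
proof -
  have 1: "integral {0..T} (\<lambda>x. f' x \<bullet> v' x + f'' x \<bullet> v x) = 0"
  proof (rule integral_derivative_periodic)
    show "((\<lambda>x. f' x \<bullet> v x) has_real_derivative f' x \<bullet> v' x + f'' x \<bullet> v x) (at x)" for x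
      by (rule has_real_derivative_inner[OF f' C1qD(1)[OF v]])
    show "f' T \<bullet> v T = f' 0 \<bullet> v 0"
      using C1qD(4)[OF v, of 0] C1qD(5)[OF f, of 0] by (simp add: inner_mult_unit lam)
  qed (use T in simp)
  note cts = continuous_intros C1qD[OF f] C1qD[OF v] cont_W cont_W' cont_s continuous_on_subset[OF f'']
  have eq': "f' x \<bullet> v' x + (s x - 1) * (f x \<bullet> v x) + 2 * (W x \<bullet> f x) * (W x \<bullet> v x)
    = (f' x \<bullet> v' x + f'' x \<bullet> v x) + (\<alpha> * (W x \<bullet> v x) + \<beta> * ((\<i> * W' x) \<bullet> v x))" for x
  proof -
    have "(- f'' x + (s x - 1) *\<^sub>R f x + (2 * (W x \<bullet> f x)) *\<^sub>R W x) \<bullet> v x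
        = (\<alpha> *\<^sub>R W x + \<beta> *\<^sub>R (\<i> * W' x)) \<bullet> v x" by (simp only: eq)
    then show ?thesis by (simp only: inner_add_left inner_diff_left inner_minus_left inner_scaleR_left)
  qed
  have "Hb f f' v v' = integral {0..T} (\<lambda>x. f' x \<bullet> v' x + f'' x \<bullet> v x) +
     integral {0..T} (\<lambda>x. \<alpha> * (W x \<bullet> v x) + \<beta> * ((\<i> * W' x) \<bullet> v x))"
    unfolding Hb_def eq' by (intro Henstock_Kurzweil_Integration.integral_add cint cts) auto
  also have "integral {0..T} (\<lambda>x. \<alpha> * (W x \<bullet> v x) + \<beta> * ((\<i> * W' x) \<bullet> v x))
     = integral {0..T} (\<lambda>x. \<alpha> * (W x \<bullet> v x)) + integral {0..T} (\<lambda>x. \<beta> * ((\<i> * W' x) \<bullet> v x))"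
    by (intro Henstock_Kurzweil_Integration.integral_add cint cts)
  finally show ?thesis using 1 by (simp add: N1_def M2_def)
qed

definition Sig where "Sig = (SOME F. F 0 = 0 \<and> (\<forall>x. (F has_vector_derivative s x) (at x)))"

lemma Sig0: "Sig 0 = 0" and dSig: "(Sig has_real_derivative s x) (at x)"
proof -
  have "\<exists>F. F 0 = 0 \<and> (\<forall>x. (F has_vector_derivative s x) (at x))"
    by (rule continuous_antiderivative[OF cont_s]) blast
  then have "Sig 0 = 0 \<and> (\<forall>x. (Sig has_vector_derivative s x) (at x))"
    unfolding Sig_def by (rule someI_ex)
  then show "Sig 0 = 0" "(Sig has_real_derivative s x) (at x)"
    by (auto simp: has_real_derivative_iff_has_vector_derivative)
qed

definition sbar where "sbar = Sig T / T"
text \<open>The periodic part of the antiderivative of \<open>s\<close>. The linear growth that is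
  removed here is what scaling and boost compensate in \<open>Psi\<close> and
  \<open>Phi\<close>.\<close>

definition S where "S x = Sig x - sbar * x"

lemma Sig_T: "Sig T = sbar * T"
  using T by (simp add: sbar_def)

lemma Sig_shift: "Sig (x + T) = Sig x + sbar * T"
proof -
  have d: "((\<lambda>x. Sig (x + T)) has_real_derivative s x) (at x)" for x
    using has_vector_derivative_shift[of Sig "s (x + T)" x T] dSig[of "x + T"]
    by (simp add: s_per has_real_derivative_iff_has_vector_derivative)
  have "((\<lambda>x. Sig (x + T) - Sig x) has_real_derivative 0) (at x)" for x
    using DERIV_diff[OF d dSig] by simp
  then have "Sig (x + T) - Sig x = Sig (0 + T) - Sig 0"
    using DERIV_isconst_all[of "\<lambda>x. Sig (x + T) - Sig x"] by blast
  then have "Sig (x + T) - Sig x = sbar * T" by (simp add: Sig0 Sig_T)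
  then show ?thesis by linarith
qed

lemma S_per: "S (x + T) = S x"
  unfolding S_def Sig_shift by (simp add: algebra_simps)

lemma dS: "(S has_real_derivative s x - sbar) (at x)"
proof -
  have "((\<lambda>x. Sig x - sbar * x) has_real_derivative s x - sbar) (at x)"
    by (auto intro!: derivative_eq_intros dSig)
  then show ?thesis by (simp add: S_def[abs_def])
qed

lemma cont_S: "continuous_on A S"
  using dS by (auto intro!: continuous_at_imp_continuous_on DERIV_isCont)

lemma int_s: "integral {0..T} s = sbar * T"
  using fundamental_theorem_of_calculus[of 0 T Sig s] dSig T
  by (auto simp: has_real_derivative_iff_has_vector_derivative Sig0 Sig_T
      intro: has_vector_derivative_at_within dest!: integral_unique)

lemma int_ds: "integral {0..T} ds = 0"
  using integral_derivative_periodic[of T s ds] T ds s_per[of 0] by simp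

text \<open>The second-order equation for \<open>s\<close> integrates to zero over a period, which
  expresses the second moment of \<open>s\<close> through its mean. Hence \<open>sbar\<close>,
  \<open>E\<close> and \<open>J\<close> are the only parameters in all that follows.\<close>

lemma int_s2: "integral {0..T} (\<lambda>x. (s x)\<^sup>2) = (4 * sbar - 4 * E) / 3 * T"
proof -
  have "integral {0..T} (\<lambda>x. 3 * (s x)\<^sup>2 - 4 * s x + 4 * E) = 0"
    using integral_derivative_periodic[of T ds, OF _ dds] T ds_per[of 0] by simp
  moreover have "((\<lambda>x. 3 * (s x)\<^sup>2 - 4 * s x + 4 * E) has_integral
      (3 * integral {0..T} (\<lambda>x. (s x)\<^sup>2) - 4 * (sbar * T) + (4 * E) * T)) {0..T}"
    unfolding int_s[symmetric] using has_integral_const_real[of "4 * E" 0 T] T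
    by (intro has_integral_add has_integral_diff has_integral_mult_right integrable_integral cint
        continuous_intros cont_s) (auto simp: algebra_simps)
  ultimately show ?thesis by (auto dest!: integral_unique simp: field_simps)
qed

lemma int_ds_S: "integral {0..T} (\<lambda>x. ds x * S x) = sbar\<^sup>2 * T - (4 * sbar - 4 * E) / 3 * T"
proof -
  have "integral {0..T} (\<lambda>x. s x * (s x - sbar) + ds x * S x) = 0"
    by (rule integral_derivative_periodic[of T "\<lambda>x. s x * S x"])
      (use T S_per[of 0] s_per[of 0] in \<open>auto intro!: derivative_eq_intros ds dS\<close>)
  moreover have "((\<lambda>x. ((s x)\<^sup>2 - sbar * s x) + ds x * S x) has_integral
      ((4 * sbar - 4 * E) / 3 * T - sbar * (sbar * T)) + integral {0..T} (\<lambda>x. ds x * S x)) {0..T}"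
    unfolding int_s2[symmetric] unfolding int_s[symmetric]
    by (intro has_integral_add has_integral_diff has_integral_mult_right integrable_integral cint
        continuous_intros cont_s cont_ds cont_S)
  moreover have "(\<lambda>x. ((s x)\<^sup>2 - sbar * s x) + ds x * S x) = (\<lambda>x. s x * (s x - sbar) + ds x * S x)"
    by (simp add: power2_eq_square algebra_simps)
  ultimately have "((4 * sbar - 4 * E) / 3 * T - sbar * (sbar * T)) + integral {0..T} (\<lambda>x. ds x * S x) = 0"
    by (auto dest!: integral_unique)
  then show ?thesis by (simp add: power2_eq_square algebra_simps)
qed

end

section \<open>Preimages of the gradients of mass and momentum, and their moments\<close>

lemma moment_arith_n:
  fixes l m d J T E sb :: real
  shows "(l * J) * T + m * ((sb\<^sup>2 * T - (4 * sb - 4 * E) / 3 * T) * (1/2) + ((2 - sb) * (sb * T) - (4 * sb - 4 * E) / 3 * T))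
      + d * (0 * (1/2)) = T * (J * l + (2 * E - sb\<^sup>2 / 2) * m)"
  by (simp add: field_simps power2_eq_square)

lemma moment_arith_m:
  fixes l m e J T E sb :: real
  shows "l * ((sb\<^sup>2 * T - (4 * sb - 4 * E) / 3 * T) * (1/4) - (2 * E * T - sb * T + ((4 * sb - 4 * E) / 3 * T) * (1/2)))
      + m * (J * (sb * T) - J * (2 - sb) * T) + e * (0 * (1/2)) = - T * ((E - sb\<^sup>2 / 4) * l + J * (2 - 2 * sb) * m)"
  by (simp add: field_simps)

context periodic_wave
begin

text \<open>The Hessian maps \<open>Psi\<close> and \<open>Phi\<close> into the span of \<open>W\<close> and \<open>\<i> W'\<close>, the gradients of mass and momentum.\<close>

definition Psi where "Psi x = (S x / 2) *\<^sub>R (\<i> * W x) - \<i> * W' x"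
definition Psi' where "Psi' x = (S x / 2) *\<^sub>R (\<i> * W' x) + ((s x - sbar) / 2) *\<^sub>R (\<i> * W x)
  - (s x - 1) *\<^sub>R (\<i> * W x)"
definition Psi'' where "Psi'' x = (S x / 2 * (s x - 1)) *\<^sub>R (\<i> * W x)
  + (s x - sbar) *\<^sub>R (\<i> * W' x) + (ds x / 2) *\<^sub>R (\<i> * W x)
  - ds x *\<^sub>R (\<i> * W x) - (s x - 1) *\<^sub>R (\<i> * W' x)"

definition Phi where "Phi x = S x *\<^sub>R W' x + (2 - sbar - s x) *\<^sub>R W x"
definition Phi' where "Phi' x = (S x * (s x - 1) - ds x) *\<^sub>R W x + (2 - 2 * sbar) *\<^sub>R W' x"
definition Phi'' where "Phi'' x = (S x * (s x - 1) - ds x) *\<^sub>R W' x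
  + ((s x - sbar) * (s x - 1) + S x * ds x - (3 * (s x)\<^sup>2 - 4 * s x + 4 * E)) *\<^sub>R W x
  + ((2 - 2 * sbar) * (s x - 1)) *\<^sub>R W x"

lemma dPsi: "(Psi has_vector_derivative Psi' x) (at x)"
proof -
  have 1: "((\<lambda>x. S x / 2) has_real_derivative (s x - sbar) / 2) (at x)"
    by (rule DERIV_cdivide[OF dS])
  show ?thesis
    unfolding Psi_def[abs_def] Psi'_def
    using has_vector_derivative_diff[OF has_vector_derivative_scaleR_real[OF 1 has_vector_derivative_i[OF dW]]
        has_vector_derivative_i[OF dW'_s]]
    by (simp add: mult_scaleR_right)
qed

lemma dPsi': "(Psi' has_vector_derivative Psi'' x) (at x)"
proof -
  have 1: "((\<lambda>x. S x / 2) has_real_derivative (s x - sbar) / 2) (at x)"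
    by (rule DERIV_cdivide[OF dS])
  have 2: "((\<lambda>x. (s x - sbar) / 2) has_real_derivative ds x / 2) (at x)"
    using DERIV_cdivide[OF DERIV_diff[OF ds DERIV_const[of sbar]]] by simp
  have 3: "((\<lambda>x. s x - 1) has_real_derivative ds x) (at x)"
    using DERIV_diff[OF ds DERIV_const[of 1]] by simp
  have "(Psi' has_vector_derivative
     ((S x / 2) *\<^sub>R (\<i> * ((s x - 1) *\<^sub>R W x)) + ((s x - sbar) / 2) *\<^sub>R (\<i> * W' x))
     + (((s x - sbar) / 2) *\<^sub>R (\<i> * W' x) + (ds x / 2) *\<^sub>R (\<i> * W x))
     - ((s x - 1) *\<^sub>R (\<i> * W' x) + ds x *\<^sub>R (\<i> * W x))) (at x)"
    unfolding Psi'_def[abs_def]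
    by (intro has_vector_derivative_diff has_vector_derivative_add has_vector_derivative_scaleR_real
        1 2 3 has_vector_derivative_i dW dW'_s)
  then show ?thesis unfolding Psi''_def by (rule back_subst) (simp add: complex_eq_iff field_simps)
qed

lemma dPhi: "(Phi has_vector_derivative Phi' x) (at x)"
proof -
  have 2: "((\<lambda>x. 2 - sbar - s x) has_real_derivative - ds x) (at x)"
    by (auto intro!: derivative_eq_intros ds)
  have "(Phi has_vector_derivative
     (S x *\<^sub>R ((s x - 1) *\<^sub>R W x) + (s x - sbar) *\<^sub>R W' x)
     + ((2 - sbar - s x) *\<^sub>R W' x + (- ds x) *\<^sub>R W x)) (at x)"
    unfolding Phi_def[abs_def]
    by (intro has_vector_derivative_add has_vector_derivative_scaleR_real 2 dS dW dW'_s)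
  then show ?thesis unfolding Phi'_def by (rule back_subst) (simp add: complex_eq_iff algebra_simps)
qed

lemma dPhi': "(Phi' has_vector_derivative Phi'' x) (at x)"
proof -
  have 2: "((\<lambda>x. S x * (s x - 1) - ds x) has_real_derivative
      (s x - sbar) * (s x - 1) + S x * ds x - (3 * (s x)\<^sup>2 - 4 * s x + 4 * E)) (at x)"
    by (auto intro!: derivative_eq_intros ds dS dds)
  have "(Phi' has_vector_derivative
     ((S x * (s x - 1) - ds x) *\<^sub>R W' x +
      ((s x - sbar) * (s x - 1) + S x * ds x - (3 * (s x)\<^sup>2 - 4 * s x + 4 * E)) *\<^sub>R W x)
     + ((2 - 2 * sbar) *\<^sub>R ((s x - 1) *\<^sub>R W x) + 0 *\<^sub>R W' x)) (at x)"
    unfolding Phi'_def[abs_def]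
    by (intro has_vector_derivative_add has_vector_derivative_scaleR_real 2 dS dW dW'_s DERIV_const)
  then show ?thesis unfolding Phi''_def by (rule back_subst) (simp add: complex_eq_iff algebra_simps)
qed

lemma inner_facts:
  "W x \<bullet> W' x = ds x / 2" "W' x \<bullet> W x = ds x / 2"
  "(\<i> * W x) \<bullet> W x = 0" "W x \<bullet> (\<i> * W x) = 0" "(\<i> * W' x) \<bullet> W' x = 0" "W' x \<bullet> (\<i> * W' x) = 0"
  "W' x \<bullet> (\<i> * W x) = J" "(\<i> * W' x) \<bullet> W x = - J" "W x \<bullet> (\<i> * W' x) = - J"
  "(\<i> * W' x) \<bullet> (\<i> * W x) = ds x / 2" "(\<i> * W' x) \<bullet> (\<i> * W' x) = W' x \<bullet> W' x" "W x \<bullet> W x = s x"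
  using J_eq[of x] by (auto simp: ds_def s_inner inner_complex_def algebra_simps)

lemma s_W': "s x *\<^sub>R (\<i> * W' x) = (ds x / 2) *\<^sub>R (\<i> * W x) - J *\<^sub>R W x"
proof -
  have "(W x \<bullet> W x) *\<^sub>R (\<i> * W' x) = (W x \<bullet> W' x) *\<^sub>R (\<i> * W x) - ((\<i> * W x) \<bullet> W' x) *\<^sub>R W x"
    by (simp add: complex_eq_iff inner_complex_def algebra_simps)
  then show ?thesis unfolding J_eq s_inner[symmetric] by (simp add: ds_def)
qed

lemma W_Psi: "W x \<bullet> Psi x = J" and W'_Psi: "(\<i> * W' x) \<bullet> Psi x = S x * ds x / 4 - (2 * E - s x + (s x)\<^sup>2 / 2)"
  and W_Phi: "W x \<bullet> Phi x = S x * ds x / 2 + (2 - sbar - s x) * s x"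
  and W'_Phi: "(\<i> * W' x) \<bullet> Phi x = - J * (2 - sbar - s x)"
  by (simp_all only: Psi_def Phi_def inner_facts inner_diff_right inner_add_right inner_scaleR_right E_eq)
    (simp_all add: algebra_simps)

text \<open>With the full antiderivative \<open>Sig\<close> in place of \<open>S\<close> the image
  would be \<open>3 * J\<close> times \<open>W\<close>. The part that is subtracted,
  \<open>sbar * x / 2\<close> times \<open>\<i> * W\<close>, is a Galilean boost; since
  \<open>\<i> * W\<close> is a zero mode, its removal contributes \<open>sbar\<close> times
  \<open>\<i> * W'\<close>.\<close>

lemma L_Psi: "- Psi'' x + (s x - 1) *\<^sub>R Psi x + (2 * (W x \<bullet> Psi x)) *\<^sub>R W x
  = (3 * J) *\<^sub>R W x + sbar *\<^sub>R (\<i> * W' x)"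
  using s_W'[of x] unfolding W_Psi by (simp add: Psi_def Psi''_def complex_eq_iff field_simps)

text \<open>The field \<open>Sig * W' + (2 - s) * W\<close> has the image
  \<open>8 * E * W + 2 * J * \<i> * W'\<close>. Its secular growth is cancelled by subtracting
  \<open>sbar\<close> times \<open>x * W' + W\<close>, the generator of scaling, whose image is
  \<open>2 * W\<close>.\<close>

lemma L_Phi: "- Phi'' x + (s x - 1) *\<^sub>R Phi x + (2 * (W x \<bullet> Phi x)) *\<^sub>R W x
  = (8 * E - 2 * sbar) *\<^sub>R W x + (2 * J) *\<^sub>R (\<i> * W' x)"
  using ds_W'[of x] unfolding W_Phi
  by (simp add: Phi_def Phi''_def complex_eq_iff power2_eq_square algebra_simps)

lemma L_W': "- (ds x *\<^sub>R W x + (s x - 1) *\<^sub>R W' x) + (s x - 1) *\<^sub>R W' x + (2 * (W x \<bullet> W' x)) *\<^sub>R W x = 0"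
  by (simp add: inner_facts)

lemma L_iW: "- ((s x - 1) *\<^sub>R (\<i> * W x)) + (s x - 1) *\<^sub>R (\<i> * W x) + (2 * (W x \<bullet> (\<i> * W x))) *\<^sub>R W x = 0"
  by (simp add: inner_facts)

text \<open>The parameters \<open>d\<close> and \<open>e\<close> belong to the tangent space of the
  orbit, to translation and rotation. These directions lie in the kernel of the Hessian and,
  \<open>ds\<close> having mean zero, in that of \<open>N1\<close> and \<open>M2\<close>, so that
  only \<open>l\<close> and \<open>m\<close> appear in the formulas below.\<close>

definition Fam where "Fam l m d e x = l *\<^sub>R Psi x + m *\<^sub>R Phi x + d *\<^sub>R W' x + e *\<^sub>R (\<i> * W x)"
definition Fam' where "Fam' l m d e x = l *\<^sub>R Psi' x + m *\<^sub>R Phi' x + d *\<^sub>R ((s x - 1) *\<^sub>R W x) + e *\<^sub>R (\<i> * W' x)"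
definition Fam'' where "Fam'' l m d e x = l *\<^sub>R Psi'' x + m *\<^sub>R Phi'' x
  + d *\<^sub>R (ds x *\<^sub>R W x + (s x - 1) *\<^sub>R W' x) + e *\<^sub>R ((s x - 1) *\<^sub>R (\<i> * W x))"

lemma dFam: "(Fam l m d e has_vector_derivative Fam' l m d e x) (at x)"
  unfolding Fam_def[abs_def] Fam'_def
  by (intro has_vector_derivative_add dPsi dPhi dW'_s
      has_vector_derivative_i dW bounded_linear.has_vector_derivative[OF bounded_linear_scaleR_right])

lemma dFam': "(Fam' l m d e has_vector_derivative Fam'' l m d e x) (at x)"
proof -
  have 3: "((\<lambda>x. s x - 1) has_real_derivative ds x) (at x)"
    using DERIV_diff[OF ds DERIV_const[of 1]] by simp
  have "((\<lambda>x. (s x - 1) *\<^sub>R W x) has_vector_derivative ((s x - 1) *\<^sub>R W' x + ds x *\<^sub>R W x)) (at x)"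
    by (rule has_vector_derivative_scaleR_real[OF 3 dW])
  then have 4: "((\<lambda>x. (s x - 1) *\<^sub>R W x) has_vector_derivative (ds x *\<^sub>R W x + (s x - 1) *\<^sub>R W' x)) (at x)"
    by (simp add: add.commute)
  have 5: "((\<lambda>x. \<i> * W' x) has_vector_derivative ((s x - 1) *\<^sub>R (\<i> * W x))) (at x)"
    using has_vector_derivative_i[OF dW'_s] by (simp add: mult_scaleR_right)
  show ?thesis
    unfolding Fam'_def[abs_def] Fam''_def
    by (intro has_vector_derivative_add dPsi' dPhi' 4 5
        bounded_linear.has_vector_derivative[OF bounded_linear_scaleR_right])
qed

lemma cont_Fam'': "continuous_on UNIV (Fam'' l m d e)"
  unfolding Fam''_def[abs_def] Psi''_def Phi''_def
  by (intro continuous_intros cont_W cont_W' cont_s cont_ds cont_S) auto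

lemma C1q_Fam: "C1q (Fam l m d e) (Fam' l m d e)"
proof -
  have "continuous_on UNIV (Fam' l m d e)"
    using dFam' by (auto intro!: continuous_at_imp_continuous_on has_vector_derivative_continuous)
  moreover have "Fam l m d e (x + T) = lam * Fam l m d e x" for x
    unfolding Fam_def Psi_def Phi_def S_per s_per W_qper W'_qper by (simp add: scaleR_conv_of_real algebra_simps)
  ultimately show ?thesis using dFam by (simp add: C1q_def)
qed

text \<open>\<open>aF\<close> and \<open>bF\<close> are the coefficients of the Hessian image of the
  family on \<open>W\<close> and \<open>\<i> * W'\<close>; \<open>nF\<close> and \<open>mF\<close>
  are its values under \<open>N1\<close> and \<open>M2\<close>.\<close>

definition aF where "aF l m = 3 * J * l + (8 * E - 2 * sbar) * m"
definition bF where "bF l m = sbar * l + 2 * J * m"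
definition nF where "nF l m = T * (J * l + (2 * E - sbar\<^sup>2 / 2) * m)"
definition mF where "mF l m = - T * ((E - sbar\<^sup>2 / 4) * l + J * (2 - 2 * sbar) * m)"

lemma Hb_Fam:
  assumes "C1q v v'"
  shows "Hb (Fam l m d e) (Fam' l m d e) v v' = aF l m * N1 v + bF l m * M2 v"
proof (rule Hb_by_parts[OF C1q_Fam assms dFam' cont_Fam''])
  fix x
  have "- Fam'' l m d e x + (s x - 1) *\<^sub>R Fam l m d e x + (2 * (W x \<bullet> Fam l m d e x)) *\<^sub>R W x
    = l *\<^sub>R (- Psi'' x + (s x - 1) *\<^sub>R Psi x + (2 * (W x \<bullet> Psi x)) *\<^sub>R W x)
    + m *\<^sub>R (- Phi'' x + (s x - 1) *\<^sub>R Phi x + (2 * (W x \<bullet> Phi x)) *\<^sub>R W x)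
    + d *\<^sub>R (- (ds x *\<^sub>R W x + (s x - 1) *\<^sub>R W' x) + (s x - 1) *\<^sub>R W' x + (2 * (W x \<bullet> W' x)) *\<^sub>R W x)
    + e *\<^sub>R (- ((s x - 1) *\<^sub>R (\<i> * W x)) + (s x - 1) *\<^sub>R (\<i> * W x) + (2 * (W x \<bullet> (\<i> * W x))) *\<^sub>R W x)"
    unfolding Fam_def Fam''_def inner_add_right inner_scaleR_right by (simp add: algebra_simps)
  then show "- Fam'' l m d e x + (s x - 1) *\<^sub>R Fam l m d e x + (2 * (W x \<bullet> Fam l m d e x)) *\<^sub>R W x
      = aF l m *\<^sub>R W x + bF l m *\<^sub>R (\<i> * W' x)"
    unfolding L_Psi L_Phi L_W' L_iW by (simp add: aF_def bF_def algebra_simps)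
qed

lemma has_integral_s: "(s has_integral sbar * T) {0..T}"
  unfolding int_s[symmetric] by (rule integrable_integral[OF cint[OF cont_s]])

lemma has_integral_s2: "((\<lambda>x. (s x)\<^sup>2) has_integral (4 * sbar - 4 * E) / 3 * T) {0..T}"
  unfolding int_s2[symmetric] by (intro integrable_integral cint continuous_intros cont_s)

lemma has_integral_ds: "(ds has_integral 0) {0..T}"
  using integrable_integral[OF cint[OF cont_ds]] unfolding int_ds .

lemma has_integral_ds_S: "((\<lambda>x. ds x * S x) has_integral (sbar\<^sup>2 * T - (4 * sbar - 4 * E) / 3 * T)) {0..T}"
  unfolding int_ds_S[symmetric] by (intro integrable_integral cint continuous_intros cont_ds cont_S)

lemma N1_Fam: "N1 (Fam l m d e) = nF l m"
proof -
  have "((\<lambda>x. l * J + m * ((ds x * S x) * (1/2) + ((2 - sbar) * s x - (s x)\<^sup>2)) + d * (ds x * (1/2))) has_integral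
     (l * J) * T + m * ((sbar\<^sup>2 * T - (4 * sbar - 4 * E) / 3 * T) * (1/2) + ((2 - sbar) * (sbar * T) - (4 * sbar - 4 * E) / 3 * T))
      + d * (0 * (1/2))) {0..T}"
    using has_integral_const_real[of "l * J" 0 T] T
    by (intro has_integral_add has_integral_diff has_integral_mult_right has_integral_mult_left has_integral_s
        has_integral_s2 has_integral_ds has_integral_ds_S) (auto simp: algebra_simps)
  moreover have "W x \<bullet> Fam l m d e x
    = l * J + m * ((ds x * S x) * (1/2) + ((2 - sbar) * s x - (s x)\<^sup>2)) + d * (ds x * (1/2))" for x
    by (simp only: Fam_def inner_add_right inner_scaleR_right W_Psi W_Phi inner_facts)
      (simp add: power2_eq_square algebra_simps)
  ultimately have "N1 (Fam l m d e) = (l * J) * T + m * ((sbar\<^sup>2 * T - (4 * sbar - 4 * E) / 3 * T) * (1/2) + ((2 - sbar) * (sbar * T) - (4 * sbar - 4 * E) / 3 * T))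
      + d * (0 * (1/2))"
    unfolding N1_def by (simp only: integral_unique)
  also have "\<dots> = nF l m" unfolding nF_def by (rule moment_arith_n)
  finally show ?thesis .
qed

lemma M2_Fam: "M2 (Fam l m d e) = mF l m"
proof -
  have "((\<lambda>x. l * ((ds x * S x) * (1/4) - (2 * E - s x + (s x)\<^sup>2 * (1/2))) + m * (J * s x - J * (2 - sbar)) + e * (ds x * (1/2))) has_integral
     l * ((sbar\<^sup>2 * T - (4 * sbar - 4 * E) / 3 * T) * (1/4) - (2 * E * T - sbar * T + ((4 * sbar - 4 * E) / 3 * T) * (1/2)))
      + m * (J * (sbar * T) - J * (2 - sbar) * T) + e * (0 * (1/2))) {0..T}"
    using has_integral_const_real[of "2 * E" 0 T] has_integral_const_real[of "J * (2 - sbar)" 0 T] T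
    by (intro has_integral_add has_integral_diff has_integral_mult_right has_integral_mult_left has_integral_s
        has_integral_s2 has_integral_ds has_integral_ds_S) (auto simp: algebra_simps)
  moreover have "(\<i> * W' x) \<bullet> Fam l m d e x
    = l * ((ds x * S x) * (1/4) - (2 * E - s x + (s x)\<^sup>2 * (1/2))) + m * (J * s x - J * (2 - sbar)) + e * (ds x * (1/2))" for x
    by (simp only: Fam_def inner_add_right inner_scaleR_right W'_Psi W'_Phi inner_facts)
      (simp add: power2_eq_square algebra_simps)
  ultimately have "M2 (Fam l m d e) = l * ((sbar\<^sup>2 * T - (4 * sbar - 4 * E) / 3 * T) * (1/4) - (2 * E * T - sbar * T + ((4 * sbar - 4 * E) / 3 * T) * (1/2)))
      + m * (J * (sbar * T) - J * (2 - sbar) * T) + e * (0 * (1/2))"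
    unfolding M2_def by (simp only: integral_unique)
  also have "\<dots> = mF l m" unfolding mF_def by (rule moment_arith_m)
  finally show ?thesis .
qed

text \<open>The cross terms see only the two moments of \<open>v\<close>, so they disappear as soon
  as \<open>v\<close> satisfies the constraints.\<close>

lemma Hb_diff_Fam:
  assumes v: "C1q v v'"
  shows "Hb (\<lambda>x. v x - Fam l m d e x) (\<lambda>x. v' x - Fam' l m d e x) (\<lambda>x. v x - Fam l m d e x) (\<lambda>x. v' x - Fam' l m d e x)
   = Hb v v' v v' - 2 * (aF l m * N1 v + bF l m * M2 v) + (aF l m * nF l m + bF l m * mF l m)"
proof -
  let ?f = "Fam l m d e" and ?f' = "Fam' l m d e"
  note F = C1q_Fam[of l m d e]
  let ?h = "\<lambda>f f' v v' x. f' x \<bullet> v' x + (s x - 1) * (f x \<bullet> v x) + 2 * (W x \<bullet> f x) * (W x \<bullet> v x)"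
  have i: "(?h a a' b b' has_integral Hb a a' b b') {0..T}"
    if "C1q a a'" "C1q b b'" for a a' b b'
    unfolding Hb_def by (intro integrable_integral cint continuous_intros C1qD[OF that(1)] C1qD[OF that(2)] cont_s cont_W)
  have "((\<lambda>x. ?h v v' v v' x - 2 * ?h ?f ?f' v v' x + ?h ?f ?f' ?f ?f' x) has_integral
      (Hb v v' v v' - 2 * Hb ?f ?f' v v' + Hb ?f ?f' ?f ?f')) {0..T}"
    by (intro has_integral_add has_integral_diff has_integral_mult_right i v F)
  moreover have "?h v v' v v' x - 2 * ?h ?f ?f' v v' x + ?h ?f ?f' ?f ?f' x
     = ?h (\<lambda>x. v x - ?f x) (\<lambda>x. v' x - ?f' x) (\<lambda>x. v x - ?f x) (\<lambda>x. v' x - ?f' x) x" for x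
    by (simp add: inner_diff_left inner_diff_right inner_commute algebra_simps)
  ultimately have "Hb (\<lambda>x. v x - ?f x) (\<lambda>x. v' x - ?f' x) (\<lambda>x. v x - ?f x) (\<lambda>x. v' x - ?f' x)
     = Hb v v' v v' - 2 * Hb ?f ?f' v v' + Hb ?f ?f' ?f ?f'"
    unfolding Hb_def by (simp only: integral_unique)
  then show ?thesis unfolding Hb_Fam[OF v] Hb_Fam[OF F] N1_Fam M2_Fam .
qed

end

section \<open>Shape of the modulus, roots of the cubic and signs of the two determinants\<close>

lemma integral_pos_continuous:
  fixes f :: "real \<Rightarrow> real"
  assumes c: "continuous_on {a..b} f" and "a < b" and nn: "\<And>x. x \<in> {a..b} \<Longrightarrow> f x \<ge> 0"
    and t: "t \<in> {a..b}" "f t > 0"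
  shows "integral {a..b} f > 0"
proof -
  have "integral {a..b} f \<ge> 0"
    using c nn by (intro integral_nonneg integrable_continuous_real) auto
  moreover have "integral {a..b} f \<noteq> 0"
    using integral_eq_0_iff[OF c \<open>a < b\<close>] nn t by force
  ultimately show ?thesis by simp
qed

lemma indefinite_quadratic_form:
  fixes a b c :: real
  assumes "a * c < b\<^sup>2"
  shows "\<exists>l m. a * l\<^sup>2 + 2 * b * l * m + c * m\<^sup>2 < 0"
proof -
  consider "a < 0" | "a > 0" | "a = 0" by linarith
  then show ?thesis
  proof cases
    case 1
    then show ?thesis by (intro exI[of _ 1] exI[of _ 0]) simp
  next
    case 2
    have "a * b\<^sup>2 + 2 * b * b * (- a) + c * (- a)\<^sup>2 = a * (a * c - b\<^sup>2)"
      by (simp add: power2_eq_square algebra_simps)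
    also have "\<dots> < 0" using 2 assms by (simp add: mult_pos_neg)
    finally show ?thesis by blast
  next
    case 3
    with assms have "b \<noteq> 0" by auto
    have "a * ((- c - 1) / (2 * b))\<^sup>2 + 2 * b * ((- c - 1) / (2 * b)) * 1 + c * 1\<^sup>2 < 0"
      using 3 \<open>b \<noteq> 0\<close> by simp
    then show ?thesis by blast
  qed
qed

locale oscillating_wave = periodic_wave +
  assumes min0: "\<And>x. s 0 \<le> s x" and nonconst: "\<exists>x. s x \<noteq> s 0"
    and min_period: "\<And>R. 0 < R \<Longrightarrow> R < T \<Longrightarrow> \<exists>x. s (x + R) \<noteq> s x"
begin

lemma s_bounded: "\<exists>B. \<forall>x. s x \<le> B"
proof -
  obtain B where B: "\<And>x. x \<in> {0..T} \<Longrightarrow> s x \<le> B"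
    using continuous_attains_sup[OF compact_Icc, of 0 T s] T cont_s by (metis atLeastAtMost_iff empty_iff less_eq_real_def order_refl)
  have "s x \<le> B" for x
  proof -
    have pern: "s (x + of_nat m * T) = s x" for x m
    proof (induction m arbitrary: x)
      case (Suc m)
      have "s (x + of_nat (Suc m) * T) = s ((x + of_nat m * T) + T)" by (simp add: algebra_simps)
      then show ?case using Suc s_per by simp
    qed simp
    have peri: "s (x + of_int m * T) = s x" for x m
    proof (cases "m \<ge> 0")
      case True then show ?thesis using pern[of x "nat m"] by simp
    next
      case False then show ?thesis using pern[of "x + of_int m * T" "nat (- m)"] by simp
    qed
    have "x + of_int (- \<lfloor>x / T\<rfloor>) * T \<in> {0..T}"
      using floor_divide_lower[OF T, of x] floor_divide_upper[OF T, of x] by (auto simp: algebra_simps)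
    from B[OF this] show ?thesis by (simp only: peri)
  qed
  then show ?thesis by blast
qed

lemma s_bound_abs: "\<exists>B. \<forall>x y. \<bar>3 * (s x + s y) - 4\<bar> \<le> B"
proof -
  obtain B where B: "\<And>x. s x \<le> B" using s_bounded by blast
  have "\<bar>3 * (s x + s y) - 4\<bar> \<le> 6 * B + 4" for x y
    using B[of x] B[of y] s_nonneg[of x] s_nonneg[of y] by auto
  then show ?thesis by blast
qed

text \<open>The reflected function solves the same second-order equation as \<open>s\<close>, with
  the same value and slope at \<open>a\<close>. The equation is quadratic, so the difference
  satisfies a linear one, whose coefficient is bounded because \<open>s\<close> is.\<close>

lemma reflect:
  assumes "ds a = 0"
  shows "s (2 * a - x) = s x"
proof -
  obtain B where B: "\<And>x y. \<bar>3 * (s x + s y) - 4\<bar> \<le> B" using s_bound_abs by blast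
  let ?f = "\<lambda>x. s (2 * a - x) - s x" and ?f' = "\<lambda>x. - ds (2 * a - x) - ds x"
  let ?f'' = "\<lambda>x. (3 * (s (2 * a - x) + s x) - 4) * (s (2 * a - x) - s x)"
  have "?f x = 0"
  proof (rule second_order_zero[where x = x and f = ?f and a = a and f' = ?f' and f'' = ?f'' and K = B])
    show "(?f has_vector_derivative ?f' x) (at x)" for x
      using ds by (intro has_vector_derivative_diff has_vector_derivative_reflect)
        (auto simp: has_real_derivative_iff_has_vector_derivative)
    show "(?f' has_vector_derivative ?f'' x) (at x)" for x
    proof -
      have "(?f' has_vector_derivative - (- (3 * (s (2 * a - x))\<^sup>2 - 4 * s (2 * a - x) + 4 * E))
          - (3 * (s x)\<^sup>2 - 4 * s x + 4 * E)) (at x)"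
        using dds by (intro has_vector_derivative_diff has_vector_derivative_minus has_vector_derivative_reflect)
          (auto simp: has_real_derivative_iff_has_vector_derivative)
      then show ?thesis by (rule back_subst) (simp add: power2_eq_square algebra_simps)
    qed
    show "norm (?f'' x) \<le> B * norm (?f x)" for x
      unfolding real_norm_def abs_mult by (intro mult_right_mono B) auto
  qed (use assms in auto)
  then show ?thesis by simp
qed

text \<open>Otherwise \<open>s\<close> would coincide with the constant solution \<open>s a\<close>
  of its second-order equation.\<close>

lemma not_equilibrium:
  assumes "ds a = 0"
  shows "3 * (s a)\<^sup>2 - 4 * s a + 4 * E \<noteq> 0"
proof
  assume eq: "3 * (s a)\<^sup>2 - 4 * s a + 4 * E = 0"
  obtain B where B: "\<And>x y. \<bar>3 * (s x + s y) - 4\<bar> \<le> B" using s_bound_abs by blast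
  have "s x - s a = 0" for x
  proof (rule second_order_zero[where x = x and f = "\<lambda>x. s x - s a" and a = a and f' = ds and f'' = "\<lambda>x. (3 * (s x + s a) - 4) * (s x - s a)" and K = B])
    show "((\<lambda>x. s x - s a) has_vector_derivative ds x) (at x)" for x
      using has_vector_derivative_diff[OF ds[of x, unfolded has_real_derivative_iff_has_vector_derivative]
          has_vector_derivative_const[of "s a"]] by simp
    have "(3 * (s x + s a) - 4) * (s x - s a) = 3 * (s x)\<^sup>2 - 4 * s x + 4 * E" for x
      using eq by (simp add: power2_eq_square algebra_simps)
    then show "(ds has_vector_derivative (3 * (s x + s a) - 4) * (s x - s a)) (at x)" for x
      using dds[of x] by (simp add: has_real_derivative_iff_has_vector_derivative)
    show "norm ((3 * (s x + s a) - 4) * (s x - s a)) \<le> B * norm (s x - s a)" for x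
      unfolding real_norm_def abs_mult by (intro mult_right_mono B) auto
  qed (use assms in auto)
  then show False using nonconst by (metis eq_iff_diff_eq_0)
qed

lemma ds0: "ds 0 = 0"
  using DERIV_local_min[OF ds, of 1 0] min0 by auto

lemma s_even: "s (- x) = s x"
  using reflect[OF ds0, of x] by simp

lemma dds0_pos: "3 * (s 0)\<^sup>2 - 4 * s 0 + 4 * E > 0"
proof (rule ccontr)
  assume "\<not> ?thesis"
  then have neg: "3 * (s 0)\<^sup>2 - 4 * s 0 + 4 * E < 0" using not_equilibrium[OF ds0] by linarith
  obtain d where d: "d > 0" "\<And>h. 0 < h \<Longrightarrow> h < d \<Longrightarrow> ds h < 0"
    using DERIV_neg_dec_right[OF dds neg] ds0 by auto
  have "\<exists>z>0. z < d / 2 \<and> s (d / 2) - s 0 = (d / 2 - 0) * ds z"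
    using MVT2[of 0 "d / 2" s ds] ds d(1) by auto
  then obtain z where z: "0 < z" "z < d / 2" "s (d / 2) - s 0 = (d / 2) * ds z" by auto
  with d have "(d / 2) * ds z < 0" by (intro mult_pos_neg) auto
  with z min0[of "d / 2"] show False by linarith
qed

text \<open>Let \<open>t1\<close> be the first positive zero of \<open>ds\<close>. Reflection at 0
  and at \<open>t1\<close> makes \<open>2 * t1\<close> a period of \<open>s\<close>, so
  \<open>T \<le> 2 * t1\<close> by minimality. If \<open>T < 2 * t1\<close>, then \<open>T\<close>
  or its mirror image \<open>2 * t1 - T\<close> lies between 0 and \<open>t1\<close>, where
  \<open>s\<close> exceeds \<open>s 0 = s T\<close>.\<close>

lemma half_period:
  "ds (T / 2) = 0" "\<And>x. 0 < x \<Longrightarrow> x < T / 2 \<Longrightarrow> ds x > 0"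
proof -
  obtain d where d: "d > 0" "\<And>h. 0 < h \<Longrightarrow> h < d \<Longrightarrow> ds h > 0"
    using DERIV_pos_inc_right[OF dds dds0_pos] ds0 by auto
  \<comment> \<open>The left end \<open>d / 2\<close> keeps the set compact and excludes the zero of
    \<open>ds\<close> at 0.\<close>
  define Z where "Z = {d / 2..max d T} \<inter> ds -` {0}"
  have "compact Z" unfolding Z_def
    by (intro compact_Int_closed compact_Icc continuous_closed_vimage closed_singleton)
      (use cont_ds[of UNIV] in \<open>auto simp: continuous_on_eq_continuous_at\<close>)
  moreover have dT: "d \<le> T"
  proof (rule ccontr)
    assume "\<not> d \<le> T"
    then have "ds T > 0" using d T by auto
    then show False using ds_per[of 0] ds0 by simp
  qed
  then have "T \<in> Z" using d ds_per[of 0] ds0 by (auto simp: Z_def)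
  ultimately obtain t1 where t1: "t1 \<in> Z" "\<And>t. t \<in> Z \<Longrightarrow> t1 \<le> t"
    using compact_attains_inf[of Z] by blast
  have t1d: "t1 \<ge> d"
  proof (rule ccontr)
    assume "\<not> t1 \<ge> d"
    moreover have "d / 2 \<le> t1" "ds t1 = 0" using t1(1) by (auto simp: Z_def)
    ultimately show False using d(1) d(2)[of t1] by auto
  qed
  have t1_pos: "t1 > 0" "ds t1 = 0" "t1 \<le> T" using t1 \<open>T \<in> Z\<close> d by (auto simp: Z_def)
  have pos: "ds x > 0" if "0 < x" "x < t1" for x
  proof (cases "x < d")
    case True then show ?thesis using d that by simp
  next
    case False
    show ?thesis
    proof (rule ccontr)
      assume "\<not> ds x > 0"
      then have "ds x \<le> 0" by simp
      moreover have "0 \<le> ds (d / 2)" using d(1) d(2)[of "d / 2"] by simp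
      moreover have "d / 2 \<le> x" using False d(1) by simp
      ultimately obtain y where y: "d / 2 \<le> y" "y \<le> x" "ds y = 0"
        using IVT2'[of ds x 0 "d / 2", OF _ _ _ cont_ds] by blast
      then have "y \<in> Z" using that t1_pos by (auto simp: Z_def)
      from t1(2)[OF this] y that show False by simp
    qed
  qed
  have sper: "s (x + 2 * t1) = s x" for x
    using reflect[OF t1_pos(2), of "- x"] s_even[of x] by (simp add: add.commute)
  have "\<not> 2 * t1 < T" using min_period[of "2 * t1"] t1_pos sper by auto
  moreover have inc: "s x > s 0" if "0 < x" "x \<le> t1" for x
  proof -
    have "\<exists>z>0. z < x \<and> s x - s 0 = (x - 0) * ds z"
      using MVT2[of 0 x s ds] ds that by auto
    then obtain z where z: "0 < z" "z < x" "s x - s 0 = x * ds z" by auto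
    have "x * ds z > 0" using pos[of z] that z by (intro mult_pos_pos) auto
    with z(3) show ?thesis by linarith
  qed
  have "\<not> T < 2 * t1"
  proof
    assume "T < 2 * t1"
    have "s T = s 0" using s_per[of 0] by simp
    moreover have "s T = s (2 * t1 - T)" using reflect[OF t1_pos(2), of T] by simp
    moreover have "T > 0" by (rule T)
    ultimately show False using inc[of T] inc[of "2 * t1 - T"] \<open>T < 2 * t1\<close> by (cases "T \<le> t1") auto
  qed
  ultimately have "t1 = T / 2" by linarith
  then show "ds (T / 2) = 0" "\<And>x. 0 < x \<Longrightarrow> x < T / 2 \<Longrightarrow> ds x > 0" using t1_pos pos by auto
qed

definition r1 where "r1 = s 0"
definition r2 where "r2 = s (T / 2)"
text \<open>The third root of the cubic, whose roots have the sum 2.\<close>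

definition r3 where "r3 = 2 - r1 - r2"

lemma s_reflect_T: "s (T - x) = s x"
  using reflect[OF half_period(1), of x] by simp

lemma s_mono: "0 \<le> x \<Longrightarrow> x < y \<Longrightarrow> y \<le> T / 2 \<Longrightarrow> s x < s y"
proof -
  assume xy: "0 \<le> x" "x < y" "y \<le> T / 2"
  have "\<exists>z>x. z < y \<and> s y - s x = (y - x) * ds z"
    using MVT2[of x y s ds] ds xy by auto
  then obtain z where z: "x < z" "z < y" "s y - s x = (y - x) * ds z" by auto
  have "(y - x) * ds z > 0" using half_period(2)[of z] xy z by (intro mult_pos_pos) auto
  with z(3) show ?thesis by linarith
qed

lemma r12: "0 \<le> r1" "r1 < r2"
  using s_mono[of 0 "T / 2"] T s_nonneg by (auto simp: r1_def r2_def)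

lemma s_range: "x \<in> {0..T} \<Longrightarrow> r1 \<le> s x \<and> s x \<le> r2"
proof -
  have *: "r1 \<le> s x \<and> s x \<le> r2" if "0 \<le> x" "x \<le> T / 2" for x
  proof
    show "r1 \<le> s x" unfolding r1_def by (rule min0)
    show "s x \<le> r2" using s_mono[of x "T / 2"] that unfolding r2_def by (cases "x = T / 2") auto
  qed
  assume "x \<in> {0..T}"
  then show ?thesis using *[of x] *[of "T - x"] unfolding s_reflect_T[of x] by (cases "x \<le> T / 2") simp_all
qed

lemma E_roots: "4 * E = r1 * r2 + r1 * r3 + r2 * r3" and J_roots: "2 * J\<^sup>2 = r1 * r2 * r3"
proof -
  have 1: "2 * r1^3 - 4 * r1\<^sup>2 + 8 * E * r1 - 4 * J\<^sup>2 = 0" using ds_sq[of 0] ds0 by (simp add: r1_def)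
  have 2: "2 * r2^3 - 4 * r2\<^sup>2 + 8 * E * r2 - 4 * J\<^sup>2 = 0" using ds_sq[of "T / 2"] half_period(1) by (simp add: r2_def)
  have "(r2 - r1) * (2 * (r1\<^sup>2 + r1 * r2 + r2\<^sup>2) - 4 * (r1 + r2) + 8 * E) = 0"
    using 1 2 by (simp add: power2_eq_square power3_eq_cube algebra_simps)
  then have 3: "2 * (r1\<^sup>2 + r1 * r2 + r2\<^sup>2) - 4 * (r1 + r2) + 8 * E = 0" using r12 by simp
  then show E: "4 * E = r1 * r2 + r1 * r3 + r2 * r3"
    by (simp add: r3_def power2_eq_square algebra_simps)
  have "4 * J\<^sup>2 = 2 * r1^3 - 4 * r1\<^sup>2 + 2 * (4 * E) * r1" using 1 by simp
  then show "2 * J\<^sup>2 = r1 * r2 * r3"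
    unfolding E by (simp add: r3_def power2_eq_square power3_eq_cube algebra_simps)
qed

lemma ds_sq_roots: "(ds x)\<^sup>2 = 2 * ((s x - r1) * (s x - r2) * (s x - r3))"
proof -
  have "(ds x)\<^sup>2 = 2 * (s x)^3 - 4 * (s x)\<^sup>2 + 2 * (4 * E) * s x - 2 * (2 * J\<^sup>2)"
    using ds_sq[of x] by simp
  then show ?thesis unfolding E_roots J_roots
    by (simp add: r3_def power2_eq_square power3_eq_cube algebra_simps)
qed

text \<open>If \<open>r2 = r3\<close>, the maximum of \<open>s\<close> would be an equilibrium. If
  \<open>r3 < r2\<close>, the cubic would be negative just below \<open>r2\<close>, at a value that
  \<open>s\<close> takes, although along \<open>s\<close> it equals
  \<open>ds\<^sup>2 / 2\<close>.\<close>

lemma r23: "r2 < r3"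
proof (rule ccontr)
  assume "\<not> r2 < r3"
  moreover have "r2 \<noteq> r3"
  proof
    assume "r2 = r3"
    then have r1: "r1 = 2 - 2 * r2" by (simp add: r3_def)
    have "3 * r2\<^sup>2 - 4 * r2 + 4 * E = 0" unfolding E_roots \<open>r2 = r3\<close>[symmetric] r1
      by (simp add: power2_eq_square algebra_simps)
    then show False using not_equilibrium[OF half_period(1)] by (simp add: r2_def)
  qed
  ultimately have lt: "r3 < r2" by simp
  define v where "v = (max r1 r3 + r2) / 2"
  have v: "r1 < v" "r3 < v" "v < r2" using r12 lt by (auto simp: v_def)
  obtain t where t: "0 \<le> t" "t \<le> T / 2" "s t = v"
    using IVT'[of s 0 v "T / 2"] v T cont_s by (auto simp: r1_def r2_def)
  have "(v - r1) * (v - r2) * (v - r3) < 0"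
    using v by (simp add: mult_pos_neg mult_neg_pos)
  with ds_sq_roots[of t] t show False by (metis mult_2 add_neg_neg not_less zero_le_power2)
qed

lemma sbar_range: "r1 < sbar" "sbar < r2"
proof -
  have h: "T / 2 \<in> {0..T}" "0 \<in> {0..T}" using T by auto
  have "integral {0..T} (\<lambda>x. s x - r1) > 0"
    by (rule integral_pos_continuous[OF _ T _ h(1)])
      (use r12 s_range in \<open>auto simp: r2_def intro!: continuous_intros cont_s\<close>)
  moreover have "((\<lambda>x. s x - r1) has_integral sbar * T - r1 * T) {0..T}"
    using has_integral_const_real[of r1 0 T] T
    by (intro has_integral_diff has_integral_s) (simp add: mult.commute)
  ultimately have "r1 * T < sbar * T" by (auto dest!: integral_unique)
  then show "r1 < sbar" using T by simp
  have "integral {0..T} (\<lambda>x. r2 - s x) > 0"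
    by (rule integral_pos_continuous[OF _ T _ h(2)])
      (use r12 s_range in \<open>auto simp: r1_def intro!: continuous_intros cont_s\<close>)
  moreover have "((\<lambda>x. r2 - s x) has_integral r2 * T - sbar * T) {0..T}"
    using has_integral_const_real[of r2 0 T] T
    by (intro has_integral_diff has_integral_s) (simp add: mult.commute)
  ultimately have "sbar * T < r2 * T" by (auto dest!: integral_unique)
  then show "sbar < r2" using T by simp
qed

text \<open>Nonnegativity of the variance of \<open>s\<close>, with the second moment from
  \<open>has_integral_s2\<close>.\<close>

lemma sbar_jensen: "3 * sbar\<^sup>2 - 4 * sbar + 4 * E \<le> 0"
proof -
  have "((\<lambda>x. (s x)\<^sup>2 - (2 * sbar) * s x + sbar\<^sup>2) has_integral
      (4 * sbar - 4 * E) / 3 * T - (2 * sbar) * (sbar * T) + sbar\<^sup>2 * T) {0..T}"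
    using has_integral_const_real[of "sbar\<^sup>2" 0 T] T
    by (intro has_integral_add has_integral_diff has_integral_mult_right has_integral_s has_integral_s2)
      (simp add: mult.commute)
  moreover have "0 \<le> (s x)\<^sup>2 - (2 * sbar) * s x + sbar\<^sup>2" for x
    using zero_le_power2[of "s x - sbar"] by (simp add: power2_eq_square algebra_simps)
  ultimately have "0 \<le> (4 * sbar - 4 * E) / 3 * T - (2 * sbar) * (sbar * T) + sbar\<^sup>2 * T"
    using has_integral_nonneg by blast
  also have "\<dots> = T * ((4 * sbar - 4 * E) / 3 - sbar\<^sup>2)" by (simp add: power2_eq_square algebra_simps)
  finally show ?thesis using T by (simp add: zero_le_mult_iff)
qed

text \<open>Integrating \<open>u (2ab - (a + b) u) \<ge> 0\<close> for \<open>u = s - r1 \<in> [0, a]\<close>; this is the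
  monotonicity of the period.\<close>

lemma sbar_upper:
  defines "a \<equiv> r2 - r1" and "b \<equiv> r3 - r1" and "d \<equiv> sbar - r1"
  shows "2 * d * (a\<^sup>2 - a * b + b\<^sup>2) \<le> a * b * (a + b)"
proof -
  have ab: "0 < a" "a < b" using r12 r23 by (auto simp: a_def b_def)
  define M where "M = (4 * sbar - 4 * E) / 3"
  have "((\<lambda>x. (- (a + b)) * (s x)\<^sup>2 + (2 * (a + b) * r1 + 2 * a * b) * s x + (- (a + b) * r1\<^sup>2 - 2 * a * b * r1)) has_integral
      (- (a + b)) * (M * T) + (2 * (a + b) * r1 + 2 * a * b) * (sbar * T) + (- (a + b) * r1\<^sup>2 - 2 * a * b * r1) * T) {0..T}"
    unfolding M_def using has_integral_const_real[of "- (a + b) * r1\<^sup>2 - 2 * a * b * r1" 0 T] T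
    by (intro has_integral_add has_integral_diff has_integral_mult_right has_integral_s has_integral_s2)
      (simp add: mult.commute)
  moreover have "0 \<le> (- (a + b)) * (s x)\<^sup>2 + (2 * (a + b) * r1 + 2 * a * b) * s x + (- (a + b) * r1\<^sup>2 - 2 * a * b * r1)"
    if "x \<in> {0..T}" for x
  proof -
    define u where "u = s x - r1"
    have u: "0 \<le> u" "u \<le> a" using s_range[OF that] by (auto simp: u_def a_def)
    have "(a + b) * u \<le> (a + b) * a" using u ab by (intro mult_left_mono) auto
    also have "\<dots> \<le> 2 * a * b" using ab by (simp add: algebra_simps)
    finally have "0 \<le> u * (2 * a * b - (a + b) * u)" using u by simp
    also have "\<dots> = (- (a + b)) * (s x)\<^sup>2 + (2 * (a + b) * r1 + 2 * a * b) * s x + (- (a + b) * r1\<^sup>2 - 2 * a * b * r1)"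
      by (simp add: u_def power2_eq_square algebra_simps)
    finally show ?thesis .
  qed
  ultimately have "0 \<le> (- (a + b)) * (M * T) + (2 * (a + b) * r1 + 2 * a * b) * (sbar * T) + (- (a + b) * r1\<^sup>2 - 2 * a * b * r1) * T"
    using has_integral_nonneg by blast
  also have "\<dots> = T * (2 * a * b * d - (a + b) * (M - 2 * r1 * sbar + r1\<^sup>2))"
    by (simp add: d_def power2_eq_square algebra_simps)
  finally have 1: "(a + b) * (M - 2 * r1 * sbar + r1\<^sup>2) \<le> 2 * a * b * d" using T by (simp add: zero_le_mult_iff)
  have "3 * (M - 2 * r1 * sbar + r1\<^sup>2) = 4 * sbar - (r1 * r2 + r1 * r3 + r2 * r3) - 6 * r1 * sbar + 3 * r1\<^sup>2"
    unfolding E_roots[symmetric] by (simp add: M_def)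
  also have "\<dots> = 2 * (a + b) * d - a * b"
    unfolding a_def b_def d_def by (simp add: r3_def power2_eq_square algebra_simps)
  finally have 2: "3 * (M - 2 * r1 * sbar + r1\<^sup>2) = 2 * (a + b) * d - a * b" .
  have "(a + b) * (3 * (M - 2 * r1 * sbar + r1\<^sup>2)) \<le> 6 * a * b * d" using 1 by (simp add: algebra_simps)
  then show ?thesis unfolding 2 by (simp add: power2_eq_square algebra_simps)
qed

lemma cubic_sbar_pos: "(sbar - r1) * (sbar - r2) * (sbar - r3) > 0"
  using sbar_range r23 by (simp add: mult_pos_neg mult_neg_neg)

text \<open>The determinant of \<open>aF\<close> and \<open>bF\<close> in \<open>l\<close> and
  \<open>m\<close> is twice this quantity. It equals \<open>sbar\<close> times the expression in
  \<open>sbar_jensen\<close> minus three times the cubic at \<open>sbar\<close>, which is positive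
  because \<open>sbar\<close> lies strictly between the two smaller roots.\<close>

lemma det_C_neg: "3 * J\<^sup>2 - 4 * E * sbar + sbar\<^sup>2 < 0"
proof -
  have "2 * (3 * J\<^sup>2 - 4 * E * sbar + sbar\<^sup>2) = 3 * (2 * J\<^sup>2) - 2 * (4 * E) * sbar + 2 * sbar\<^sup>2" by simp
  also have "\<dots> = sbar * (3 * sbar\<^sup>2 - 4 * sbar + 4 * E) - 3 * ((sbar - r1) * (sbar - r2) * (sbar - r3))"
    unfolding E_roots J_roots by (simp add: r3_def power2_eq_square algebra_simps)
  also have "\<dots> < 0"
  proof -
    have "sbar * (3 * sbar\<^sup>2 - 4 * sbar + 4 * E) \<le> 0"
      using sbar_jensen sbar_range r12 by (intro mult_nonneg_nonpos) auto
    then show ?thesis using cubic_sbar_pos by linarith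
  qed
  finally show ?thesis by simp
qed

text \<open>The numerator of the duplication formula on \<open>y\<^sup>2 = (x - r1) (x - r2) (x - r3)\<close> at \<open>x = sbar\<close>:
  it is positive because doubling leads to the unbounded real component of the curve.\<close>

lemma det_V_pos: "(E - sbar\<^sup>2 / 4)\<^sup>2 - J\<^sup>2 * (1 - sbar) > 0"
proof -
  have "16 * ((E - sbar\<^sup>2 / 4)\<^sup>2 - J\<^sup>2 * (1 - sbar)) = (4 * E - sbar\<^sup>2)\<^sup>2 - 8 * (2 * J\<^sup>2) * (1 - sbar)"
    by (simp add: power2_eq_square field_simps)
  also have "\<dots> = 4 * r3 * ((sbar - r1) * (sbar - r2) * (sbar - r3)) + ((sbar - r3)\<^sup>2 - (r3 - r1) * (r3 - r2))\<^sup>2"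
  proof -
    have r1: "r1 = 2 - r2 - r3" by (simp add: r3_def)
    show ?thesis unfolding E_roots J_roots unfolding r1 by (simp add: power2_eq_square algebra_simps)
  qed
  also have "\<dots> > 0"
  proof -
    have "4 * r3 > 0" using r12 r23 by simp
    then have "4 * r3 * ((sbar - r1) * (sbar - r2) * (sbar - r3)) > 0" using cubic_sbar_pos by (rule mult_pos_pos)
    then show ?thesis by (rule add_pos_nonneg) simp
  qed
  finally show ?thesis by simp
qed

text \<open>On the family the Hessian is the product of the matrix of \<open>aF\<close>,
  \<open>bF\<close> and the matrix of \<open>nF\<close>, \<open>mF\<close>, so its determinant is
  the product of theirs. By \<open>det_C_neg\<close> and \<open>det_V_pos\<close> the product is
  negative, and the form is indefinite.\<close>

lemma negative_direction: "\<exists>l m. aF l m * nF l m + bF l m * mF l m < 0"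
proof -
  define G where "G = E - sbar\<^sup>2 / 4"
  define a b c where "a = T * (3 * J\<^sup>2 - sbar * G)" and "b = T * (3 * J * (2 * G) - sbar * J * (2 - 2 * sbar))"
    and "c = T * ((8 * E - 2 * sbar) * (2 * G) - 4 * J\<^sup>2 * (1 - sbar))"
  have G2: "2 * E - sbar\<^sup>2 / 2 = 2 * G" by (simp add: G_def)
  have E_G: "8 * E - 2 * sbar = 8 * G + 2 * sbar\<^sup>2 - 2 * sbar" by (simp add: G_def)
  have q: "aF l m * nF l m + bF l m * mF l m = a * l\<^sup>2 + 2 * b * l * m + c * m\<^sup>2" for l m
    unfolding aF_def bF_def nF_def mF_def a_def b_def c_def G2 unfolding G_def[symmetric] E_G
    by (simp add: power2_eq_square algebra_simps)
  have "b\<^sup>2 - a * c = T\<^sup>2 * (- 4 * (3 * J\<^sup>2 - 4 * E * sbar + sbar\<^sup>2)) * (G\<^sup>2 - J\<^sup>2 * (1 - sbar))"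
  proof -
    have E: "E = G + sbar\<^sup>2 / 4" by (simp add: G_def)
    show ?thesis unfolding a_def b_def c_def unfolding E by (simp add: power2_eq_square algebra_simps)
  qed
  also have "\<dots> > 0"
    using det_C_neg det_V_pos T unfolding G_def[symmetric] by (simp add: zero_less_mult_iff)
  finally show ?thesis unfolding q by (intro indefinite_quadratic_form) simp
qed

text \<open>Cramer's rule; the determinant is nonzero by \<open>det_V_pos\<close>. The bound means
  that the moments of a perturbation can be removed at a cost proportional to their squares, which
  becomes the penalty term of the coercivity estimate.\<close>

lemma solve_moments:
  "\<exists>K\<ge>0. \<forall>n1 m2. \<exists>l m. nF l m = n1 \<and> mF l m = m2 \<and> l\<^sup>2 + m\<^sup>2 \<le> K * (n1\<^sup>2 + m2\<^sup>2)"
proof -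
  define G where "G = E - sbar\<^sup>2 / 4"
  define H where "H = J * (2 - 2 * sbar)"
  define D where "D = 2 * T * (G\<^sup>2 - J\<^sup>2 * (1 - sbar))"
  have D: "D > 0" using det_V_pos T by (simp add: D_def G_def)
  have D': "D = T * (2 * G * G - J * H)" by (simp add: D_def H_def power2_eq_square algebra_simps)
  have nm: "nF l m = T * (J * l + 2 * G * m)" "mF l m = - T * (G * l + H * m)" for l m
    by (simp_all add: nF_def mF_def G_def H_def algebra_simps)
  define K where "K = 2 * (H\<^sup>2 + G\<^sup>2 + 4 * G\<^sup>2 + J\<^sup>2) / D\<^sup>2"
  have "\<exists>l m. nF l m = n1 \<and> mF l m = m2 \<and> l\<^sup>2 + m\<^sup>2 \<le> K * (n1\<^sup>2 + m2\<^sup>2)" for n1 m2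
  proof (intro exI conjI)
    let ?l = "- (H * n1 + 2 * G * m2) / D" and ?m = "(G * n1 + J * m2) / D"
    have "nF ?l ?m = T * (2 * G * G - J * H) * n1 / D"
      unfolding nm using D by (simp add: field_simps)
    then show "nF ?l ?m = n1" using D unfolding D'[symmetric] by simp
    have "mF ?l ?m = T * (2 * G * G - J * H) * m2 / D"
      unfolding nm using D by (simp add: field_simps)
    then show "mF ?l ?m = m2" using D unfolding D'[symmetric] by simp
    have sq: "(p + q)\<^sup>2 \<le> 2 * (p\<^sup>2 + q\<^sup>2)" for p q :: real
      using sum_squares_bound[of p q] by (simp add: power2_eq_square algebra_simps)
    have "?l\<^sup>2 + ?m\<^sup>2 = ((H * n1 + 2 * G * m2)\<^sup>2 + (G * n1 + J * m2)\<^sup>2) / D\<^sup>2"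
      by (simp only: power_divide power2_minus) (simp only: add_divide_distrib)
    also have "\<dots> \<le> (2 * ((H * n1)\<^sup>2 + (2 * G * m2)\<^sup>2) + 2 * ((G * n1)\<^sup>2 + (J * m2)\<^sup>2)) / D\<^sup>2"
      by (intro divide_right_mono add_mono sq) auto
    also have "\<dots> \<le> (2 * (H\<^sup>2 + G\<^sup>2 + 4 * G\<^sup>2 + J\<^sup>2) * (n1\<^sup>2 + m2\<^sup>2)) / D\<^sup>2"
    proof (intro divide_right_mono)
      have "0 \<le> 2 * ((4 * G\<^sup>2 + J\<^sup>2) * n1\<^sup>2 + (H\<^sup>2 + G\<^sup>2) * m2\<^sup>2)" by simp
      then show "2 * ((H * n1)\<^sup>2 + (2 * G * m2)\<^sup>2) + 2 * ((G * n1)\<^sup>2 + (J * m2)\<^sup>2)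
        \<le> 2 * (H\<^sup>2 + G\<^sup>2 + 4 * G\<^sup>2 + J\<^sup>2) * (n1\<^sup>2 + m2\<^sup>2)"
        by (simp add: power_mult_distrib algebra_simps)
    qed simp
    finally show "?l\<^sup>2 + ?m\<^sup>2 \<le> K * (n1\<^sup>2 + m2\<^sup>2)" by (simp add: K_def)
  qed
  moreover have "K \<ge> 0" by (simp add: K_def)
  ultimately show ?thesis by blast
qed

end

section \<open>From point conditions to coercivity modulo the tangent space\<close>

context oscillating_wave
begin

lemma nrm2_nonneg: "C1q v v' \<Longrightarrow> nrm2 v v' \<ge> 0"
  unfolding nrm2_def
  by (intro integral_nonneg cint continuous_intros) (auto intro: C1qD)

lemma nrm2_add3:
  assumes "C1q a a'" "C1q b b'" "C1q c c'"
  shows "nrm2 (\<lambda>x. a x + b x + c x) (\<lambda>x. a' x + b' x + c' x) \<le> 3 * (nrm2 a a' + nrm2 b b' + nrm2 c c')"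
proof -
  have sq: "(p + q + r) \<bullet> (p + q + r) \<le> 3 * (p \<bullet> p + q \<bullet> q + r \<bullet> r)" for p q r :: complex
  proof -
    have "0 \<le> (p - q) \<bullet> (p - q) + (q - r) \<bullet> (q - r) + (p - r) \<bullet> (p - r)" by simp
    then show ?thesis by (simp add: inner_diff_left inner_diff_right inner_add_left inner_add_right inner_commute)
  qed
  note D = C1qD[OF assms(1)] C1qD[OF assms(2)] C1qD[OF assms(3)]
  let ?h = "\<lambda>v v' x. v x \<bullet> v x + v' x \<bullet> v' (x::real) :: real"
  have "nrm2 (\<lambda>x. a x + b x + c x) (\<lambda>x. a' x + b' x + c' x)
     \<le> integral {0..T} (\<lambda>x. 3 * (?h a a' x + ?h b b' x + ?h c c' x))"
    unfolding nrm2_def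
  proof (rule integral_le)
    fix x
    show "(a x + b x + c x) \<bullet> (a x + b x + c x) + (a' x + b' x + c' x) \<bullet> (a' x + b' x + c' x)
        \<le> 3 * (?h a a' x + ?h b b' x + ?h c c' x)"
      using sq[of "a x" "b x" "c x"] sq[of "a' x" "b' x" "c' x"] by simp
  qed (intro cint continuous_intros D)+
  also have "((\<lambda>x. 3 * (?h a a' x + ?h b b' x + ?h c c' x)) has_integral
      3 * (nrm2 a a' + nrm2 b b' + nrm2 c c')) {0..T}"
    unfolding nrm2_def by (intro has_integral_mult_right has_integral_add integrable_integral cint continuous_intros D)
  then have "integral {0..T} (\<lambda>x. 3 * (?h a a' x + ?h b b' x + ?h c c' x)) = 3 * (nrm2 a a' + nrm2 b b' + nrm2 c c')"
    by (rule integral_unique)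
  finally show ?thesis .
qed

lemma nrm2_scale: "nrm2 (\<lambda>x. c *\<^sub>R v x) (\<lambda>x. c *\<^sub>R v' x) = c\<^sup>2 * nrm2 v v'"
proof -
  have "(\<lambda>x. (c *\<^sub>R v x) \<bullet> (c *\<^sub>R v x) + (c *\<^sub>R v' x) \<bullet> (c *\<^sub>R v' x)) = (\<lambda>x. c\<^sup>2 * (v x \<bullet> v x + v' x \<bullet> v' x))"
    by (simp add: power2_eq_square algebra_simps)
  then show ?thesis unfolding nrm2_def by simp
qed

lemma Fam_bound: "\<exists>K\<ge>0. \<forall>l m. nrm2 (Fam l m 0 0) (Fam' l m 0 0) \<le> K * (l\<^sup>2 + m\<^sup>2)"
proof -
  define K where "K = 3 * (nrm2 Psi Psi' + nrm2 Phi Phi')"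
  have P: "C1q Psi Psi'" "C1q Phi Phi'"
    using C1q_Fam[of 1 0 0 0] C1q_Fam[of 0 1 0 0] by (simp_all add: Fam_def[abs_def] Fam'_def[abs_def])
  have pos: "nrm2 Psi Psi' \<ge> 0" "nrm2 Phi Phi' \<ge> 0" using P nrm2_nonneg by auto
  have "nrm2 (Fam l m 0 0) (Fam' l m 0 0) \<le> K * (l\<^sup>2 + m\<^sup>2)" for l m
  proof -
    have S: "C1q (\<lambda>x. l *\<^sub>R Psi x) (\<lambda>x. l *\<^sub>R Psi' x)" "C1q (\<lambda>x. m *\<^sub>R Phi x) (\<lambda>x. m *\<^sub>R Phi' x)" "C1q (\<lambda>x. 0) (\<lambda>x. 0)"
      using C1q_Fam[of l 0 0 0] C1q_Fam[of 0 m 0 0] C1q_Fam[of 0 0 0 0] by (simp_all add: Fam_def[abs_def] Fam'_def[abs_def])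
    have "nrm2 (Fam l m 0 0) (Fam' l m 0 0)
        \<le> 3 * (nrm2 (\<lambda>x. l *\<^sub>R Psi x) (\<lambda>x. l *\<^sub>R Psi' x) + nrm2 (\<lambda>x. m *\<^sub>R Phi x) (\<lambda>x. m *\<^sub>R Phi' x) + nrm2 (\<lambda>x. 0) (\<lambda>x. 0))"
      using nrm2_add3[OF S] by (simp add: Fam_def[abs_def] Fam'_def[abs_def])
    also have "\<dots> = 3 * (l\<^sup>2 * nrm2 Psi Psi' + m\<^sup>2 * nrm2 Phi Phi')"
      unfolding nrm2_scale by (simp add: nrm2_def)
    also have "\<dots> \<le> K * (l\<^sup>2 + m\<^sup>2)"
    proof -
      have "0 \<le> 3 * (l\<^sup>2 * nrm2 Phi Phi' + m\<^sup>2 * nrm2 Psi Psi')" using pos by simp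
      then show ?thesis by (simp add: K_def algebra_simps)
    qed
    finally show ?thesis .
  qed
  moreover have "K \<ge> 0" using pos by (simp add: K_def)
  ultimately show ?thesis by blast
qed

lemma Fam_add: "Fam (l + l') (m + m') (d + d') (e + e') x = Fam l m d e x + Fam l' m' d' e' x"
  and Fam_scale: "Fam (c * l) (c * m) (c * d) (c * e) x = c *\<^sub>R Fam l m d e x"
  by (simp_all add: Fam_def algebra_simps)

lemma W_W'_independent:
  assumes "\<And>x. x \<in> {0..T} \<Longrightarrow> d *\<^sub>R W' x + e *\<^sub>R (\<i> * W x) = 0"
  shows "d = 0 \<and> e = 0"
proof -
  have "W (T / 4) \<bullet> (d *\<^sub>R W' (T / 4) + e *\<^sub>R (\<i> * W (T / 4))) = 0" using assms T by simp
  then have "d * (ds (T / 4) / 2) = 0" by (simp only: inner_add_right inner_scaleR_right inner_facts)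
  then have d: "d = 0" using half_period(2)[of "T / 4"] T by simp
  have "W (T / 2) \<noteq> 0" using r12 by (auto simp: r2_def s_def)
  moreover have "e *\<^sub>R (\<i> * W (T / 2)) = 0" using assms[of "T / 2"] T d by simp
  ultimately show ?thesis using d by simp
qed

lemma nrm2_zero:
  assumes "C1q v v'" "nrm2 v v' \<le> 0" "x \<in> {0..T}"
  shows "v x = 0"
proof -
  have "integral {0..T} (\<lambda>x. v x \<bullet> v x + v' x \<bullet> v' x) = 0"
    using assms(2) nrm2_nonneg[OF assms(1)] by (simp add: nrm2_def)
  moreover have "continuous_on {0..T} (\<lambda>x. v x \<bullet> v x + v' x \<bullet> v' x)"
    by (intro continuous_intros C1qD[OF assms(1)])
  ultimately have "v x \<bullet> v x + v' x \<bullet> v' x = 0"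
    using integral_eq_0_iff[of 0 T "\<lambda>x. v x \<bullet> v x + v' x \<bullet> v' x"] T assms(3) by auto
  then have "v x \<bullet> v x = 0" using inner_ge_zero[of "v x"] inner_ge_zero[of "v' x"] by linarith
  then show ?thesis by simp
qed

text \<open>Positivity on the kernel of three point evaluations suffices: these have to separate the
  tangent space and one negative direction of the Hessian, and the latter is explicit.\<close>

lemma coercive_modulo_tangent:
  fixes a :: "nat \<Rightarrow> complex" and t :: "nat \<Rightarrow> real"
  defines "L \<equiv> \<lambda>v::real \<Rightarrow> complex. (a 0 \<bullet> v (t 0), a 1 \<bullet> v (t 1), a 2 \<bullet> v (t 2))"
  assumes \<delta>: "\<delta> > 0" and Z: "\<And>z z'. C1q z z' \<Longrightarrow> L z = 0 \<Longrightarrow> \<delta> * nrm2 z z' \<le> Hb z z' z z'"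
  shows "\<exists>c>0. \<exists>C\<ge>0. \<forall>v v'. C1q v v' \<longrightarrow> (\<exists>d e. c * nrm2 (\<lambda>x. v x - Fam 0 0 d e x) (\<lambda>x. v' x - Fam' 0 0 d e x)
    \<le> Hb v v' v v' + C * ((N1 v)\<^sup>2 + (M2 v)\<^sup>2))"
proof -
  define q where "q = (\<lambda>l m. aF l m * nF l m + bF l m * mF l m)"
  have q_scale: "q (c * l) (c * m) = c\<^sup>2 * q l m" for c l m
    by (simp add: q_def aF_def bF_def nF_def mF_def power2_eq_square algebra_simps)
  have q_Hb: "Hb (Fam l m d e) (Fam' l m d e) (Fam l m d e) (Fam' l m d e) = q l m" for l m d e
    unfolding Hb_Fam[OF C1q_Fam] N1_Fam M2_Fam q_def ..
  obtain l0 m0 where q0: "q l0 m0 < 0" using negative_direction unfolding q_def by blast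
  define f :: "real \<times> real \<times> real \<Rightarrow> real \<times> real \<times> real"
    where "f = (\<lambda>(c, d, e). L (Fam (c * l0) (c * m0) d e))"
  have lin: "linear f"
  proof (rule linearI)
    fix p p' :: "real \<times> real \<times> real"
    obtain c d e c' d' e' where p: "p = (c, d, e)" "p' = (c', d', e')" by (cases p; cases p') auto
    have "Fam ((c + c') * l0) ((c + c') * m0) (d + d') (e + e') x
        = Fam (c * l0) (c * m0) d e x + Fam (c' * l0) (c' * m0) d' e' x" for x
      using Fam_add[of "c * l0" "c' * l0" "c * m0" "c' * m0" d d' e e' x] by (simp add: algebra_simps)
    then show "f (p + p') = f p + f p'" by (simp add: f_def p L_def inner_add_right)
  next
    fix r :: real and p :: "real \<times> real \<times> real"
    obtain c d e where p: "p = (c, d, e)" by (cases p) auto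
    have "Fam (r * c * l0) (r * c * m0) (r * d) (r * e) x = r *\<^sub>R Fam (c * l0) (c * m0) d e x" for x
      using Fam_scale[of r "c * l0" "c * m0" d e x] by (simp add: algebra_simps)
    then show "f (r *\<^sub>R p) = r *\<^sub>R f p" by (simp add: f_def p L_def)
  qed
  \<comment> \<open>On an element of the kernel the three point conditions hold, so the Hessian is
    nonnegative; but it equals \<open>c\<^sup>2\<close> times the negative number
    \<open>q l0 m0\<close>. Hence \<open>c = 0\<close>, the norm vanishes as well, and a tangent
    vector of norm zero is trivial.\<close>
  have "inj f"
  proof (subst linear_injective_0[OF lin], intro allI impI)
    fix p assume "f p = 0"
    obtain c d e where p: "p = (c, d, e)" by (cases p) auto
    have "\<delta> * nrm2 (Fam (c * l0) (c * m0) d e) (Fam' (c * l0) (c * m0) d e) \<le> c\<^sup>2 * q l0 m0"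
      using Z[OF C1q_Fam, of "c * l0" "c * m0" d e] \<open>f p = 0\<close> unfolding q_Hb q_scale by (simp add: f_def p)
    moreover have "\<delta> * nrm2 (Fam (c * l0) (c * m0) d e) (Fam' (c * l0) (c * m0) d e) \<ge> 0"
      using \<delta> nrm2_nonneg[OF C1q_Fam] by simp
    ultimately have "c\<^sup>2 * q l0 m0 \<ge> 0"
      and le: "\<delta> * nrm2 (Fam (c * l0) (c * m0) d e) (Fam' (c * l0) (c * m0) d e) \<le> c\<^sup>2 * q l0 m0" by linarith+
    with q0 have c: "c = 0" by (simp add: zero_le_mult_iff)
    with le \<delta> have "nrm2 (Fam 0 0 d e) (Fam' 0 0 d e) \<le> 0" by (simp add: mult_le_0_iff)
    then have "Fam 0 0 d e x = 0" if "x \<in> {0..T}" for x using nrm2_zero[OF C1q_Fam] that by blast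
    then have "d = 0 \<and> e = 0" by (intro W_W'_independent) (simp add: Fam_def)
    with c show "p = 0" by (simp add: p zero_prod_def)
  qed
  then have surj: "surj f" by (rule linear_injective_imp_surjective[OF lin]) simp
  obtain K where K: "K \<ge> 0" "\<And>n1 m2. \<exists>l m. nF l m = n1 \<and> mF l m = m2 \<and> l\<^sup>2 + m\<^sup>2 \<le> K * (n1\<^sup>2 + m2\<^sup>2)"
    using solve_moments by blast
  obtain K1 where K1: "K1 \<ge> 0" "\<And>l m. nrm2 (Fam l m 0 0) (Fam' l m 0 0) \<le> K1 * (l\<^sup>2 + m\<^sup>2)"
    using Fam_bound by blast
  define K2 where "K2 = (l0\<^sup>2 + m0\<^sup>2) * K1"
  \<comment> \<open>Large enough to absorb the factor 3 of \<open>nrm2_add3\<close>, both against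
    \<open>\<delta>\<close> and against the negative value \<open>q l0 m0\<close>.\<close>
  define M where "M = 3 / \<delta> + 3 * K2 / (- q l0 m0) + 1"
  have M: "M \<ge> 1" "M * \<delta> \<ge> 3" "M * (- q l0 m0) \<ge> 3 * K2"
  proof -
    define qn where "qn = - q l0 m0"
    have pos: "qn > 0" "K2 \<ge> 0" using q0 K1(1) by (simp_all add: qn_def K2_def)
    have M: "M = 3 / \<delta> + 3 * K2 / qn + 1" by (simp add: M_def qn_def)
    have n: "0 \<le> 3 / \<delta>" "0 \<le> 3 * K2 / qn" using pos \<delta> by simp_all
    show "M \<ge> 1" using n unfolding M by linarith
    have "M * \<delta> = 3 + 3 * K2 / qn * \<delta> + \<delta>" using \<delta> by (simp add: M distrib_right)
    moreover have "0 \<le> 3 * K2 / qn * \<delta>" using n(2) \<delta> by (intro mult_nonneg_nonneg) auto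
    ultimately show "M * \<delta> \<ge> 3" using \<delta> by linarith
    have "M * qn = 3 / \<delta> * qn + 3 * K2 + qn" using pos by (simp add: M distrib_right)
    moreover have "0 \<le> 3 / \<delta> * qn" using n(1) pos by (intro mult_nonneg_nonneg) auto
    ultimately have "M * qn \<ge> 3 * K2" using pos by linarith
    then show "M * (- q l0 m0) \<ge> 3 * K2" by (simp add: qn_def)
  qed
  have q_bound: "\<bar>q l m\<bar> \<le> ((\<bar>aF 1 0\<bar> + \<bar>aF 0 1\<bar>) * (\<bar>nF 1 0\<bar> + \<bar>nF 0 1\<bar>) + (\<bar>bF 1 0\<bar> + \<bar>bF 0 1\<bar>) * (\<bar>mF 1 0\<bar> + \<bar>mF 0 1\<bar>)) * (l\<^sup>2 + m\<^sup>2)" for l m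
  proof -
    define r where "r = sqrt (l\<^sup>2 + m\<^sup>2)"
    have lm: "\<bar>l\<bar> \<le> r" "\<bar>m\<bar> \<le> r" by (auto simp: r_def intro: real_le_rsqrt)
    have r0: "r \<ge> 0" by (simp add: r_def)
    have b: "\<bar>u * l + w * m\<bar> \<le> (\<bar>u\<bar> + \<bar>w\<bar>) * r" for u w :: real
    proof -
      have "\<bar>u * l + w * m\<bar> \<le> \<bar>u\<bar> * \<bar>l\<bar> + \<bar>w\<bar> * \<bar>m\<bar>" by (metis abs_mult abs_triangle_ineq)
      also have "\<dots> \<le> \<bar>u\<bar> * r + \<bar>w\<bar> * r" by (intro add_mono mult_left_mono lm) auto
      finally show ?thesis by (simp add: algebra_simps)
    qed
    have e: "aF l m = aF 1 0 * l + aF 0 1 * m" "bF l m = bF 1 0 * l + bF 0 1 * m"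
      "nF l m = nF 1 0 * l + nF 0 1 * m" "mF l m = mF 1 0 * l + mF 0 1 * m"
      by (simp_all add: aF_def bF_def nF_def mF_def algebra_simps)
    have "\<bar>q l m\<bar> \<le> \<bar>aF l m\<bar> * \<bar>nF l m\<bar> + \<bar>bF l m\<bar> * \<bar>mF l m\<bar>"
      unfolding q_def by (metis abs_mult abs_triangle_ineq)
    also have "\<dots> \<le> ((\<bar>aF 1 0\<bar> + \<bar>aF 0 1\<bar>) * r) * ((\<bar>nF 1 0\<bar> + \<bar>nF 0 1\<bar>) * r)
       + ((\<bar>bF 1 0\<bar> + \<bar>bF 0 1\<bar>) * r) * ((\<bar>mF 1 0\<bar> + \<bar>mF 0 1\<bar>) * r)"
      unfolding e by (intro add_mono mult_mono b mult_nonneg_nonneg abs_ge_zero add_nonneg_nonneg r0)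
    also have "\<dots> = ((\<bar>aF 1 0\<bar> + \<bar>aF 0 1\<bar>) * (\<bar>nF 1 0\<bar> + \<bar>nF 0 1\<bar>) + (\<bar>bF 1 0\<bar> + \<bar>bF 0 1\<bar>) * (\<bar>mF 1 0\<bar> + \<bar>mF 0 1\<bar>)) * (r * r)"
      by (simp add: algebra_simps)
    also have "r * r = l\<^sup>2 + m\<^sup>2" by (simp add: r_def)
    finally show ?thesis .
  qed
  then obtain K3 where K3: "K3 \<ge> 0" "\<And>l m. \<bar>q l m\<bar> \<le> K3 * (l\<^sup>2 + m\<^sup>2)"
    by (metis (no_types, lifting) abs_ge_zero add_nonneg_nonneg mult_nonneg_nonneg)
  define C where "C = (K3 + 3 * K1) * K"
  have C: "C \<ge> 0" using K K1 K3 by (simp add: C_def)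
  have "\<exists>d e. (1 / M) * nrm2 (\<lambda>x. v x - Fam 0 0 d e x) (\<lambda>x. v' x - Fam' 0 0 d e x)
      \<le> Hb v v' v v' + C * ((N1 v)\<^sup>2 + (M2 v)\<^sup>2)" if v: "C1q v v'" for v v'
  proof -
    \<comment> \<open>Two corrections follow. A member of the family with the moments of
      \<open>v\<close> is subtracted, so that \<open>y\<close> satisfies the constraints; then a
      combination of the negative direction and tangent vectors, so that all three point evaluations
      of \<open>z\<close> vanish.\<close>
    obtain l m where lm: "nF l m = N1 v" "mF l m = M2 v" "l\<^sup>2 + m\<^sup>2 \<le> K * ((N1 v)\<^sup>2 + (M2 v)\<^sup>2)"
      using K(2) by blast
    define y y' where "y = (\<lambda>x. v x - Fam l m 0 0 x)" and "y' = (\<lambda>x. v' x - Fam' l m 0 0 x)"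
    have y: "C1q y y'" unfolding y_def y'_def by (rule C1q_diff[OF v C1q_Fam])
    note cts = continuous_intros C1qD[OF v] C1qD[OF C1q_Fam[of l m 0 0]] cont_W cont_W'
    have N1y: "N1 y = 0"
    proof -
      have "N1 y = N1 v - N1 (Fam l m 0 0)"
        unfolding N1_def y_def inner_diff_right
        by (intro Henstock_Kurzweil_Integration.integral_diff cint cts)
      then show ?thesis unfolding N1_Fam lm by simp
    qed
    have M2y: "M2 y = 0"
    proof -
      have "M2 y = M2 v - M2 (Fam l m 0 0)"
        unfolding M2_def y_def inner_diff_right
        by (intro Henstock_Kurzweil_Integration.integral_diff cint cts)
      then show ?thesis unfolding M2_Fam lm by simp
    qed
    have Hy: "Hb y y' y y' = Hb v v' v v' - q l m"
      unfolding y_def y'_def Hb_diff_Fam[OF v] by (simp add: q_def lm algebra_simps)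
    obtain c d e where cde: "f (c, d, e) = L y" using surj by (metis surj_f_inv_f prod_cases3)
    define z z' where "z = (\<lambda>x. y x - Fam (c * l0) (c * m0) d e x)" and "z' = (\<lambda>x. y' x - Fam' (c * l0) (c * m0) d e x)"
    have z: "C1q z z'" unfolding z_def z'_def by (rule C1q_diff[OF y C1q_Fam])
    have "L z = L y - f (c, d, e)" by (simp add: L_def z_def f_def inner_diff_right)
    then have Lz: "L z = 0" using cde by simp
    \<comment> \<open>The mixed terms vanish because \<open>y\<close> satisfies the constraints. As
      \<open>q l0 m0\<close> is negative, a lower bound for the Hessian of \<open>z\<close> bounds
      the coefficient \<open>c\<close> of the negative direction too.\<close>
    have Hz: "Hb z z' z z' = Hb y y' y y' + c\<^sup>2 * q l0 m0"
      unfolding z_def z'_def Hb_diff_Fam[OF y] N1y M2y q_scale[symmetric] by (simp add: q_def)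
    have "nrm2 (\<lambda>x. v x - Fam 0 0 d e x) (\<lambda>x. v' x - Fam' 0 0 d e x)
        = nrm2 (\<lambda>x. z x + Fam (c * l0) (c * m0) 0 0 x + Fam l m 0 0 x) (\<lambda>x. z' x + Fam' (c * l0) (c * m0) 0 0 x + Fam' l m 0 0 x)"
    proof -
      have "v x - Fam 0 0 d e x = z x + Fam (c * l0) (c * m0) 0 0 x + Fam l m 0 0 x"
        "v' x - Fam' 0 0 d e x = z' x + Fam' (c * l0) (c * m0) 0 0 x + Fam' l m 0 0 x" for x
        by (simp_all add: z_def z'_def y_def y'_def Fam_def Fam'_def)
      then show ?thesis by simp
    qed
    also have "\<dots> \<le> 3 * (nrm2 z z' + nrm2 (Fam (c * l0) (c * m0) 0 0) (Fam' (c * l0) (c * m0) 0 0)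
        + nrm2 (Fam l m 0 0) (Fam' l m 0 0))"
      by (rule nrm2_add3[OF z C1q_Fam C1q_Fam])
    also have "\<dots> \<le> 3 * (nrm2 z z' + K1 * ((c * l0)\<^sup>2 + (c * m0)\<^sup>2) + K1 * (l\<^sup>2 + m\<^sup>2))"
      by (intro mult_left_mono add_mono K1) auto
    also have "\<dots> = 3 * nrm2 z z' + (3 * K2) * c\<^sup>2 + 3 * K1 * (l\<^sup>2 + m\<^sup>2)"
      by (simp add: K2_def power_mult_distrib algebra_simps)
    also have "\<dots> \<le> (M * \<delta>) * nrm2 z z' + (M * (- q l0 m0)) * c\<^sup>2 + M * (3 * K1) * (l\<^sup>2 + m\<^sup>2)"
      using M K1(1) mult_right_mono[of 1 M "3 * K1"] nrm2_nonneg[OF z]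
      by (intro add_mono mult_right_mono) auto
    also have "\<dots> = M * (\<delta> * nrm2 z z' - c\<^sup>2 * q l0 m0 + 3 * K1 * (l\<^sup>2 + m\<^sup>2))" by (simp add: algebra_simps)
    also have "\<dots> \<le> M * (Hb v v' v v' + K3 * (l\<^sup>2 + m\<^sup>2) + 3 * K1 * (l\<^sup>2 + m\<^sup>2))"
    proof (rule mult_left_mono)
      have "\<delta> * nrm2 z z' \<le> Hb v v' v v' - q l m + c\<^sup>2 * q l0 m0"
        using Z[OF z Lz] unfolding Hz Hy .
      then show "\<delta> * nrm2 z z' - c\<^sup>2 * q l0 m0 + 3 * K1 * (l\<^sup>2 + m\<^sup>2) \<le> Hb v v' v v' + K3 * (l\<^sup>2 + m\<^sup>2) + 3 * K1 * (l\<^sup>2 + m\<^sup>2)"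
        using K3(2)[of l m] by linarith
    qed (use M in simp)
    also have "\<dots> = M * (Hb v v' v v' + (K3 + 3 * K1) * (l\<^sup>2 + m\<^sup>2))" by (simp add: algebra_simps)
    also have "\<dots> \<le> M * (Hb v v' v v' + (K3 + 3 * K1) * (K * ((N1 v)\<^sup>2 + (M2 v)\<^sup>2)))"
      using M K1 K3 lm(3) by (intro mult_left_mono add_left_mono) auto
    also have "\<dots> = M * (Hb v v' v v' + C * ((N1 v)\<^sup>2 + (M2 v)\<^sup>2))" by (simp add: C_def algebra_simps)
    finally show ?thesis using M by (intro exI[of _ d] exI[of _ e]) (simp add: field_simps)
  qed
  then show ?thesis using M C by (intro exI[of _ "1 / M"] conjI exI[of _ C]) auto
qed

end

section \<open>Polar coordinates for perturbations\<close>

context periodic_wave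
begin

definition pA where "pA z x = (W x \<bullet> z x) / s x"
definition pT where "pT z x = ((\<i> * W x) \<bullet> z x) / s x"
definition pA' where "pA' z z' x = ((W x \<bullet> z' x + W' x \<bullet> z x) * s x - (W x \<bullet> z x) * ds x) / (s x * s x)"
definition pT' where "pT' z z' x = (((\<i> * W x) \<bullet> z' x + (\<i> * W' x) \<bullet> z x) * s x - ((\<i> * W x) \<bullet> z x) * ds x) / (s x * s x)"

lemma dpA: "C1q z z' \<Longrightarrow> s x \<noteq> 0 \<Longrightarrow> (pA z has_real_derivative pA' z z' x) (at x)"
  unfolding pA_def[abs_def] pA'_def
  by (rule DERIV_divide[OF has_real_derivative_inner[OF dW C1qD(1)] ds])

lemma dpT: "C1q z z' \<Longrightarrow> s x \<noteq> 0 \<Longrightarrow> (pT z has_real_derivative pT' z z' x) (at x)"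
  unfolding pT_def[abs_def] pT'_def
  by (rule DERIV_divide[OF has_real_derivative_inner[OF has_vector_derivative_i[OF dW] C1qD(1)] ds])

lemma polar_eq: "s x \<noteq> 0 \<Longrightarrow> z x = pA z x *\<^sub>R W x + pT z x *\<^sub>R (\<i> * W x)"
proof -
  assume "s x \<noteq> 0"
  have "s x *\<^sub>R z x = (W x \<bullet> z x) *\<^sub>R W x + ((\<i> * W x) \<bullet> z x) *\<^sub>R (\<i> * W x)"
    by (simp add: s_inner inner_complex_def complex_eq_iff algebra_simps)
  then have "z x = (1 / s x) *\<^sub>R ((W x \<bullet> z x) *\<^sub>R W x + ((\<i> * W x) \<bullet> z x) *\<^sub>R (\<i> * W x))"
    using \<open>s x \<noteq> 0\<close> by (metis divideR_right scaleR_one scaleR_scaleR divide_inverse mult_1)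
  then show ?thesis by (simp add: pA_def pT_def scaleR_add_right)
qed

lemma polar_eq':
  assumes z: "C1q z z'" and x: "s x \<noteq> 0"
  shows "z' x = (pA z x *\<^sub>R W' x + pA' z z' x *\<^sub>R W x) + (pT z x *\<^sub>R (\<i> * W' x) + pT' z z' x *\<^sub>R (\<i> * W x))"
proof (rule vector_derivative_unique_at)
  show "(z has_vector_derivative z' x) (at x)" by (rule C1qD[OF z])
  have "((\<lambda>x. pA z x *\<^sub>R W x + pT z x *\<^sub>R (\<i> * W x)) has_vector_derivative
     (pA z x *\<^sub>R W' x + pA' z z' x *\<^sub>R W x) + (pT z x *\<^sub>R (\<i> * W' x) + pT' z z' x *\<^sub>R (\<i> * W x))) (at x)"
    by (intro has_vector_derivative_add has_vector_derivative_scaleR_real dpA[OF z x] dpT[OF z x]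
        has_vector_derivative_i dW)
  moreover have "open {x. s x \<noteq> 0}"
    using cont_s[of UNIV] by (intro open_Collect_neq) auto
  ultimately show "(z has_vector_derivative (pA z x *\<^sub>R W' x + pA' z z' x *\<^sub>R W x)
      + (pT z x *\<^sub>R (\<i> * W' x) + pT' z z' x *\<^sub>R (\<i> * W x))) (at x)"
    by (rule has_vector_derivative_transform_within_open) (use x polar_eq in auto)
qed

text \<open>The exact part of the Hessian density. It involves the values of the coordinates and not
  their derivatives, so that it is periodic and leaves no contribution over a full period.\<close>

definition pB where "pB z x = ds x / 2 * ((pA z x)\<^sup>2 + (pT z x)\<^sup>2) - 2 * J * (pA z x * pT z x)"
definition pB' where "pB' z z' x = (3 * (s x)\<^sup>2 - 4 * s x + 4 * E) / 2 * ((pA z x)\<^sup>2 + (pT z x)\<^sup>2)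
  + ds x * (pA z x * pA' z z' x + pT z x * pT' z z' x) - 2 * J * (pA' z z' x * pT z x + pA z x * pT' z z' x)"

lemma dpB: "C1q z z' \<Longrightarrow> s x \<noteq> 0 \<Longrightarrow> (pB z has_real_derivative pB' z z' x) (at x)"
  unfolding pB_def[abs_def] pB'_def
  by (rule derivative_eq_intros dpA dpT dds refl | assumption | simp)+ (simp add: power2_eq_square field_simps)

lemma norm_polar: "s x \<noteq> 0 \<Longrightarrow> z x \<bullet> z x = s x * ((pA z x)\<^sup>2 + (pT z x)\<^sup>2)"
proof -
  assume x: "s x \<noteq> 0"
  have "(pA z x *\<^sub>R W x + pT z x *\<^sub>R (\<i> * W x)) \<bullet> (pA z x *\<^sub>R W x + pT z x *\<^sub>R (\<i> * W x))
      = s x * ((pA z x)\<^sup>2 + (pT z x)\<^sup>2)"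
    by (simp add: s_inner inner_complex_def power2_eq_square algebra_simps)
  then show ?thesis using polar_eq[OF x] by metis
qed

text \<open>In polar coordinates the Hessian density is a sum of squares up to an exact derivative and
  the sign of the coefficient of the squared amplitude.\<close>

lemma density_polar:
  assumes z: "C1q z z'" and x: "s x \<noteq> 0"
  shows "z' x \<bullet> z' x + (s x - 1) * (z x \<bullet> z x) + 2 * (W x \<bullet> z x) * (W x \<bullet> z x)
    = s x * ((pA' z z' x)\<^sup>2 + (pT' z z' x)\<^sup>2) + 4 * J * pA z x * pT' z z' x + 2 * (s x)\<^sup>2 * (pA z x)\<^sup>2 + pB' z z' x"
proof -
  define A A' B B' where "A = pA z x" and "A' = pA' z z' x" and "B = pT z x" and "B' = pT' z z' x"
  have 1: "W x \<bullet> z x = s x * A" using x by (simp add: A_def pA_def)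
  have i2: "(\<i> * W' x) \<bullet> W' x = 0" "W' x \<bullet> (\<i> * W' x) = 0" "(\<i> * W x) \<bullet> (\<i> * W x) = s x"
    "(\<i> * W x) \<bullet> W' x = J" "(\<i> * W x) \<bullet> (\<i> * W' x) = ds x / 2"
    using inner_facts[of x] J_eq[of x] by (auto simp: inner_complex_def algebra_simps)
  have 2: "z' x \<bullet> z' x = (A\<^sup>2 + B\<^sup>2) * (2 * E - s x + (s x)\<^sup>2 / 2) + s x * (A'\<^sup>2 + B'\<^sup>2)
     + ds x * (A * A' + B * B') + 2 * J * (A * B' - A' * B)"
    unfolding polar_eq'[OF z x] A_def[symmetric] B_def[symmetric] A'_def[symmetric] B'_def[symmetric]
    by (simp only: inner_add_left inner_add_right inner_scaleR_left inner_scaleR_right inner_facts i2 E_eq)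
      (simp add: power2_eq_square algebra_simps)
  show ?thesis
    unfolding 1 2 norm_polar[OF x, of z] pB'_def A_def[symmetric] B_def[symmetric] A'_def[symmetric] B'_def[symmetric]
    by (simp add: power2_eq_square field_simps)
qed

lemma cont_polar:
  assumes z: "C1q z z'" and X: "\<And>x. x \<in> X \<Longrightarrow> s x \<noteq> 0"
  shows "continuous_on X (pA z)" "continuous_on X (pT z)" "continuous_on X (pA' z z')" "continuous_on X (pT' z z')"
    "continuous_on X (pB' z z')"
proof -
  note c = continuous_intros cont_s cont_ds cont_W cont_W' C1qD[OF z]
  show 1: "continuous_on X (pA z)" "continuous_on X (pT z)" "continuous_on X (pA' z z')" "continuous_on X (pT' z z')"
    unfolding pA_def[abs_def] pT_def[abs_def] pA'_def[abs_def] pT'_def[abs_def]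
    by (intro c, use X in simp)+
  show "continuous_on X (pB' z z')"
    unfolding pB'_def[abs_def] by (intro c 1) auto
qed

lemma polar_per: "C1q z z' \<Longrightarrow> pA z (x + T) = pA z x \<and> pT z (x + T) = pT z x"
proof -
  assume z: "C1q z z'"
  have "\<i> * (lam * W x) = lam * (\<i> * W x)" by simp
  then show ?thesis
    by (simp only: pA_def pT_def s_per W_qper C1qD(4)[OF z] inner_mult_unit[OF lam] simp_thms)
qed

lemma Hb_per: "C1q z z' \<Longrightarrow> z' (x + T) \<bullet> z' (x + T) + (s (x + T) - 1) * (z (x + T) \<bullet> z (x + T)) + 2 * (W (x + T) \<bullet> z (x + T)) * (W (x + T) \<bullet> z (x + T))
  = z' x \<bullet> z' x + (s x - 1) * (z x \<bullet> z x) + 2 * (W x \<bullet> z x) * (W x \<bullet> z x)"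
  by (simp add: s_per W_qper C1qD(4,5) inner_mult_unit lam)

text \<open>The only term of the density that can be negative is \<open>- |z|\<^sup>2\<close>, so a
  pointwise bound for \<open>z\<close> by the Hessian also bounds the derivative. The two coercivity
  proofs below therefore aim at pointwise bounds only.\<close>

lemma nrm2_le_Hb:
  assumes z: "C1q z z'" and K: "\<And>x. x \<in> {0..T} \<Longrightarrow> z x \<bullet> z x \<le> K * Hb z z' z z'"
  shows "nrm2 z z' \<le> (1 + 2 * T * K) * Hb z z' z z'"
proof -
  note c = continuous_intros cont_s cont_W C1qD[OF z]
  let ?h = "\<lambda>x. z' x \<bullet> z' x + (s x - 1) * (z x \<bullet> z x) + 2 * (W x \<bullet> z x) * (W x \<bullet> z x)"
  have "nrm2 z z' \<le> integral {0..T} (\<lambda>x. ?h x + 2 * (K * Hb z z' z z'))"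
    unfolding nrm2_def
  proof (rule integral_le)
    fix x assume x: "x \<in> {0..T}"
    have "0 \<le> s x * (z x \<bullet> z x)" "0 \<le> 2 * ((W x \<bullet> z x) * (W x \<bullet> z x))" using s_nonneg by simp_all
    moreover have "(s x - 1) * (z x \<bullet> z x) = s x * (z x \<bullet> z x) - z x \<bullet> z x"
      "2 * (W x \<bullet> z x) * (W x \<bullet> z x) = 2 * ((W x \<bullet> z x) * (W x \<bullet> z x))" by (simp_all add: algebra_simps)
    ultimately show "z x \<bullet> z x + z' x \<bullet> z' x \<le> ?h x + 2 * (K * Hb z z' z z')"
      using K[OF x] by linarith
  qed (intro cint c)+
  also have "((\<lambda>x. ?h x + 2 * (K * Hb z z' z z')) has_integral Hb z z' z z' + 2 * (K * Hb z z' z z') * T) {0..T}"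
    using has_integral_const_real[of "2 * (K * Hb z z' z z')" 0 T] T unfolding Hb_def
    by (intro has_integral_add integrable_integral cint c) (simp add: mult.commute)
  then have "integral {0..T} (\<lambda>x. ?h x + 2 * (K * Hb z z' z z')) = Hb z z' z z' + 2 * (K * Hb z z' z z') * T"
    by (rule integral_unique)
  finally show ?thesis by (simp add: algebra_simps)
qed

end

lemma square_le_integral_derivative:
  fixes f f' :: "real \<Rightarrow> real"
  assumes "a \<le> b" and d: "\<And>x. x \<in> {a..b} \<Longrightarrow> (f has_real_derivative f' x) (at x)"
    and c: "continuous_on {a..b} f'"
  shows "(f b - f a)\<^sup>2 \<le> (b - a) * integral {a..b} (\<lambda>x. (f' x)\<^sup>2)"
proof -
  have "integral {a..b} (\<lambda>x. 1 * f' x) = f b - f a"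
    using fundamental_theorem_of_calculus[of a b f f'] d \<open>a \<le> b\<close>
    by (auto simp: has_real_derivative_iff_has_vector_derivative[symmetric]
        intro: has_field_derivative_at_within dest!: integral_unique)
  moreover have "(integral {a..b} (\<lambda>x. 1 * f' x))\<^sup>2 \<le> integral {a..b} (\<lambda>x. 1\<^sup>2) * integral {a..b} (\<lambda>x. (f' x)\<^sup>2)"
    by (rule Cauchy_Schwarz_integral) (auto intro: c)
  ultimately show ?thesis using \<open>a \<le> b\<close> by simp
qed

text \<open>For a common zero of \<open>z\<close> and \<open>W\<close>: dividing both by
  \<open>x\<close> gives the limit of \<open>|z|\<^sup>2 / s\<close> there.\<close>

lemma difference_quotient_at_0:
  fixes f :: "real \<Rightarrow> 'a::real_normed_vector"
  assumes "(f has_vector_derivative d) (at 0)" "f 0 = 0"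
  shows "((\<lambda>x. f x /\<^sub>R x) \<longlongrightarrow> d) (at 0)"
proof -
  have "((\<lambda>h. norm (f h - h *\<^sub>R d) / norm h) \<longlongrightarrow> 0) (at 0)"
    using assms by (simp add: has_vector_derivative_def has_derivative_at)
  moreover have "\<forall>\<^sub>F h in at 0. norm (f h - h *\<^sub>R d) / norm h = norm (f h /\<^sub>R h - d)"
  proof (rule eventually_at_topological[THEN iffD2], intro exI[of _ UNIV] conjI ballI impI)
    fix h :: real assume "h \<noteq> 0"
    then have "f h /\<^sub>R h - d = (f h - h *\<^sub>R d) /\<^sub>R h" by (simp add: scaleR_diff_right)
    then show "norm (f h - h *\<^sub>R d) / norm h = norm (f h /\<^sub>R h - d)" by (simp add: divide_inverse mult.commute)
  qed auto
  ultimately have "((\<lambda>h. norm (f h /\<^sub>R h - d)) \<longlongrightarrow> 0) (at 0)"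
    using tendsto_cong by fast
  then show ?thesis by (simp add: tendsto_norm_zero_iff LIM_zero_iff)
qed

section \<open>Waves with zeros, \<open>J = 0\<close>\<close>

context oscillating_wave
begin

lemma s_pos: "0 < x \<Longrightarrow> x < T \<Longrightarrow> s x > 0"
  using s_mono[of 0 x] s_mono[of 0 "T - x"] s_reflect_T[of x] s_nonneg[of 0] T by (cases "x \<le> T / 2") auto

text \<open>In the application one end of the interval is \<open>T / 2\<close>, and \<open>c\<close>
  is the value of \<open>s\<close> at the other end, where \<open>s\<close> is smallest by
  monotonicity on each half period.\<close>

lemma weighted_poincare:
  assumes z: "C1q z z'" and ab: "0 < a" "a \<le> b" "b < T"
    and c: "c \<ge> 0" "\<And>y. y \<in> {a..b} \<Longrightarrow> c \<le> s y"
  shows "c * ((pA z b - pA z a)\<^sup>2 + (pT z b - pT z a)\<^sup>2)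
    \<le> (b - a) * integral {a..b} (\<lambda>y. s y * ((pA' z z' y)\<^sup>2 + (pT' z z' y)\<^sup>2))"
proof -
  have nz: "s y \<noteq> 0" if "y \<in> {a..b}" for y using s_pos[of y] ab that by auto
  note cts = continuous_intros cont_polar[OF z nz] cont_s
  have 1: "(pA z b - pA z a)\<^sup>2 \<le> (b - a) * integral {a..b} (\<lambda>y. (pA' z z' y)\<^sup>2)"
    using ab nz dpA[OF z] cont_polar(3)[OF z, of "{a..b}"] by (intro square_le_integral_derivative) auto
  have 2: "(pT z b - pT z a)\<^sup>2 \<le> (b - a) * integral {a..b} (\<lambda>y. (pT' z z' y)\<^sup>2)"
    using ab nz dpT[OF z] cont_polar(4)[OF z, of "{a..b}"] by (intro square_le_integral_derivative) auto
  have i: "((\<lambda>y. c * ((pA' z z' y)\<^sup>2 + (pT' z z' y)\<^sup>2)) has_integral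
      c * (integral {a..b} (\<lambda>y. (pA' z z' y)\<^sup>2) + integral {a..b} (\<lambda>y. (pT' z z' y)\<^sup>2))) {a..b}"
    by (intro has_integral_mult_right has_integral_add integrable_integral integrable_continuous_real
        continuous_intros cont_polar[OF z nz])
  have "c * ((pA z b - pA z a)\<^sup>2 + (pT z b - pT z a)\<^sup>2)
    \<le> c * ((b - a) * integral {a..b} (\<lambda>y. (pA' z z' y)\<^sup>2) + (b - a) * integral {a..b} (\<lambda>y. (pT' z z' y)\<^sup>2))"
    using 1 2 c(1) by (intro mult_left_mono add_mono) auto
  also have "\<dots> = (b - a) * integral {a..b} (\<lambda>y. c * ((pA' z z' y)\<^sup>2 + (pT' z z' y)\<^sup>2))"
    unfolding integral_unique[OF i] by (simp add: algebra_simps)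
  also have "\<dots> \<le> (b - a) * integral {a..b} (\<lambda>y. s y * ((pA' z z' y)\<^sup>2 + (pT' z z' y)\<^sup>2))"
  proof (intro mult_left_mono integral_le)
    show "(\<lambda>y. c * ((pA' z z' y)\<^sup>2 + (pT' z z' y)\<^sup>2)) integrable_on {a..b}" using i by blast
    show "(\<lambda>y. s y * ((pA' z z' y)\<^sup>2 + (pT' z z' y)\<^sup>2)) integrable_on {a..b}"
      by (intro integrable_continuous_real cts)
  qed (use ab c(2) in \<open>auto intro: mult_right_mono\<close>)
  finally show ?thesis .
qed

text \<open>For \<open>J = 0\<close> the wave vanishes at 0, and polar coordinates are available on
  \<open>{\<epsilon>..T-\<epsilon>}\<close> only. The boundary terms \<open>pB\<close> tend to 0,
  because \<open>|z|\<^sup>2 / s\<close> has a limit at 0 while \<open>ds 0 = 0\<close>. The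
  remaining density is a sum of squares and controls, with the weight \<open>s\<close>, how far the
  coordinates move away from their values at \<open>T / 2\<close>.\<close>

lemma Hb_bound_zero_J:
  assumes J: "J = 0" and z: "C1q z z'" and z0: "z 0 = 0" and zT: "(\<i> * W (T / 2)) \<bullet> z (T / 2) = 0"
  shows "\<And>x. 0 < x \<Longrightarrow> x < T \<Longrightarrow>
      s x * ((pA z x - pA z (T / 2))\<^sup>2 + (pT z x)\<^sup>2) \<le> T / 2 * Hb z z' z z'" (is "\<And>x. _ \<Longrightarrow> _ \<Longrightarrow> ?P x")
    and "2 * integral {0..T} (\<lambda>x. (W x \<bullet> z x)\<^sup>2) \<le> Hb z z' z z'"
proof -
  define h where "h = (\<lambda>x. z' x \<bullet> z' x + (s x - 1) * (z x \<bullet> z x) + 2 * (W x \<bullet> z x) * (W x \<bullet> z x))"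
  define g where "g = (\<lambda>x. s x * ((pA' z z' x)\<^sup>2 + (pT' z z' x)\<^sup>2))"
  define k where "k = (\<lambda>x. 2 * (W x \<bullet> z x)\<^sup>2)"
  have ch: "continuous_on X h" "continuous_on X k" for X
    unfolding h_def k_def by (intro continuous_intros C1qD[OF z] cont_s cont_W)+
  obtain F where F: "\<And>x. (F has_vector_derivative h x) (at x)"
    by (rule continuous_antiderivative[OF ch(1)]) blast
  obtain G where G: "\<And>x. (G has_vector_derivative k x) (at x)"
    by (rule continuous_antiderivative[OF ch(2)]) blast
  have intF: "integral {a..b} h = F b - F a" and intG: "integral {a..b} k = G b - G a" if "a \<le> b" for a b
    using fundamental_theorem_of_calculus[OF that, of F h] fundamental_theorem_of_calculus[OF that, of G k] F G
    by (auto intro: has_vector_derivative_at_within dest!: integral_unique)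
  have H: "Hb z z' z z' = F T - F 0" using intF[of 0 T] T by (simp add: Hb_def h_def)
  have r10: "r1 = 0" using J_roots J r12 r23 by auto
  then have W0: "W 0 = 0" by (simp add: r1_def s_def)
  have "4 * E > 0" unfolding E_roots r10 using r12 r23 by simp
  then have E: "E > 0" by simp
  have "W' 0 \<bullet> W' 0 = 2 * E" using E_eq[of 0] r10 by (simp add: r1_def)
  then have W'0: "W' 0 \<noteq> 0" using E by auto
  have sper: "s x > 0" if "x \<noteq> 0" "\<bar>x\<bar> < T" for x
    using s_pos[of "\<bar>x\<bar>"] s_even[of x] that by (cases "x > 0") auto
  have pB0: "(pB z \<longlongrightarrow> 0) (at 0)"
  proof -
    have "((\<lambda>x. ds x / 2 * (((z x /\<^sub>R x) \<bullet> (z x /\<^sub>R x)) / ((W x /\<^sub>R x) \<bullet> (W x /\<^sub>R x)))) \<longlongrightarrow>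
        ds 0 / 2 * ((z' 0 \<bullet> z' 0) / (W' 0 \<bullet> W' 0))) (at 0)"
      using W'0 difference_quotient_at_0[OF C1qD(1)[OF z] z0] difference_quotient_at_0[OF dW W0]
        cont_ds[of UNIV]
      by (intro tendsto_mult tendsto_divide tendsto_inner tendsto_const) (auto simp: continuous_on_eq_continuous_at isCont_def)
    moreover have "\<forall>\<^sub>F x in at 0. ds x / 2 * (((z x /\<^sub>R x) \<bullet> (z x /\<^sub>R x)) / ((W x /\<^sub>R x) \<bullet> (W x /\<^sub>R x))) = pB z x"
    proof (rule eventually_at[THEN iffD2], intro exI[of _ T] conjI ballI impI T)
      fix x :: real assume "x \<noteq> 0 \<and> dist x 0 < T"
      then have x: "x \<noteq> 0" "s x > 0" using sper[of x] by auto
      have "((z x /\<^sub>R x) \<bullet> (z x /\<^sub>R x)) / ((W x /\<^sub>R x) \<bullet> (W x /\<^sub>R x)) = (z x \<bullet> z x) / s x"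
        using x by (simp add: s_inner)
      also have "\<dots> = (pA z x)\<^sup>2 + (pT z x)\<^sup>2" using norm_polar[of x z] x by simp
      finally show "ds x / 2 * (((z x /\<^sub>R x) \<bullet> (z x /\<^sub>R x)) / ((W x /\<^sub>R x) \<bullet> (W x /\<^sub>R x))) = pB z x"
        by (simp add: pB_def J)
    qed
    ultimately show ?thesis using ds0 tendsto_cong by fastforce
  qed
  \<comment> \<open>The Hessian over \<open>{\<epsilon>..T-\<epsilon>}\<close> without its boundary
    terms. The value of \<open>pB z\<close> at \<open>T - \<epsilon>\<close> is written as the one
    at \<open>- \<epsilon>\<close>, so that both limits are taken at 0.\<close>
  define R where "R = (\<lambda>\<epsilon>. F (T - \<epsilon>) - F \<epsilon> - (pB z (- \<epsilon>) - pB z \<epsilon>))"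
  have R: "(R \<longlongrightarrow> Hb z z' z z') (at_right 0)"
  proof -
    have cF: "isCont F x" for x using F has_vector_derivative_continuous by blast
    have "((\<lambda>\<epsilon>. F (T - \<epsilon>)) \<longlongrightarrow> F (T - 0)) (at 0)"
      by (rule isCont_tendsto_compose[OF cF]) (intro tendsto_intros)
    moreover have "((\<lambda>\<epsilon>. F \<epsilon>) \<longlongrightarrow> F 0) (at 0)" using cF[of 0] by (simp add: isCont_def)
    moreover have "((\<lambda>\<epsilon>. pB z (- \<epsilon>)) \<longlongrightarrow> 0) (at 0)"
      using pB0 filterlim_at_to_0 by (subst filterlim_compose[OF pB0]) (auto simp: filterlim_at eventually_at intro!: tendsto_eq_intros exI[of _ 1])
    ultimately have "(R \<longlongrightarrow> F (T - 0) - F 0 - (0 - 0)) (at 0)"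
      unfolding R_def using pB0 by (intro tendsto_diff)
    then show ?thesis by (simp add: H filterlim_at_split)
  qed
  have Req: "R \<epsilon> = integral {\<epsilon>..T-\<epsilon>} (\<lambda>x. g x + k x)" if \<epsilon>: "0 < \<epsilon>" "\<epsilon> < T / 2" for \<epsilon>
  proof -
    have nz: "s x \<noteq> 0" if "x \<in> {\<epsilon>..T-\<epsilon>}" for x using s_pos[of x] \<epsilon> that by auto
    have "((\<lambda>x. pB' z z' x) has_integral pB z (T - \<epsilon>) - pB z \<epsilon>) {\<epsilon>..T-\<epsilon>}"
      using \<epsilon> dpB[OF z nz] by (intro fundamental_theorem_of_calculus)
        (auto simp: has_real_derivative_iff_has_vector_derivative[symmetric] intro: has_field_derivative_at_within)
    moreover have "(h has_integral F (T - \<epsilon>) - F \<epsilon>) {\<epsilon>..T-\<epsilon>}"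
      using \<epsilon> F by (intro fundamental_theorem_of_calculus) (auto intro: has_vector_derivative_at_within)
    ultimately have "((\<lambda>x. h x - pB' z z' x) has_integral (F (T - \<epsilon>) - F \<epsilon> - (pB z (T - \<epsilon>) - pB z \<epsilon>))) {\<epsilon>..T-\<epsilon>}"
      by (rule has_integral_diff[rotated])
    moreover have "pB z (T - \<epsilon>) = pB z (- \<epsilon>)"
      using polar_per[OF z, of "- \<epsilon>"] ds_per[of "- \<epsilon>"] by (simp add: pB_def)
    moreover have "h x - pB' z z' x = g x + k x" if "x \<in> {\<epsilon>..T-\<epsilon>}" for x
    proof -
      have "s x * pA z x = W x \<bullet> z x" using nz[OF that] by (simp add: pA_def)
      then have "2 * (s x)\<^sup>2 * (pA z x)\<^sup>2 = k x" by (simp add: k_def power_mult_distrib[symmetric])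
      then show ?thesis using density_polar[OF z nz[OF that]] by (simp add: h_def g_def J)
    qed
    ultimately show ?thesis unfolding R_def
      by (metis (mono_tags, lifting) Henstock_Kurzweil_Integration.integral_cong integral_unique)
  qed
  have gk: "g x \<ge> 0" "k x \<ge> 0" for x using s_nonneg[of x] by (simp_all add: g_def k_def)
  have cg: "continuous_on {\<epsilon>..T-\<epsilon>} g" if "0 < \<epsilon>" for \<epsilon>
  proof -
    have nz: "s x \<noteq> 0" if "x \<in> {\<epsilon>..T-\<epsilon>}" for x using s_pos[of x] \<open>0 < \<epsilon>\<close> that by auto
    show ?thesis unfolding g_def by (intro continuous_intros cont_s cont_polar[OF z nz])
  qed
  have m0: "pT z (T / 2) = 0" using zT by (simp add: pT_def)
  show "?P x" if x: "0 < x" "x < T" for x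
  proof -
    have "s x * ((pA z x - pA z (T / 2))\<^sup>2 + (pT z x)\<^sup>2) \<le> T / 2 * R \<epsilon>" if \<epsilon>: "0 < \<epsilon>" "\<epsilon> < min (T / 2) (min x (T - x))" for \<epsilon>
    proof -
      have sub: "{a..b} \<subseteq> {\<epsilon>..T-\<epsilon>} \<Longrightarrow> integral {a..b} g \<le> R \<epsilon>" for a b
      proof -
        assume sub: "{a..b} \<subseteq> {\<epsilon>..T-\<epsilon>}"
        have "integral {a..b} g \<le> integral {\<epsilon>..T-\<epsilon>} g"
          by (intro integral_subset_le[OF sub] integrable_continuous_real continuous_on_subset[OF cg[OF \<epsilon>(1)] sub]
              cg \<epsilon> ballI gk)
        also have "\<dots> \<le> integral {\<epsilon>..T-\<epsilon>} (\<lambda>x. g x + k x)"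
          by (rule integral_le) (use cg[OF \<epsilon>(1)] gk ch in \<open>auto intro!: integrable_continuous_real continuous_intros\<close>)
        also have "\<dots> = R \<epsilon>" using Req \<epsilon> by simp
        finally show ?thesis .
      qed
      have R0: "R \<epsilon> \<ge> 0" using sub[of 1 0] by simp
      show ?thesis
      proof (cases "x \<le> T / 2")
        case True
        have "s x * ((pA z (T / 2) - pA z x)\<^sup>2 + (pT z (T / 2) - pT z x)\<^sup>2) \<le> (T / 2 - x) * integral {x..T/2} g"
          unfolding g_def
        proof (rule weighted_poincare[OF z])
          show "s x \<le> s y" if "y \<in> {x..T / 2}" for y
            using s_mono[of x y] that x by (cases "x = y") auto
        qed (use x True s_nonneg in auto)
        also have "\<dots> \<le> (T / 2 - x) * R \<epsilon>" using \<epsilon> x True by (intro mult_left_mono sub) auto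
        also have "\<dots> \<le> T / 2 * R \<epsilon>" using x R0 by (intro mult_right_mono) auto
        finally show ?thesis by (simp add: m0 power2_commute)
      next
        case False
        have "s x * ((pA z x - pA z (T / 2))\<^sup>2 + (pT z x - pT z (T / 2))\<^sup>2) \<le> (x - T / 2) * integral {T/2..x} g"
          unfolding g_def
        proof (rule weighted_poincare[OF z])
          show "s x \<le> s y" if "y \<in> {T / 2..x}" for y
            using s_mono[of "T - x" "T - y"] s_reflect_T[of x] s_reflect_T[of y] that x by (cases "x = y") auto
        qed (use x False s_nonneg in auto)
        also have "\<dots> \<le> (x - T / 2) * R \<epsilon>" using \<epsilon> x False by (intro mult_left_mono sub) auto
        also have "\<dots> \<le> T / 2 * R \<epsilon>" using x R0 by (intro mult_right_mono) auto
        finally show ?thesis by (simp add: m0)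
      qed
    qed
    then have "\<forall>\<^sub>F \<epsilon> in at_right 0. s x * ((pA z x - pA z (T / 2))\<^sup>2 + (pT z x)\<^sup>2) \<le> T / 2 * R \<epsilon>"
      using x T by (auto simp: eventually_at_right intro!: exI[of _ "min (T / 2) (min x (T - x))"])
    then show ?thesis
      by (rule tendsto_lowerbound[OF tendsto_mult[OF tendsto_const R]]) auto
  qed
  have "\<forall>\<^sub>F \<epsilon> in at_right 0. G (T - \<epsilon>) - G \<epsilon> \<le> R \<epsilon>"
  proof -
    have "G (T - \<epsilon>) - G \<epsilon> \<le> R \<epsilon>" if \<epsilon>: "0 < \<epsilon>" "\<epsilon> < T / 2" for \<epsilon>
    proof -
      have "G (T - \<epsilon>) - G \<epsilon> = integral {\<epsilon>..T-\<epsilon>} k" using intG \<epsilon> by simp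
      also have "\<dots> \<le> integral {\<epsilon>..T-\<epsilon>} (\<lambda>x. g x + k x)"
        by (rule integral_le) (use cg[OF \<epsilon>(1)] gk ch in \<open>auto intro!: integrable_continuous_real continuous_intros\<close>)
      also have "\<dots> = R \<epsilon>" using Req \<epsilon> by simp
      finally show ?thesis .
    qed
    then show ?thesis using T by (auto simp: eventually_at_right intro!: exI[of _ "T / 2"])
  qed
  moreover have "((\<lambda>\<epsilon>. G (T - \<epsilon>) - G \<epsilon>) \<longlongrightarrow> G T - G 0) (at_right 0)"
  proof -
    have cG: "isCont G x" for x using G has_vector_derivative_continuous by blast
    have "((\<lambda>\<epsilon>. G (T - \<epsilon>)) \<longlongrightarrow> G (T - 0)) (at 0)"
      by (rule isCont_tendsto_compose[OF cG]) (intro tendsto_intros)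
    moreover have "((\<lambda>\<epsilon>. G \<epsilon>) \<longlongrightarrow> G 0) (at 0)" using cG[of 0] by (simp add: isCont_def)
    ultimately have "((\<lambda>\<epsilon>. G (T - \<epsilon>) - G \<epsilon>) \<longlongrightarrow> G (T - 0) - G 0) (at 0)" by (intro tendsto_diff)
    then show ?thesis by (simp add: filterlim_at_split)
  qed
  ultimately have "G T - G 0 \<le> Hb z z' z z'" using R by (intro tendsto_le[OF _ R]) auto
  then show "2 * integral {0..T} (\<lambda>x. (W x \<bullet> z x)\<^sup>2) \<le> Hb z z' z z'"
    using intG[of 0 T] T by (simp add: k_def)
qed

text \<open>After \<open>Hb_bound_zero_J\<close> only the amplitude \<open>m\<close> at
  \<open>T / 2\<close> is undetermined. Up to the controlled deviation, \<open>W \<bullet> z\<close>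
  equals \<open>m * s\<close>, so the second bound of that lemma controls \<open>m\<^sup>2\<close>
  times the integral of \<open>s\<^sup>2\<close>.\<close>

lemma coercive_zero_J:
  assumes J: "J = 0"
  shows "\<exists>K>0. \<forall>z z'. C1q z z' \<and> z 0 = 0 \<and> (\<i> * W (T / 2)) \<bullet> z (T / 2) = 0 \<longrightarrow>
    (\<forall>x\<in>{0..T}. z x \<bullet> z x \<le> K * Hb z z' z z')"
proof -
  define I where "I = integral {0..T} (\<lambda>x. (s x)\<^sup>2)"
  have I: "I > 0"
    unfolding I_def
    by (rule integral_pos_continuous[where t = "T / 2"])
      (use T s_pos[of "T / 2"] in \<open>auto intro!: continuous_intros cont_s\<close>)
  define K1 where "K1 = (r2 * T * T + 1) / I"
  define K where "K = T + 2 * r2 * K1"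
  have "z x \<bullet> z x \<le> K * Hb z z' z z'"
    if z: "C1q z z'" and z0: "z 0 = 0" and zT: "(\<i> * W (T / 2)) \<bullet> z (T / 2) = 0" and x: "x \<in> {0..T}" for z z' x
  proof -
    define H where "H = Hb z z' z z'"
    define m where "m = pA z (T / 2)"
    note P = Hb_bound_zero_J[OF J z z0 zT, folded H_def m_def]
    have "0 \<le> integral {0..T} (\<lambda>x. (W x \<bullet> z x)\<^sup>2)"
      by (intro integral_nonneg cint continuous_intros cont_W C1qD[OF z]) auto
    with P(2) have H0: "H \<ge> 0" by linarith
    have r2: "r2 \<ge> 0" using r12 by simp
    have sle: "s y \<le> r2" if "y \<in> {0..T}" for y using s_range[OF that] by simp
    have sq: "(p + q)\<^sup>2 \<le> 2 * (p\<^sup>2 + q\<^sup>2)" for p q :: real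
      using sum_squares_bound[of p q] by (simp add: power2_eq_square algebra_simps)
    have s0: "s 0 = 0" "s T = 0" using J_roots J r12 r23 s_per[of 0] by (auto simp: r1_def)
    have pt: "m\<^sup>2 * (s y)\<^sup>2 \<le> r2 * T * H + 2 * (W y \<bullet> z y)\<^sup>2" if y: "y \<in> {0..T}" for y
    proof (cases "0 < y \<and> y < T")
      case True
      then have "s y > 0" using s_pos by simp
      then have W: "W y \<bullet> z y = s y * pA z y" by (simp add: pA_def)
      have "m\<^sup>2 * (s y)\<^sup>2 = ((- (s y * (pA z y - m))) + s y * pA z y)\<^sup>2" by (simp add: power2_eq_square algebra_simps)
      also have "\<dots> \<le> 2 * ((- (s y * (pA z y - m)))\<^sup>2 + (s y * pA z y)\<^sup>2)" by (rule sq)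
      also have "\<dots> = 2 * (s y * (s y * (pA z y - m)\<^sup>2)) + 2 * (W y \<bullet> z y)\<^sup>2"
        unfolding W by (simp add: power2_eq_square algebra_simps)
      also have "s y * (s y * (pA z y - m)\<^sup>2) \<le> r2 * (T / 2 * H)"
      proof (rule mult_mono[OF sle[OF y] _ r2])
        have "s y * (pA z y - m)\<^sup>2 \<le> s y * ((pA z y - m)\<^sup>2 + (pT z y)\<^sup>2)"
          using \<open>s y > 0\<close> by simp
        also have "\<dots> \<le> T / 2 * H" using P(1) True by simp
        finally show "s y * (pA z y - m)\<^sup>2 \<le> T / 2 * H" .
      qed (use \<open>s y > 0\<close> in simp)
      finally show ?thesis by simp
    next
      case False
      then have "y = 0 \<or> y = T" using y by auto
      then have "s y = 0" using s0 by auto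
      then show ?thesis using r2 T H0 by simp
    qed
    have "integral {0..T} (\<lambda>y. m\<^sup>2 * (s y)\<^sup>2) \<le> integral {0..T} (\<lambda>y. r2 * T * H + 2 * (W y \<bullet> z y)\<^sup>2)"
      by (rule integral_le) (use pt in \<open>auto intro!: cint continuous_intros cont_s cont_W C1qD[OF z]\<close>)
    also have "((\<lambda>y. r2 * T * H + 2 * (W y \<bullet> z y)\<^sup>2) has_integral r2 * T * H * T + 2 * integral {0..T} (\<lambda>x. (W x \<bullet> z x)\<^sup>2)) {0..T}"
      using has_integral_const_real[of "r2 * T * H" 0 T] T
      by (intro has_integral_add has_integral_mult_right integrable_integral cint continuous_intros cont_W C1qD[OF z])
        (simp add: mult.commute)
    then have "integral {0..T} (\<lambda>y. r2 * T * H + 2 * (W y \<bullet> z y)\<^sup>2) = r2 * T * H * T + 2 * integral {0..T} (\<lambda>x. (W x \<bullet> z x)\<^sup>2)"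
      by (rule integral_unique)
    finally have "m\<^sup>2 * I \<le> (r2 * T * T + 1) * H" using P(2) by (simp add: I_def algebra_simps)
    then have m: "m\<^sup>2 \<le> K1 * H" using I by (simp add: K1_def pos_le_divide_eq)
    have K0: "K * H \<ge> 0" using H0 r2 T I by (simp add: K_def K1_def)
    show ?thesis
    proof (cases "0 < x \<and> x < T")
      case True
      then have sx: "s x > 0" using s_pos by simp
      have "z x \<bullet> z x = s x * (((pA z x - m) + m)\<^sup>2 + (pT z x)\<^sup>2)" using norm_polar[of x z] sx by simp
      also have "\<dots> \<le> s x * (2 * ((pA z x - m)\<^sup>2 + m\<^sup>2) + 2 * (pT z x)\<^sup>2)"
        using sx sq[of "pA z x - m" m] by (intro mult_left_mono add_mono) auto
      also have "\<dots> = 2 * (s x * ((pA z x - m)\<^sup>2 + (pT z x)\<^sup>2)) + 2 * (s x * m\<^sup>2)" by (simp add: algebra_simps)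
      also have "\<dots> \<le> 2 * (T / 2 * H) + 2 * (r2 * (K1 * H))"
      proof (rule add_mono)
        show "2 * (s x * ((pA z x - m)\<^sup>2 + (pT z x)\<^sup>2)) \<le> 2 * (T / 2 * H)" using P(1)[of x] True by linarith
        have "s x * m\<^sup>2 \<le> r2 * (K1 * H)" by (rule mult_mono[OF sle[OF x] m r2]) simp
        then show "2 * (s x * m\<^sup>2) \<le> 2 * (r2 * (K1 * H))" by linarith
      qed
      also have "\<dots> = K * H" by (simp add: K_def algebra_simps)
      finally show ?thesis by (simp add: H_def)
    next
      case False
      then have "x = 0 \<or> x = T" using x by auto
      then have "z x = 0" using z0 C1qD(4)[OF z, of 0] by auto
      then show ?thesis using K0 by (simp add: H_def)
    qed
  qed
  moreover have "K > 0" using T r12 I unfolding K_def K1_def by (intro add_pos_nonneg) auto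
  ultimately show ?thesis by blast
qed

end

section \<open>Waves without zeros, \<open>J \<noteq> 0\<close>\<close>

context oscillating_wave
begin

text \<open>The even zero mode of the amplitude equation, made of the scaling and the third-order
  symmetry; its secular growth over a period is twice \<open>kap\<close>.\<close>

definition k1 where "k1 = 2 * J\<^sup>2 * (1 - 3 * E)"
definition k2 where "k2 = 4 * E\<^sup>2 - 3 * J\<^sup>2"
definition k3 where "k3 = 9 / 4 * J\<^sup>2 - E"
definition u where "u x = 2 * k1 + k2 * (2 * s x + x * ds x) + k3 * (ds x * Sig x - 2 * (s x)\<^sup>2 + 4 * s x)"
definition g where "g x = 3 * (s x)\<^sup>2 - 4 * s x + 4 * E"
definition du where "du x = k2 * (3 * ds x + x * g x) + k3 * (g x * Sig x - 3 * s x * ds x + 4 * ds x)"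
definition ddu where "ddu x = k2 * (4 * g x + x * ((6 * s x - 4) * ds x))
  + k3 * ((6 * s x - 4) * ds x * Sig x - 2 * s x * g x - 3 * (ds x)\<^sup>2 + 4 * g x)"
definition Cw where "Cw = 16 * E\<^sup>2 - 64 * E^3 - 16 * J\<^sup>2 + 72 * E * J\<^sup>2 - 27 * J^4"
definition kap where "kap = (k2 * T + k3 * (sbar * T)) / 2"

lemma dds_g: "(ds has_real_derivative g x) (at x)"
  unfolding g_def by (rule dds)

lemma dg: "(g has_real_derivative (6 * s x - 4) * ds x) (at x)"
  unfolding g_def[abs_def] by (auto intro!: derivative_eq_intros ds simp: algebra_simps)

lemma du: "(u has_real_derivative du x) (at x)"
  unfolding u_def[abs_def] du_def
  by (rule derivative_eq_intros ds dds_g dSig refl | simp)+ (simp add: power2_eq_square algebra_simps)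

lemma ddu: "(du has_real_derivative ddu x) (at x)"
  unfolding du_def[abs_def] ddu_def
  by (rule derivative_eq_intros ds dds_g dg dSig refl | simp)+ (simp add: power2_eq_square algebra_simps)

text \<open>\<open>ds\<close> is twice \<open>W \<bullet> W'\<close>, hence the amplitude mode of
  translation, and solves the same second-order equation as \<open>u\<close>; the Wronskian of two
  solutions of that equation is a multiple of \<open>s\<close>. Its sign makes \<open>u / ds\<close>
  decreasing between zeros of \<open>ds\<close>.\<close>

lemma wronskian_u: "du x * ds x - u x * g x = - Cw * s x"
proof -
  have "du x * ds x - u x * g x = k2 * (3 * (ds x)\<^sup>2 - 2 * s x * g x)
      + k3 * ((4 - 3 * s x) * (ds x)\<^sup>2 - (4 * s x - 2 * (s x)\<^sup>2) * g x) - 2 * k1 * g x"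
    by (simp add: u_def du_def power2_eq_square algebra_simps)
  also have "\<dots> = - Cw * s x"
    unfolding ds_sq g_def k1_def k2_def k3_def Cw_def
    by (simp add: field_simps power2_eq_square power3_eq_cube power4_eq_xxxx)
  finally show ?thesis .
qed

text \<open>For \<open>J \<noteq> 0\<close>, \<open>u\<close> is \<open>2 * (W \<bullet> z)\<close>
  for a combination \<open>z\<close> of the nonperiodic versions of \<open>Psi\<close> and
  \<open>Phi\<close>, the scaling field and the boost. Up to a common factor the coefficients are
  determined by \<open>3 * k1 + 2 * k2 + 8 * E * k3 = 0\<close>, so that the Hessian annihilates
  \<open>z\<close>, and by \<open>2 * E * k1 + 3 * J\<^sup>2 * k2 + 4 * J\<^sup>2 * k3 = 0\<close>,
  so that the first integral \<open>s * \<Theta>' + 2 * J * A\<close> of \<open>z\<close> vanishes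
  and the phase can be eliminated.\<close>

lemma u_ode: "s x * ddu x = ds x * du x + (3 * (s x)\<^sup>2 - 4 * E) * u x"
proof -
  have "s x * ddu x - ds x * du x - (3 * (s x)\<^sup>2 - 4 * E) * u x
    = k2 * (4 * s x * g x - 3 * (ds x)\<^sup>2 - (3 * (s x)\<^sup>2 - 4 * E) * (2 * s x))
     + k3 * (- 2 * (s x)\<^sup>2 * g x + 4 * s x * g x - 4 * (ds x)\<^sup>2 - (3 * (s x)\<^sup>2 - 4 * E) * (4 * s x - 2 * (s x)\<^sup>2))
     - (3 * (s x)\<^sup>2 - 4 * E) * (2 * k1)"
    by (simp add: u_def du_def ddu_def g_def power2_eq_square algebra_simps)
  also have "\<dots> = 0"
    unfolding ds_sq g_def k1_def k2_def k3_def
    by (simp add: field_simps power2_eq_square power3_eq_cube)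
  finally show ?thesis by simp
qed

text \<open>\<open>4 * Cw\<close> is the discriminant of the monic cubic with the coefficients
  \<open>- 2\<close>, \<open>4 * E\<close> and \<open>- 2 * J\<^sup>2\<close>, whose roots are
  distinct.\<close>

lemma Cw_pos: "Cw > 0"
proof -
  have e1: "2 = r1 + r2 + r3" by (simp add: r3_def)
  define p q where "p = 4 * E" and "q = 2 * J\<^sup>2"
  have "4 * Cw = 2\<^sup>2 * p\<^sup>2 - 4 * p^3 - 4 * 2^3 * q + 18 * 2 * p * q - 27 * q\<^sup>2"
    by (simp add: Cw_def p_def q_def power2_eq_square power3_eq_cube power4_eq_xxxx)
  also have "\<dots> = (r1 + r2 + r3)\<^sup>2 * p\<^sup>2 - 4 * p^3 - 4 * (r1 + r2 + r3)^3 * q + 18 * (r1 + r2 + r3) * p * q - 27 * q\<^sup>2"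
    unfolding e1[symmetric] ..
  also have "\<dots> = ((r1 - r2) * (r1 - r3) * (r2 - r3))\<^sup>2"
    unfolding p_def q_def E_roots J_roots by algebra
  also have "\<dots> > 0" using r12 r23 by simp
  finally show ?thesis by simp
qed

text \<open>Expressed in differences of the roots, \<open>8 * (k2 + k3 * sbar)\<close> is
  \<open>r1\<close> times the gap in \<open>sbar_upper\<close> plus two positive terms.\<close>

lemma kap_pos: "kap > 0"
proof -
  have e1: "2 = r1 + r2 + r3" by (simp add: r3_def)
  define a b d where "a = r2 - r1" and "b = r3 - r1" and "d = sbar - r1"
  have ab: "0 < a" "a < b" "0 < d" "d < a" using r12 r23 sbar_range by (auto simp: a_def b_def d_def)
  define p q where "p = 4 * E" and "q = 2 * J\<^sup>2"
  have "8 * (k2 + k3 * sbar) = 2 * (p\<^sup>2 - 3 * 2 * q) + (9 * q - 2 * p) * sbar"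
    by (simp add: k2_def k3_def p_def q_def power2_eq_square algebra_simps)
  also have "\<dots> = 2 * (p\<^sup>2 - 3 * (r1 + r2 + r3) * q) + (9 * q - (r1 + r2 + r3) * p) * sbar"
    unfolding e1[symmetric] by simp
  also have "\<dots> = r1 * (a * b * (a + b) - 2 * d * (a\<^sup>2 - a * b + b\<^sup>2)) + a * b\<^sup>2 * (a - d) + a\<^sup>2 * b * (b - d)"
    unfolding p_def q_def E_roots J_roots a_def b_def d_def by algebra
  also have "\<dots> > 0"
  proof -
    have "0 \<le> r1 * (a * b * (a + b) - 2 * d * (a\<^sup>2 - a * b + b\<^sup>2))"
      using sbar_upper r12 by (intro mult_nonneg_nonneg) (auto simp: a_def b_def d_def)
    moreover have "0 < a * b\<^sup>2 * (a - d)" "0 < a\<^sup>2 * b * (b - d)" using ab by simp_all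
    ultimately show ?thesis by linarith
  qed
  finally have "0 < k2 + k3 * sbar" by simp
  moreover have "kap = T * (k2 + k3 * sbar) / 2" by (simp add: kap_def algebra_simps)
  ultimately show ?thesis using T by (simp only: half_gt_zero mult_pos_pos)
qed

lemma ds_odd: "ds (- x) = - ds x"
proof -
  have "((\<lambda>x. s (0 - x)) has_vector_derivative - ds (0 - x)) (at x)"
    using ds by (intro has_vector_derivative_reflect) (auto simp: has_real_derivative_iff_has_vector_derivative)
  moreover have "((\<lambda>x. s (0 - x)) has_vector_derivative ds x) (at x)"
    using ds[of x] by (simp add: s_even has_real_derivative_iff_has_vector_derivative)
  ultimately have "- ds (0 - x) = ds x" by (rule vector_derivative_unique_at)
  then show ?thesis by simp
qed

lemma Sig_odd: "Sig (- x) = - Sig x"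
proof -
  have "((\<lambda>x. Sig (0 - x)) has_vector_derivative - s (0 - x)) (at x)" for x
    using dSig by (intro has_vector_derivative_reflect) (auto simp: has_real_derivative_iff_has_vector_derivative)
  then have "((\<lambda>x. Sig (- x)) has_real_derivative - s x) (at x)" for x
    by (simp add: s_even has_real_derivative_iff_has_vector_derivative)
  from DERIV_add[OF this dSig] have "((\<lambda>x. Sig (- x) + Sig x) has_real_derivative 0) (at x)" for x by simp
  then have "Sig (- x) + Sig x = Sig (- 0) + Sig 0"
    using DERIV_isconst_all[of "\<lambda>x. Sig (- x) + Sig x"] by blast
  then show ?thesis by (simp add: Sig0)
qed

lemma u_even: "u (- x) = u x"
  by (simp add: u_def s_even ds_odd Sig_odd)

text \<open>Over one period \<open>u\<close> gains \<open>2 * kap * ds\<close>. Subtracting half of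
  this yields the zero mode that is even about \<open>T / 2\<close> instead of 0.\<close>

lemma u2_reflect: "u (T - x) - kap * ds (T - x) = u x - kap * ds x"
proof -
  have "s (T - x) = s x" "ds (T - x) = - ds x" "Sig (T - x) = sbar * T - Sig x"
    using s_per[of "- x"] ds_per[of "- x"] Sig_shift[of "- x"] by (simp_all add: s_even ds_odd Sig_odd)
  then show ?thesis unfolding u_def kap_def by (simp only:) (simp add: field_simps)
qed

text \<open>On the half period \<open>u / ds\<close> decreases, and \<open>x0\<close> is the point
  where it equals \<open>kap / 2\<close>. As \<open>kap > 0\<close>, the quotient is positive up to
  \<open>x0\<close> and less than \<open>kap\<close> beyond it, so each of the two modes is free of
  zeros on its own part; evenness about 0 and about \<open>T / 2\<close> gives the other halves. Any
  level strictly between 0 and \<open>kap\<close> would serve.\<close>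

lemma sign_change:
  assumes J: "J \<noteq> 0"
  shows "\<exists>x0. 0 < x0 \<and> x0 < T / 2 \<and> (\<forall>x\<in>{-x0..x0}. u x \<noteq> 0) \<and> (\<forall>x\<in>{x0..T-x0}. u x - kap * ds x \<noteq> 0)"
proof -
  have "r1 \<noteq> 0" using J_roots J by auto
  then have r1: "r1 > 0" using r12 by simp
  have cu: "continuous_on X u" for X
    using du by (auto intro!: continuous_at_imp_continuous_on DERIV_isCont)
  have u0: "u 0 > 0"
  proof -
    have "u 0 * g 0 > 0" using wronskian_u[of 0] ds0 Cw_pos r1 by (simp add: r1_def)
    moreover have "g 0 > 0" using dds0_pos by (simp add: g_def)
    ultimately show ?thesis by (simp add: zero_less_mult_iff)
  qed
  have uT: "u (T / 2) < 0"
  proof -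
    have "2 * g (T / 2) = 2 * ((r2 - r1) * (r2 - r3))"
    proof -
      have e1: "2 = r1 + r2 + r3" by (simp add: r3_def)
      have "g (T / 2) = 3 * r2\<^sup>2 - 2 * 2 * r2 + 4 * E" by (simp add: g_def r2_def)
      also have "\<dots> = 3 * r2\<^sup>2 - 2 * (r1 + r2 + r3) * r2 + 4 * E" unfolding e1[symmetric] ..
      finally show ?thesis unfolding E_roots by (simp add: power2_eq_square algebra_simps)
    qed
    then have "g (T / 2) < 0" using r12 r23 by (simp add: mult_pos_neg)
    moreover have "u (T / 2) * g (T / 2) > 0"
      using wronskian_u[of "T / 2"] half_period(1) Cw_pos r12 by (simp add: r2_def)
    ultimately show ?thesis by (simp add: zero_less_mult_iff)
  qed
  have "\<exists>x\<ge>0. x \<le> T / 2 \<and> u x - kap / 2 * ds x = 0"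
    by (rule IVT2') (use u0 uT ds0 half_period(1) T in \<open>auto intro!: continuous_intros cu cont_ds\<close>)
  then obtain x0 where x0: "0 \<le> x0" "x0 \<le> T / 2" "u x0 - kap / 2 * ds x0 = 0" by blast
  have "x0 \<noteq> 0" "x0 \<noteq> T / 2" using x0 u0 uT ds0 half_period(1) by auto
  then have x0': "0 < x0" "x0 < T / 2" using x0 by auto
  define h where "h = (\<lambda>x. u x / ds x)"
  have dh: "(h has_real_derivative - Cw * s x / (ds x * ds x)) (at x)" if "0 < x" "x < T / 2" for x
    using DERIV_divide[OF du dds_g, of x] half_period(2)[OF that] wronskian_u[of x] by (simp add: h_def)
  have dec: "h y < h x" if "0 < x" "x < y" "y < T / 2" for x y
  proof (rule DERIV_neg_imp_decreasing[OF that(2)])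
    fix t assume "x \<le> t" "t \<le> y"
    then have t: "0 < t" "t < T / 2" using that by auto
    then have "s t > 0" "ds t > 0" using s_pos[of t] half_period(2)[of t] T by auto
    then have "- Cw * s t / (ds t * ds t) < 0" using Cw_pos by (simp add: divide_neg_pos)
    then show "\<exists>y. (h has_real_derivative y) (at t) \<and> y < 0" using dh[OF t] by blast
  qed
  have hx0: "h x0 = kap / 2" using x0 half_period(2)[OF x0'] by (simp add: h_def field_simps)
  have pos: "u x > 0" if "0 \<le> x" "x \<le> x0" for x
  proof (cases "x = 0")
    case False
    then have x: "0 < x" "x < T / 2" using that x0' by auto
    have "h x \<ge> h x0" using dec[of x x0] x that x0' by (cases "x = x0") auto
    then have "h x > 0" using hx0 kap_pos by simp
    then show ?thesis using half_period(2)[OF x] by (simp add: h_def zero_less_divide_iff)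
  qed (use u0 in simp)
  have neg: "u x - kap * ds x < 0" if "x0 \<le> x" "x \<le> T / 2" for x
  proof (cases "x = T / 2")
    case False
    then have x: "0 < x" "x < T / 2" using that x0' by auto
    have "h x \<le> h x0" using dec[of x0 x] x that x0' by (cases "x = x0") auto
    then have "h x < kap" using hx0 kap_pos by simp
    then show ?thesis using half_period(2)[OF x] by (simp add: h_def pos_divide_less_eq)
  next
    case True
    show ?thesis unfolding True using uT half_period(1) by simp
  qed
  have "u x \<noteq> 0" if "x \<in> {-x0..x0}" for x
    using pos[of x] pos[of "- x"] u_even[of x] that by (cases "x \<ge> 0") auto
  moreover have "u x - kap * ds x \<noteq> 0" if "x \<in> {x0..T-x0}" for x
    using neg[of x] neg[of "T - x"] u2_reflect[of x] that by (cases "x \<le> T / 2") auto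
  ultimately show ?thesis using x0' by blast
qed

text \<open>What remains of the density when the exact part and the square
  \<open>s * (\<Theta>' + 2 * J * A / s)\<^sup>2\<close> are split off; completing this square
  produces \<open>- 4 * J\<^sup>2 / s\<close>.\<close>

definition amp where "amp z z' x = s x * (pA' z z' x)\<^sup>2 + (2 * (s x)\<^sup>2 - 4 * J\<^sup>2 / s x) * (pA z x)\<^sup>2"

text \<open>Jacobi's factorisation of the amplitude form by a zero mode without zeros.\<close>

lemma amplitude_bound:
  assumes ab: "a < b" and sp: "\<And>x. s x > 0"
    and v: "\<And>x. (v has_real_derivative dv x) (at x)" "\<And>x. (dv has_real_derivative ddv x) (at x)"
    and ode: "\<And>x. s x * ddv x = ds x * dv x + (3 * (s x)\<^sup>2 - 4 * E) * v x"
    and nz: "\<And>x. x \<in> {a..b} \<Longrightarrow> v x \<noteq> 0"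
  shows "\<exists>K>0. \<forall>z z'. C1q z z' \<and> pA z a = 0 \<and> pA z b = 0 \<longrightarrow>
    (\<forall>x\<in>{a..b}. (pA z x)\<^sup>2 \<le> K * integral {a..b} (amp z z'))"
proof -
  have cv: "continuous_on X v" "continuous_on X dv" for X
    using v by (auto intro!: continuous_at_imp_continuous_on DERIV_isCont)
  \<comment> \<open>Compactness turns the absence of zeros of \<open>v\<close> into a positive lower
    bound \<open>\<kappa>\<close> for the new weight, and the supremum \<open>B\<close> serves to
    return from \<open>h\<close> to the amplitude.\<close>
  have "\<exists>t\<in>{a..b}. \<forall>x\<in>{a..b}. (v t)\<^sup>2 / s t \<le> (v x)\<^sup>2 / s x"
    by (rule continuous_attains_inf) (use ab sp in \<open>auto intro!: continuous_intros cv cont_s simp: less_imp_neq[symmetric]\<close>)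
  then obtain t where t: "t \<in> {a..b}" "\<And>x. x \<in> {a..b} \<Longrightarrow> (v t)\<^sup>2 / s t \<le> (v x)\<^sup>2 / s x" by blast
  define \<kappa> where "\<kappa> = (v t)\<^sup>2 / s t"
  have \<kappa>: "\<kappa> > 0" using nz[OF t(1)] sp[of t] by (simp add: \<kappa>_def)
  have "\<exists>t\<in>{a..b}. \<forall>x\<in>{a..b}. (v x / s x)\<^sup>2 \<le> (v t / s t)\<^sup>2"
    by (rule continuous_attains_sup) (use ab sp in \<open>auto intro!: continuous_intros cv cont_s simp: less_imp_neq[symmetric]\<close>)
  then obtain t' where t': "t' \<in> {a..b}" "\<And>x. x \<in> {a..b} \<Longrightarrow> (v x / s x)\<^sup>2 \<le> (v t' / s t')\<^sup>2" by blast
  define B where "B = (v t' / s t')\<^sup>2"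
  have B: "B > 0" using nz[OF t'(1)] sp[of t'] by (simp add: B_def)
  define K where "K = B * ((b - a) / \<kappa>)"
  have "(pA z x)\<^sup>2 \<le> K * integral {a..b} (amp z z')"
    if z: "C1q z z'" and za: "pA z a = 0" and zb: "pA z b = 0" and x: "x \<in> {a..b}" for z z' x
  proof -
    have snz: "s y \<noteq> 0" for y using sp[of y] by simp
    \<comment> \<open>The equation of \<open>v\<close> is the Euler-Lagrange equation of
      \<open>amp\<close> written for \<open>s * A\<close>, so \<open>h\<close> is the quotient by a
      zero mode. Then \<open>amp\<close> equals \<open>v\<^sup>2 / s * h'\<^sup>2\<close> plus the
      derivative of \<open>w\<close>, and \<open>w\<close> vanishes at both ends together with the
      amplitude.\<close>
    define h where "h = (\<lambda>y. s y * pA z y / v y)"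
    define h' where "h' = (\<lambda>y. ((ds y * pA z y + pA' z z' y * s y) * v y - (s y * pA z y) * dv y) / (v y * v y))"
    have dh: "(h has_real_derivative h' y) (at y)" if "y \<in> {a..b}" for y
      unfolding h_def h'_def by (rule DERIV_divide[OF DERIV_mult[OF ds dpA[OF z snz]] v(1) nz[OF that]])
    have ch': "continuous_on {a..b} h'"
      unfolding h'_def by (intro continuous_intros cont_s cont_ds cont_polar[OF z snz] cv) (use nz in auto)
    define w where "w = (\<lambda>y. (s y * dv y / v y - ds y) * (pA z y)\<^sup>2)"
    define w' where "w' = (\<lambda>y. (((ds y * dv y + ddv y * s y) * v y - (s y * dv y) * dv y) / (v y * v y) - g y) * (pA z y)\<^sup>2
      + (2 * (pA z y * pA' z z' y)) * (s y * dv y / v y - ds y))"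
    have dw: "(w has_real_derivative w' y) (at y)" if "y \<in> {a..b}" for y
    proof -
      have "((\<lambda>y. (pA z y)\<^sup>2) has_real_derivative 2 * (pA z y * pA' z z' y)) (at y)"
        by (rule derivative_eq_intros dpA[OF z snz] refl | simp)+
      then show ?thesis unfolding w_def w'_def
        by (intro DERIV_mult DERIV_diff DERIV_divide ds v dds_g nz[OF that])
    qed
    have amp_eq: "amp z z' y = (v y)\<^sup>2 / s y * (h' y)\<^sup>2 + w' y" if y: "y \<in> {a..b}" for y
    proof -
      define A A' q where "A = pA z y" and "A' = pA' z z' y" and "q = dv y / v y"
      have vy: "v y \<noteq> 0" by (rule nz[OF y])
      have dv: "dv y = q * v y" using vy by (simp add: q_def)
      have h'y: "h' y = (ds y * A + A' * s y - s y * A * q) / v y"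
        unfolding h'_def A_def[symmetric] A'_def[symmetric] dv using vy by (simp add: field_simps)
      have 1: "(v y)\<^sup>2 / s y * (h' y)\<^sup>2 = (ds y * A + A' * s y - s y * A * q)\<^sup>2 / s y"
        unfolding h'y using vy by (simp add: power_divide)
      have ode': "ddv y * s y = ds y * (q * v y) + (3 * (s y)\<^sup>2 - 4 * E) * v y" using ode[of y] by (simp add: dv mult.commute)
      have 2: "((ds y * dv y + ddv y * s y) * v y - (s y * dv y) * dv y) / (v y * v y)
          = 2 * ds y * q + (3 * (s y)\<^sup>2 - 4 * E) - s y * q\<^sup>2"
        unfolding dv ode' using vy by (simp add: field_simps power2_eq_square)
      have 3: "s y * dv y / v y = s y * q" by (simp add: q_def)
      have "w' y = (2 * ds y * q + (3 * (s y)\<^sup>2 - 4 * E) - s y * q\<^sup>2 - g y) * A\<^sup>2 + (2 * (A * A')) * (s y * q - ds y)"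
        unfolding w'_def 2 3 A_def A'_def ..
      moreover have "(ds y * A + A' * s y - s y * A * q)\<^sup>2 / s y
         = (ds y)\<^sup>2 * A\<^sup>2 / s y + A'\<^sup>2 * s y + s y * A\<^sup>2 * q\<^sup>2 + 2 * ds y * A * A' - 2 * ds y * A\<^sup>2 * q - 2 * A' * s y * A * q"
        using snz[of y] by (simp add: field_simps power2_eq_square)
      moreover have "(ds y)\<^sup>2 * A\<^sup>2 / s y = (2 * (s y)\<^sup>2 - 4 * s y + 8 * E - 4 * J\<^sup>2 / s y) * A\<^sup>2"
        unfolding ds_sq using snz[of y] by (simp add: field_simps power2_eq_square power3_eq_cube)
      ultimately show ?thesis
        unfolding 1 amp_def A_def[symmetric] A'_def[symmetric] g_def by (simp add: power2_eq_square algebra_simps)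
    qed
    have "((\<lambda>y. w' y) has_integral w b - w a) {a..b}"
      using ab dw by (intro fundamental_theorem_of_calculus)
        (auto simp: has_real_derivative_iff_has_vector_derivative[symmetric] intro: has_field_derivative_at_within)
    then have iw: "(w' has_integral 0) {a..b}" by (simp add: w_def za zb)
    have ih: "((\<lambda>y. (v y)\<^sup>2 / s y * (h' y)\<^sup>2) has_integral integral {a..b} (\<lambda>y. (v y)\<^sup>2 / s y * (h' y)\<^sup>2)) {a..b}"
      by (intro integrable_integral integrable_continuous_real continuous_intros cv cont_s ch') (use snz in auto)
    have "((\<lambda>y. (v y)\<^sup>2 / s y * (h' y)\<^sup>2 + w' y) has_integral integral {a..b} (\<lambda>y. (v y)\<^sup>2 / s y * (h' y)\<^sup>2) + 0) {a..b}"
      by (rule has_integral_add[OF ih iw])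
    then have "(amp z z' has_integral integral {a..b} (\<lambda>y. (v y)\<^sup>2 / s y * (h' y)\<^sup>2)) {a..b}"
      by (subst has_integral_cong[of _ _ "\<lambda>y. (v y)\<^sup>2 / s y * (h' y)\<^sup>2 + w' y"]) (use amp_eq in auto)
    then have amp: "integral {a..b} (amp z z') = integral {a..b} (\<lambda>y. (v y)\<^sup>2 / s y * (h' y)\<^sup>2)"
      by (rule integral_unique)
    have ch2: "(\<lambda>y. (h' y)\<^sup>2) integrable_on {c..d}" if "{c..d} \<subseteq> {a..b}" for c d
      by (intro integrable_continuous_real continuous_intros continuous_on_subset[OF ch' that])
    have "\<kappa> * integral {a..b} (\<lambda>y. (h' y)\<^sup>2) = integral {a..b} (\<lambda>y. \<kappa> * (h' y)\<^sup>2)" by simp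
    also have "\<dots> \<le> integral {a..b} (amp z z')"
      unfolding amp
    proof (rule integral_le)
      show "(\<lambda>y. \<kappa> * (h' y)\<^sup>2) integrable_on {a..b}"
        using has_integral_mult_right[OF integrable_integral[OF ch2[of a b]], of \<kappa>] by blast
      show "(\<lambda>y. (v y)\<^sup>2 / s y * (h' y)\<^sup>2) integrable_on {a..b}" using ih by blast
      show "\<kappa> * (h' y)\<^sup>2 \<le> (v y)\<^sup>2 / s y * (h' y)\<^sup>2" if "y \<in> {a..b}" for y
        unfolding \<kappa>_def using t(2)[OF that] by (rule mult_right_mono) simp
    qed
    finally have 4: "integral {a..b} (\<lambda>y. (h' y)\<^sup>2) \<le> integral {a..b} (amp z z') / \<kappa>"
      using \<kappa> by (simp add: pos_le_divide_eq mult.commute)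
    have "(h x - h a)\<^sup>2 \<le> (x - a) * integral {a..x} (\<lambda>y. (h' y)\<^sup>2)"
      using x dh by (intro square_le_integral_derivative continuous_on_subset[OF ch']) auto
    also have "\<dots> \<le> (b - a) * integral {a..b} (\<lambda>y. (h' y)\<^sup>2)"
      using x ch2[of a x] ch2[of a b]
      by (intro mult_mono integral_subset_le integral_nonneg) auto
    also have "\<dots> \<le> (b - a) * (integral {a..b} (amp z z') / \<kappa>)"
      using ab 4 by (intro mult_left_mono) auto
    finally have 5: "(h x)\<^sup>2 \<le> (b - a) / \<kappa> * integral {a..b} (amp z z')" by (simp add: h_def za)
    have "pA z x = v x / s x * h x" using nz[OF x] snz[of x] by (simp add: h_def)
    then have "(pA z x)\<^sup>2 = (v x / s x)\<^sup>2 * (h x)\<^sup>2" by (simp only: power_mult_distrib)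
    also have "\<dots> \<le> B * ((b - a) / \<kappa> * integral {a..b} (amp z z'))"
      using B t'(2)[OF x] by (intro mult_mono 5) (auto simp: B_def)
    finally show ?thesis by (simp add: K_def)
  qed
  moreover have "K > 0" using B \<kappa> ab by (simp add: K_def)
  ultimately show ?thesis by blast
qed

text \<open>The interval from \<open>- x0\<close> to \<open>T - x0\<close> is a full period, divided
  at \<open>x0\<close>. The amplitude vanishes at all three points, at the last one by periodicity,
  and each piece has its own zero mode. This bounds the amplitude; the square that was split off
  then bounds \<open>\<Theta>'\<close>, and the condition at 0 bounds
  \<open>\<Theta>\<close>.\<close>

lemma coercive_nonzero_J:
  assumes J: "J \<noteq> 0"
  shows "\<exists>x0. \<exists>K>0. \<forall>z z'. C1q z z' \<and> W x0 \<bullet> z x0 = 0 \<and> W (- x0) \<bullet> z (- x0) = 0 \<and> (\<i> * W 0) \<bullet> z 0 = 0 \<longrightarrow>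
    (\<forall>x\<in>{0..T}. z x \<bullet> z x \<le> K * Hb z z' z z')"
proof -
  have "r1 \<noteq> 0" using J_roots J by auto
  then have r1: "r1 > 0" using r12 by simp
  have sr1: "s x \<ge> r1" for x using min0 by (simp add: r1_def)
  have sp: "s x > 0" for x using sr1[of x] r1 by linarith
  have snz: "s x \<noteq> 0" for x using sp[of x] by simp
  obtain x0 where x0: "0 < x0" "x0 < T / 2" "\<And>x. x \<in> {-x0..x0} \<Longrightarrow> u x \<noteq> 0"
    "\<And>x. x \<in> {x0..T-x0} \<Longrightarrow> u x - kap * ds x \<noteq> 0" using sign_change[OF J] by blast
  have ode1: "s x * ddu x = ds x * du x + (3 * (s x)\<^sup>2 - 4 * E) * u x" for x by (rule u_ode)
  have v2: "((\<lambda>x. u x - kap * ds x) has_real_derivative du x - kap * g x) (at x)"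
    "((\<lambda>x. du x - kap * g x) has_real_derivative ddu x - kap * ((6 * s x - 4) * ds x)) (at x)" for x
    by (intro DERIV_diff du ddu DERIV_cmult dds_g dg)+
  have ode2: "s x * (ddu x - kap * ((6 * s x - 4) * ds x))
      = ds x * (du x - kap * g x) + (3 * (s x)\<^sup>2 - 4 * E) * (u x - kap * ds x)" for x
    using u_ode[of x] by (simp add: g_def power2_eq_square algebra_simps)
  have "- x0 < x0" using x0 by simp
  from amplitude_bound[OF this sp du ddu ode1 x0(3)] obtain K1 where K1: "K1 > 0"
    "\<And>z z' x. C1q z z' \<Longrightarrow> pA z (- x0) = 0 \<Longrightarrow> pA z x0 = 0 \<Longrightarrow> x \<in> {-x0..x0} \<Longrightarrow>
      (pA z x)\<^sup>2 \<le> K1 * integral {-x0..x0} (amp z z')" by blast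
  have "x0 < T - x0" using x0 by simp
  from amplitude_bound[OF this sp v2 ode2 x0(4)] obtain K2 where K2: "K2 > 0"
    "\<And>z z' x. C1q z z' \<Longrightarrow> pA z x0 = 0 \<Longrightarrow> pA z (T - x0) = 0 \<Longrightarrow> x \<in> {x0..T-x0} \<Longrightarrow>
      (pA z x)\<^sup>2 \<le> K2 * integral {x0..T-x0} (amp z z')" by blast
  define K3 where "K3 = K1 + K2"
  define K4 where "K4 = T * (2 / r1 + 8 * J\<^sup>2 / r1\<^sup>2 * K3 * T)"
  define K where "K = r2 * (K3 + K4)"
  have "z x \<bullet> z x \<le> K * Hb z z' z z'"
    if z: "C1q z z'" and z1: "W x0 \<bullet> z x0 = 0" and z2: "W (- x0) \<bullet> z (- x0) = 0"
      and z3: "(\<i> * W 0) \<bullet> z 0 = 0" and x: "x \<in> {0..T}" for z z' x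
  proof -
    define H where "H = Hb z z' z z'"
    let ?w = "{-x0..T-x0}"
    have A0: "pA z x0 = 0" "pA z (- x0) = 0" using z1 z2 by (simp_all add: pA_def)
    then have A1: "pA z (T - x0) = 0" using polar_per[OF z, of "- x0"] by simp
    define \<eta> where "\<eta> = (\<lambda>x. s x * (pT' z z' x + 2 * J * pA z x / s x)\<^sup>2)"
    have c\<eta>: "continuous_on X \<eta>" and camp: "continuous_on X (amp z z')" for X
      unfolding \<eta>_def amp_def[abs_def] by (intro continuous_intros cont_s cont_polar[OF z snz], use snz in simp)+
    have iab: "f integrable_on {a..b}" if "\<And>X. continuous_on X f" for f :: "real \<Rightarrow> real" and a b
      using that by (rule integrable_continuous_real)
    let ?d = "\<lambda>x. z' x \<bullet> z' x + (s x - 1) * (z x \<bullet> z x) + 2 * (W x \<bullet> z x) * (W x \<bullet> z x)"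
    have cd: "continuous_on X ?d" for X
      by (intro continuous_intros C1qD[OF z] cont_s cont_W)
    have "H = integral {-x0..-x0+T} ?d"
      unfolding H_def Hb_def
      using integral_shift_Icc_real[of _ _ ?d T] Hb_per[OF z]
      by (intro integral_period_shift[symmetric, OF _ T iab[OF cd]]) (simp add: o_def add.commute)
    also have "?d = (\<lambda>x. \<eta> x + amp z z' x + pB' z z' x)"
    proof
      fix x
      show "?d x = \<eta> x + amp z z' x + pB' z z' x"
        unfolding density_polar[OF z snz] \<eta>_def amp_def using snz[of x]
        by (simp add: field_simps power2_eq_square)
    qed
    also have "integral {-x0..-x0+T} (\<lambda>x. \<eta> x + amp z z' x + pB' z z' x)
        = integral ?w \<eta> + (integral {-x0..x0} (amp z z') + integral {x0..T-x0} (amp z z')) + 0"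
    proof (rule integral_unique)
      have "(pB' z z' has_integral pB z (T - x0) - pB z (- x0)) ?w"
        using T dpB[OF z snz] by (intro fundamental_theorem_of_calculus)
          (auto simp: has_real_derivative_iff_has_vector_derivative[symmetric] intro: has_field_derivative_at_within)
      moreover have "pB z (T - x0) = pB z (- x0)" using polar_per[OF z, of "- x0"] ds_per[of "- x0"] by (simp add: pB_def)
      ultimately have 1: "(pB' z z' has_integral 0) ?w" by simp
      have "integral {-x0..x0} (amp z z') + integral {x0..T-x0} (amp z z') = integral ?w (amp z z')"
        using x0 by (intro Henstock_Kurzweil_Integration.integral_combine iab camp) auto
      then have 2: "(amp z z' has_integral integral {-x0..x0} (amp z z') + integral {x0..T-x0} (amp z z')) ?w"
        using integrable_integral[OF iab[OF camp]] by metis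
      show "((\<lambda>x. \<eta> x + amp z z' x + pB' z z' x) has_integral
          integral ?w \<eta> + (integral {-x0..x0} (amp z z') + integral {x0..T-x0} (amp z z')) + 0) {-x0..-x0+T}"
        using has_integral_add[OF has_integral_add[OF integrable_integral[OF iab[OF c\<eta>]] 2] 1] by (simp add: add.commute)
    qed
    finally have Heq: "H = integral ?w \<eta> + (integral {-x0..x0} (amp z z') + integral {x0..T-x0} (amp z z'))" by simp
    have \<eta>0: "integral ?w \<eta> \<ge> 0"
      using sr1 r1 s_nonneg by (intro integral_nonneg iab c\<eta>) (simp add: \<eta>_def)
    \<comment> \<open>Evaluating \<open>amplitude_bound\<close> at one point of each piece shows
      that both amplitude integrals are nonnegative, so that each of them is at most
      \<open>H\<close>.\<close>
    have "0 \<le> (pA z 0)\<^sup>2" "0 \<le> (pA z (T / 2))\<^sup>2" by simp_all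
    moreover have "(pA z 0)\<^sup>2 \<le> K1 * integral {-x0..x0} (amp z z')" using x0 by (intro K1 z A0) auto
    moreover have "(pA z (T / 2))\<^sup>2 \<le> K2 * integral {x0..T-x0} (amp z z')" using x0 by (intro K2 z A0 A1) auto
    ultimately have "0 \<le> K1 * integral {-x0..x0} (amp z z')" "0 \<le> K2 * integral {x0..T-x0} (amp z z')" by linarith+
    then have a0: "0 \<le> integral {-x0..x0} (amp z z')" "0 \<le> integral {x0..T-x0} (amp z z')"
      using K1(1) K2(1) by (simp_all add: zero_le_mult_iff)
    then have H: "H \<ge> 0" "integral ?w \<eta> \<le> H" "integral {-x0..x0} (amp z z') \<le> H" "integral {x0..T-x0} (amp z z') \<le> H"
      using \<eta>0 Heq by linarith+
    have K3: "K3 > 0" using K1 K2 by (simp add: K3_def)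
    have A: "(pA z y)\<^sup>2 \<le> K3 * H" if "y \<in> ?w" for y
    proof (cases "y \<le> x0")
      case True
      then have "(pA z y)\<^sup>2 \<le> K1 * integral {-x0..x0} (amp z z')" using that by (intro K1 z A0) auto
      also have "\<dots> \<le> K3 * H" using K1(1) K2(1) H a0 by (intro mult_mono) (auto simp: K3_def)
      finally show ?thesis .
    next
      case False
      then have "(pA z y)\<^sup>2 \<le> K2 * integral {x0..T-x0} (amp z z')" using that by (intro K2 z A0 A1) auto
      also have "\<dots> \<le> K3 * H" using K1(1) K2(1) H a0 by (intro mult_mono) (auto simp: K3_def)
      finally show ?thesis .
    qed
    define L where "L = 2 / r1 * H + 8 * J\<^sup>2 / r1\<^sup>2 * (K3 * H) * T"
    have cT': "continuous_on X (\<lambda>y. (pT' z z' y)\<^sup>2)" for X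
      by (intro continuous_intros cont_polar[OF z snz])
    have "integral ?w (\<lambda>y. (pT' z z' y)\<^sup>2) \<le> integral ?w (\<lambda>y. 2 / r1 * \<eta> y + 8 * J\<^sup>2 / r1\<^sup>2 * (K3 * H))"
    proof (rule integral_le)
      fix y assume y: "y \<in> ?w"
      define p q where "p = pT' z z' y + 2 * J * pA z y / s y" and "q = 2 * J * pA z y / s y"
      have "(p - q)\<^sup>2 \<le> 2 * p\<^sup>2 + 2 * q\<^sup>2"
        using zero_le_power2[of "p + q"] by (simp add: power2_eq_square algebra_simps)
      moreover have "p\<^sup>2 \<le> \<eta> y / r1"
      proof -
        have "r1 * p\<^sup>2 \<le> s y * p\<^sup>2" by (intro mult_right_mono sr1) simp
        then show ?thesis using r1 by (simp add: \<eta>_def p_def pos_le_divide_eq mult.commute)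
      qed
      moreover have "q\<^sup>2 \<le> 4 * J\<^sup>2 / r1\<^sup>2 * (K3 * H)"
      proof -
        have "q\<^sup>2 = 4 * J\<^sup>2 * (pA z y)\<^sup>2 / (s y)\<^sup>2" by (simp add: q_def power_divide power_mult_distrib)
        also have "\<dots> \<le> 4 * J\<^sup>2 * (K3 * H) / r1\<^sup>2"
          using A[OF y] r1 sr1[of y] K3 H(1) by (intro frac_le mult_left_mono power_mono) auto
        finally show ?thesis by simp
      qed
      ultimately have "(p - q)\<^sup>2 \<le> 2 * (\<eta> y / r1) + 2 * (4 * J\<^sup>2 / r1\<^sup>2 * (K3 * H))" by linarith
      moreover have "pT' z z' y = p - q" by (simp add: p_def q_def)
      ultimately show "(pT' z z' y)\<^sup>2 \<le> 2 / r1 * \<eta> y + 8 * J\<^sup>2 / r1\<^sup>2 * (K3 * H)" by simp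
    qed (intro iab cT' continuous_intros c\<eta>)+
    also have "((\<lambda>y. 2 / r1 * \<eta> y + 8 * J\<^sup>2 / r1\<^sup>2 * (K3 * H)) has_integral
        2 / r1 * integral ?w \<eta> + 8 * J\<^sup>2 / r1\<^sup>2 * (K3 * H) * T) ?w"
      using has_integral_const_real[of "8 * J\<^sup>2 / r1\<^sup>2 * (K3 * H)" "-x0" "T-x0"] T
      by (intro has_integral_add has_integral_mult_right integrable_integral iab c\<eta>) (simp add: mult.commute)
    then have "integral ?w (\<lambda>y. 2 / r1 * \<eta> y + 8 * J\<^sup>2 / r1\<^sup>2 * (K3 * H)) =
        2 / r1 * integral ?w \<eta> + 8 * J\<^sup>2 / r1\<^sup>2 * (K3 * H) * T" by (rule integral_unique)
    also have "\<dots> \<le> L" unfolding L_def using H(2) r1 by (intro add_right_mono mult_left_mono) auto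
    finally have L: "integral ?w (\<lambda>y. (pT' z z' y)\<^sup>2) \<le> L" .
    have T0: "pT z 0 = 0" using z3 by (simp add: pT_def)
    have Tb: "(pT z y)\<^sup>2 \<le> T * L" if y: "y \<in> ?w" for y
    proof -
      have sub: "(b - a) * integral {a..b} (\<lambda>y. (pT' z z' y)\<^sup>2) \<le> T * L" if "{a..b} \<subseteq> ?w" "a \<le> b" for a b
      proof -
        have "integral {a..b} (\<lambda>y. (pT' z z' y)\<^sup>2) \<le> integral ?w (\<lambda>y. (pT' z z' y)\<^sup>2)"
          using that by (intro integral_subset_le iab cT') auto
        moreover have "integral {a..b} (\<lambda>y. (pT' z z' y)\<^sup>2) \<ge> 0"
          by (intro integral_nonneg iab cT') auto
        ultimately show ?thesis using that L by (intro mult_mono) auto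
      qed
      show ?thesis
      proof (cases "y \<ge> 0")
        case True
        have "(pT z y - pT z 0)\<^sup>2 \<le> (y - 0) * integral {0..y} (\<lambda>y. (pT' z z' y)\<^sup>2)"
          using True dpT[OF z snz] by (intro square_le_integral_derivative cont_polar[OF z snz]) auto
        also have "\<dots> \<le> T * L" using True y x0 by (intro sub) auto
        finally show ?thesis by (simp add: T0)
      next
        case False
        have "(pT z 0 - pT z y)\<^sup>2 \<le> (0 - y) * integral {y..0} (\<lambda>y. (pT' z z' y)\<^sup>2)"
          using False dpT[OF z snz] by (intro square_le_integral_derivative cont_polar[OF z snz]) auto
        also have "\<dots> \<le> T * L" using False y x0 by (intro sub) auto
        finally show ?thesis by (simp add: T0)
      qed
    qed
    have TL: "T * L = K4 * H" by (simp add: L_def K4_def algebra_simps)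
    have win: "z y \<bullet> z y \<le> K * H" if y: "y \<in> ?w" for y
    proof -
      have "s y \<le> r2" using s_range[of "\<bar>y\<bar>"] s_even[of y] y x0 by (cases "y \<ge> 0") auto
      then have "s y * ((pA z y)\<^sup>2 + (pT z y)\<^sup>2) \<le> r2 * (K3 * H + K4 * H)"
        using A[OF y] Tb[OF y] r12 unfolding TL by (intro mult_mono add_mono) auto
      then show ?thesis using norm_polar[of y z, OF snz] by (simp add: K_def algebra_simps)
    qed
    show ?thesis
    proof (cases "x \<le> T - x0")
      case True
      then show ?thesis using win[of x] x x0 by (simp add: H_def)
    next
      case False
      then have "z (x - T) \<bullet> z (x - T) \<le> K * H" using win[of "x - T"] x x0 by simp
      moreover have "z x = lam * z (x - T)" using C1qD(4)[OF z, of "x - T"] by simp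
      ultimately show ?thesis by (simp add: inner_mult_unit lam H_def)
    qed
  qed
  moreover have "K > 0"
  proof -
    have "K4 \<ge> 0" using T r1 K1 K2 by (simp add: K4_def K3_def)
    then show ?thesis using r12 K1 K2 by (simp add: K_def K3_def)
  qed
  ultimately show ?thesis by blast
qed

theorem coercive:
  "\<exists>c>0. \<exists>C\<ge>0. \<forall>v v'. C1q v v' \<longrightarrow> (\<exists>d e. c * nrm2 (\<lambda>x. v x - Fam 0 0 d e x) (\<lambda>x. v' x - Fam' 0 0 d e x)
    \<le> Hb v v' v v' + C * ((N1 v)\<^sup>2 + (M2 v)\<^sup>2))"
proof -
  have main: "\<exists>c>0. \<exists>C\<ge>0. \<forall>v v'. C1q v v' \<longrightarrow> (\<exists>d e. c * nrm2 (\<lambda>x. v x - Fam 0 0 d e x) (\<lambda>x. v' x - Fam' 0 0 d e x)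
    \<le> Hb v v' v v' + C * ((N1 v)\<^sup>2 + (M2 v)\<^sup>2))"
    if K0: "K > 0" and K: "\<And>z z' x. C1q z z' \<Longrightarrow> a 0 \<bullet> z (t 0) = 0 \<Longrightarrow> a 1 \<bullet> z (t 1) = 0 \<Longrightarrow> a 2 \<bullet> z (t 2) = 0 \<Longrightarrow> x \<in> {0..T}
       \<Longrightarrow> z x \<bullet> z x \<le> K * Hb z z' z z'"
    for K and a :: "nat \<Rightarrow> complex" and t :: "nat \<Rightarrow> real"
  proof -
    define M where "M = 1 + 2 * T * K"
    have M: "M > 0" using T K0 by (simp add: M_def add_pos_nonneg)
    show ?thesis
    proof (rule coercive_modulo_tangent[of "1 / M" a t])
      show "1 / M > 0" using M by simp
      fix z z' assume z: "C1q z z'" and L: "(a 0 \<bullet> z (t 0), a 1 \<bullet> z (t 1), a 2 \<bullet> z (t 2)) = 0"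
      have "nrm2 z z' \<le> (1 + 2 * T * K) * Hb z z' z z'"
        by (rule nrm2_le_Hb[OF z]) (use K[OF z] L in \<open>simp add: zero_prod_def\<close>)
      then show "1 / M * nrm2 z z' \<le> Hb z z' z z'" using M by (simp add: M_def pos_divide_le_eq mult.commute)
    qed
  qed
  show ?thesis
  proof (cases "J = 0")
    case True
    obtain K where K: "K > 0" "\<And>z z' x. C1q z z' \<Longrightarrow> z 0 = 0 \<Longrightarrow> (\<i> * W (T / 2)) \<bullet> z (T / 2) = 0 \<Longrightarrow> x \<in> {0..T}
       \<Longrightarrow> z x \<bullet> z x \<le> K * Hb z z' z z'"
      using coercive_zero_J[OF True] by blast
    \<comment> \<open>The vectors 1 and \<open>\<i>\<close>, both at the point 0, together encode
      the complex condition \<open>z 0 = 0\<close>.\<close>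
    show ?thesis
    proof (rule main[of K "\<lambda>i. if i = 0 then 1 else if i = 1 then \<i> else \<i> * W (T / 2)" "\<lambda>i. if i = 2 then T / 2 else 0"])
      fix z z' x assume "C1q z z'"
        "(if (0::nat) = 0 then 1 else if (0::nat) = 1 then \<i> else \<i> * W (T / 2)) \<bullet> z (if (0::nat) = 2 then T / 2 else 0) = 0"
        "(if (1::nat) = 0 then 1 else if (1::nat) = 1 then \<i> else \<i> * W (T / 2)) \<bullet> z (if (1::nat) = 2 then T / 2 else 0) = 0"
        "(if (2::nat) = 0 then 1 else if (2::nat) = 1 then \<i> else \<i> * W (T / 2)) \<bullet> z (if (2::nat) = 2 then T / 2 else 0) = 0"
        "x \<in> {0..T}"
      then show "z x \<bullet> z x \<le> K * Hb z z' z z'"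
        by (intro K) (simp_all add: inner_complex_def complex_eq_iff)
    qed (rule K(1))
  next
    case False
    obtain x0 K where K: "K > 0" "\<And>z z' x. C1q z z' \<Longrightarrow> W x0 \<bullet> z x0 = 0 \<Longrightarrow> W (- x0) \<bullet> z (- x0) = 0
       \<Longrightarrow> (\<i> * W 0) \<bullet> z 0 = 0 \<Longrightarrow> x \<in> {0..T} \<Longrightarrow> z x \<bullet> z x \<le> K * Hb z z' z z'"
      using coercive_nonzero_J[OF False] by blast
    show ?thesis
    proof (rule main[of K "\<lambda>i. if i = 0 then W x0 else if i = 1 then W (- x0) else \<i> * W 0" "\<lambda>i. if i = 0 then x0 else if i = 1 then - x0 else 0"])
      fix z z' x assume "C1q z z'"
        "(if (0::nat) = 0 then W x0 else if (0::nat) = 1 then W (- x0) else \<i> * W 0) \<bullet> z (if (0::nat) = 0 then x0 else if (0::nat) = 1 then - x0 else 0) = 0"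
        "(if (1::nat) = 0 then W x0 else if (1::nat) = 1 then W (- x0) else \<i> * W 0) \<bullet> z (if (1::nat) = 0 then x0 else if (1::nat) = 1 then - x0 else 0) = 0"
        "(if (2::nat) = 0 then W x0 else if (2::nat) = 1 then W (- x0) else \<i> * W 0) \<bullet> z (if (2::nat) = 0 then x0 else if (2::nat) = 1 then - x0 else 0) = 0"
        "x \<in> {0..T}"
      then show "z x \<bullet> z x \<le> K * Hb z z' z z'" by (intro K) simp_all
    qed (rule K(1))
  qed
qed

end

section \<open>Square integrable functions and weak derivatives\<close>

definition l2 :: "real \<Rightarrow> real \<Rightarrow> (real \<Rightarrow> complex) \<Rightarrow> real" where
  "l2 a b f = sqrt (LBINT x:{a..b}. (cmod (f x))\<^sup>2)"

lemma L2_locD: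
  assumes "f \<in> L2_loc"
  shows "f \<in> borel_measurable borel" "set_integrable lborel {a..b} (\<lambda>x. (cmod (f x))\<^sup>2)"
  using assms by (auto simp: L2_loc_def)

lemma set_borel_measurable_borel:
  fixes f :: "'a::euclidean_space \<Rightarrow> 'b::{second_countable_topology, real_normed_vector}"
  assumes "f \<in> borel_measurable borel" "A \<in> sets borel"
  shows "set_borel_measurable lborel A f"
  using assms unfolding set_borel_measurable_def
  by (auto intro!: borel_measurable_scaleR borel_measurable_indicator)

lemma L2_loc_bound:
  assumes "f \<in> borel_measurable borel" "g \<in> L2_loc" "h \<in> L2_loc"
    and "\<And>x. (cmod (f x))\<^sup>2 \<le> C * ((cmod (g x))\<^sup>2 + (cmod (h x))\<^sup>2)"
  shows "f \<in> L2_loc"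
proof -
  have "set_integrable lborel {a..b} (\<lambda>x. (cmod (f x))\<^sup>2)" for a b
  proof (rule set_integrable_bound)
    show "set_integrable lborel {a..b} (\<lambda>x. C * ((cmod (g x))\<^sup>2 + (cmod (h x))\<^sup>2))"
      using L2_locD(2)[OF assms(2)] L2_locD(2)[OF assms(3)] by (intro set_integrable_mult_right set_integral_add)
    show "set_borel_measurable lborel {a..b} (\<lambda>x. (cmod (f x))\<^sup>2)"
      using assms(1) by (intro set_borel_measurable_borel) auto
    show "AE x in lborel. x \<in> {a..b} \<longrightarrow> norm ((cmod (f x))\<^sup>2) \<le> norm (C * ((cmod (g x))\<^sup>2 + (cmod (h x))\<^sup>2))"
      using order_trans[OF assms(4) abs_ge_self] by auto
  qed
  then show ?thesis using assms(1) by (simp add: L2_loc_def)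
qed

lemma L2_loc_continuous: "continuous_on UNIV f \<Longrightarrow> f \<in> L2_loc"
  unfolding L2_loc_def
  by (auto intro!: borel_integrable_atLeastAtMost' continuous_intros borel_measurable_continuous_onI
      intro: continuous_on_subset)

lemma L2_loc_add: "f \<in> L2_loc \<Longrightarrow> g \<in> L2_loc \<Longrightarrow> (\<lambda>x. f x + g x) \<in> L2_loc"
proof (rule L2_loc_bound[of _ f g 2])
  fix x
  have "(cmod (f x + g x))\<^sup>2 \<le> (cmod (f x) + cmod (g x))\<^sup>2" by (intro power_mono norm_triangle_ineq) simp
  also have "\<dots> \<le> 2 * ((cmod (f x))\<^sup>2 + (cmod (g x))\<^sup>2)"
    using sum_squares_bound[of "cmod (f x)" "cmod (g x)"] by (simp add: power2_eq_square algebra_simps)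
  finally show "(cmod (f x + g x))\<^sup>2 \<le> 2 * ((cmod (f x))\<^sup>2 + (cmod (g x))\<^sup>2)" .
qed (auto intro: borel_measurable_add L2_locD(1))

lemma L2_loc_cmult: "f \<in> L2_loc \<Longrightarrow> (\<lambda>x. c * f x) \<in> L2_loc"
  by (rule L2_loc_bound[of _ f f "(cmod c)\<^sup>2"])
    (auto dest: L2_locD(1) simp: norm_mult power_mult_distrib algebra_simps)

lemma L2_loc_diff: "f \<in> L2_loc \<Longrightarrow> g \<in> L2_loc \<Longrightarrow> (\<lambda>x. f x - g x) \<in> L2_loc"
  using L2_loc_add[of f "\<lambda>x. (-1) * g x"] L2_loc_cmult[of g "-1"] by simp

lemma L2_loc_cnj: "f \<in> L2_loc \<Longrightarrow> (\<lambda>x. cnj (f x)) \<in> L2_loc"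
  by (rule L2_loc_bound[of _ f f 1]) (auto dest!: L2_locD(1) intro: borel_measurable_continuous_on[OF continuous_on_cnj[OF continuous_on_id]])

lemma L2_loc_shift:
  assumes "f \<in> L2_loc" shows "(\<lambda>x. f (x + h)) \<in> L2_loc"
proof -
  have "set_integrable lborel {a..b} (\<lambda>x. (cmod (f (x + h)))\<^sup>2)" for a b
    using lborel_integrable_real_affine[of "\<lambda>x. indicator {a+h..b+h} x *\<^sub>R (cmod (f x))\<^sup>2" 1 h]
      L2_locD(2)[OF assms, of "a + h" "b + h"]
    by (simp add: set_integrable_def indicator_def add.commute if_distrib cong: if_cong)
  then show ?thesis using L2_locD(1)[OF assms] by (simp add: L2_loc_def)
qed

lemma L2_loc_mult_continuous:
  assumes u: "continuous_on UNIV u" and f: "f \<in> L2_loc"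
  shows "(\<lambda>x. u x * f x) \<in> L2_loc"
proof -
  have m: "(\<lambda>x. u x * f x) \<in> borel_measurable borel"
    using L2_locD(1)[OF f] borel_measurable_continuous_onI[OF u] by measurable
  have "set_integrable lborel {a..b} (\<lambda>x. (cmod (u x * f x))\<^sup>2)" for a b
  proof -
    have "bounded (u ` {a..b})" by (intro compact_imp_bounded compact_continuous_image continuous_on_subset[OF u]) auto
    then obtain B where "\<forall>y\<in>u ` {a..b}. cmod y \<le> B" unfolding bounded_iff by blast
    then have B: "\<And>x. x \<in> {a..b} \<Longrightarrow> cmod (u x) \<le> B" by blast
    show ?thesis
    proof (rule set_integrable_bound)
      show "set_integrable lborel {a..b} (\<lambda>x. B\<^sup>2 * (cmod (f x))\<^sup>2)" using L2_locD(2)[OF f] by simp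
      show "set_borel_measurable lborel {a..b} (\<lambda>x. (cmod (u x * f x))\<^sup>2)"
        using m by (intro set_borel_measurable_borel) auto
      show "AE x in lborel. x \<in> {a..b} \<longrightarrow> norm ((cmod (u x * f x))\<^sup>2) \<le> norm (B\<^sup>2 * (cmod (f x))\<^sup>2)"
        using B by (auto simp: norm_mult power_mult_distrib intro!: mult_right_mono power_mono)
    qed
  qed
  then show ?thesis using m by (simp add: L2_loc_def)
qed

lemma L2_loc_mult_integrable:
  assumes f: "f \<in> L2_loc" and g: "g \<in> L2_loc"
  shows "set_integrable lborel {a..b} (\<lambda>x. f x * g x)" "set_integrable lborel {a..b} (\<lambda>x. cmod (f x) * cmod (g x))"
proof -
  have 1: "set_integrable lborel {a..b} (\<lambda>x. (cmod (f x))\<^sup>2 + (cmod (g x))\<^sup>2)"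
    by (intro set_integral_add L2_locD assms)
  have 2: "cmod (f x) * cmod (g x) \<le> (cmod (f x))\<^sup>2 + (cmod (g x))\<^sup>2" for x
  proof -
    have "2 * (cmod (f x) * cmod (g x)) \<le> (cmod (f x))\<^sup>2 + (cmod (g x))\<^sup>2"
      using sum_squares_bound[of "cmod (f x)" "cmod (g x)"] by (simp add: algebra_simps)
    moreover have "0 \<le> cmod (f x) * cmod (g x)" by simp
    ultimately show ?thesis by linarith
  qed
  note m = L2_locD(1)[OF f] L2_locD(1)[OF g]
  show "set_integrable lborel {a..b} (\<lambda>x. f x * g x)"
    by (rule set_integrable_bound[OF 1 set_borel_measurable_borel]) (use m 2 in \<open>auto simp: norm_mult\<close>)
  show "set_integrable lborel {a..b} (\<lambda>x. cmod (f x) * cmod (g x))"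
    by (rule set_integrable_bound[OF 1 set_borel_measurable_borel]) (use m 2 in \<open>auto simp: norm_mult\<close>)
qed

lemma L2_loc_integrable: "f \<in> L2_loc \<Longrightarrow> set_integrable lborel {a..b} f"
  using L2_loc_mult_integrable(1)[of f "\<lambda>_. 1" a b] L2_loc_continuous[of "\<lambda>_. 1"] by simp

lemma set_integral_nonneg':
  assumes "\<And>x. x \<in> A \<Longrightarrow> f x \<ge> (0::real)"
  shows "(LINT x:A|M. f x) \<ge> 0"
  unfolding set_lebesgue_integral_def by (rule integral_nonneg_AE) (use assms in \<open>auto simp: indicator_def\<close>)

lemma l2_nonneg: "l2 a b f \<ge> 0" and l2_sq: "(l2 a b f)\<^sup>2 = (LBINT x:{a..b}. (cmod (f x))\<^sup>2)"
  by (simp_all add: l2_def set_integral_nonneg')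

lemma Cauchy_Schwarz_norms:
  assumes f: "f \<in> L2_loc" and g: "g \<in> L2_loc"
  shows "(LBINT x:{a..b}. cmod (f x) * cmod (g x)) \<le> l2 a b f * l2 a b g"
proof -
  define F G K where "F = l2 a b f" and "G = l2 a b g" and "K = (LBINT x:{a..b}. cmod (f x) * cmod (g x))"
  have i: "set_integrable lborel {a..b} (\<lambda>x. (cmod (f x))\<^sup>2)" "set_integrable lborel {a..b} (\<lambda>x. (cmod (g x))\<^sup>2)"
    "set_integrable lborel {a..b} (\<lambda>x. cmod (f x) * cmod (g x))"
    by (intro L2_locD L2_loc_mult_integrable f g)+
  have "0 \<le> F\<^sup>2 - 2 * t * K + t\<^sup>2 * G\<^sup>2" for t
  proof -
    have "F\<^sup>2 - 2 * t * K + t\<^sup>2 * G\<^sup>2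
      = (LBINT x:{a..b}. (cmod (f x))\<^sup>2 - 2 * t * (cmod (f x) * cmod (g x)) + t\<^sup>2 * (cmod (g x))\<^sup>2)"
      unfolding F_def G_def K_def l2_sq using i by (simp add: set_integral_add set_integral_diff)
    also have "\<dots> = (LBINT x:{a..b}. (cmod (f x) - t * cmod (g x))\<^sup>2)"
      by (rule arg_cong[of _ _ "\<lambda>h. set_lebesgue_integral lborel {a..b} h"]) (simp add: fun_eq_iff power2_eq_square algebra_simps)
    also have "\<dots> \<ge> 0" by (rule set_integral_nonneg') simp
    finally show ?thesis .
  qed
  then have "K\<^sup>2 \<le> (F * G)\<^sup>2" unfolding power_mult_distrib by (rule discriminant_nonpos) simp
  then have "K \<le> F * G" by (rule power2_le_imp_le) (simp add: F_def G_def l2_nonneg)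
  then show ?thesis by (simp add: K_def F_def G_def)
qed

lemma Cauchy_Schwarz_L2:
  assumes f: "f \<in> L2_loc" and g: "g \<in> L2_loc"
  shows "cmod (LBINT x:{a..b}. f x * g x) \<le> l2 a b f * l2 a b g"
proof -
  have "cmod (LBINT x:{a..b}. f x * g x) \<le> (LBINT x:{a..b}. cmod (f x * g x))"
    unfolding set_lebesgue_integral_def
    using integral_norm_bound[of lborel "\<lambda>x. indicator {a..b} x *\<^sub>R (f x * g x)"] by (simp add: abs_mult)
  also have "\<dots> \<le> l2 a b f * l2 a b g" unfolding norm_mult by (rule Cauchy_Schwarz_norms[OF f g])
  finally show ?thesis .
qed

lemma set_integral_norm_le:
  fixes f :: "'a::euclidean_space \<Rightarrow> 'b::{banach, second_countable_topology}"
  assumes "set_integrable lborel A f"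
  shows "norm (LBINT x:A. f x) \<le> (LBINT x:A. norm (f x))"
  unfolding set_lebesgue_integral_def
  using integral_norm_bound[of lborel "\<lambda>x. indicator A x *\<^sub>R f x"] by simp

lemma l2_triangle:
  assumes f: "f \<in> L2_loc" and g: "g \<in> L2_loc"
  shows "l2 a b (\<lambda>x. f x + g x) \<le> l2 a b f + l2 a b g"
proof -
  have "(l2 a b (\<lambda>x. f x + g x))\<^sup>2 \<le> (LBINT x:{a..b}. (cmod (f x))\<^sup>2 + 2 * (cmod (f x) * cmod (g x)) + (cmod (g x))\<^sup>2)"
    unfolding l2_sq
  proof (rule set_integral_mono)
    show "set_integrable lborel {a..b} (\<lambda>x. (cmod (f x))\<^sup>2 + 2 * (cmod (f x) * cmod (g x)) + (cmod (g x))\<^sup>2)"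
      by (intro set_integral_add set_integrable_mult_right L2_locD L2_loc_mult_integrable f g)
    fix x
    have "(cmod (f x + g x))\<^sup>2 \<le> (cmod (f x) + cmod (g x))\<^sup>2" by (intro power_mono norm_triangle_ineq) simp
    then show "(cmod (f x + g x))\<^sup>2 \<le> (cmod (f x))\<^sup>2 + 2 * (cmod (f x) * cmod (g x)) + (cmod (g x))\<^sup>2"
      by (simp add: power2_eq_square algebra_simps)
  qed (intro L2_locD L2_loc_add f g)
  also have "\<dots> = (l2 a b f)\<^sup>2 + 2 * (LBINT x:{a..b}. cmod (f x) * cmod (g x)) + (l2 a b g)\<^sup>2"
    unfolding l2_sq by (simp add: set_integral_add set_integral_diff L2_locD L2_loc_mult_integrable f g)
  also have "\<dots> \<le> (l2 a b f + l2 a b g)\<^sup>2"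
    using Cauchy_Schwarz_norms[OF f g, of a b] by (simp add: power2_eq_square algebra_simps)
  finally show ?thesis by (rule power2_le_imp_le) (simp add: l2_nonneg)
qed

lemma l2_cmult: "l2 a b (\<lambda>x. c * f x) = cmod c * l2 a b f"
  by (simp add: l2_def norm_mult power_mult_distrib real_sqrt_mult)

lemma l2_triangle_diff:
  assumes f: "f \<in> L2_loc" and g: "g \<in> L2_loc"
  shows "l2 a b (\<lambda>x. f x - g x) \<le> l2 a b f + l2 a b g"
  using l2_triangle[OF f L2_loc_cmult[OF g, of "-1"], of a b] l2_cmult[of a b "-1" g] by simp

lemma l2_mono:
  assumes f: "f \<in> L2_loc" and g: "g \<in> L2_loc" and le: "\<And>x. x \<in> {a..b} \<Longrightarrow> cmod (f x) \<le> cmod (g x)"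
  shows "l2 a b f \<le> l2 a b g"
  unfolding l2_def by (intro real_sqrt_le_mono set_integral_mono L2_locD f g power_mono le) auto

lemma l2_subset:
  assumes f: "f \<in> L2_loc" and sub: "{a..b} \<subseteq> {c..d}"
  shows "l2 a b f \<le> l2 c d f"
proof -
  have "(LBINT x:{a..b}. (cmod (f x))\<^sup>2) \<le> (LBINT x:{c..d}. (cmod (f x))\<^sup>2)"
    using L2_locD(2)[OF f] unfolding set_lebesgue_integral_def set_integrable_def
    by (intro integral_mono) (use sub in \<open>auto simp: indicator_def\<close>)
  then show ?thesis unfolding l2_def by simp
qed

lemma l2_le_sup:
  assumes f: "f \<in> L2_loc" and ab: "a \<le> b" and B: "\<And>x. x \<in> {a..b} \<Longrightarrow> cmod (f x) \<le> B" "B \<ge> 0"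
  shows "l2 a b f \<le> B * sqrt (b - a)"
proof -
  have "l2 a b f \<le> l2 a b (\<lambda>_. complex_of_real B)"
    using B by (intro l2_mono f L2_loc_continuous) auto
  also have "\<dots> = B * sqrt (b - a)"
    using ab B by (simp add: l2_def set_lebesgue_integral_def real_sqrt_mult mult.commute)
  finally show ?thesis .
qed

lemma l2_cong_AE:
  assumes "f \<in> borel_measurable borel" "g \<in> borel_measurable borel" "AE x in lborel. x \<in> {a..b} \<longrightarrow> f x = g x"
  shows "l2 a b f = l2 a b g"
proof -
  have "(LBINT x:{a..b}. (cmod (f x))\<^sup>2) = (LBINT x:{a..b}. (cmod (g x))\<^sup>2)"
    using assms by (intro set_lebesgue_integral_cong_AE) auto
  then show ?thesis by (simp add: l2_def)
qed

lemma l2_eq_0_AE: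
  assumes f: "f \<in> L2_loc" and 0: "l2 a b f = 0"
  shows "AE x in lborel. x \<in> {a..b} \<longrightarrow> f x = 0"
proof -
  have "(LINT x|lborel. indicator {a..b} x *\<^sub>R (cmod (f x))\<^sup>2) = 0"
    using 0 l2_sq[of a b f] by (simp add: set_lebesgue_integral_def)
  then have "AE x in lborel. indicator {a..b} x *\<^sub>R (cmod (f x))\<^sup>2 = 0"
    using L2_locD(2)[OF f, of a b] unfolding set_integrable_def
    by (subst (asm) integral_nonneg_eq_0_iff_AE) auto
  then show ?thesis by eventually_elim (auto simp: indicator_def)
qed

text \<open>A measurable function is an almost everywhere limit of continuous ones; truncating both by the
  retraction onto a disc turns this into convergence in the mean square.\<close>

definition clip :: "real \<Rightarrow> complex \<Rightarrow> complex" where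
  "clip K w = (K / max K (cmod w)) *\<^sub>R w"

lemma clip:
  assumes "K > 0"
  shows "continuous_on UNIV (clip K)" "cmod (clip K w) \<le> K" "cmod (clip K w) \<le> cmod w"
    "cmod w \<le> K \<Longrightarrow> clip K w = w"
proof -
  have pos: "max K (cmod w) > 0" for w using assms by (simp add: less_max_iff_disj)
  show "continuous_on UNIV (clip K)"
    unfolding clip_def[abs_def] by (intro continuous_intros) (metis pos less_irrefl)
  have n: "cmod (clip K w) = K / max K (cmod w) * cmod w" using pos[of w] assms by (simp add: clip_def abs_of_pos)
  have "K / max K (cmod w) \<le> 1" using pos[of w] by simp
  from mult_right_mono[OF this norm_ge_zero[of w]] show "cmod (clip K w) \<le> cmod w" unfolding n by simp
  have "cmod w / max K (cmod w) \<le> 1" using pos[of w] by simp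
  from mult_left_mono[OF this, of K] assms show "cmod (clip K w) \<le> K" unfolding n by simp
  show "cmod w \<le> K \<Longrightarrow> clip K w = w" using assms by (simp add: clip_def)
qed

lemma l2_tendsto_0:
  assumes F: "\<And>n. F n \<in> L2_loc" and h: "h \<in> L2_loc"
    and le: "\<And>n x. cmod (F n x) \<le> cmod (h x)"
    and lim: "AE x in lborel. x \<in> {a..b} \<longrightarrow> (\<lambda>n. F n x) \<longlonglongrightarrow> 0"
  shows "(\<lambda>n. l2 a b (F n)) \<longlonglongrightarrow> 0"
proof -
  have "(\<lambda>n. LINT x|lborel. indicator {a..b} x *\<^sub>R (cmod (F n x))\<^sup>2) \<longlonglongrightarrow> (LINT (x::real)|lborel. 0::real)"
  proof (rule integral_dominated_convergence[where w = "\<lambda>x. indicator {a..b} x *\<^sub>R (cmod (h x))\<^sup>2"])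
    show "integrable lborel (\<lambda>x. indicator {a..b} x *\<^sub>R (cmod (h x))\<^sup>2)"
      using L2_locD(2)[OF h] by (simp add: set_integrable_def)
    show "(\<lambda>x. indicator {a..b} x *\<^sub>R (cmod (F n x))\<^sup>2) \<in> borel_measurable lborel" for n
      using L2_locD(1)[OF F[of n]] by measurable
    show "AE x in lborel. (\<lambda>n. indicator {a..b} x *\<^sub>R (cmod (F n x))\<^sup>2) \<longlonglongrightarrow> 0"
      using lim
    proof eventually_elim
      case (elim x)
      show ?case
      proof (cases "x \<in> {a..b}")
        case True
        with elim have "(\<lambda>n. (cmod (F n x))\<^sup>2) \<longlonglongrightarrow> 0" by (auto intro!: tendsto_eq_intros)
        then show ?thesis using True by simp
      qed simp
    qed
    show "AE x in lborel. norm (indicator {a..b} x *\<^sub>R (cmod (F n x))\<^sup>2) \<le> indicator {a..b} x *\<^sub>R (cmod (h x))\<^sup>2" for n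
      using le by (auto simp: indicator_def intro!: power_mono)
  qed simp
  then have "(\<lambda>n. sqrt (LBINT x:{a..b}. (cmod (F n x))\<^sup>2)) \<longlonglongrightarrow> sqrt 0"
    unfolding set_lebesgue_integral_def by (intro tendsto_real_sqrt) simp
  then show ?thesis by (simp add: l2_def)
qed

lemma L2_dense_continuous:
  assumes g: "g \<in> L2_loc" and e: "e > 0"
  shows "\<exists>h. continuous_on UNIV h \<and> l2 a b (\<lambda>x. g x - h x) < e"
proof -
  note gm = L2_locD(1)[OF g]
  have clipg: "(\<lambda>x. clip K (g x)) \<in> L2_loc" if "K > 0" for K
  proof (rule L2_loc_bound[OF _ g g, of _ 1])
    show "(\<lambda>x. clip K (g x)) \<in> borel_measurable borel"
      using measurable_comp[OF gm borel_measurable_continuous_onI[OF clip(1)[OF that]]] by (simp add: comp_def)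
    show "(cmod (clip K (g x)))\<^sup>2 \<le> 1 * ((cmod (g x))\<^sup>2 + (cmod (g x))\<^sup>2)" for x
      using power_mono[OF clip(3)[OF that, of "g x"] norm_ge_zero, of 2] zero_le_power2[of "cmod (g x)"]
      unfolding mult_1 by linarith
  qed
  have "(\<lambda>n. l2 a b (\<lambda>x. g x - clip (real (Suc n)) (g x))) \<longlonglongrightarrow> 0"
  proof (rule l2_tendsto_0)
    show "(\<lambda>x. g x - clip (real (Suc n)) (g x)) \<in> L2_loc" for n by (intro L2_loc_diff g clipg) simp
    show "(\<lambda>x. 2 * g x) \<in> L2_loc" by (rule L2_loc_cmult[OF g])
    show "cmod (g x - clip (real (Suc n)) (g x)) \<le> cmod (2 * g x)" for n x
      using norm_triangle_ineq4[of "g x" "clip (real (Suc n)) (g x)"] clip(3)[of "real (Suc n)" "g x"]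
      by (simp add: norm_mult)
    have "(\<lambda>n. g x - clip (real (Suc n)) (g x)) \<longlonglongrightarrow> 0" for x
    proof (rule tendsto_eventually, rule eventually_sequentiallyI)
      fix n assume "n \<ge> nat \<lceil>cmod (g x)\<rceil>"
      then have "cmod (g x) \<le> real (Suc n)" by linarith
      then show "g x - clip (real (Suc n)) (g x) = 0" using clip(4)[of "real (Suc n)" "g x"] by simp
    qed
    then show "AE x in lborel. x \<in> {a..b} \<longrightarrow> (\<lambda>n. g x - clip (real (Suc n)) (g x)) \<longlonglongrightarrow> 0" by simp
  qed
  then obtain n where n: "l2 a b (\<lambda>x. g x - clip (real (Suc n)) (g x)) < e / 2"
    using order_tendstoD(2)[of _ 0 sequentially "e / 2"] e by (metis (no_types, lifting) eventually_sequentially half_gt_zero order_refl)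
  define K where "K = real (Suc n)"
  have K: "K > 0" by (simp add: K_def)
  \<comment> \<open>In the Henstock-Kurzweil setting measurability is by definition an almost
    everywhere limit of continuous functions.\<close>
  have "g measurable_on UNIV"
    using measurable_completion[of g lborel borel] gm by (simp add: measurable_on_iff_borel_measurable lebesgue_on_UNIV_eq)
  then obtain N G where N: "negligible N" "\<And>n. continuous_on UNIV (G n)"
    "\<And>x. x \<notin> N \<Longrightarrow> (\<lambda>n. G n x) \<longlonglongrightarrow> g x" by (auto simp: measurable_on_def)
  have AEN: "AE x in lborel. (\<lambda>n. G n x) \<longlonglongrightarrow> g x"
  proof -
    have "N \<in> null_sets lebesgue" using N(1) by (simp add: negligible_iff_null_sets)
    then have "AE x in lebesgue. x \<notin> N" by (rule AE_not_in)
    then have "AE x in lborel. x \<notin> N" by (simp add: AE_completion_iff)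
    then show ?thesis by eventually_elim (rule N(3))
  qed
  have cc: "continuous_on UNIV (\<lambda>x. clip K (G m x))" for m
    using continuous_on_compose2[OF clip(1)[OF K] N(2)] by auto
  have "(\<lambda>m. l2 a b (\<lambda>x. clip K (g x) - clip K (G m x))) \<longlonglongrightarrow> 0"
  proof (rule l2_tendsto_0)
    show "(\<lambda>x. clip K (g x) - clip K (G m x)) \<in> L2_loc" for m
      by (intro L2_loc_diff clipg K L2_loc_continuous cc)
    show "(\<lambda>x. complex_of_real (2 * K)) \<in> L2_loc" by (rule L2_loc_continuous) simp
    show "cmod (clip K (g x) - clip K (G m x)) \<le> cmod (complex_of_real (2 * K))" for m x
      using norm_triangle_ineq4[of "clip K (g x)" "clip K (G m x)"] clip(2)[OF K, of "g x"] clip(2)[OF K, of "G m x"] K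
      by simp
    show "AE x in lborel. x \<in> {a..b} \<longrightarrow> (\<lambda>m. clip K (g x) - clip K (G m x)) \<longlonglongrightarrow> 0"
      using AEN
    proof eventually_elim
      case (elim x)
      have "isCont (clip K) (g x)" using clip(1)[OF K] by (simp add: continuous_on_eq_continuous_at)
      from isCont_tendsto_compose[OF this elim] have "(\<lambda>m. clip K (g x) - clip K (G m x)) \<longlonglongrightarrow> clip K (g x) - clip K (g x)"
        by (intro tendsto_intros)
      then show ?case by simp
    qed
  qed
  then obtain m where m: "l2 a b (\<lambda>x. clip K (g x) - clip K (G m x)) < e / 2"
    using order_tendstoD(2)[of _ 0 sequentially "e / 2"] e by (metis (no_types, lifting) eventually_sequentially half_gt_zero order_refl)
  have "l2 a b (\<lambda>x. (g x - clip K (g x)) + (clip K (g x) - clip K (G m x)))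
      \<le> l2 a b (\<lambda>x. g x - clip K (g x)) + l2 a b (\<lambda>x. clip K (g x) - clip K (G m x))"
    by (intro l2_triangle L2_loc_diff clipg K L2_loc_continuous cc g)
  then have "l2 a b (\<lambda>x. g x - clip K (G m x)) < e" using n m by (simp add: K_def)
  then show ?thesis using cc by blast
qed

text \<open>The fundamental theorem of calculus taken as a definition. By
  \<open>wpair_imp_weak_derivative\<close> and \<open>weak_derivative_imp_wpair\<close> it is
  equivalent to \<open>g\<close> being a square integrable weak derivative of the continuous
  function \<open>u\<close>, but it is free of test functions.\<close>

definition wpair :: "(real \<Rightarrow> complex) \<Rightarrow> (real \<Rightarrow> complex) \<Rightarrow> bool" where
  "wpair u g \<longleftrightarrow> continuous_on UNIV u \<and> g \<in> L2_loc \<and> (\<forall>a b. a \<le> b \<longrightarrow> u b - u a = (LBINT x:{a..b}. g x))"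

definition dq :: "real \<Rightarrow> (real \<Rightarrow> complex) \<Rightarrow> real \<Rightarrow> complex" where
  "dq h u x = (u (x + h) - u x) / complex_of_real h"

lemma wpairD:
  assumes "wpair u g"
  shows "continuous_on A u" "g \<in> L2_loc" "a \<le> b \<Longrightarrow> u b - u a = (LBINT x:{a..b}. g x)"
  using assms by (auto simp: wpair_def intro: continuous_on_subset)

lemma continuous_dq: "continuous_on UNIV u \<Longrightarrow> continuous_on A (dq h u)"
  unfolding dq_def[abs_def] divide_inverse
  by (intro continuous_intros continuous_on_compose2[where f = "\<lambda>x. x + h" and g = u and t = UNIV])
    (auto intro: continuous_on_subset intro!: continuous_intros)

lemma L2_dq: "continuous_on UNIV u \<Longrightarrow> dq h u \<in> L2_loc"
  by (intro L2_loc_continuous continuous_dq)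

lemma dq_pointwise:
  assumes w: "wpair u g" and h: "h > 0"
  shows "(cmod (dq h u x))\<^sup>2 \<le> (l2 x (x + h) g)\<^sup>2 / h"
proof -
  have one: "(\<lambda>_. 1) \<in> L2_loc" by (rule L2_loc_continuous) simp
  have "cmod (u (x + h) - u x) \<le> l2 x (x + h) g * l2 x (x + h) (\<lambda>_. 1)"
    using Cauchy_Schwarz_L2[OF wpairD(2)[OF w] one, of x "x + h"] wpairD(3)[OF w, of x "x + h"] h by simp
  also have "l2 x (x + h) (\<lambda>_. 1) = sqrt h" using h by (simp add: l2_def set_lebesgue_integral_def)
  finally have "(cmod (u (x + h) - u x))\<^sup>2 \<le> (l2 x (x + h) g * sqrt h)\<^sup>2" by (intro power_mono) auto
  then have "(cmod (u (x + h) - u x))\<^sup>2 \<le> (l2 x (x + h) g)\<^sup>2 * h" using h by (simp add: power_mult_distrib)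
  then have "(cmod (u (x + h) - u x))\<^sup>2 / h\<^sup>2 \<le> (l2 x (x + h) g)\<^sup>2 * h / h\<^sup>2" by (intro divide_right_mono) auto
  then show ?thesis using h by (simp add: dq_def norm_divide power_divide power2_eq_square[of h])
qed

text \<open>The pointwise bound is \<open>G (x + h) - G x\<close> over \<open>h\<close>, where
  \<open>G\<close> is the increasing primitive of \<open>|g|\<^sup>2\<close>. Its integral over
  \<open>{a..b}\<close> telescopes to two integrals over intervals of length \<open>h\<close>. The
  constant is 1, and the interval is enlarged by \<open>h\<close> only.\<close>

lemma dq_bound:
  assumes w: "wpair u g" and h: "h > 0" and ab: "a \<le> b"
  shows "l2 a b (dq h u) \<le> l2 a (b + h) g"
proof -
  define k where "k = (\<lambda>x. (cmod (g x))\<^sup>2)"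
  have ki: "set_integrable lborel {c..d} k" for c d unfolding k_def by (rule L2_locD(2)[OF wpairD(2)[OF w]])
  have kint: "k integrable_on {c..d}" "(LBINT x:{c..d}. k x) = integral {c..d} k" for c d
    using set_borel_integral_eq_integral[OF ki[of c d]] by auto
  define G where "G = (\<lambda>x. integral {a..x} k)"
  have G0: "G x \<ge> 0" for x unfolding G_def by (rule integral_nonneg[OF kint(1)]) (simp add: k_def)
  have Gdiff: "integral {x..y} k = G y - G x" if "a \<le> x" "x \<le> y" for x y
    using Henstock_Kurzweil_Integration.integral_combine[OF that kint(1)] by (simp add: G_def)
  have Gmono: "G x \<le> G y" if "a \<le> x" "x \<le> y" for x y
  proof -
    have "integral {x..y} k \<ge> 0" by (rule integral_nonneg[OF kint(1)]) (simp add: k_def)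
    then show ?thesis using Gdiff[OF that] by simp
  qed
  have cG: "continuous_on {a..b+h} G" unfolding G_def by (rule indefinite_integral_continuous_1[OF kint(1)])
  have iG: "G integrable_on {c..d}" if "a \<le> c" "d \<le> b + h" for c d
    by (intro integrable_continuous_real continuous_on_subset[OF cG]) (use that in auto)
  have shift: "integral {a..b} (\<lambda>x. G (x + h)) = integral {a+h..b+h} G"
    using integral_shift_Icc_real[of a b G h] by (simp add: o_def add.commute)
  have iGs: "(\<lambda>x. G (x + h)) integrable_on {a..b}"
    by (intro integrable_continuous_real continuous_on_compose2[OF cG] continuous_intros) (use h in auto)
  have cd: "continuous_on {a..b} (\<lambda>x. (cmod (dq h u x))\<^sup>2)"
    by (intro continuous_intros continuous_dq wpairD(1)[OF w])
  have "(l2 a b (dq h u))\<^sup>2 = integral {a..b} (\<lambda>x. (cmod (dq h u x))\<^sup>2)"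
    unfolding l2_sq by (rule set_borel_integral_eq_integral(2)[OF borel_integrable_atLeastAtMost'[OF cd]])
  also have "\<dots> \<le> integral {a..b} (\<lambda>x. (G (x + h) - G x) / h)"
  proof (rule integral_le)
    show "(\<lambda>x. (G (x + h) - G x) / h) integrable_on {a..b}"
      by (intro integrable_on_divide Henstock_Kurzweil_Integration.integrable_diff iGs iG) (use h in auto)
    show "(\<lambda>x. (cmod (dq h u x))\<^sup>2) integrable_on {a..b}" by (rule integrable_continuous_real[OF cd])
    fix x assume x: "x \<in> {a..b}"
    have "(l2 x (x + h) g)\<^sup>2 = G (x + h) - G x"
      using Gdiff[of x "x + h"] x h kint(2)[of x "x + h"] by (simp add: l2_sq k_def)
    then show "(cmod (dq h u x))\<^sup>2 \<le> (G (x + h) - G x) / h" using dq_pointwise[OF w h, of x] by simp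
  qed
  also have "\<dots> = (integral {a..b} (\<lambda>x. G (x + h)) - integral {a..b} G) / h"
    using iGs iG[of a b] h by (simp add: Henstock_Kurzweil_Integration.integral_diff)
  also have "integral {a..b} (\<lambda>x. G (x + h)) - integral {a..b} G = integral {b..b+h} G - integral {a..a+h} G"
    unfolding shift
    using Henstock_Kurzweil_Integration.integral_combine[of a "a + h" "b + h" G]
      Henstock_Kurzweil_Integration.integral_combine[of a b "b + h" G] iG[of a "b + h"] h ab by simp
  also have "\<dots> / h \<le> (G (b + h) * h - 0) / h"
  proof (intro divide_right_mono diff_mono)
    have "integral {b..b+h} G \<le> integral {b..b+h} (\<lambda>_. G (b + h))"
      using h ab by (intro integral_le iG Gmono) auto
    then show "integral {b..b+h} G \<le> G (b + h) * h" using h by (simp add: mult.commute)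
    show "0 \<le> integral {a..a+h} G" using h ab G0 by (intro integral_nonneg iG) auto
  qed (use h in auto)
  also have "\<dots> = (l2 a (b + h) g)\<^sup>2"
    using kint(2)[of a "b + h"] h by (simp add: l2_sq G_def k_def)
  finally show ?thesis by (rule power2_le_imp_le) (rule l2_nonneg)
qed

lemma wpair_C1:
  assumes "\<And>x. (u has_vector_derivative u' x) (at x)" "continuous_on UNIV u'"
  shows "wpair u u'"
proof -
  have "u b - u a = (LBINT x:{a..b}. u' x)" if "a \<le> b" for a b
  proof -
    have "(u' has_integral u b - u a) {a..b}"
      using assms that by (intro fundamental_theorem_of_calculus) (auto intro: has_vector_derivative_at_within)
    then have "u b - u a = integral {a..b} u'" by (simp add: integral_unique)
    also have "\<dots> = (LBINT x:{a..b}. u' x)"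
      by (rule set_borel_integral_eq_integral(2)[symmetric])
        (intro borel_integrable_atLeastAtMost' continuous_on_subset[OF assms(2)], simp)
    finally show ?thesis .
  qed
  moreover have "continuous_on UNIV u"
    using assms by (auto intro!: continuous_at_imp_continuous_on has_vector_derivative_continuous)
  ultimately show ?thesis by (simp add: wpair_def L2_loc_continuous assms)
qed

lemma wpair_add: "wpair u g \<Longrightarrow> wpair v k \<Longrightarrow> wpair (\<lambda>x. u x + v x) (\<lambda>x. g x + k x)"
  unfolding wpair_def using L2_loc_integrable
  by (auto intro!: continuous_intros L2_loc_add simp: set_integral_add algebra_simps)

lemma wpair_cmult: "wpair u g \<Longrightarrow> wpair (\<lambda>x. c * u x) (\<lambda>x. c * g x)"
  unfolding wpair_def by (auto intro!: continuous_intros L2_loc_cmult simp: right_diff_distrib[symmetric])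

lemma wpair_diff: "wpair u g \<Longrightarrow> wpair v k \<Longrightarrow> wpair (\<lambda>x. u x - v x) (\<lambda>x. g x - k x)"
  using wpair_add[of u g "\<lambda>x. (-1) * v x" "\<lambda>x. (-1) * k x"] wpair_cmult[of v k "-1"] by simp

lemma dq_diff: "dq h (\<lambda>x. u x - v x) x = dq h u x - dq h v x"
  by (simp add: dq_def diff_divide_distrib)

text \<open>A continuous function \<open>k\<close> close to \<open>g\<close> has a primitive whose
  difference quotients converge uniformly. The error between \<open>g\<close> and \<open>k\<close>
  passes to the difference quotients by \<open>dq_bound\<close>, uniformly in
  \<open>h\<close>.\<close>

lemma dq_tendsto:
  assumes w: "wpair u g" and ab: "a \<le> b"
  shows "((\<lambda>h. l2 a b (\<lambda>x. dq h u x - g x)) \<longlongrightarrow> 0) (at_right 0)"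
proof (rule tendstoI)
  fix e :: real assume e: "e > 0"
  note g = wpairD(2)[OF w]
  obtain k where k: "continuous_on UNIV k" "l2 a (b + 1) (\<lambda>x. g x - k x) < e / 3"
    using L2_dense_continuous[OF g, of "e / 3" a "b + 1"] e by auto
  obtain K where K: "\<And>x. (K has_vector_derivative k x) (at x)"
    by (rule continuous_antiderivative[OF k(1)]) blast
  have wK: "wpair K k" by (rule wpair_C1[OF K k(1)])
  have kL: "k \<in> L2_loc" by (rule L2_loc_continuous[OF k(1)])
  \<comment> \<open>The summand 1 keeps \<open>s\<close> positive when \<open>a = b\<close>.\<close>
  define s where "s = sqrt (b - a) + 1"
  have s: "s > 0" using ab by (simp add: s_def add_nonneg_pos)
  have "uniformly_continuous_on {a..b+1} k"
    by (intro compact_uniformly_continuous continuous_on_subset[OF k(1)]) auto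
  then obtain d where d: "d > 0" "\<And>x y. x \<in> {a..b+1} \<Longrightarrow> y \<in> {a..b+1} \<Longrightarrow> dist y x < d \<Longrightarrow> dist (k y) (k x) < e / (3 * s)"
    unfolding uniformly_continuous_on_def using e s by (metis divide_pos_pos mult_pos_pos zero_less_numeral)
  have small: "l2 a b (\<lambda>x. dq h u x - g x) < e" if h: "0 < h" "h < min 1 d" for h
  proof -
    have "l2 a b (\<lambda>x. ((dq h u x - dq h K x) + (dq h K x - k x)) + (k x - g x))
      \<le> (l2 a b (\<lambda>x. dq h u x - dq h K x) + l2 a b (\<lambda>x. dq h K x - k x)) + l2 a b (\<lambda>x. k x - g x)"
      by (rule order_trans[OF l2_triangle add_right_mono[OF l2_triangle]])
        (intro L2_loc_add L2_loc_diff L2_dq wpairD(1)[OF w] wpairD(1)[OF wK] kL g)+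
    moreover have "l2 a b (\<lambda>x. dq h u x - dq h K x) < e / 3"
    proof -
      have "l2 a b (dq h (\<lambda>x. u x - K x)) \<le> l2 a (b + h) (\<lambda>x. g x - k x)"
        by (rule dq_bound[OF wpair_diff[OF w wK] h(1) ab])
      also have "\<dots> \<le> l2 a (b + 1) (\<lambda>x. g x - k x)" using h by (intro l2_subset L2_loc_diff g kL) auto
      finally show ?thesis using k(2) by (simp add: dq_diff[abs_def])
    qed
    moreover have "l2 a b (\<lambda>x. k x - g x) < e / 3"
    proof -
      have "l2 a b (\<lambda>x. k x - g x) = l2 a b (\<lambda>x. g x - k x)" by (simp add: l2_def norm_minus_commute)
      also have "\<dots> \<le> l2 a (b + 1) (\<lambda>x. g x - k x)" by (intro l2_subset L2_loc_diff g kL) auto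
      finally show ?thesis using k(2) by simp
    qed
    moreover have "l2 a b (\<lambda>x. dq h K x - k x) \<le> e / 3"
    proof -
      have "cmod (dq h K x - k x) \<le> e / (3 * s)" if x: "x \<in> {a..b}" for x
      proof -
        have "norm (K (x + h) - K x - (x + h - x) *\<^sub>R k x) \<le> norm (x + h - x) * (e / (3 * s))"
        proof (rule vector_differentiable_bound_linearization[of "{x..x+h}" K k])
          show "(K has_vector_derivative k t) (at t within {x..x+h})" if "t \<in> {x..x+h}" for t
            using K[of t] by (rule has_vector_derivative_at_within)
          show "norm (k t - k x) \<le> e / (3 * s)" if "t \<in> {x..x+h}" for t
            using d(2)[of x t] x that h by (auto simp: dist_norm less_imp_le)
          show "closed_segment x (x + h) \<subseteq> {x..x+h}" using h by (simp add: closed_segment_eq_real_ivl)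
          show "x \<in> {x..x+h}" using h by simp
        qed
        then have "cmod (K (x + h) - K x - h *\<^sub>R k x) / h \<le> e / (3 * s)"
          using h by (simp add: pos_divide_le_eq mult.commute)
        moreover have "dq h K x - k x = (K (x + h) - K x - h *\<^sub>R k x) / complex_of_real h"
          using h by (simp add: dq_def diff_divide_distrib scaleR_conv_of_real)
        ultimately show ?thesis using h by (simp add: norm_divide)
      qed
      then have "l2 a b (\<lambda>x. dq h K x - k x) \<le> e / (3 * s) * sqrt (b - a)"
        by (rule l2_le_sup[rotated 2]) (use e s ab in \<open>auto intro!: L2_loc_diff L2_dq wpairD(1)[OF wK] kL\<close>)
      also have "\<dots> \<le> e / (3 * s) * s" using e s by (intro mult_left_mono) (auto simp: s_def)
      also have "\<dots> = e / 3" using s by simp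
      finally show ?thesis .
    qed
    ultimately show ?thesis by simp
  qed
  show "\<forall>\<^sub>F h in at_right 0. dist (l2 a b (\<lambda>x. dq h u x - g x)) 0 < e"
    unfolding eventually_at_right[OF zero_less_one]
    by (rule exI[of _ "min 1 d"]) (use small d(1) l2_nonneg in \<open>auto simp: abs_of_nonneg\<close>)
qed

text \<open>Both functions are mean-square limits of the same difference quotients of
  \<open>u\<close>.\<close>

lemma wpair_unique:
  assumes w: "wpair u g" "wpair u k"
  shows "AE x in lborel. g x = k x"
proof -
  note L = wpairD(2)[OF w(1)] wpairD(2)[OF w(2)]
  have "l2 a b (\<lambda>x. g x - k x) = 0" if ab: "a \<le> b" for a b
  proof -
    have "((\<lambda>h. l2 a b (\<lambda>x. dq h u x - k x) + l2 a b (\<lambda>x. dq h u x - g x)) \<longlongrightarrow> 0 + 0) (at_right 0)"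
      by (intro tendsto_add dq_tendsto w ab)
    moreover have "l2 a b (\<lambda>x. g x - k x) \<le> l2 a b (\<lambda>x. dq h u x - k x) + l2 a b (\<lambda>x. dq h u x - g x)" for h
      using l2_triangle_diff[of "\<lambda>x. dq h u x - k x" "\<lambda>x. dq h u x - g x" a b] L L2_dq[OF wpairD(1)[OF w(1)], of h]
      by (simp add: L2_loc_diff)
    ultimately have "l2 a b (\<lambda>x. g x - k x) \<le> 0 + 0"
      by (intro tendsto_lowerbound[where F = "at_right 0"]) auto
    then show ?thesis using l2_nonneg[of a b "\<lambda>x. g x - k x"] by simp
  qed
  then have "AE x in lborel. x \<in> {- real n..real n} \<longrightarrow> g x - k x = 0" for n
    by (intro l2_eq_0_AE L2_loc_diff L) simp
  then have "AE x in lborel. \<forall>n. x \<in> {- real n..real n} \<longrightarrow> g x - k x = 0" unfolding AE_all_countable by blast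
  then show ?thesis
  proof eventually_elim
    case (elim x)
    obtain n where "\<bar>x\<bar> \<le> real n" using real_arch_simple by blast
    then show ?case using elim by (force simp: abs_le_iff)
  qed
qed

lemma wpair_cnj: "wpair u g \<Longrightarrow> wpair (\<lambda>x. cnj (u x)) (\<lambda>x. cnj (g x))"
proof -
  assume w: "wpair u g"
  have "cnj (u b) - cnj (u a) = (LBINT x:{a..b}. cnj (g x))" if "a \<le> b" for a b
  proof -
    have "cnj (u b - u a) = cnj (LBINT x:{a..b}. g x)" using wpairD(3)[OF w that] by simp
    also have "\<dots> = (LBINT x:{a..b}. cnj (g x))"
      unfolding set_lebesgue_integral_def
      using Bochner_Integration.integral_cnj[of lborel "\<lambda>x. indicator {a..b} x *\<^sub>R g x"] by simp
    finally show ?thesis by simp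
  qed
  then show ?thesis
    using w by (auto simp: wpair_def intro!: L2_loc_cnj continuous_intros)
qed

lemma set_integral_shift:
  fixes f :: "real \<Rightarrow> 'a::{banach, second_countable_topology}"
  shows "(LBINT x:{a..b}. f (x + h)) = (LBINT x:{a+h..b+h}. f x)"
proof -
  have "(LINT x|lborel. indicator {a+h..b+h} x *\<^sub>R f x) = (LINT x|lborel. indicator {a+h..b+h} (h + 1 * x) *\<^sub>R f (h + 1 * x))"
    using lborel_integral_real_affine[of 1 "\<lambda>x. indicator {a+h..b+h} x *\<^sub>R f x" h] by simp
  also have "\<dots> = (LINT x|lborel. indicator {a..b} x *\<^sub>R f (x + h))"
    by (rule Bochner_Integration.integral_cong) (auto simp: indicator_def add.commute)
  finally show ?thesis by (simp add: set_lebesgue_integral_def)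
qed

lemma wpair_shift: "wpair u g \<Longrightarrow> wpair (\<lambda>x. u (x + h)) (\<lambda>x. g (x + h))"
  unfolding wpair_def
  by (auto simp: set_integral_shift intro!: L2_loc_shift continuous_intros
      continuous_on_compose2[where f = "\<lambda>x. x + h" and g = u and t = UNIV])

lemma dq_norm_bounded:
  assumes w: "wpair u g" and ab: "a \<le> b" and h: "0 < h" "h \<le> 1"
  shows "l2 a b (dq h u) \<le> l2 a (b + 1) g"
  using order_trans[OF dq_bound[OF w h(1) ab] l2_subset[OF wpairD(2)[OF w]]] h by simp

lemma l2_one: "a \<le> b \<Longrightarrow> l2 a b (\<lambda>_. 1) = sqrt (b - a)"
  by (simp add: l2_def set_lebesgue_integral_def)

lemma L1_le_l2:
  assumes f: "f \<in> L2_loc" and ab: "a \<le> b"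
  shows "(LBINT x:{a..b}. cmod (f x)) \<le> l2 a b f * sqrt (b - a)"
  using Cauchy_Schwarz_norms[OF f L2_loc_continuous[of "\<lambda>_. 1"], of a b] by (simp add: l2_one[OF ab])

lemma set_integral_mult_tendsto:
  assumes f: "f \<in> L2_loc" "\<And>n. F n \<in> L2_loc" "((\<lambda>n. l2 a b (\<lambda>x. F n x - f x)) \<longlongrightarrow> 0) net"
    and g: "g \<in> L2_loc" "\<And>n. G n \<in> L2_loc" "((\<lambda>n. l2 a b (\<lambda>x. G n x - g x)) \<longlongrightarrow> 0) net"
  shows "((\<lambda>n. LBINT x:{a..b}. F n x * G n x) \<longlongrightarrow> (LBINT x:{a..b}. f x * g x)) net"
proof (rule Lim_null[THEN iffD2], rule Lim_null_comparison[OF always_eventually], rule allI)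
  fix n
  note D = L2_loc_diff[OF f(2,1)] L2_loc_diff[OF g(2,1)]
  have "(LBINT x:{a..b}. F n x * G n x) - (LBINT x:{a..b}. f x * g x)
    = (LBINT x:{a..b}. (F n x - f x) * G n x) + (LBINT x:{a..b}. f x * (G n x - g x))"
    by (simp add: left_diff_distrib right_diff_distrib set_integral_diff L2_loc_mult_integrable f g)
  also have "cmod \<dots> \<le> l2 a b (\<lambda>x. F n x - f x) * l2 a b (G n) + l2 a b f * l2 a b (\<lambda>x. G n x - g x)"
    by (intro norm_triangle_mono Cauchy_Schwarz_L2 D f g)
  also have "l2 a b (G n) \<le> l2 a b (\<lambda>x. G n x - g x) + l2 a b g"
    using l2_triangle[OF D(2)[of n] g(1), of a b] by simp
  finally show "norm ((LBINT x:{a..b}. F n x * G n x) - (LBINT x:{a..b}. f x * g x))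
    \<le> l2 a b (\<lambda>x. F n x - f x) * (l2 a b (\<lambda>x. G n x - g x) + l2 a b g) + l2 a b f * l2 a b (\<lambda>x. G n x - g x)"
    by (simp add: mult_left_mono l2_nonneg)
next
  show "((\<lambda>n. l2 a b (\<lambda>x. F n x - f x) * (l2 a b (\<lambda>x. G n x - g x) + l2 a b g) + l2 a b f * l2 a b (\<lambda>x. G n x - g x)) \<longlongrightarrow> 0) net"
    using tendsto_add[OF tendsto_mult[OF f(3) tendsto_add[OF g(3) tendsto_const[of "l2 a b g"]]] tendsto_mult_right_zero[OF g(3), of "l2 a b f"]] by simp
qed

text \<open>The approximations are primitives of continuous functions close to \<open>g\<close>,
  normalised at \<open>a\<close>. They serve to carry the classical product rule over to
  \<open>wpair\<close>.\<close>

lemma wpair_C1_approximation: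
  assumes w: "wpair u g" and ab: "a \<le> b"
  shows "\<exists>U h. (\<forall>n x. (U n has_vector_derivative h n x) (at x)) \<and> (\<forall>n. continuous_on UNIV (h n)) \<and> (\<forall>n. U n a = u a)
    \<and> (\<lambda>n. U n b) \<longlonglongrightarrow> u b \<and> (\<lambda>n. l2 a b (\<lambda>x. U n x - u x)) \<longlonglongrightarrow> 0 \<and> (\<lambda>n. l2 a b (\<lambda>x. h n x - g x)) \<longlonglongrightarrow> 0"
proof -
  note g = wpairD(2)[OF w]
  have "\<exists>h. continuous_on UNIV h \<and> l2 a b (\<lambda>x. g x - h x) < inverse (real (Suc n))" for n
    using L2_dense_continuous[OF g] by simp
  then obtain h where h: "\<And>n. continuous_on UNIV (h n)" "\<And>n. l2 a b (\<lambda>x. g x - h n x) < inverse (real (Suc n))" by metis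
  have "\<exists>F. \<forall>x. (F has_vector_derivative h n x) (at x)" for n using continuous_antiderivative[OF h(1)[of n]] by metis
  then obtain F where F: "\<And>n x. (F n has_vector_derivative h n x) (at x)" by metis
  define U where "U n x = F n x + (u a - F n a)" for n x
  have dU: "(U n has_vector_derivative h n x) (at x)" for n x
    unfolding U_def[abs_def] using has_vector_derivative_add[OF F has_vector_derivative_const] by simp
  note wU = wpair_diff[OF wpair_C1[OF dU h(1)] w]
  have l: "(\<lambda>n. l2 a b (\<lambda>x. h n x - g x)) \<longlonglongrightarrow> 0"
    by (rule Lim_null_comparison[OF always_eventually LIMSEQ_inverse_real_of_nat])
      (use h(2) l2_nonneg in \<open>auto simp: l2_def norm_minus_commute intro!: less_imp_le\<close>)
  have le: "cmod (U n x - u x) \<le> l2 a b (\<lambda>x. h n x - g x) * sqrt (b - a)" if x: "x \<in> {a..b}" for n x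
  proof -
    have "cmod (U n x - u x) = cmod (LBINT t:{a..x}. h n t - g t)"
      using wpairD(3)[OF wU, of a x n] x by (simp add: U_def)
    also have "\<dots> \<le> (LBINT t:{a..x}. cmod (h n t - g t))" by (rule set_integral_norm_le[OF L2_loc_integrable[OF wpairD(2)[OF wU]]])
    also have "\<dots> \<le> l2 a x (\<lambda>x. h n x - g x) * sqrt (x - a)" using x by (intro L1_le_l2 wpairD(2)[OF wU]) auto
    also have "\<dots> \<le> l2 a b (\<lambda>x. h n x - g x) * sqrt (b - a)"
      using x by (intro mult_mono l2_subset wpairD(2)[OF wU]) (auto simp: l2_nonneg)
    finally show ?thesis .
  qed
  have l': "(\<lambda>n. l2 a b (\<lambda>x. h n x - g x) * sqrt (b - a)) \<longlonglongrightarrow> 0" by (rule tendsto_mult_left_zero[OF l])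
  have "(\<lambda>n. U n b) \<longlonglongrightarrow> u b"
    by (rule Lim_null[THEN iffD2], rule Lim_null_comparison[OF always_eventually l']) (use le[of b] ab in auto)
  moreover have "(\<lambda>n. l2 a b (\<lambda>x. U n x - u x)) \<longlonglongrightarrow> 0"
  proof (rule Lim_null_comparison[OF always_eventually tendsto_mult_left_zero[OF l', of "sqrt (b - a)"]], rule allI)
    show "norm (l2 a b (\<lambda>x. U n x - u x)) \<le> l2 a b (\<lambda>x. h n x - g x) * sqrt (b - a) * sqrt (b - a)" for n
      using l2_le_sup[OF L2_loc_continuous[OF wpairD(1)[OF wU[of n]]] ab le] ab by (simp add: l2_nonneg)
  qed
  moreover have "U n a = u a" for n by (simp add: U_def)
  ultimately show ?thesis using dU h(1) l by blast
qed

lemma wpair_mult: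
  assumes u: "wpair u g" and v: "wpair v k"
  shows "wpair (\<lambda>x. u x * v x) (\<lambda>x. g x * v x + u x * k x)"
proof -
  note L = L2_loc_continuous[OF wpairD(1)[OF u]] wpairD(2)[OF u] L2_loc_continuous[OF wpairD(1)[OF v]] wpairD(2)[OF v]
  have "u b * v b - u a * v a = (LBINT x:{a..b}. g x * v x + u x * k x)" if ab: "a \<le> b" for a b
  proof -
    obtain U h where U0: "\<forall>n x. (U n has_vector_derivative h n x) (at x)" "\<forall>n. continuous_on UNIV (h n)" "\<forall>n. U n a = u a"
      "(\<lambda>n. U n b) \<longlonglongrightarrow> u b" "(\<lambda>n. l2 a b (\<lambda>x. U n x - u x)) \<longlonglongrightarrow> 0" "(\<lambda>n. l2 a b (\<lambda>x. h n x - g x)) \<longlonglongrightarrow> 0"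
      using wpair_C1_approximation[OF u ab] by blast
    note U = U0[rule_format]
    obtain V j where V0: "\<forall>n x. (V n has_vector_derivative j n x) (at x)" "\<forall>n. continuous_on UNIV (j n)" "\<forall>n. V n a = v a"
      "(\<lambda>n. V n b) \<longlonglongrightarrow> v b" "(\<lambda>n. l2 a b (\<lambda>x. V n x - v x)) \<longlonglongrightarrow> 0" "(\<lambda>n. l2 a b (\<lambda>x. j n x - k x)) \<longlonglongrightarrow> 0"
      using wpair_C1_approximation[OF v ab] by blast
    note V = V0[rule_format]
    note c = wpairD(1)[OF wpair_C1[OF U(1,2)]] wpairD(1)[OF wpair_C1[OF V(1,2)]]
    note LU = L2_loc_continuous[OF c(1)] L2_loc_continuous[OF U(2)] L2_loc_continuous[OF c(2)] L2_loc_continuous[OF V(2)]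
    have "(\<lambda>n. (LBINT x:{a..b}. h n x * V n x) + (LBINT x:{a..b}. U n x * j n x)) \<longlonglongrightarrow>
      (LBINT x:{a..b}. g x * v x) + (LBINT x:{a..b}. u x * k x)"
      by (intro tendsto_add set_integral_mult_tendsto L LU U V)
    moreover have "(LBINT x:{a..b}. h n x * V n x) + (LBINT x:{a..b}. U n x * j n x) = U n b * V n b - u a * v a" for n
    proof -
      have "wpair (\<lambda>x. U n x * V n x) (\<lambda>x. U n x * j n x + h n x * V n x)"
        by (rule wpair_C1[OF has_vector_derivative_mult[OF U(1) V(1)]]) (intro continuous_intros c U V)
      from wpairD(3)[OF this ab] show ?thesis
        by (simp add: U V set_integral_add L2_loc_mult_integrable LU)
    qed
    ultimately have "(\<lambda>n. U n b * V n b - u a * v a) \<longlonglongrightarrow> (LBINT x:{a..b}. g x * v x) + (LBINT x:{a..b}. u x * k x)" by simp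
    moreover have "(\<lambda>n. U n b * V n b - u a * v a) \<longlonglongrightarrow> u b * v b - u a * v a" by (intro tendsto_intros U V)
    ultimately show ?thesis using LIMSEQ_unique by (simp add: set_integral_add L2_loc_mult_integrable L) blast
  qed
  moreover have "(\<lambda>x. g x * v x) \<in> L2_loc" using L2_loc_mult_continuous[OF wpairD(1)[OF v] L(2)] by (simp add: mult.commute)
  ultimately show ?thesis unfolding wpair_def
    by (auto intro!: continuous_intros wpairD(1)[OF u] wpairD(1)[OF v] L2_loc_add L2_loc_mult_continuous L)
qed

section \<open>Weak derivatives and derivatives in the sense of integration\<close>

lemma integral_supported:
  fixes f :: "real \<Rightarrow> 'a::{banach, second_countable_topology}"
  assumes "\<And>x. x \<notin> {a..b} \<Longrightarrow> f x = 0" shows "(LBINT x. f x) = (LBINT x:{a..b}. f x)"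
  unfolding set_lebesgue_integral_def
  by (rule Bochner_Integration.integral_cong) (use assms in \<open>auto simp: indicator_def\<close>)

lemma derivative_outside_support:
  fixes \<phi> :: "real \<Rightarrow> real"
  assumes d: "(\<phi> has_real_derivative d) (at x)" and 0: "\<And>x. x \<notin> {a..b} \<Longrightarrow> \<phi> x = 0" and x: "x \<notin> {a..b}"
  shows "d = 0"
proof -
  have "\<forall>\<^sub>F y in nhds x. \<phi> y = 0"
    unfolding eventually_nhds using x 0 by (intro exI[of _ "- {a..b}"]) (auto intro: open_Compl)
  then have "(\<phi> has_real_derivative 0) (at x)" by (subst DERIV_cong_ev[OF refl _ refl, of _ "\<lambda>_. 0"]) auto
  then show ?thesis using d DERIV_unique by blast
qed

lemma wpair_imp_weak_derivative:
  assumes w: "wpair u g"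
  shows "has_weak_derivative u g"
  unfolding has_weak_derivative_def
proof (intro allI impI, elim conjE exE)
  fix \<phi> \<phi>' :: "real \<Rightarrow> real" and a' b'
  assume d: "\<forall>x. (\<phi> has_real_derivative \<phi>' x) (at x)" and c: "continuous_on UNIV \<phi>'" and supp: "\<forall>x. x \<notin> {a'..b'} \<longrightarrow> \<phi> x = 0"
  \<comment> \<open>The given end points need not be in order, and \<open>\<phi>\<close> has to
    vanish at both ends of the interval that is used.\<close>
  define a b where "a = min a' b' - 1" and "b = max a' b' + 1"
  have 0: "\<phi> x = 0" "\<phi>' x = 0" if "x \<notin> {a<..<b}" for x
  proof -
    have x: "x \<notin> {a'..b'}" using that by (auto simp: a_def b_def)
    then show "\<phi> x = 0" using supp by blast
    show "\<phi>' x = 0" by (rule derivative_outside_support[of \<phi> _ x a' b']) (use d supp x in auto)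
  qed
  have "wpair (\<lambda>x. of_real (\<phi> x)) (\<lambda>x. complex_of_real (\<phi>' x))"
    using d by (intro wpair_C1 continuous_intros c) (auto intro: has_vector_derivative_of_real simp: has_real_derivative_iff_has_vector_derivative)
  note p = wpair_mult[OF this w]
  have c\<phi>: "continuous_on UNIV (\<lambda>x. complex_of_real (\<phi> x))" "continuous_on UNIV (\<lambda>x. complex_of_real (\<phi>' x))"
    using d c by (auto intro!: continuous_intros continuous_at_imp_continuous_on DERIV_isCont)
  note i = L2_loc_integrable[OF L2_loc_mult_continuous[OF c\<phi>(2) L2_loc_continuous[OF wpairD(1)[OF w]]]]
    L2_loc_integrable[OF L2_loc_mult_continuous[OF c\<phi>(1) wpairD(2)[OF w]]]
  have "a \<le> b" by (auto simp: a_def b_def)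
  from wpairD(3)[OF p this] have "(LBINT x:{a..b}. of_real (\<phi>' x) * u x) + (LBINT x:{a..b}. of_real (\<phi> x) * g x) = 0"
    using 0[of a] 0[of b] by (simp add: set_integral_add i)
  moreover have "(LBINT x. \<phi>' x *\<^sub>R u x) = (LBINT x:{a..b}. of_real (\<phi>' x) * u x)" "(LBINT x. \<phi> x *\<^sub>R g x) = (LBINT x:{a..b}. of_real (\<phi> x) * g x)"
    using 0 by (subst integral_supported[of a b]; auto simp: scaleR_conv_of_real)+
  ultimately show "(LBINT x. \<phi>' x *\<^sub>R u x) = - (LBINT x. \<phi> x *\<^sub>R g x)" by (simp add: eq_neg_iff_add_eq_0)
qed

lemma wpair_antiderivative:
  assumes g: "g \<in> L2_loc"
  shows "\<exists>G. wpair G g"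
proof -
  note i = L2_loc_integrable[OF g]
  define G where "G x = (if 0 \<le> x then (LBINT t:{0..x}. g t) else - (LBINT t:{x..0}. g t))" for x
  have comb: "(LBINT t:{a..c}. g t) = (LBINT t:{a..b}. g t) + (LBINT t:{b..c}. g t)" if "a \<le> b" "b \<le> c" for a b c
    using Henstock_Kurzweil_Integration.integral_combine[OF that set_borel_integral_eq_integral(1)[OF i]]
    by (simp add: set_borel_integral_eq_integral(2)[OF i])
  have G: "G b - G a = (LBINT t:{a..b}. g t)" if "a \<le> b" for a b
    unfolding G_def using that comb[of 0 a b] comb[of a b 0] comb[of a 0 b] by auto
  have le: "cmod (G b - G a) \<le> l2 (x - 1) (x + 1) g * sqrt \<bar>b - a\<bar>" if "x - 1 \<le> a" "a \<le> b" "b \<le> x + 1" for a b x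
  proof -
    have "cmod (G b - G a) \<le> l2 a b g * sqrt (b - a)"
      unfolding G[OF that(2)] by (rule order_trans[OF set_integral_norm_le[OF i] L1_le_l2[OF g that(2)]])
    also have "\<dots> \<le> l2 (x - 1) (x + 1) g * sqrt \<bar>b - a\<bar>"
      using that by (intro mult_mono l2_subset g) (auto simp: l2_nonneg)
    finally show ?thesis .
  qed
  have "isCont G x" for x
  proof -
    have "((\<lambda>y. l2 (x - 1) (x + 1) g * sqrt \<bar>y - x\<bar>) \<longlongrightarrow> l2 (x - 1) (x + 1) g * sqrt \<bar>x - x\<bar>) (at x)"
      by (intro tendsto_intros)
    then have z: "((\<lambda>y. l2 (x - 1) (x + 1) g * sqrt \<bar>y - x\<bar>) \<longlongrightarrow> 0) (at x)" by simp
    have "\<forall>\<^sub>F y in at x. norm (G y - G x) \<le> l2 (x - 1) (x + 1) g * sqrt \<bar>y - x\<bar>"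
      unfolding eventually_at
    proof (intro exI[of _ 1] conjI ballI impI)
      fix y assume "y \<noteq> x \<and> dist y x < 1"
      then have y: "\<bar>y - x\<bar> < 1" by (simp add: dist_real_def)
      show "norm (G y - G x) \<le> l2 (x - 1) (x + 1) g * sqrt \<bar>y - x\<bar>"
        using le[of x x y] le[of x y x] y by (cases "x \<le> y") (auto simp: norm_minus_commute abs_minus_commute)
    qed simp
    from Lim_null_comparison[OF this z] show ?thesis by (simp add: isCont_def LIM_zero_iff)
  qed
  then have "continuous_on UNIV G" by (simp add: continuous_at_imp_continuous_on)
  then show ?thesis unfolding wpair_def using g G by blast
qed

text \<open>Du Bois-Reymond: test with an antiderivative of \<open>\<omega> (f - m)\<close>, where \<open>m\<close> is the mean of \<open>f\<close>
  with respect to the weight \<open>\<omega>\<close>.\<close>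

lemma orthogonal_to_derivatives_imp_constant:
  fixes f :: "real \<Rightarrow> real"
  assumes f: "continuous_on UNIV f" and ab: "a < b"
    and orth: "\<And>\<phi> \<phi>'. (\<And>x. (\<phi> has_real_derivative \<phi>' x) (at x)) \<Longrightarrow> continuous_on UNIV \<phi>' \<Longrightarrow> (\<And>x. x \<notin> {a..b} \<Longrightarrow> \<phi> x = 0) \<Longrightarrow>
      integral {a..b} (\<lambda>x. \<phi>' x * f x) = 0"
  shows "\<exists>m. \<forall>x\<in>{a<..<b}. f x = m"
proof -
  define \<omega> where "\<omega> x = max 0 ((x - a) * (b - x))" for x
  have c: "continuous_on UNIV \<omega>" unfolding \<omega>_def by (intro continuous_intros)
  have \<omega>: "\<omega> x \<ge> 0" "x \<in> {a<..<b} \<Longrightarrow> \<omega> x > 0" "x \<notin> {a<..<b} \<Longrightarrow> \<omega> x = 0" for x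
    using ab by (auto simp: \<omega>_def max_def mult_le_0_iff zero_le_mult_iff intro: antisym)
  have int: "h integrable_on {x..y}" if "continuous_on UNIV h" for h :: "real \<Rightarrow> real" and x y
    using that by (intro integrable_continuous_real) (auto intro: continuous_on_subset)
  define m where "m = integral {a..b} (\<lambda>x. \<omega> x * f x) / integral {a..b} \<omega>"
  define \<psi> where "\<psi> x = \<omega> x * (f x - m)" for x
  have c\<psi>: "continuous_on UNIV \<psi>" unfolding \<psi>_def by (intro continuous_intros c f)
  have "integral {a..b} \<omega> \<noteq> 0"
  proof
    assume "integral {a..b} \<omega> = 0"
    then have "\<forall>x\<in>{a..b}. \<omega> x = 0" using ab \<omega>(1) integral_eq_0_iff[of a b \<omega>] continuous_on_subset[OF c] by auto
    then show False using \<omega>(2)[of "(a + b) / 2"] ab by auto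
  qed
  moreover have "integral {a..b} \<psi> = integral {a..b} (\<lambda>x. \<omega> x * f x) - integral {a..b} (\<lambda>x. \<omega> x * m)"
    unfolding \<psi>_def right_diff_distrib by (intro Henstock_Kurzweil_Integration.integral_diff int continuous_intros c f)
  ultimately have \<psi>0: "integral {a..b} \<psi> = 0" by (simp add: m_def)
  obtain F where F: "\<And>x. (F has_vector_derivative \<psi> x) (at x)" using continuous_antiderivative[OF c\<psi>] by blast
  have FTC: "F y - F x = integral {x..y} \<psi>" if "x \<le> y" for x y
    using F that by (intro integral_unique[symmetric] fundamental_theorem_of_calculus) (auto intro: has_vector_derivative_at_within)
  have out: "F y - F x = 0" if "x \<le> y" "y \<le> a \<or> b \<le> x" for x y
    unfolding FTC[OF that(1)] using that(2) by (intro integral_unique has_integral_is_0) (auto simp: \<psi>_def \<omega>)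
  have "integral {a..b} (\<lambda>x. \<psi> x * f x) = 0"
  proof (rule orth[of "\<lambda>x. F x - F a"])
    show "((\<lambda>x. F x - F a) has_real_derivative \<psi> x) (at x)" for x
      using has_vector_derivative_diff[OF F has_vector_derivative_const] by (simp add: has_real_derivative_iff_has_vector_derivative)
    show "F x - F a = 0" if "x \<notin> {a..b}" for x
      using out[of x a] out[of b x] FTC[of a b] \<psi>0 that ab by (cases "x < a") auto
  qed (rule c\<psi>)
  moreover have "integral {a..b} (\<lambda>x. \<omega> x * (f x - m)\<^sup>2) = integral {a..b} (\<lambda>x. \<psi> x * f x) - integral {a..b} (\<lambda>x. \<psi> x * m)"
    by (subst Henstock_Kurzweil_Integration.integral_diff[symmetric])
      (auto intro!: int continuous_intros c c\<psi> f simp: \<psi>_def power2_eq_square algebra_simps)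
  ultimately have "integral {a..b} (\<lambda>x. \<omega> x * (f x - m)\<^sup>2) = 0" using \<psi>0 by simp
  moreover have "continuous_on {a..b} (\<lambda>x. \<omega> x * (f x - m)\<^sup>2)"
    by (intro continuous_intros continuous_on_subset[OF c] continuous_on_subset[OF f]) auto
  ultimately have "\<forall>x\<in>{a..b}. \<omega> x * (f x - m)\<^sup>2 = 0"
    using ab \<omega>(1) by (subst (asm) integral_eq_0_iff) auto
  then have "\<omega> x * (f x - m)\<^sup>2 = 0" if "x \<in> {a<..<b}" for x using that by auto
  then have "f x = m" if "x \<in> {a<..<b}" for x using \<omega>(2)[OF that] that by force
  then show ?thesis by blast
qed

text \<open>\<open>u\<close> minus a primitive of \<open>g\<close> has the weak derivative zero.
  Applied to its real and imaginary parts, \<open>orthogonal_to_derivatives_imp_constant\<close>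
  makes this difference constant.\<close>

lemma weak_derivative_imp_wpair:
  assumes u: "continuous_on UNIV u" and g: "g \<in> L2_loc" and w: "has_weak_derivative u g"
  shows "wpair u g"
proof -
  obtain G where G: "wpair G g" using wpair_antiderivative[OF g] by blast
  define f where "f x = u x - G x" for x
  have cf: "continuous_on UNIV f" unfolding f_def by (intro continuous_intros u wpairD[OF G])
  have zero: "(LBINT x:{a..b}. of_real (\<phi>' x) * f x) = 0"
    if d: "\<And>x. (\<phi> has_real_derivative \<phi>' x) (at x)" and c: "continuous_on UNIV \<phi>'" and supp: "\<And>x. x \<notin> {a..b} \<Longrightarrow> \<phi> x = 0" for \<phi> \<phi>' a b
  proof -
    have 0: "\<phi>' x = 0" if "x \<notin> {a..b}" for x using derivative_outside_support[OF d supp that] by blast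
    have i: "set_integrable lborel {a..b} (\<lambda>x. of_real (\<phi>' x) * v x)" if "continuous_on UNIV v" for v :: "real \<Rightarrow> complex"
      using that c by (intro borel_integrable_atLeastAtMost' continuous_on_subset[OF _ subset_UNIV[of "{a..b}"]]) (auto intro!: continuous_intros)
    have e: "(LBINT x. \<phi>' x *\<^sub>R v x) = (LBINT x:{a..b}. of_real (\<phi>' x) * v x)" for v :: "real \<Rightarrow> complex"
      using 0 by (subst integral_supported[of a b]; auto simp: scaleR_conv_of_real)
    have "(LBINT x. \<phi>' x *\<^sub>R v x) = - (LBINT x. \<phi> x *\<^sub>R g x)" if "has_weak_derivative v g" for v
      using that d c supp unfolding has_weak_derivative_def by blast
    from this[OF w] this[OF wpair_imp_weak_derivative[OF G]]
    have "(LBINT x. \<phi>' x *\<^sub>R u x) = (LBINT x. \<phi>' x *\<^sub>R G x)" by simp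
    then show ?thesis unfolding f_def right_diff_distrib e
      by (simp add: set_integral_diff i u wpairD(1)[OF G])
  qed
  have const: "\<exists>m. \<forall>x\<in>{a<..<b}. T (f x) = m" if T: "bounded_linear T" "\<And>r w. T (of_real r * w) = r * T w" and ab: "a < b" for a b and T :: "complex \<Rightarrow> real"
  proof (rule orthogonal_to_derivatives_imp_constant[OF _ ab])
    show cT: "continuous_on UNIV (\<lambda>x. T (f x))" by (rule bounded_linear.continuous_on[OF T(1) cf])
    fix \<phi> \<phi>' assume d: "\<And>x. (\<phi> has_real_derivative \<phi>' x) (at x)" and c: "continuous_on UNIV \<phi>'" and supp: "\<And>x. x \<notin> {a..b} \<Longrightarrow> \<phi> x = 0"
    have i: "set_integrable lborel {a..b} (\<lambda>x. of_real (\<phi>' x) * f x)"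
      by (intro borel_integrable_atLeastAtMost' continuous_on_subset[OF _ subset_UNIV[of "{a..b}"]] continuous_intros cf c)
    have "integral {a..b} (\<lambda>x. T (of_real (\<phi>' x) * f x)) = T (integral {a..b} (\<lambda>x. of_real (\<phi>' x) * f x))"
      using integral_linear[OF set_borel_integral_eq_integral(1)[OF i] T(1)] by (simp add: o_def)
    then show "integral {a..b} (\<lambda>x. \<phi>' x * T (f x)) = 0"
      unfolding set_borel_integral_eq_integral(2)[OF i, symmetric] zero[where a = a and b = b, OF d c supp, simplified]
      by (simp add: T(2) linear_0[OF bounded_linear.linear[OF T(1)]])
  qed
  have "f a = f b" for a b
  proof -
    have ab: "min a b - 1 < max a b + 1" by auto
    have "T (f a) = T (f b)" if T: "bounded_linear T" "\<And>r w. T (of_real r * w) = r * T w" for T :: "complex \<Rightarrow> real"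
      using const[OF T ab] by (auto simp: min_def max_def split: if_splits)
    from this[OF bounded_linear_Re] this[OF bounded_linear_Im] show ?thesis by (simp add: complex_eq_iff)
  qed
  then have "u b - u a = G b - G a" for a b unfolding f_def by (simp add: algebra_simps)
  then show ?thesis using u g wpairD(3)[OF G] by (simp add: wpair_def)
qed

lemma H1_loc_iff: "u \<in> H1_loc \<longleftrightarrow> (\<exists>g. wpair u g)"
  unfolding H1_loc_def using weak_derivative_imp_wpair wpair_imp_weak_derivative wpairD(1,2) by blast

lemma wpair_weak_deriv:
  assumes "u \<in> H1_loc" shows "wpair u (weak_deriv u)"
proof -
  have "\<exists>g. g \<in> L2_loc \<and> has_weak_derivative u g" and c: "continuous_on UNIV u" using assms by (auto simp: H1_loc_def)
  then have "weak_deriv u \<in> L2_loc \<and> has_weak_derivative u (weak_deriv u)" unfolding weak_deriv_def by (metis (mono_tags, lifting) someI_ex)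
  then show ?thesis using weak_derivative_imp_wpair c by blast
qed

lemma weak_deriv_AE: "wpair u g \<Longrightarrow> AE x in lborel. weak_deriv u x = g x"
  using wpair_unique[OF wpair_weak_deriv] H1_loc_iff by blast

lemma integral_AE_period_shift:
  fixes f :: "real \<Rightarrow> 'a::euclidean_space"
  assumes m: "f \<in> borel_measurable borel" and i: "\<And>a b. set_integrable lborel {a..b} f"
    and per: "AE x in lborel. f (x + T) = f x" and T: "T > 0"
  shows "(LBINT x:{0..T}. f (x + a)) = (LBINT x:{0..T}. f x)"
proof -
  note hk = set_borel_integral_eq_integral[OF i]
  have "integral {c + T..d + T} f = integral {c..d} f" for c d
  proof -
    have "(LBINT x:{c+T..d+T}. f x) = (LBINT x:{c..d}. f (x + T))" by (simp add: set_integral_shift)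
    also have "\<dots> = (LBINT x:{c..d}. f x)"
      using m per by (intro set_lebesgue_integral_cong_AE) auto
    finally show ?thesis by (simp add: hk)
  qed
  from integral_period_shift[OF this T hk(1), of a] show ?thesis
    by (simp add: set_integral_shift hk add.commute)
qed

section \<open>The periodic space with its norm and embedding\<close>

definition ppair :: "(real \<Rightarrow> complex) \<Rightarrow> (real \<Rightarrow> complex) \<Rightarrow> bool" where
  "ppair u g \<longleftrightarrow> wpair u g \<and> (\<forall>z. u (z + 2 * pi) = u z)"

abbreviation "nrm \<equiv> l2 0 (2 * pi)"

lemma ppair_wpair: "ppair u g \<Longrightarrow> wpair u g" and ppair_per: "ppair u g \<Longrightarrow> u (z + 2 * pi) = u z"
  by (simp_all add: ppair_def)

lemmas ppairD = wpairD[OF ppair_wpair]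

lemma ppair_L2: "ppair u g \<Longrightarrow> u \<in> L2_loc" "ppair u g \<Longrightarrow> g \<in> L2_loc"
  by (auto intro: L2_loc_continuous ppairD)

lemma ppair_AE: "ppair u g \<Longrightarrow> AE z in lborel. g (z + 2 * pi) = g z"
  using wpair_unique[OF wpair_shift[OF ppair_wpair, of u g "2 * pi"], of g] by (simp add: ppair_per ppair_wpair)

lemma H1_per_iff: "u \<in> H1_per \<longleftrightarrow> (\<exists>g. ppair u g)"
  by (auto simp: H1_per_def H1_loc_iff ppair_def)

lemma ppair_weak_deriv: "u \<in> H1_per \<Longrightarrow> ppair u (weak_deriv u)"
  using wpair_weak_deriv by (auto simp: H1_per_def ppair_def)

text \<open>\<open>weak_deriv\<close> is an arbitrary choice, but two weak derivatives agree almost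
  everywhere. From here on the norm can be computed from any pair.\<close>

lemma norm_X_eq:
  assumes "ppair u g" shows "norm_X u = sqrt ((nrm u)\<^sup>2 + (nrm g)\<^sup>2)"
proof -
  have u: "u \<in> H1_per" using assms H1_per_iff by blast
  have W: "weak_deriv u \<in> L2_loc" using ppair_L2 ppair_weak_deriv[OF u] by blast
  have "nrm (weak_deriv u) = nrm g"
    by (rule l2_cong_AE) (use L2_locD(1)[OF W] L2_locD(1)[OF ppair_L2(2)[OF assms]] weak_deriv_AE[OF ppair_wpair[OF assms]] in auto)
  moreover have "(LBINT z:{0..2*pi}. (cmod (u z))\<^sup>2 + (cmod (weak_deriv u z))\<^sup>2) = (nrm u)\<^sup>2 + (nrm (weak_deriv u))\<^sup>2"
    unfolding l2_sq by (intro set_integral_add L2_locD ppair_L2[OF assms] W)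
  ultimately show ?thesis by (simp add: norm_X_def)
qed

lemma norm_X_nonneg: "norm_X u \<ge> 0"
  unfolding norm_X_def by (simp add: set_integral_nonneg')

lemma nrm_le_norm_X:
  assumes "ppair u g" shows "nrm u \<le> norm_X u" "nrm g \<le> norm_X u"
  unfolding norm_X_eq[OF assms] by (rule real_le_rsqrt; simp)+

lemma norm_X_le:
  assumes "ppair u g" shows "norm_X u \<le> nrm u + nrm g"
  unfolding norm_X_eq[OF assms] by (rule sqrt_sum_squares_le_sum) (simp_all add: l2_nonneg)

lemma ppair_add: "ppair u g \<Longrightarrow> ppair v k \<Longrightarrow> ppair (\<lambda>x. u x + v x) (\<lambda>x. g x + k x)"
  and ppair_diff: "ppair u g \<Longrightarrow> ppair v k \<Longrightarrow> ppair (\<lambda>x. u x - v x) (\<lambda>x. g x - k x)"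
  and ppair_cmult: "ppair u g \<Longrightarrow> ppair (\<lambda>x. c * u x) (\<lambda>x. c * g x)"
  and ppair_cnj: "ppair u g \<Longrightarrow> ppair (\<lambda>x. cnj (u x)) (\<lambda>x. cnj (g x))"
  and ppair_mult: "ppair u g \<Longrightarrow> ppair v k \<Longrightarrow> ppair (\<lambda>x. u x * v x) (\<lambda>x. g x * v x + u x * k x)"
  by (simp_all add: ppair_def wpair_add wpair_diff wpair_cmult wpair_cnj wpair_mult)

lemma ppair_shift: "ppair u g \<Longrightarrow> ppair (\<lambda>x. u (x + h)) (\<lambda>x. g (x + h))"
  using wpair_shift ppair_per[of u g "_ + h"] by (auto simp: ppair_def add.assoc add.commute[of "2 * pi"])

lemma norm_X_triangle:
  assumes u: "ppair u g" and v: "ppair v k"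
  shows "norm_X (\<lambda>x. u x + v x) \<le> norm_X u + norm_X v"
proof -
  have "norm_X (\<lambda>x. u x + v x) \<le> sqrt ((nrm u + nrm v)\<^sup>2 + (nrm g + nrm k)\<^sup>2)"
    unfolding norm_X_eq[OF ppair_add[OF u v]]
    by (intro real_sqrt_le_mono add_mono power_mono l2_triangle ppair_L2[OF u] ppair_L2[OF v] l2_nonneg)
  also have "\<dots> \<le> norm_X u + norm_X v"
    unfolding norm_X_eq[OF u] norm_X_eq[OF v] by (rule real_sqrt_sum_squares_triangle_ineq)
  finally show ?thesis .
qed

lemma norm_X_cmult:
  assumes u: "ppair u g" shows "norm_X (\<lambda>x. c * u x) = cmod c * norm_X u"
  unfolding norm_X_eq[OF ppair_cmult[OF u]] norm_X_eq[OF u] l2_cmult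
  by (simp add: power_mult_distrib distrib_left[symmetric] real_sqrt_mult)

lemma norm_X_triangle_diff:
  assumes u: "ppair u g" and v: "ppair v k"
  shows "norm_X (\<lambda>x. u x - v x) \<le> norm_X u + norm_X v"
  using norm_X_triangle[OF u ppair_cmult[OF v, of "-1"]] norm_X_cmult[OF v, of "-1"] by simp

lemma norm_X_commute:
  assumes u: "ppair u g" and v: "ppair v k"
  shows "norm_X (\<lambda>x. u x - v x) = norm_X (\<lambda>x. v x - u x)"
  using norm_X_cmult[OF ppair_diff[OF u v], of "-1"] by simp

lemma nrm_shift:
  assumes f: "f \<in> L2_loc" and per: "AE z in lborel. f (z + 2 * pi) = f z"
  shows "nrm (\<lambda>x. f (x + h)) = nrm f"
proof -
  have "(LBINT x:{0..2*pi}. (cmod (f (x + h)))\<^sup>2) = (LBINT x:{0..2*pi}. (cmod (f x))\<^sup>2)"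
    by (rule integral_AE_period_shift[of "\<lambda>x. (cmod (f x))\<^sup>2"])
      (use L2_locD[OF f] per in auto)
  then show ?thesis by (simp add: l2_def)
qed

lemma norm_X_shift:
  assumes u: "ppair u g" shows "norm_X (\<lambda>x. u (x + h)) = norm_X u"
  unfolding norm_X_eq[OF ppair_shift[OF u]] norm_X_eq[OF u]
  using nrm_shift[OF ppair_L2(1)[OF u], of h] nrm_shift[OF ppair_L2(2)[OF u] ppair_AE[OF u], of h] ppair_per[OF u] by simp

lemma periodic_representative:
  fixes f :: "real \<Rightarrow> 'a"
  assumes per: "\<And>z. f (z + 2 * pi) = f z"
  shows "\<exists>y\<in>{0..2*pi}. f x = f y"
proof -
  have pern: "f (x + of_nat m * (2 * pi)) = f x" for x m
  proof (induction m arbitrary: x)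
    case (Suc m)
    have "f (x + of_nat (Suc m) * (2 * pi)) = f ((x + of_nat m * (2 * pi)) + 2 * pi)" by (simp add: algebra_simps)
    then show ?case using Suc per by metis
  qed simp
  have peri: "f (x + of_int m * (2 * pi)) = f x" for x m
  proof (cases "m \<ge> 0")
    case True then show ?thesis using pern[of x "nat m"] by simp
  next
    case False then show ?thesis using pern[of "x + of_int m * (2 * pi)" "nat (- m)"] by simp
  qed
  have "2 * pi > 0" by simp
  from floor_divide_lower[OF this, of x] floor_divide_upper[OF this, of x]
  have "x + of_int (- \<lfloor>x / (2 * pi)\<rfloor>) * (2 * pi) \<in> {0..2*pi}" by (auto simp: algebra_simps)
  then show ?thesis using peri[of x "- \<lfloor>x / (2 * pi)\<rfloor>"] by metis
qed

text \<open>The Sobolev embedding: the minimum of \<open>|u|\<close> is at most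
  \<open>nrm u\<close>, and from there \<open>|u|\<close> grows by at most
  \<open>sqrt (2 * pi) * nrm g\<close>. The constant is a crude one.\<close>

lemma sup_le_norm_X:
  assumes u: "ppair u g"
  shows "cmod (u x) \<le> (1 + 2 * pi) * norm_X u"
proof -
  obtain y where y: "y \<in> {0..2*pi}" "u x = u y" using periodic_representative[of u x] ppair_per[OF u] by blast
  have d: "cmod (u t - u r) \<le> sqrt (2 * pi) * nrm g" if "r \<in> {0..2*pi}" "t \<in> {0..2*pi}" "r \<le> t" for r t
  proof -
    have "cmod (u t - u r) \<le> l2 r t g * l2 r t (\<lambda>_. 1)"
      using Cauchy_Schwarz_L2[OF ppair_L2(2)[OF u] L2_loc_continuous[of "\<lambda>_. 1"], of r t] ppairD(3)[OF u that(3)] by simp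
    also have "\<dots> \<le> nrm g * sqrt (2 * pi)"
    proof (rule mult_mono)
      show "l2 r t g \<le> nrm g" using that by (intro l2_subset ppair_L2[OF u]) auto
      show "l2 r t (\<lambda>_. 1) \<le> sqrt (2 * pi)" using that by (simp add: l2_one)
    qed (simp_all add: l2_nonneg)
    finally show ?thesis by (simp add: mult.commute)
  qed
  have "\<exists>t\<in>{0..2*pi}. \<forall>r\<in>{0..2*pi}. cmod (u t) \<le> cmod (u r)"
    by (intro continuous_attains_inf compact_Icc continuous_on_norm ppairD[OF u]) auto
  then obtain t where t: "t \<in> {0..2*pi}" "\<And>r. r \<in> {0..2*pi} \<Longrightarrow> cmod (u t) \<le> cmod (u r)" by blast
  have "cmod (u y - u t) \<le> sqrt (2 * pi) * nrm g"
    using d[of t y] d[of y t] t(1) y(1) by (cases "t \<le> y") (auto simp: norm_minus_commute)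
  then have 1: "cmod (u y) \<le> cmod (u t) + sqrt (2 * pi) * nrm g" using norm_triangle_ineq2[of "u y" "u t"] by linarith
  have s1: "sqrt (2 * pi) \<ge> 1" using pi_ge_two by simp
  have "cmod (u t) \<le> cmod (u t) * sqrt (2 * pi)" using mult_left_mono[OF s1, of "cmod (u t)"] by simp
  also have "\<dots> = nrm (\<lambda>_. u t)" using l2_cmult[of 0 "2 * pi" "u t" "\<lambda>_. 1"] by (simp add: l2_one)
  also have "\<dots> \<le> nrm u" by (intro l2_mono ppair_L2[OF u] L2_loc_continuous continuous_on_const t(2))
  finally have 2: "cmod (u t) \<le> norm_X u" using nrm_le_norm_X(1)[OF u] by linarith
  have "sqrt (2 * pi) * 1 \<le> sqrt (2 * pi) * sqrt (2 * pi)" by (rule mult_left_mono[OF s1]) simp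
  then have "sqrt (2 * pi) \<le> 2 * pi" by simp
  from mult_mono[OF this nrm_le_norm_X(2)[OF u]] have "sqrt (2 * pi) * nrm g \<le> 2 * pi * norm_X u" by (simp add: l2_nonneg)
  then show ?thesis using 1 2 y(2) by (simp add: algebra_simps)
qed

lemma inner_per_by_parts:
  assumes u: "ppair u g" and v: "ppair v k"
  shows "inner_per g v = - inner_per u k"
proof -
  note w = ppair_mult[OF u ppair_cnj[OF v]]
  have "0 = (LBINT x:{0..2*pi}. g x * cnj (v x) + u x * cnj (k x))"
    using ppairD(3)[OF w, of 0 "2 * pi"] ppair_per[OF w, of 0] by simp
  also have "\<dots> = inner_per g v + inner_per u k"
    unfolding inner_per_def
    by (intro set_integral_add L2_loc_mult_integrable L2_loc_cnj ppair_L2[OF u] ppair_L2[OF v])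
  finally show ?thesis by (simp add: eq_neg_iff_add_eq_0)
qed

text \<open>The averages of \<open>u\<close> over intervals of length \<open>h\<close> are the
  difference quotients of a primitive \<open>P\<close>, and their derivatives are those of
  \<open>u\<close> itself. So \<open>dq_tendsto\<close>, applied to \<open>P\<close> and to
  \<open>u\<close>, gives convergence in the norm. \<open>P\<close> need not be periodic, but its
  increment over a period is constant.\<close>

lemma C1_dense:
  assumes u: "ppair u g" and e: "e > 0"
  shows "\<exists>w w'. (\<forall>x. (w has_vector_derivative w' x) (at x)) \<and> continuous_on UNIV w' \<and> (\<forall>x. w (x + 2 * pi) = w x)
    \<and> ppair w w' \<and> norm_X (\<lambda>x. u x - w x) < e"
proof -
  obtain P where P: "\<And>x. (P has_vector_derivative u x) (at x)"
    by (rule continuous_antiderivative[OF ppairD(1)[OF u]]) blast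
  have wP: "wpair P u" by (rule wpair_C1[OF P ppairD(1)[OF u]])
  have "((\<lambda>h. nrm (\<lambda>x. dq h P x - u x) + nrm (\<lambda>x. dq h u x - g x)) \<longlongrightarrow> 0 + 0) (at_right 0)"
    by (intro tendsto_add dq_tendsto wP ppair_wpair[OF u]) auto
  then have "\<forall>\<^sub>F h in at_right 0. nrm (\<lambda>x. dq h P x - u x) + nrm (\<lambda>x. dq h u x - g x) < e"
    using e by (intro order_tendstoD(2)) auto
  then obtain b where b: "b > 0" "\<And>h. 0 < h \<Longrightarrow> h < b \<Longrightarrow> nrm (\<lambda>x. dq h P x - u x) + nrm (\<lambda>x. dq h u x - g x) < e"
    by (auto simp: eventually_at_right[OF zero_less_one])
  define h where "h = b / 2"
  have h: "0 < h" "nrm (\<lambda>x. dq h P x - u x) + nrm (\<lambda>x. dq h u x - g x) < e" using b by (auto simp: h_def)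
  have d: "(dq h P has_vector_derivative dq h u x) (at x)" for x
    unfolding dq_def[abs_def] divide_inverse
    by (intro has_vector_derivative_mult_left has_vector_derivative_diff has_vector_derivative_shift P)
  have c: "continuous_on UNIV (dq h u)" by (rule continuous_dq[OF ppairD(1)[OF u]])
  have per: "dq h P (x + 2 * pi) = dq h P x" for x
  proof -
    have d0: "((\<lambda>x. P (x + 2 * pi) - P x) has_vector_derivative 0) (at x)" for x
      using has_vector_derivative_diff[OF has_vector_derivative_shift[OF P[of "x + 2 * pi"]] P[of x]] ppair_per[OF u] by simp
    have "\<exists>c. \<forall>x\<in>UNIV. P (x + 2 * pi) - P x = c"
      by (rule has_vector_derivative_zero_constant[of UNIV "\<lambda>x. P (x + 2 * pi) - P x"]) (use d0 in auto)
    then have "P (x + h + 2 * pi) - P (x + h) = P (x + 2 * pi) - P x" by (metis UNIV_I)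
    then show ?thesis by (simp add: dq_def algebra_simps)
  qed
  have pw: "ppair (dq h P) (dq h u)" using wpair_C1[OF d c] per by (simp add: ppair_def)
  have "norm_X (\<lambda>x. u x - dq h P x) = norm_X (\<lambda>x. dq h P x - u x)" by (rule norm_X_commute[OF u pw])
  also have "\<dots> < e" using norm_X_le[OF ppair_diff[OF pw u]] h by linarith
  finally show ?thesis using d c per pw by blast
qed

section \<open>Conservation laws\<close>

lemma ip_int: "f \<in> L2_loc \<Longrightarrow> g \<in> L2_loc \<Longrightarrow> set_integrable lborel {a..b} (\<lambda>z. f z * cnj (g z))"
  by (intro L2_loc_mult_integrable L2_loc_cnj)

lemma ip_diff_left: "f \<in> L2_loc \<Longrightarrow> g \<in> L2_loc \<Longrightarrow> v \<in> L2_loc \<Longrightarrow>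
    inner_per (\<lambda>z. f z - g z) v = inner_per f v - inner_per g v"
  unfolding inner_per_def by (simp add: left_diff_distrib set_integral_diff ip_int)

lemma ip_diff_right: "f \<in> L2_loc \<Longrightarrow> g \<in> L2_loc \<Longrightarrow> v \<in> L2_loc \<Longrightarrow>
    inner_per v (\<lambda>z. f z - g z) = inner_per v f - inner_per v g"
  unfolding inner_per_def by (simp add: right_diff_distrib set_integral_diff ip_int)

lemma ip_add_left: "f \<in> L2_loc \<Longrightarrow> g \<in> L2_loc \<Longrightarrow> v \<in> L2_loc \<Longrightarrow>
    inner_per (\<lambda>z. f z + g z) v = inner_per f v + inner_per g v"
  unfolding inner_per_def by (simp add: distrib_right set_integral_add ip_int)

lemma ip_add_right: "f \<in> L2_loc \<Longrightarrow> g \<in> L2_loc \<Longrightarrow> v \<in> L2_loc \<Longrightarrow>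
    inner_per v (\<lambda>z. f z + g z) = inner_per v f + inner_per v g"
  unfolding inner_per_def by (simp add: distrib_left set_integral_add ip_int)

lemma ip_cmult_left: "inner_per (\<lambda>z. c * f z) g = c * inner_per f g"
  unfolding inner_per_def by (simp add: mult.assoc)

lemma ip_cnj: "cnj (inner_per f g) = inner_per g f"
  unfolding inner_per_def set_lebesgue_integral_def
  using Bochner_Integration.integral_cnj[of lborel "\<lambda>x. indicator {0..2*pi} x *\<^sub>R (f x * cnj (g x))"]
  by (simp add: mult.commute)

lemma ip_bound: "f \<in> L2_loc \<Longrightarrow> g \<in> L2_loc \<Longrightarrow> cmod (inner_per f g) \<le> nrm f * nrm g"
  using Cauchy_Schwarz_L2[of f "\<lambda>z. cnj (g z)" 0 "2 * pi"] L2_loc_cnj[of g]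
  by (simp add: inner_per_def l2_def)

lemma ip_self: "inner_per f f = complex_of_real ((nrm f)\<^sup>2)"
  unfolding inner_per_def l2_sq complex_norm_square[symmetric] of_real_power[symmetric]
  by (rule set_integral_complex_of_real)

lemma ip_cong_AE:
  assumes "f \<in> L2_loc" "g \<in> L2_loc" "f' \<in> L2_loc" "g' \<in> L2_loc"
    "AE z in lborel. f z = f' z" "AE z in lborel. g z = g' z"
  shows "inner_per f g = inner_per f' g'"
proof -
  have m: "(\<lambda>z. f z * cnj (g z)) \<in> borel_measurable lborel" "(\<lambda>z. f' z * cnj (g' z)) \<in> borel_measurable lborel"
    using L2_locD(1)[OF assms(1)] L2_locD(1)[OF L2_loc_cnj[OF assms(2)]] L2_locD(1)[OF assms(3)]
      L2_locD(1)[OF L2_loc_cnj[OF assms(4)]] by simp_all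
  have "AE z in lborel. z \<in> {0..2*pi} \<longrightarrow> f z * cnj (g z) = f' z * cnj (g' z)"
    using assms(5,6) by eventually_elim simp
  then show ?thesis unfolding inner_per_def by (intro set_lebesgue_integral_cong_AE) (use m in auto)
qed

lemma ip_shift:
  assumes "f \<in> L2_loc" "g \<in> L2_loc" "AE z in lborel. f (z + 2 * pi) = f z" "AE z in lborel. g (z + 2 * pi) = g z"
  shows "inner_per (\<lambda>z. f (z + h)) (\<lambda>z. g (z + h)) = inner_per f g"
  unfolding inner_per_def
proof (rule integral_AE_period_shift[of "\<lambda>z. f z * cnj (g z)"])
  show "(\<lambda>z. f z * cnj (g z)) \<in> borel_measurable borel"
    using L2_locD(1)[OF assms(1)] L2_locD(1)[OF L2_loc_cnj[OF assms(2)]] by simp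
  show "AE z in lborel. f (z + 2 * pi) * cnj (g (z + 2 * pi)) = f z * cnj (g z)"
    using assms(3,4) by eventually_elim simp
qed (use assms in \<open>auto intro: ip_int\<close>)

definition cub :: "(real \<Rightarrow> complex) \<Rightarrow> real \<Rightarrow> complex" where
  "cub u z = of_real ((cmod (u z))\<^sup>2) * u z"

lemma ppair_cub:
  assumes u: "ppair u g"
  shows "ppair (cub u) (\<lambda>z. 2 * of_real ((cmod (u z))\<^sup>2) * g z + (u z)\<^sup>2 * cnj (g z))"
proof -
  have "cub u = (\<lambda>z. u z * u z * cnj (u z))"
    unfolding fun_eq_iff cub_def complex_norm_square by (simp add: mult_ac)
  moreover have "(\<lambda>z. 2 * of_real ((cmod (u z))\<^sup>2) * g z + (u z)\<^sup>2 * cnj (g z))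
     = (\<lambda>z. (g z * u z + u z * g z) * cnj (u z) + u z * u z * cnj (g z))"
    unfolding fun_eq_iff complex_norm_square by (simp add: power2_eq_square algebra_simps)
  ultimately show ?thesis using ppair_mult[OF ppair_mult[OF u u] ppair_cnj[OF u]] by simp
qed

text \<open>The time derivative that the equation prescribes for the pairing with \<open>(v, k)\<close>.\<close>

definition rhs :: "real \<Rightarrow> real \<Rightarrow> (real \<Rightarrow> complex) \<Rightarrow> (real \<Rightarrow> complex) \<Rightarrow> (real \<Rightarrow> complex) \<Rightarrow> (real \<Rightarrow> complex) \<Rightarrow> complex" where
  "rhs p \<kappa> u g v k = \<i> * (4 * \<i> * of_real (p * \<kappa>) * inner_per g v - 4 * of_real (\<kappa>\<^sup>2) * inner_per g k
    + of_real (1 - p\<^sup>2) * inner_per u v - inner_per (cub u) v)"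

locale nls_solution =
  fixes p \<kappa> :: real and Q :: "real \<Rightarrow> real \<Rightarrow> complex"
  assumes sol: "solves_NLS_in_X p \<kappa> Q"
begin

definition D where "D t = weak_deriv (Q t)"

lemma pp: "ppair (Q t) (D t)"
  using sol ppair_weak_deriv unfolding solves_NLS_in_X_def D_def by blast

lemma L2: "Q t \<in> L2_loc" "D t \<in> L2_loc" "cub (Q t) \<in> L2_loc"
  using ppair_L2[OF pp] ppair_L2(1)[OF ppair_cub[OF pp]] by auto

lemma tendsto_Q: "((\<lambda>s. norm_X (\<lambda>z. Q s z - Q t z)) \<longlongrightarrow> 0) (at t)"
  using sol unfolding solves_NLS_in_X_def by blast

lemma derivative_ip:
  assumes v: "ppair v k"
  shows "((\<lambda>s. inner_per (Q s) v) has_vector_derivative rhs p \<kappa> (Q t) (D t) v k) (at t)"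
proof -
  have vH: "v \<in> H1_per" using v H1_per_iff by blast
  then obtain d where d: "((\<lambda>s. inner_per (Q s) v) has_vector_derivative d) (at t)"
    and eq: "\<i> * d + 4 * \<i> * of_real (p * \<kappa>) * inner_per (D t) v
        - 4 * of_real (\<kappa>\<^sup>2) * inner_per (D t) (weak_deriv v) + of_real (1 - p\<^sup>2) * inner_per (Q t) v
        - inner_per (cub (Q t)) v = 0"
    using sol unfolding solves_NLS_in_X_def D_def cub_def[abs_def] by blast
  have wk: "inner_per (D t) (weak_deriv v) = inner_per (D t) k"
    by (intro ip_cong_AE L2 ppair_L2[OF v] ppair_L2[OF ppair_weak_deriv[OF vH]] weak_deriv_AE ppair_wpair[OF v]) auto
  have "d = \<i> * (- (\<i> * d))" by simp
  also have "- (\<i> * d) = 4 * \<i> * of_real (p * \<kappa>) * inner_per (D t) v - 4 * of_real (\<kappa>\<^sup>2) * inner_per (D t) k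
      + of_real (1 - p\<^sup>2) * inner_per (Q t) v - inner_per (cub (Q t)) v"
    using eq unfolding wk by (simp add: algebra_simps add_eq_0_iff)
  finally show ?thesis using d by (simp add: rhs_def)
qed

lemma isCont_norm: "isCont (\<lambda>t. norm_X (Q t)) t"
proof -
  have "((\<lambda>s. norm_X (Q s) - norm_X (Q t)) \<longlongrightarrow> 0) (at t)"
  proof (rule tendsto_rabs_zero_cancel, rule tendsto_sandwich[OF _ _ tendsto_const tendsto_Q])
    have "\<bar>norm_X (Q s) - norm_X (Q t)\<bar> \<le> norm_X (\<lambda>z. Q s z - Q t z)" for s
    proof -
      have "norm_X (Q s) \<le> norm_X (\<lambda>z. Q s z - Q t z) + norm_X (Q t)"
        using norm_X_triangle[OF ppair_diff[OF pp pp] pp, of s t t] by simp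
      moreover have "norm_X (Q t) \<le> norm_X (\<lambda>z. Q s z - Q t z) + norm_X (Q s)"
        using norm_X_triangle[OF ppair_diff[OF pp pp] pp, of t s s] norm_X_commute[OF pp pp, of t s] by simp
      ultimately show ?thesis by linarith
    qed
    then show "\<forall>\<^sub>F s in at t. \<bar>norm_X (Q s) - norm_X (Q t)\<bar> \<le> norm_X (\<lambda>z. Q s z - Q t z)" by simp
  qed auto
  then show ?thesis by (simp add: isCont_def LIM_zero_iff)
qed

lemma bounded_on_interval: "\<exists>B\<ge>1. \<forall>t\<in>{a..b}. norm_X (Q t) \<le> B"
proof -
  have "compact ((\<lambda>t. norm_X (Q t)) ` {a..b})"
    using isCont_norm by (intro compact_continuous_image continuous_at_imp_continuous_on) auto
  then obtain B where "\<forall>t\<in>{a..b}. norm_X (Q t) \<le> B"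
    by (metis bounded_imp_bdd_above compact_imp_bounded bdd_above.E imageI)
  then show ?thesis by (intro exI[of _ "max 1 B"]) auto
qed

end

lemma nrm_cub_le:
  assumes u: "ppair u g" shows "nrm (cub u) \<le> ((1 + 2 * pi) * norm_X u)\<^sup>2 * nrm u"
proof -
  define S where "S = (1 + 2 * pi) * norm_X u"
  have "nrm (cub u) \<le> nrm (\<lambda>z. complex_of_real (S\<^sup>2) * u z)"
  proof (intro l2_mono L2_loc_cmult ppair_L2[OF u] ppair_L2[OF ppair_cub[OF u]])
    fix z
    have "(cmod (u z))\<^sup>2 \<le> S\<^sup>2" using sup_le_norm_X[OF u] by (intro power_mono) (auto simp: S_def)
    then show "cmod (cub u z) \<le> cmod (complex_of_real (S\<^sup>2) * u z)"
      unfolding cub_def norm_mult norm_of_real by (intro mult_right_mono) auto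
  qed
  then show ?thesis unfolding l2_cmult norm_of_real by (simp add: S_def)
qed

text \<open>The right-hand side of the equation is bounded in the dual of \<open>X\<close>,
  uniformly for \<open>u\<close> in bounded sets. This is all the time regularity that is
  available.\<close>

lemma rhs_bound:
  assumes u: "ppair u g" and v: "ppair v k" and B: "norm_X u \<le> B" "B \<ge> 0"
  shows "cmod (rhs p \<kappa> u g v k) \<le> (4 * \<bar>p * \<kappa>\<bar> * B + 4 * \<kappa>\<^sup>2 * B + \<bar>1 - p\<^sup>2\<bar> * B + ((1 + 2 * pi) * B)\<^sup>2 * B) * norm_X v"
proof -
  note L = ppair_L2[OF u] ppair_L2[OF v] ppair_L2(1)[OF ppair_cub[OF u]]
  have nu: "nrm u \<le> B" "nrm g \<le> B" using nrm_le_norm_X[OF u] B by auto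
  have nv: "nrm v \<le> norm_X v" "nrm k \<le> norm_X v" using nrm_le_norm_X[OF v] by auto
  have b: "cmod (inner_per a b) \<le> A * norm_X v" if "a \<in> L2_loc" "b \<in> L2_loc" "nrm a \<le> A" "nrm b \<le> norm_X v" for a b A
    using order_trans[OF ip_bound[OF that(1,2)] mult_mono[OF that(3,4)]] l2_nonneg[of 0 "2 * pi"] order_trans[OF l2_nonneg that(3)]
    by (simp add: norm_X_nonneg)
  have nc: "nrm (cub u) \<le> ((1 + 2 * pi) * B)\<^sup>2 * B"
    using order_trans[OF nrm_cub_le[OF u]] B nu norm_X_nonneg[of u]
    by (metis (no_types, lifting) add_nonneg_nonneg l2_nonneg mult_mono mult_left_mono mult_nonneg_nonneg pi_ge_zero power_mono zero_le_numeral zero_le_one zero_le_power2)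
  have "cmod (rhs p \<kappa> u g v k) \<le> 4 * \<bar>p * \<kappa>\<bar> * cmod (inner_per g v) + 4 * \<kappa>\<^sup>2 * cmod (inner_per g k)
    + \<bar>1 - p\<^sup>2\<bar> * cmod (inner_per u v) + cmod (inner_per (cub u) v)"
  proof -
    have n3: "cmod (a - b + c - d) \<le> cmod a + cmod b + cmod c + cmod d" for a b c d
      by (metis (no_types, opaque_lifting) add_right_mono norm_triangle_ineq norm_triangle_ineq4 order_trans)
    have "cmod (rhs p \<kappa> u g v k) = cmod (4 * \<i> * of_real (p * \<kappa>) * inner_per g v - 4 * of_real (\<kappa>\<^sup>2) * inner_per g k
      + of_real (1 - p\<^sup>2) * inner_per u v - inner_per (cub u) v)" by (simp add: rhs_def norm_mult)
    also have "\<dots> \<le> cmod (4 * \<i> * of_real (p * \<kappa>) * inner_per g v) + cmod (4 * of_real (\<kappa>\<^sup>2) * inner_per g k)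
      + cmod (of_real (1 - p\<^sup>2) * inner_per u v) + cmod (inner_per (cub u) v)" by (rule n3)
    finally show ?thesis by (simp only: norm_mult norm_of_real) simp
  qed
  also have "\<dots> \<le> 4 * \<bar>p * \<kappa>\<bar> * (B * norm_X v) + 4 * \<kappa>\<^sup>2 * (B * norm_X v) + \<bar>1 - p\<^sup>2\<bar> * (B * norm_X v) + ((1 + 2 * pi) * B)\<^sup>2 * B * norm_X v"
    by (intro add_mono mult_left_mono b L nu nv nc) auto
  finally show ?thesis by (simp add: algebra_simps)
qed

section \<open>Small translations: the flux and its expansion in \<open>h\<close>\<close>

lemma set_integral_Re: "set_integrable M A f \<Longrightarrow> Re (LINT x:A|M. f x) = (LINT x:A|M. Re (f x))"
  and set_integral_Im: "set_integrable M A f \<Longrightarrow> Im (LINT x:A|M. f x) = (LINT x:A|M. Im (f x))"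
  unfolding set_integrable_def set_lebesgue_integral_def by (simp_all flip: integral_Re integral_Im)

lemma set_integrable_continuous:
  fixes f :: "real \<Rightarrow> 'a::euclidean_space"
  shows "continuous_on UNIV f \<Longrightarrow> set_integrable lborel {a..b} f"
  by (rule borel_integrable_atLeastAtMost'[OF continuous_on_subset[OF _ subset_UNIV]])

text \<open>Difference quotients on one period with a step of at most 1 look at \<open>g\<close> up
  to \<open>2 * pi + 1\<close>, which is within two periods.\<close>

lemma nrm_two_periods:
  assumes g: "g \<in> L2_loc" and per: "AE z in lborel. g (z + 2 * pi) = g z"
  shows "l2 0 (2 * pi + 1) g \<le> 2 * nrm g"
proof -
  have i: "set_integrable lborel {a..b} (\<lambda>x. (cmod (g x))\<^sup>2)" for a b using L2_locD[OF g] by blast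
  have "(l2 0 (4 * pi) g)\<^sup>2 = (LBINT x:{0..2*pi} \<union> {2*pi..4*pi}. (cmod (g x))\<^sup>2)"
    unfolding l2_sq by (subst ivl_disj_un_two_touch(4)) auto
  also have "\<dots> = (LBINT x:{0..2*pi}. (cmod (g x))\<^sup>2) + (LBINT x:{2*pi..4*pi}. (cmod (g x))\<^sup>2)"
  proof (rule set_integral_Un_AE[OF _ _ _ i i])
    have "AE x in lborel. x \<noteq> 2 * pi" by (rule AE_lborel_singleton)
    then show "AE x in lborel. \<not> (x \<in> {0..2*pi} \<and> x \<in> {2*pi..4*pi})" by eventually_elim auto
  qed auto
  also have "(LBINT x:{2*pi..4*pi}. (cmod (g x))\<^sup>2) = (nrm (\<lambda>x. g (x + 2 * pi)))\<^sup>2"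
    unfolding l2_sq using set_integral_shift[of 0 "2*pi" "\<lambda>x. (cmod (g x))\<^sup>2" "2*pi"] by simp
  also have "nrm (\<lambda>x. g (x + 2 * pi)) = nrm g" by (rule nrm_shift[OF g per])
  also have "(LBINT x:{0..2*pi}. (cmod (g x))\<^sup>2) = (nrm g)\<^sup>2" by (simp add: l2_sq)
  finally have "(l2 0 (4 * pi) g)\<^sup>2 \<le> (2 * nrm g)\<^sup>2" by simp
  then have "l2 0 (4 * pi) g \<le> 2 * nrm g" by (rule power2_le_imp_le) (simp add: l2_nonneg)
  moreover have "l2 0 (2 * pi + 1) g \<le> l2 0 (4 * pi) g"
    using pi_gt3 by (intro l2_subset[OF g]) auto
  ultimately show ?thesis by simp
qed

lemma nrm_dq_le:
  assumes u: "ppair u g" and h: "0 < h" "h \<le> 1"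
  shows "nrm (dq h u) \<le> 2 * nrm g"
  using dq_norm_bounded[OF ppair_wpair[OF u] _ h, of 0 "2 * pi"] nrm_two_periods[OF ppair_L2(2)[OF u] ppair_AE[OF u]] by simp

text \<open>Hoelder continuity with exponent 1/2. It makes the third-order part of the flux
  negligible after division by \<open>h\<^sup>2\<close>.\<close>

lemma increment_le:
  assumes u: "ppair u g" and h: "0 < h" "h \<le> 1" and x: "x \<in> {0..2*pi}"
  shows "cmod (h * dq h u x) \<le> 2 * sqrt h * nrm g"
proof (rule power2_le_imp_le)
  have "l2 x (x + h) g \<le> l2 0 (2 * pi + 1) g" using h x by (intro l2_subset ppair_L2[OF u]) auto
  then have l: "l2 x (x + h) g \<le> 2 * nrm g" using nrm_two_periods[OF ppair_L2(2)[OF u] ppair_AE[OF u]] by simp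
  have "(cmod (h * dq h u x))\<^sup>2 = h\<^sup>2 * (cmod (dq h u x))\<^sup>2" by (simp add: norm_mult power_mult_distrib)
  also have "\<dots> \<le> h\<^sup>2 * ((l2 x (x + h) g)\<^sup>2 / h)"
    using dq_pointwise[OF ppair_wpair[OF u] h(1)] by (intro mult_left_mono) auto
  also have "\<dots> = h * (l2 x (x + h) g)\<^sup>2" using h by (simp add: power2_eq_square)
  also have "\<dots> \<le> h * (2 * nrm g)\<^sup>2" using l h by (intro mult_left_mono power_mono l2_nonneg) auto
  also have "\<dots> = (2 * sqrt h * nrm g)\<^sup>2" using h by (simp add: power_mult_distrib)
  finally show "(cmod (h * dq h u x))\<^sup>2 \<le> (2 * sqrt h * nrm g)\<^sup>2" .
qed (use h in \<open>simp add: l2_nonneg\<close>)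

lemma nrm_dq_tendsto:
  assumes u: "ppair u g"
  shows "((\<lambda>h. nrm (\<lambda>x. dq h u x - g x)) \<longlongrightarrow> 0) (at_right 0)"
  using dq_tendsto[OF ppair_wpair[OF u], of 0 "2 * pi"] by simp

lemma ip_tendsto:
  assumes f: "f \<in> L2_loc" "\<And>n. F n \<in> L2_loc" "((\<lambda>n. nrm (\<lambda>x. F n x - f x)) \<longlongrightarrow> 0) net"
    and g: "g \<in> L2_loc" "\<And>n. G n \<in> L2_loc" "((\<lambda>n. nrm (\<lambda>x. G n x - g x)) \<longlongrightarrow> 0) net"
  shows "((\<lambda>n. inner_per (F n) (G n)) \<longlongrightarrow> inner_per f g) net"
proof -
  have "((\<lambda>n. nrm (\<lambda>x. cnj (G n x) - cnj (g x))) \<longlongrightarrow> 0) net"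
    using g(3) by (simp add: l2_def flip: complex_cnj_diff)
  then show ?thesis unfolding inner_per_def by (intro set_integral_mult_tendsto L2_loc_cnj f g)
qed

lemma nrm_tendsto:
  assumes g: "g \<in> L2_loc" and F: "\<And>h. F h \<in> L2_loc"
    and lim: "((\<lambda>h. nrm (\<lambda>x. F h x - g x)) \<longlongrightarrow> 0) net"
  shows "((\<lambda>h. nrm (F h)) \<longlongrightarrow> nrm g) net"
proof (rule Lim_null[THEN iffD2], rule Lim_null_comparison[OF always_eventually lim], rule allI)
  fix h
  have "nrm (F h) \<le> nrm (\<lambda>x. F h x - g x) + nrm g"
    using l2_triangle[OF L2_loc_diff[OF F g] g, of 0 "2 * pi"] by simp
  moreover have "nrm g \<le> nrm (F h) + nrm (\<lambda>x. F h x - g x)"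
    using l2_triangle_diff[OF F[of h] L2_loc_diff[OF F[of h] g], of 0 "2 * pi"] by simp
  ultimately show "norm (nrm (F h) - nrm g) \<le> nrm (\<lambda>x. F h x - g x)" by simp
qed

text \<open>Up to the factor \<open>- \<i>\<close> this is the time derivative of the correlation of
  a solution with its translate by \<open>h\<close>; only the cubic term of the equation
  enters.\<close>

definition flux :: "real \<Rightarrow> (real \<Rightarrow> complex) \<Rightarrow> complex" where
  "flux h u = inner_per (cub u) (\<lambda>z. u (z + h)) - inner_per u (\<lambda>z. cub u (z + h))"

text \<open>For a solution \<open>u\<close> with derivative \<open>q\<close>, its imaginary part
  appears twice: as the limit of \<open>Im (flux h u) / h\<^sup>2\<close>, and as the rate of change
  of the quartic energy. These contributions cancel in the energy law. The real part is needed for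
  the Hessian.\<close>

definition cross :: "(real \<Rightarrow> complex) \<Rightarrow> (real \<Rightarrow> complex) \<Rightarrow> complex" where
  "cross u q = (LBINT z:{0..2*pi}. (cnj (u z) * q z)\<^sup>2)"

lemma cross_integrable:
  assumes "continuous_on UNIV u" "q \<in> L2_loc"
  shows "set_integrable lborel {a..b} (\<lambda>z. (cnj (u z) * q z)\<^sup>2)"
proof -
  have "(\<lambda>z. cnj (u z) * q z) \<in> L2_loc"
    using assms by (intro L2_loc_mult_continuous continuous_on_cnj)
  then show ?thesis unfolding power2_eq_square by (intro L2_loc_mult_integrable)
qed

text \<open>\<open>cross u\<close> is quadratic in its second argument, so the difference factors
  like a difference of squares.\<close>

lemma cross_diff_le:
  assumes u: "continuous_on UNIV u" and S: "\<And>z. cmod (u z) \<le> S" and q: "q \<in> L2_loc" and g: "g \<in> L2_loc"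
  shows "cmod (cross u q - cross u g) \<le> S\<^sup>2 * (nrm (\<lambda>z. q z - g z) * nrm (\<lambda>z. q z + g z))"
proof -
  have S0: "S \<ge> 0" using S[of 0] norm_ge_zero order_trans by blast
  have c2: "continuous_on UNIV (\<lambda>z. (cnj (u z))\<^sup>2)" using u by (intro continuous_intros)
  note L = L2_loc_mult_continuous[OF c2 L2_loc_diff[OF q g]] L2_loc_add[OF q g]
  have "cross u q - cross u g = (LBINT z:{0..2*pi}. ((cnj (u z))\<^sup>2 * (q z - g z)) * (q z + g z))"
    unfolding cross_def set_integral_diff(2)[OF cross_integrable[OF u q] cross_integrable[OF u g], symmetric]
    by (rule arg_cong[where f = "set_lebesgue_integral _ _"]) (simp add: fun_eq_iff power2_eq_square algebra_simps)
  also have "cmod \<dots> \<le> nrm (\<lambda>z. (cnj (u z))\<^sup>2 * (q z - g z)) * nrm (\<lambda>z. q z + g z)"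
    by (rule Cauchy_Schwarz_L2[OF L])
  also have "nrm (\<lambda>z. (cnj (u z))\<^sup>2 * (q z - g z)) \<le> nrm (\<lambda>z. complex_of_real (S\<^sup>2) * (q z - g z))"
  proof (intro l2_mono L L2_loc_cmult L2_loc_diff q g)
    fix z show "cmod ((cnj (u z))\<^sup>2 * (q z - g z)) \<le> cmod (complex_of_real (S\<^sup>2) * (q z - g z))"
      unfolding norm_mult norm_power norm_of_real complex_mod_cnj
      using S[of z] by (intro mult_right_mono) (auto intro: power_mono)
  qed
  also have "\<dots> = S\<^sup>2 * nrm (\<lambda>z. q z - g z)" unfolding l2_cmult norm_of_real by simp
  finally show ?thesis by (simp add: mult_right_mono l2_nonneg mult.assoc)
qed

lemma cross_le:
  assumes "continuous_on UNIV u" "\<And>z. cmod (u z) \<le> S" "q \<in> L2_loc"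
  shows "cmod (cross u q) \<le> S\<^sup>2 * (nrm q)\<^sup>2"
  using cross_diff_le[OF assms, of "\<lambda>_. 0"] by (simp add: cross_def L2_loc_continuous power2_eq_square)

lemma flux_eq:
  assumes u: "ppair u g"
  shows "flux h u = (LBINT z:{0..2*pi}. of_real ((cmod (u z))\<^sup>2 - (cmod (u (z + h)))\<^sup>2) * (u z * cnj (u (z + h))))"
proof -
  note L = ppair_L2(1)[OF u] ppair_L2(1)[OF ppair_cub[OF u]] ppair_L2(1)[OF ppair_shift[OF u]] ppair_L2(1)[OF ppair_shift[OF ppair_cub[OF u]]]
  show ?thesis unfolding flux_def inner_per_def set_integral_diff(2)[OF ip_int[OF L(2,3)] ip_int[OF L(1,4)], symmetric]
    by (rule arg_cong[where f = "set_lebesgue_integral _ _"]) (simp add: fun_eq_iff cub_def algebra_simps)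
qed

lemma flux_integrable:
  assumes u: "ppair u g"
  shows "set_integrable lborel {0..2*pi} (\<lambda>z. of_real ((cmod (u z))\<^sup>2 - (cmod (u (z + h)))\<^sup>2) * (u z * cnj (u (z + h))))"
proof -
  have c: "continuous_on UNIV u" "continuous_on UNIV (\<lambda>z. u (z + h))" using ppairD(1)[OF u] ppairD(1)[OF ppair_shift[OF u]] by auto
  show ?thesis by (intro set_integrable_continuous continuous_intros c)
qed

lemma Re_of_real_mult: "Re (complex_of_real a * b) = a * Re b" and Im_of_real_mult: "Im (complex_of_real a * b) = a * Im b"
  by simp_all

lemma flux_0: "flux 0 u = 0" by (simp add: flux_def cub_def inner_per_def mult_ac)

lemma sum_squares_identity:
  fixes a b :: complex
  shows "((cmod a)\<^sup>2 - (cmod b)\<^sup>2) * Re (a * cnj b) = ((cmod a)^4 - (cmod b)^4) / 2 - ((cmod a)\<^sup>2 - (cmod b)\<^sup>2) * (cmod (b - a))\<^sup>2 / 2"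
proof -
  have "(cmod (b - a))\<^sup>2 = (cmod a)\<^sup>2 + (cmod b)\<^sup>2 - 2 * Re (a * cnj b)"
    unfolding cmod_power2 by (simp add: power2_eq_square algebra_simps)
  moreover have "(cmod a)^4 - (cmod b)^4 = ((cmod a)\<^sup>2 - (cmod b)\<^sup>2) * ((cmod a)\<^sup>2 + (cmod b)\<^sup>2)"
    by (simp add: algebra_simps power2_eq_square eval_nat_numeral)
  moreover have "(A - B) * R = P / 2 - (A - B) * X / 2" if "X = A + B - 2 * R" "P = (A - B) * (A + B)" for A B R P X :: real
    unfolding that by (simp add: field_simps)
  ultimately show ?thesis by blast
qed

text \<open>The quartic part integrates to zero by translation invariance, which leaves a quantity of second order in \<open>h\<close>.\<close>

lemma Re_flux_le:
  assumes u: "ppair u g" and S: "\<And>z. cmod (u z) \<le> S" and h: "0 < h"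
  shows "\<bar>Re (flux h u)\<bar> \<le> S\<^sup>2 * h\<^sup>2 * (nrm (dq h u))\<^sup>2"
proof -
  have c: "continuous_on UNIV u" "continuous_on UNIV (\<lambda>z. u (z + h))" using ppairD(1)[OF u] ppairD(1)[OF ppair_shift[OF u]] by auto
  define r where "r z = ((cmod (u z))\<^sup>2 - (cmod (u (z + h)))\<^sup>2) * (cmod (u (z + h) - u z))\<^sup>2" for z
  have i: "set_integrable lborel {0..2*pi} (\<lambda>z. (cmod (u z))^4)" "set_integrable lborel {0..2*pi} (\<lambda>z. (cmod (u (z + h)))^4)"
    "set_integrable lborel {0..2*pi} r" "set_integrable lborel {0..2*pi} (\<lambda>z. S\<^sup>2 * h\<^sup>2 * (cmod (dq h u z))\<^sup>2)"
    unfolding r_def dq_def[abs_def] using h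
    by (intro set_integrable_continuous continuous_intros c; simp)+
  have "Re (flux h u) = (LBINT z:{0..2*pi}. Re (of_real ((cmod (u z))\<^sup>2 - (cmod (u (z + h)))\<^sup>2) * (u z * cnj (u (z + h)))))"
    unfolding flux_eq[OF u] by (rule set_integral_Re[OF flux_integrable[OF u]])
  also have "\<dots> = (LBINT z:{0..2*pi}. ((cmod (u z))^4 - (cmod (u (z + h)))^4) * (1/2) - r z * (1/2))"
    by (rule arg_cong[where f = "set_lebesgue_integral _ _"])
      (auto simp: fun_eq_iff Re_of_real_mult sum_squares_identity r_def simp del: of_real_diff times_complex.sel)
  also have "\<dots> = (LBINT z:{0..2*pi}. ((cmod (u z))^4 - (cmod (u (z + h)))^4)) * (1/2) - (LBINT z:{0..2*pi}. r z) * (1/2)"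
    by (simp only: set_integral_diff set_integrable_mult_left i set_integral_mult_left)
  also have "(LBINT z:{0..2*pi}. ((cmod (u z))^4 - (cmod (u (z + h)))^4)) = (LBINT z:{0..2*pi}. (cmod (u z))^4) - (LBINT z:{0..2*pi}. (cmod (u (z + h)))^4)"
    using i by (simp add: set_integral_diff)
  also have "(LBINT z:{0..2*pi}. (cmod (u (z + h)))^4) = (LBINT z:{0..2*pi}. (cmod (u z))^4)"
  proof (rule integral_AE_period_shift[of "\<lambda>z. (cmod (u z))^4"])
    show "(\<lambda>z. (cmod (u z))^4) \<in> borel_measurable borel"
      using borel_measurable_continuous_onI[OF c(1)] by measurable
    show "set_integrable lborel {a..b} (\<lambda>z. (cmod (u z))^4)" for a b
      by (intro set_integrable_continuous continuous_intros c)
  qed (auto simp: ppair_per[OF u])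
  finally have "\<bar>Re (flux h u)\<bar> \<le> \<bar>LBINT z:{0..2*pi}. r z\<bar>" by simp
  also have "\<dots> \<le> (LBINT z:{0..2*pi}. norm (r z))" using set_integral_norm_le[OF i(3)] by simp
  also have "\<dots> \<le> (LBINT z:{0..2*pi}. S\<^sup>2 * h\<^sup>2 * (cmod (dq h u z))\<^sup>2)"
  proof (intro set_integral_mono i set_integrable_norm)
    fix z
    have "(cmod (u z))\<^sup>2 \<le> S\<^sup>2" "(cmod (u (z + h)))\<^sup>2 \<le> S\<^sup>2" using S by (auto intro: power_mono)
    then have b: "\<bar>(cmod (u z))\<^sup>2 - (cmod (u (z + h)))\<^sup>2\<bar> \<le> S\<^sup>2"
      using zero_le_power2[of "cmod (u z)"] zero_le_power2[of "cmod (u (z + h))"] by linarith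
    have "norm (r z) = \<bar>(cmod (u z))\<^sup>2 - (cmod (u (z + h)))\<^sup>2\<bar> * (cmod (u (z + h) - u z))\<^sup>2" by (simp add: r_def abs_mult)
    also have "\<dots> \<le> S\<^sup>2 * (cmod (u (z + h) - u z))\<^sup>2" using b by (rule mult_right_mono) simp
    also have "\<dots> = S\<^sup>2 * h\<^sup>2 * (cmod (dq h u z))\<^sup>2" using h by (simp add: dq_def norm_divide power_divide)
    finally show "norm (r z) \<le> S\<^sup>2 * h\<^sup>2 * (cmod (dq h u z))\<^sup>2" .
  qed
  also have "\<dots> = S\<^sup>2 * h\<^sup>2 * (nrm (dq h u))\<^sup>2" by (simp add: l2_sq)
  finally show ?thesis .
qed

text \<open>With \<open>b = u (z + h)\<close> and \<open>q\<close> the difference quotient, the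
  coefficient of \<open>h\<^sup>2\<close> is isolated. What remains carries a further factor
  \<open>h * q\<close>, an increment of \<open>u\<close>, and is small by
  \<open>increment_le\<close>.\<close>

lemma Im_flux_identity:
  fixes a q :: complex and h :: real
  defines "b \<equiv> a + h * q"
  shows "((cmod a)\<^sup>2 - (cmod b)\<^sup>2) * Im (a * cnj b) = h\<^sup>2 * (Im ((cnj a * q)\<^sup>2) + h * (cmod q)\<^sup>2 * Im (cnj a * q))"
  unfolding b_def cmod_power2 by (simp add: power2_eq_square algebra_simps)

lemma Im_flux_approx:
  assumes u: "ppair u g" and S: "\<And>z. cmod (u z) \<le> S" and h: "0 < h" "h \<le> 1"
  shows "\<bar>Im (flux h u) / h\<^sup>2 - Im (cross u (dq h u))\<bar> \<le> 2 * sqrt h * nrm g * S * (nrm (dq h u))\<^sup>2"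
proof -
  have c: "continuous_on UNIV u" "continuous_on UNIV (\<lambda>z. u (z + h))" using ppairD(1)[OF u] ppairD(1)[OF ppair_shift[OF u]] by auto
  have cd: "continuous_on UNIV (dq h u)" by (rule continuous_dq[OF c(1)])
  have S0: "S \<ge> 0" using S[of 0] norm_ge_zero order_trans by blast
  define r where "r z = h * (cmod (dq h u z))\<^sup>2 * Im (cnj (u z) * dq h u z)" for z
  have i: "set_integrable lborel {0..2*pi} r" "set_integrable lborel {0..2*pi} (\<lambda>z. 2 * sqrt h * nrm g * S * (cmod (dq h u z))\<^sup>2)"
    "set_integrable lborel {0..2*pi} (\<lambda>z. Im ((cnj (u z) * dq h u z)\<^sup>2))"
    unfolding r_def
    by (intro set_integrable_continuous continuous_intros c cd)+
  have "Im (flux h u) = (LBINT z:{0..2*pi}. Im (of_real ((cmod (u z))\<^sup>2 - (cmod (u (z + h)))\<^sup>2) * (u z * cnj (u (z + h)))))"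
    unfolding flux_eq[OF u] by (rule set_integral_Im[OF flux_integrable[OF u]])
  also have "\<dots> = (LBINT z:{0..2*pi}. h\<^sup>2 * (Im ((cnj (u z) * dq h u z)\<^sup>2) + r z))"
  proof (rule arg_cong[where f = "set_lebesgue_integral _ _"], rule ext)
    fix z
    have "u (z + h) = u z + h * dq h u z" using h by (simp add: dq_def)
    then show "Im (of_real ((cmod (u z))\<^sup>2 - (cmod (u (z + h)))\<^sup>2) * (u z * cnj (u (z + h)))) = h\<^sup>2 * (Im ((cnj (u z) * dq h u z)\<^sup>2) + r z)"
      using Im_flux_identity[of "u z" h "dq h u z"] unfolding r_def by (simp only: Im_of_real_mult mult.assoc)
  qed
  also have "\<dots> = h\<^sup>2 * ((LBINT z:{0..2*pi}. Im ((cnj (u z) * dq h u z)\<^sup>2)) + (LBINT z:{0..2*pi}. r z))"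
    using i by (simp add: set_integral_add)
  also have "(LBINT z:{0..2*pi}. Im ((cnj (u z) * dq h u z)\<^sup>2)) = Im (cross u (dq h u))"
    unfolding cross_def by (rule set_integral_Im[symmetric, OF cross_integrable[OF c(1) L2_dq[OF c(1)]]])
  finally have "Im (flux h u) / h\<^sup>2 - Im (cross u (dq h u)) = (LBINT z:{0..2*pi}. r z)" using h by simp
  also have "\<bar>\<dots>\<bar> \<le> (LBINT z:{0..2*pi}. norm (r z))" using set_integral_norm_le[OF i(1)] by simp
  also have "\<dots> \<le> (LBINT z:{0..2*pi}. 2 * sqrt h * nrm g * S * (cmod (dq h u z))\<^sup>2)"
  proof (intro set_integral_mono i set_integrable_norm)
    fix z assume z: "z \<in> {0..2*pi}"
    have "norm (r z) \<le> h * (cmod (dq h u z))\<^sup>2 * cmod (cnj (u z) * dq h u z)"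
      unfolding r_def real_norm_def abs_mult using h abs_Im_le_cmod[of "cnj (u z) * dq h u z"]
      by (simp del: times_complex.sel add: mult_left_mono)
    also have "\<dots> = cmod (h * dq h u z) * (cmod (u z) * (cmod (dq h u z))\<^sup>2)" using h by (simp add: norm_mult power2_eq_square)
    also have "\<dots> \<le> (2 * sqrt h * nrm g) * (S * (cmod (dq h u z))\<^sup>2)"
      by (intro mult_mono increment_le[OF u h z] S order_refl) (use h S0 in \<open>auto simp: l2_nonneg\<close>)
    finally show "norm (r z) \<le> 2 * sqrt h * nrm g * S * (cmod (dq h u z))\<^sup>2" by (simp add: mult_ac)
  qed
  also have "\<dots> = 2 * sqrt h * nrm g * S * (nrm (dq h u))\<^sup>2" by (simp add: l2_sq)
  finally show ?thesis .
qed

lemma Im_flux_tendsto: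
  assumes u: "ppair u g"
  shows "((\<lambda>h. Im (flux h u) / h\<^sup>2) \<longlongrightarrow> Im (cross u g)) (at_right 0)"
proof -
  define S where "S = (1 + 2 * pi) * norm_X u"
  have S: "cmod (u z) \<le> S" for z using sup_le_norm_X[OF u] by (simp add: S_def)
  have S0: "S \<ge> 0" using S[of 0] norm_ge_zero order_trans by blast
  note c = ppairD(1)[OF u] and g = ppair_L2(2)[OF u]
  note L = L2_dq[OF c]
  have ev: "\<forall>\<^sub>F h in at_right (0::real). 0 < h \<and> h \<le> 1"
    unfolding eventually_at_right_field by (intro exI[of _ 1]) auto
  define B where "B h = S\<^sup>2 * (nrm (\<lambda>z. dq h u z - g z) * (3 * nrm g)) + 2 * sqrt h * nrm g * S * (2 * nrm g)\<^sup>2" for h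
  have "((\<lambda>h. B h) \<longlongrightarrow> S\<^sup>2 * (0 * (3 * nrm g)) + 2 * sqrt 0 * nrm g * S * (2 * nrm g)\<^sup>2) (at_right 0)"
    unfolding B_def by (intro tendsto_intros nrm_dq_tendsto[OF u])
  then have B0: "(B \<longlongrightarrow> 0) (at_right 0)" by simp
  show ?thesis
  proof (rule Lim_null[THEN iffD2], rule Lim_null_comparison[OF _ B0])
    show "\<forall>\<^sub>F h in at_right 0. norm (Im (flux h u) / h\<^sup>2 - Im (cross u g)) \<le> B h"
      using ev
    proof eventually_elim
      case (elim h)
      then have h: "0 < h" "h \<le> 1" by auto
      have n: "nrm (dq h u) \<le> 2 * nrm g" by (rule nrm_dq_le[OF u h])
      have "\<bar>Im (flux h u) / h\<^sup>2 - Im (cross u (dq h u))\<bar> \<le> 2 * sqrt h * nrm g * S * (2 * nrm g)\<^sup>2"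
        by (rule order_trans[OF Im_flux_approx[OF u S h] mult_left_mono[OF power_mono[OF n l2_nonneg]]])
          (use h S0 in \<open>simp add: l2_nonneg\<close>)
      moreover have "\<bar>Im (cross u (dq h u)) - Im (cross u g)\<bar> \<le> S\<^sup>2 * (nrm (\<lambda>z. dq h u z - g z) * (3 * nrm g))"
      proof -
        have "\<bar>Im (cross u (dq h u)) - Im (cross u g)\<bar> \<le> cmod (cross u (dq h u) - cross u g)"
          using abs_Im_le_cmod[of "cross u (dq h u) - cross u g"] by simp
        also have "\<dots> \<le> S\<^sup>2 * (nrm (\<lambda>z. dq h u z - g z) * nrm (\<lambda>z. dq h u z + g z))"
          by (rule cross_diff_le[OF c S L g])
        also have "\<dots> \<le> S\<^sup>2 * (nrm (\<lambda>z. dq h u z - g z) * (3 * nrm g))"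
          using l2_triangle[OF L g, of 0 "2*pi" h] n
          by (auto intro!: mult_left_mono simp: l2_nonneg)
        finally show ?thesis .
      qed
      ultimately show ?case unfolding B_def real_norm_def by linarith
    qed
  qed
qed

text \<open>For bounded \<open>w\<close> and \<open>w + d\<close> the last bracket is of second
  order in \<open>d\<close>. With \<open>d\<close> an increment in time it is disposed of by
  \<open>quadratic_remainder\<close>; with \<open>d\<close> a perturbation of the profile it
  contains the Hessian of the quartic term.\<close>

lemma quartic_expansion:
  fixes w d :: complex
  shows "(cmod (w + d))^4 / 2 = (cmod w)^4 / 2 + 2 * (cmod w)\<^sup>2 * Re (d * cnj w)
    + ((cmod w)\<^sup>2 * (cmod d)\<^sup>2 + ((cmod (w + d))\<^sup>2 - (cmod w)\<^sup>2)\<^sup>2 / 2)"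
proof -
  have e: "(cmod (w + d))\<^sup>2 = (cmod w)\<^sup>2 + 2 * Re (d * cnj w) + (cmod d)\<^sup>2"
    unfolding cmod_power2 by (simp add: power2_eq_square algebra_simps)
  have "Y\<^sup>2 / 2 = X\<^sup>2 / 2 + 2 * X * R + (X * Z + (Y - X)\<^sup>2 / 2)" if "Y = X + 2 * R + Z" for X Y Z R :: real
    unfolding that by (simp add: power2_eq_square field_simps)
  from this[OF e] show ?thesis by (simp flip: power_mult)
qed

definition quartic :: "(real \<Rightarrow> complex) \<Rightarrow> real" where
  "quartic u = (LBINT z:{0..2*pi}. (cmod (u z))^4 / 2)"

lemma ip_Re: "f \<in> L2_loc \<Longrightarrow> g \<in> L2_loc \<Longrightarrow> Re (inner_per f g) = (LBINT z:{0..2*pi}. Re (f z * cnj (g z)))"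
  unfolding inner_per_def by (rule set_integral_Re[OF ip_int])

lemma quartic_diff:
  assumes u: "ppair u g" and d: "ppair d k"
  shows "quartic (\<lambda>z. u z + d z) = quartic u + 2 * Re (inner_per d (cub u))
    + (LBINT z:{0..2*pi}. (cmod (u z))\<^sup>2 * (cmod (d z))\<^sup>2 + ((cmod (u z + d z))\<^sup>2 - (cmod (u z))\<^sup>2)\<^sup>2 / 2)"
proof -
  note c = ppairD(1)[OF u] ppairD(1)[OF d]
  have 2: "2 * (cmod (u z))\<^sup>2 * Re (d z * cnj (u z)) = 2 * Re (d z * cnj (cub u z))" for z
    by (simp add: cub_def algebra_simps)
  have i: "set_integrable lborel {0..2*pi} (\<lambda>z. (cmod (u z))^4 / 2)"
    "set_integrable lborel {0..2*pi} (\<lambda>z. 2 * Re (d z * cnj (cub u z)))"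
    "set_integrable lborel {0..2*pi} (\<lambda>z. (cmod (u z))\<^sup>2 * (cmod (d z))\<^sup>2 + ((cmod (u z + d z))\<^sup>2 - (cmod (u z))\<^sup>2)\<^sup>2 / 2)"
    unfolding 2[symmetric] by (intro set_integrable_continuous continuous_intros c; simp)+
  have "quartic (\<lambda>z. u z + d z) = (LBINT z:{0..2*pi}. ((cmod (u z))^4 / 2 + 2 * Re (d z * cnj (cub u z)))
    + ((cmod (u z))\<^sup>2 * (cmod (d z))\<^sup>2 + ((cmod (u z + d z))\<^sup>2 - (cmod (u z))\<^sup>2)\<^sup>2 / 2))"
    unfolding quartic_def by (rule arg_cong[where f = "set_lebesgue_integral _ _"], rule ext) (simp only: quartic_expansion 2)
  also have "\<dots> = quartic u + (LBINT z:{0..2*pi}. 2 * Re (d z * cnj (cub u z)))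
    + (LBINT z:{0..2*pi}. (cmod (u z))\<^sup>2 * (cmod (d z))\<^sup>2 + ((cmod (u z + d z))\<^sup>2 - (cmod (u z))\<^sup>2)\<^sup>2 / 2)"
    unfolding quartic_def by (subst set_integral_add(2)[OF set_integral_add(1)[OF i(1,2)] i(3)], subst set_integral_add(2)[OF i(1,2)]) simp
  also have "(LBINT z:{0..2*pi}. 2 * Re (d z * cnj (cub u z))) = 2 * Re (inner_per d (cub u))"
    unfolding ip_Re[OF ppair_L2(1)[OF d] ppair_L2(1)[OF ppair_cub[OF u]]] by (rule set_integral_mult_right)
  finally show ?thesis by simp
qed

lemma quartic_remainder_le:
  assumes u: "ppair u g" and d: "ppair d k" and S: "\<And>z. cmod (u z) \<le> S" "\<And>z. cmod (u z + d z) \<le> S"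
  shows "\<bar>LBINT z:{0..2*pi}. (cmod (u z))\<^sup>2 * (cmod (d z))\<^sup>2 + ((cmod (u z + d z))\<^sup>2 - (cmod (u z))\<^sup>2)\<^sup>2 / 2\<bar>
    \<le> 3 * S\<^sup>2 * (nrm d)\<^sup>2" (is "\<bar>set_lebesgue_integral _ _ ?f\<bar> \<le> _")
proof -
  note c = ppairD(1)[OF u] ppairD(1)[OF d]
  have S0: "S \<ge> 0" using S(1)[of 0] norm_ge_zero order_trans by blast
  have i: "set_integrable lborel {0..2*pi} ?f" "set_integrable lborel {0..2*pi} (\<lambda>z. 3 * S\<^sup>2 * (cmod (d z))\<^sup>2)"
    by (intro set_integrable_continuous continuous_intros c; simp)+
  have "\<bar>set_lebesgue_integral lborel {0..2*pi} ?f\<bar> = set_lebesgue_integral lborel {0..2*pi} ?f"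
    by (intro abs_of_nonneg set_integral_nonneg') auto
  also have "\<dots> \<le> (LBINT z:{0..2*pi}. 3 * S\<^sup>2 * (cmod (d z))\<^sup>2)"
  proof (intro set_integral_mono i)
    fix z
    have "\<bar>(cmod (u z + d z))\<^sup>2 - (cmod (u z))\<^sup>2\<bar> = \<bar>cmod (u z + d z) - cmod (u z)\<bar> * (cmod (u z + d z) + cmod (u z))"
      by (simp add: power2_eq_square square_diff_square_factored abs_mult mult.commute)
    also have "\<dots> \<le> cmod (d z) * (S + S)"
      using norm_triangle_ineq3[of "u z + d z" "u z"] S[of z] by (intro mult_mono add_mono) auto
    finally have "((cmod (u z + d z))\<^sup>2 - (cmod (u z))\<^sup>2)\<^sup>2 \<le> (cmod (d z) * (S + S))\<^sup>2"
      using power_mono[OF _ abs_ge_zero, of _ _ 2] by fastforce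
    moreover have "(cmod (u z))\<^sup>2 * (cmod (d z))\<^sup>2 \<le> S\<^sup>2 * (cmod (d z))\<^sup>2"
      using S(1)[of z] by (intro mult_right_mono power_mono) auto
    ultimately show "?f z \<le> 3 * S\<^sup>2 * (cmod (d z))\<^sup>2" by (simp add: power_mult_distrib power2_eq_square field_simps)
  qed
  also have "\<dots> = 3 * S\<^sup>2 * (nrm d)\<^sup>2" by (simp add: l2_sq)
  finally show ?thesis .
qed

text \<open>The integrand is the derivative of \<open>|u|\<^sup>4 / 4\<close>. In the proof,
  integration by parts shows that the quantity equals minus three times itself.\<close>

lemma Re_ip_self_by_parts:
  assumes u: "ppair u g"
  shows "Re (inner_per g (cub u)) = 0"
proof -
  define k where "k z = 2 * of_real ((cmod (u z))\<^sup>2) * g z + (u z)\<^sup>2 * cnj (g z)" for z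
  have c: "ppair (cub u) k" unfolding k_def by (rule ppair_cub[OF u])
  note L = ppair_L2[OF u] ppair_L2[OF c]
  have "Re (inner_per g (cub u)) = - Re (inner_per u k)" by (simp add: inner_per_by_parts[OF u c])
  also have "Re (inner_per u k) = 3 * Re (inner_per g (cub u))"
    unfolding ip_Re[OF L(1,4)] ip_Re[OF L(2,3)] set_integral_mult_right[symmetric]
    by (rule arg_cong[where f = "set_lebesgue_integral _ _"])
      (simp add: fun_eq_iff k_def cub_def cmod_power2[unfolded power2_eq_square] power2_eq_square algebra_simps)
  finally show ?thesis by simp
qed

text \<open>The transport term vanishes by \<open>Re_ip_self_by_parts\<close>, and the terms of
  order zero pair to real numbers, so that only dispersion contributes.\<close>

lemma Re_rhs_cub:
  assumes u: "ppair u g"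
  shows "Re (rhs p \<kappa> u g (cub u) (\<lambda>z. 2 * of_real ((cmod (u z))\<^sup>2) * g z + (u z)\<^sup>2 * cnj (g z))) = 4 * \<kappa>\<^sup>2 * Im (cross u g)"
proof -
  define k where "k z = 2 * of_real ((cmod (u z))\<^sup>2) * g z + (u z)\<^sup>2 * cnj (g z)" for z
  have c: "ppair (cub u) k" unfolding k_def by (rule ppair_cub[OF u])
  note L = ppair_L2[OF u] ppair_L2[OF c]
  have "Im (inner_per g k) = Im (cross u g)"
    unfolding inner_per_def cross_def set_integral_Im[OF ip_int[OF L(2,4)]] set_integral_Im[OF cross_integrable[OF ppairD(1)[OF u] L(2)]]
    by (rule arg_cong[where f = "set_lebesgue_integral _ _"])
      (simp add: fun_eq_iff k_def power2_eq_square algebra_simps)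
  moreover have "Im (inner_per u (cub u)) = 0"
  proof -
    have "Im (u z * cnj (cub u z)) = 0" for z by (simp add: cub_def algebra_simps)
    then show ?thesis unfolding inner_per_def set_integral_Im[OF ip_int[OF L(1,3)]] by simp
  qed
  moreover have "Im (inner_per (cub u) (cub u)) = 0" by (simp add: ip_self)
  ultimately show ?thesis using Re_ip_self_by_parts[OF u]
    unfolding rhs_def k_def[symmetric] by simp
qed

text \<open>The linear part of the equation is skew-adjoint and commutes with translations, so its
  contributions from the two slots of the correlation cancel. The conjugate and the step
  \<open>- h\<close> arise when the translation is moved to the other slot.\<close>

lemma rhs_shift_cancel:
  assumes u: "ppair u g"
  shows "rhs p \<kappa> u g (\<lambda>z. u (z + h)) (\<lambda>z. g (z + h)) + cnj (rhs p \<kappa> u g (\<lambda>z. u (z - h)) (\<lambda>z. g (z - h))) = - \<i> * flux h u"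
proof -
  note c = ppair_cub[OF u]
  have m: "ppair (\<lambda>z. u (z - h)) (\<lambda>z. g (z - h))" using ppair_shift[OF u, of "- h"] by simp
  note p = ppair_shift[OF u, of h]
  have sh: "inner_per (\<lambda>z. f (z - h)) f' = inner_per f (\<lambda>z. f' (z + h))"
    if "(\<lambda>z. f (z - h)) \<in> L2_loc" "f' \<in> L2_loc" "AE z in lborel. f (z + 2 * pi - h) = f (z - h)" "AE z in lborel. f' (z + 2 * pi) = f' z" for f f'
    using ip_shift[OF that, of h] by simp
  have AE0: "AE z in lborel. u (z + 2 * pi - h) = u (z - h)" "AE z in lborel. cub u (z + 2 * pi) = cub u z" "AE z in lborel. u (z + 2 * pi) = u z"
    using ppair_per[OF m] ppair_per[OF c] ppair_per[OF u] by auto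
  note AE1 = ppair_AE[OF m] ppair_AE[OF u]
  have sh': "inner_per (\<lambda>z. u (z - h)) g = inner_per u (\<lambda>z. g (z + h))"
    "inner_per (\<lambda>z. g (z - h)) g = inner_per g (\<lambda>z. g (z + h))"
    "inner_per (\<lambda>z. u (z - h)) u = inner_per u (\<lambda>z. u (z + h))"
    "inner_per (\<lambda>z. u (z - h)) (cub u) = inner_per u (\<lambda>z. cub u (z + h))"
    by (intro sh AE0 AE1 ppair_L2[OF u] ppair_L2[OF m] ppair_L2(1)[OF c])+
  have "inner_per u (\<lambda>z. g (z + h)) = - inner_per g (\<lambda>z. u (z + h))"
    by (simp add: inner_per_by_parts[OF u p])
  then show ?thesis unfolding rhs_def flux_def
    by (simp add: ip_cnj sh' algebra_simps)
qed

section \<open>Time derivatives along a solution\<close>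

context nls_solution
begin

text \<open>The increment is paired with itself. In the dual of \<open>X\<close> it is Lipschitz in
  time by \<open>rhs_bound\<close>, and the other factor is measured in \<open>X\<close>, where it
  tends to zero; so the square is of smaller order than the time step.\<close>

lemma increment_bound:
  "\<exists>L\<ge>0. \<forall>s. \<bar>s - t\<bar> \<le> 1 \<longrightarrow> (nrm (\<lambda>z. Q s z - Q t z))\<^sup>2 \<le> L * \<bar>s - t\<bar> * norm_X (\<lambda>z. Q s z - Q t z)"
proof -
  obtain B where B: "B \<ge> 1" "\<And>s. s \<in> {t-1..t+1} \<Longrightarrow> norm_X (Q s) \<le> B" using bounded_on_interval[of "t-1" "t+1"] by blast
  define L where "L = 4 * \<bar>p * \<kappa>\<bar> * B + 4 * \<kappa>\<^sup>2 * B + \<bar>1 - p\<^sup>2\<bar> * B + ((1 + 2 * pi) * B)\<^sup>2 * B"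
  have L0: "L \<ge> 0" using B by (auto simp: L_def)
  have lip: "cmod (inner_per (Q s) v - inner_per (Q t) v) \<le> L * norm_X v * \<bar>s - t\<bar>"
    if v: "ppair v k" and s: "\<bar>s - t\<bar> \<le> 1" for v k s
  proof -
    have "norm (inner_per (Q s) v - inner_per (Q t) v) \<le> (L * norm_X v) * norm (s - t)"
    proof (rule differentiable_bound[of "{t-1..t+1}" _ "\<lambda>\<tau> h. h *\<^sub>R rhs p \<kappa> (Q \<tau>) (D \<tau>) v k"])
      fix \<tau> assume \<tau>: "\<tau> \<in> {t-1..t+1}"
      show "((\<lambda>s. inner_per (Q s) v) has_derivative (\<lambda>h. h *\<^sub>R rhs p \<kappa> (Q \<tau>) (D \<tau>) v k)) (at \<tau> within {t-1..t+1})"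
        using derivative_ip[OF v] by (simp add: has_vector_derivative_def has_derivative_at_withinI)
      show "onorm (\<lambda>h. h *\<^sub>R rhs p \<kappa> (Q \<tau>) (D \<tau>) v k) \<le> L * norm_X v"
      proof (rule onorm_le)
        fix h :: real
        have "cmod (rhs p \<kappa> (Q \<tau>) (D \<tau>) v k) \<le> L * norm_X v"
          unfolding L_def using rhs_bound[OF pp v B(2)[OF \<tau>]] B by simp
        then show "norm (h *\<^sub>R rhs p \<kappa> (Q \<tau>) (D \<tau>) v k) \<le> L * norm_X v * norm h"
          by (simp add: mult.commute mult_left_mono)
      qed
    qed (use s in auto)
    then show ?thesis by simp
  qed
  show ?thesis
  proof (intro exI[of _ L] conjI L0 allI impI)
    fix s assume s: "\<bar>s - t\<bar> \<le> 1"
    have d: "ppair (\<lambda>z. Q s z - Q t z) (\<lambda>z. D s z - D t z)" by (intro ppair_diff pp)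
    have "(nrm (\<lambda>z. Q s z - Q t z))\<^sup>2 = cmod (inner_per (\<lambda>z. Q s z - Q t z) (\<lambda>z. Q s z - Q t z))"
      by (simp add: ip_self norm_power l2_nonneg del: of_real_power)
    also have "\<dots> = cmod (inner_per (Q s) (\<lambda>z. Q s z - Q t z) - inner_per (Q t) (\<lambda>z. Q s z - Q t z))"
      by (simp add: ip_diff_left L2 ppair_L2[OF d])
    also have "\<dots> \<le> L * norm_X (\<lambda>z. Q s z - Q t z) * \<bar>s - t\<bar>" by (rule lip[OF d s])
    finally show "(nrm (\<lambda>z. Q s z - Q t z))\<^sup>2 \<le> L * \<bar>s - t\<bar> * norm_X (\<lambda>z. Q s z - Q t z)" by (simp add: mult_ac)
  qed
qed

text \<open>Quadratic remainders do not contribute to time derivatives although \<open>t \<mapsto> Q t\<close>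
  is differentiable only in the dual of \<open>X\<close>.\<close>

lemma quadratic_remainder:
  fixes r :: "real \<Rightarrow> 'a::real_normed_vector"
  assumes r: "\<And>s. \<bar>s - t\<bar> \<le> 1 \<Longrightarrow> norm (r s - r t) \<le> C * (nrm (\<lambda>z. Q s z - Q t z))\<^sup>2" and C: "C \<ge> 0"
  shows "(r has_vector_derivative 0) (at t)"
proof -
  obtain L where L: "L \<ge> 0" "\<And>s. \<bar>s - t\<bar> \<le> 1 \<Longrightarrow> (nrm (\<lambda>z. Q s z - Q t z))\<^sup>2 \<le> L * \<bar>s - t\<bar> * norm_X (\<lambda>z. Q s z - Q t z)"
    using increment_bound[of t] by blast
  have z: "((\<lambda>s. C * L * norm_X (\<lambda>z. Q s z - Q t z)) \<longlongrightarrow> 0) (at t)" by (rule tendsto_mult_right_zero[OF tendsto_Q])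
  have ev: "\<forall>\<^sub>F s in at t. \<bar>s - t\<bar> \<le> 1 \<and> s \<noteq> t"
    unfolding eventually_at by (intro exI[of _ 1]) (auto simp: dist_real_def)
  have "((\<lambda>s. norm (r s - r t - 0) / norm (s - t)) \<longlongrightarrow> 0) (at t)"
  proof (rule Lim_null_comparison[OF _ z])
    show "\<forall>\<^sub>F s in at t. norm (norm (r s - r t - 0) / norm (s - t)) \<le> C * L * norm_X (\<lambda>z. Q s z - Q t z)"
      using ev
    proof eventually_elim
      case (elim s)
      have "norm (r s - r t) \<le> C * (L * \<bar>s - t\<bar> * norm_X (\<lambda>z. Q s z - Q t z))"
        using elim by (intro order_trans[OF r mult_left_mono[OF L(2) C]]) auto
      then show ?case using elim by (simp add: divide_le_eq mult_ac)
    qed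
  qed
  then show ?thesis unfolding has_vector_derivative_def has_derivative_iff_norm by simp
qed

lemma derivative_correlation:
  "((\<lambda>s. inner_per (Q s) (\<lambda>z. Q s (z + h))) has_vector_derivative - \<i> * flux h (Q t)) (at t)"
proof -
  note sp = ppair_shift[OF pp] 
  have m: "ppair (\<lambda>z. Q t (z - h)) (\<lambda>z. D t (z - h))" for t using sp[of t "- h"] by simp
  define A where "A s = inner_per (Q s) (\<lambda>z. Q t (z + h))" for s
  define B where "B s = inner_per (Q s) (\<lambda>z. Q t (z - h))" for s
  define r where "r s = inner_per (\<lambda>z. Q s z - Q t z) (\<lambda>z. Q s (z + h) - Q t (z + h))" for s
  have LL: "(\<lambda>z. Q s z - Q t z) \<in> L2_loc" "(\<lambda>z. Q s (z + h) - Q t (z + h)) \<in> L2_loc" "(\<lambda>z. Q s (z + h)) \<in> L2_loc" for s t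
    using ppair_L2[OF ppair_diff[OF pp pp]] ppair_L2[OF ppair_diff[OF sp sp]] ppair_L2[OF sp] by blast+
  \<comment> \<open>Both slots depend on time. Freezing one of them at \<open>t\<close> gives
    \<open>A\<close> and the conjugate of \<open>B\<close>, which are differentiable by the
    equation; the product of the two increments is \<open>r\<close>.\<close>
  have eq: "inner_per (Q s) (\<lambda>z. Q s (z + h)) = A s + cnj (B s) + r s - A t" for s
  proof -
    have "cnj (B s) = inner_per (Q t) (\<lambda>z. Q s (z + h))"
      unfolding B_def ip_cnj using ip_shift[of "\<lambda>z. Q t (z - h)" "Q s" h] ppair_L2(1)[OF m] L2
        ppair_per[OF m, of t] ppair_per[OF pp, of s] by (simp add: add.commute)
    then show ?thesis unfolding A_def r_def
      by (simp add: ip_diff_left ip_diff_right L2 LL)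
  qed
  have r0: "(r has_vector_derivative 0) (at t)"
  proof (rule quadratic_remainder)
    fix s
    have "nrm (\<lambda>z. Q s (z + h) - Q t (z + h)) = nrm (\<lambda>z. Q s z - Q t z)"
      using nrm_shift[OF LL(1), of s t h] ppair_per[OF pp, of s] ppair_per[OF pp, of t] by simp
    then show "norm (r s - r t) \<le> 1 * (nrm (\<lambda>z. Q s z - Q t z))\<^sup>2"
      using ip_bound[OF LL(1)[of s t] LL(2)[of s t]] by (simp add: r_def power2_eq_square inner_per_def)
  qed simp
  have AB: "((\<lambda>s. A s + cnj (B s)) has_vector_derivative (rhs p \<kappa> (Q t) (D t) (\<lambda>z. Q t (z + h)) (\<lambda>z. D t (z + h))
      + cnj (rhs p \<kappa> (Q t) (D t) (\<lambda>z. Q t (z - h)) (\<lambda>z. D t (z - h))))) (at t)"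
    unfolding A_def B_def
    by (intro has_vector_derivative_add has_vector_derivative_cnj derivative_ip sp m)
  have "((\<lambda>s. A s + cnj (B s) + r s - A t) has_vector_derivative (rhs p \<kappa> (Q t) (D t) (\<lambda>z. Q t (z + h)) (\<lambda>z. D t (z + h))
      + cnj (rhs p \<kappa> (Q t) (D t) (\<lambda>z. Q t (z - h)) (\<lambda>z. D t (z - h)))) + 0 - 0) (at t)"
    by (rule has_vector_derivative_diff[OF has_vector_derivative_add[OF AB r0] has_vector_derivative_const])
  then show ?thesis unfolding eq[symmetric] rhs_shift_cancel[OF pp] by simp
qed

lemma norm_conserved: "nrm (Q t) = nrm (Q 0)"
proof -
  have "((\<lambda>s. inner_per (Q s) (Q s)) has_vector_derivative 0) (at t within UNIV)" for t
    using derivative_correlation[of 0 t] by (simp add: flux_0)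
  from has_vector_derivative_zero_constant[OF convex_UNIV this]
  obtain c where "\<And>t. inner_per (Q t) (Q t) = c" by auto
  then have "(nrm (Q t))\<^sup>2 = (nrm (Q 0))\<^sup>2" by (metis ip_self of_real_eq_iff)
  then show ?thesis by (simp add: l2_nonneg)
qed

end

lemma ip_cmult_right: "inner_per f (\<lambda>z. c * g z) = cnj c * inner_per f g"
  using arg_cong[OF ip_cmult_left[of c g f], of cnj] by (simp add: ip_cnj)

text \<open>The limits \<open>L\<close> are not known to be differentiable in time. The integrated
  identities for \<open>G n\<close> pass to the limit by dominated convergence instead.\<close>

lemma limit_conserved:
  fixes G G' :: "nat \<Rightarrow> real \<Rightarrow> real"
  assumes d: "\<And>n t. (G n has_vector_derivative G' n t) (at t)"
    and bd: "\<And>a b. \<exists>B. \<forall>n. \<forall>t\<in>{a..b}. \<bar>G' n t\<bar> \<le> B"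
    and lim': "\<And>t. (\<lambda>n. G' n t) \<longlonglongrightarrow> 0" and lim: "\<And>t. (\<lambda>n. G n t) \<longlonglongrightarrow> L t"
  shows "L a = L b"
proof -
  have *: "L a = L b" if ab: "a \<le> b" for a b
  proof -
    obtain B where B: "\<And>n t. t \<in> {a..b} \<Longrightarrow> \<bar>G' n t\<bar> \<le> B" using bd[of a b] by blast
    have "((\<lambda>_. 0) has_integral L b - L a) {a..b}"
    proof (rule has_integral_dominated_convergence[of G' "\<lambda>n. G n b - G n a" "{a..b}" "\<lambda>_. B"])
      show "(G' n has_integral G n b - G n a) {a..b}" for n
        using d by (intro fundamental_theorem_of_calculus[OF ab]) (rule has_vector_derivative_at_within)
      show "(\<lambda>n. G n b - G n a) \<longlonglongrightarrow> L b - L a" by (intro tendsto_diff lim)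
    qed (use B lim' in auto)
    then show ?thesis using has_integral_0_eq by fastforce
  qed
  then show ?thesis by (metis linear)
qed

context nls_solution
begin

lemma uniform_bound: "\<exists>S\<ge>1. \<forall>t\<in>{a..b}. nrm (D t) \<le> S \<and> (\<forall>z. cmod (Q t z) \<le> S)"
proof -
  obtain B where B: "B \<ge> 1" "\<And>t. t \<in> {a..b} \<Longrightarrow> norm_X (Q t) \<le> B" using bounded_on_interval[of a b] by blast
  have "nrm (D t) \<le> (1 + 2 * pi) * B \<and> (\<forall>z. cmod (Q t z) \<le> (1 + 2 * pi) * B)" if "t \<in> {a..b}" for t
  proof -
    have "(1 + 2 * pi) * norm_X (Q t) \<le> (1 + 2 * pi) * B" using B(2)[OF that] by (intro mult_left_mono) auto
    moreover have "norm_X (Q t) \<le> (1 + 2 * pi) * norm_X (Q t)" using norm_X_nonneg[of "Q t"] by (simp add: algebra_simps)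
    ultimately show ?thesis using sup_le_norm_X[OF pp, of t] nrm_le_norm_X(2)[OF pp, of t] by (meson order_trans)
  qed
  moreover have "(1 + 2 * pi) * B \<ge> 1 * 1" using B by (intro mult_mono) auto
  ultimately show ?thesis by (intro exI[of _ "(1 + 2 * pi) * B"]) auto
qed

definition step where "step n = inverse (real (Suc n))"

lemma step: "0 < step n" "step n \<le> 1" by (auto simp: step_def field_simps)

lemma filterlim_step: "filterlim step (at_right 0) sequentially"
  unfolding step_def[abs_def]
  by (intro filterlim_compose[OF filterlim_inverse_at_right_top] filterlim_compose[OF filterlim_real_sequentially] filterlim_Suc)

lemma nrm_dq_D: "nrm (dq (step n) (Q t)) \<le> 2 * nrm (D t)"
  by (rule nrm_dq_le[OF pp step])

text \<open>The order one in \<open>h\<close>: the imaginary part of the correlation over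
  \<open>h\<close> tends to minus the momentum, while its time derivative
  \<open>- Re (flux h Q) / h\<close> is of order \<open>h\<close> by
  \<open>Re_flux_le\<close>.\<close>

lemma momentum_conserved: "Im (inner_per (D t) (Q t)) = Im (inner_per (D 0) (Q 0))"
proof -
  define G where "G n t = Im (inner_per (Q t) (\<lambda>z. Q t (z + step n))) / step n" for n t
  define G' where "G' n t = - Re (flux (step n) (Q t)) / step n" for n t
  have bound: "\<bar>G' n t\<bar> \<le> 4 * S^4 * step n" if S: "nrm (D t) \<le> S" "\<And>z. cmod (Q t z) \<le> S" for n t S
  proof -
    have "\<bar>G' n t\<bar> = \<bar>Re (flux (step n) (Q t))\<bar> / step n" using step[of n] by (simp add: G'_def)
    also have "\<dots> \<le> (S\<^sup>2 * (step n)\<^sup>2 * (nrm (dq (step n) (Q t)))\<^sup>2) / step n"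
      using step[of n] by (intro divide_right_mono Re_flux_le[OF pp S(2)]) auto
    also have "\<dots> = S\<^sup>2 * step n * (nrm (dq (step n) (Q t)))\<^sup>2" using step[of n] by (simp add: power2_eq_square)
    also have "\<dots> \<le> S\<^sup>2 * step n * (2 * S)\<^sup>2"
      using nrm_dq_D[of n t] S(1) step[of n] by (intro mult_left_mono power_mono l2_nonneg) auto
    finally show ?thesis by (simp add: power_mult_distrib power2_eq_square eval_nat_numeral mult_ac)
  qed
  have st: "step \<longlonglongrightarrow> 0" using filterlim_step by (simp add: filterlim_at)
  have "- Im (inner_per (D t) (Q t)) = - Im (inner_per (D 0) (Q 0))"
  proof (rule limit_conserved[of G G' "\<lambda>t. - Im (inner_per (D t) (Q t))"])
    fix n t
    have "((\<lambda>s. Im (inner_per (Q s) (\<lambda>z. Q s (z + step n)))) has_vector_derivative Im (- \<i> * flux (step n) (Q t))) (at t)"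
      by (rule bounded_linear.has_vector_derivative[OF bounded_linear_Im derivative_correlation])
    from has_vector_derivative_divide[OF this, of "step n"]
    show "(G n has_vector_derivative G' n t) (at t)" by (simp add: G_def[abs_def] G'_def)
  next
    fix a b
    obtain S where S: "S \<ge> 1" "\<And>t. t \<in> {a..b} \<Longrightarrow> nrm (D t) \<le> S \<and> (\<forall>z. cmod (Q t z) \<le> S)" using uniform_bound[of a b] by blast
    have "\<bar>G' n t\<bar> \<le> 4 * S^4" if "t \<in> {a..b}" for n t
    proof -
      have "\<bar>G' n t\<bar> \<le> 4 * S^4 * step n" using S(2)[OF that] by (intro bound) auto
      also have "\<dots> \<le> 4 * S^4 * 1" using step[of n] by (intro mult_left_mono) auto
      finally show ?thesis by simp
    qed
    then show "\<exists>B. \<forall>n. \<forall>t\<in>{a..b}. \<bar>G' n t\<bar> \<le> B" by blast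
  next
    fix t
    obtain S where S: "S \<ge> 1" "nrm (D t) \<le> S" "\<And>z. cmod (Q t z) \<le> S" using uniform_bound[of t t] by auto
    show "(\<lambda>n. G' n t) \<longlonglongrightarrow> 0"
    proof (rule Lim_null_comparison)
      show "\<forall>\<^sub>F n in sequentially. norm (G' n t) \<le> 4 * S^4 * step n" using bound[OF S(2,3)] by simp
      show "(\<lambda>n. 4 * S^4 * step n) \<longlonglongrightarrow> 0" by (rule tendsto_mult_right_zero[OF st])
    qed
    have "((\<lambda>h. inner_per (Q t) (dq h (Q t))) \<longlongrightarrow> inner_per (Q t) (D t)) (at_right 0)"
      by (intro ip_tendsto L2 L2_dq[OF ppairD(1)[OF pp]] nrm_dq_tendsto[OF pp]) (simp add: l2_def)
    from tendsto_Im[OF filterlim_compose[OF this filterlim_step]]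
    have "(\<lambda>n. Im (inner_per (Q t) (dq (step n) (Q t)))) \<longlonglongrightarrow> Im (inner_per (Q t) (D t))" .
    moreover have "Im (inner_per (Q t) (dq (step n) (Q t))) = G n t" for n
    proof -
      have s: "(\<lambda>z. Q t (z + step n)) \<in> L2_loc" using ppair_L2(1)[OF ppair_shift[OF pp]] .
      have "inner_per (Q t) (dq (step n) (Q t)) = inner_per (Q t) (\<lambda>z. Q t (z + step n) - Q t z) / of_real (step n)"
        using ip_cmult_right[of "Q t" "inverse (of_real (step n))" "\<lambda>z. Q t (z + step n) - Q t z"]
        by (simp add: dq_def[abs_def] divide_inverse mult.commute)
      also have "\<dots> = (inner_per (Q t) (\<lambda>z. Q t (z + step n)) - inner_per (Q t) (Q t)) / of_real (step n)"
        by (simp add: ip_diff_right L2 s)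
      finally show ?thesis by (simp add: G_def ip_self)
    qed
    moreover have "Im (inner_per (Q t) (D t)) = - Im (inner_per (D t) (Q t))"
      unfolding ip_cnj[symmetric, of "D t"] by simp
    ultimately show "(\<lambda>n. G n t) \<longlonglongrightarrow> - Im (inner_per (D t) (Q t))" by simp
  qed
  then show ?thesis by simp
qed

lemma derivative_quartic:
  "((\<lambda>s. quartic (Q s)) has_vector_derivative 8 * \<kappa>\<^sup>2 * Im (cross (Q t) (D t))) (at t)"
proof -
  define r where "r s = (LBINT z:{0..2*pi}. (cmod (Q t z))\<^sup>2 * (cmod (Q s z - Q t z))\<^sup>2 + ((cmod (Q s z))\<^sup>2 - (cmod (Q t z))\<^sup>2)\<^sup>2 / 2)" for s
  obtain S where S: "S \<ge> 1" "\<And>s. s \<in> {t-1..t+1} \<Longrightarrow> nrm (D s) \<le> S \<and> (\<forall>z. cmod (Q s z) \<le> S)"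
    using uniform_bound[of "t-1" "t+1"] by blast
  have eq: "quartic (Q s) = quartic (Q t) - 2 * Re (inner_per (Q t) (cub (Q t))) + 2 * Re (inner_per (Q s) (cub (Q t))) + r s" for s
    using quartic_diff[OF pp[of t] ppair_diff[OF pp[of s] pp[of t]]]
    by (simp add: r_def ip_diff_left L2)
  have "(r has_vector_derivative 0) (at t)"
  proof (rule quadratic_remainder[of t r "3 * S\<^sup>2"])
    fix s assume s: "\<bar>s - t\<bar> \<le> 1"
    have "\<bar>r s\<bar> \<le> 3 * S\<^sup>2 * (nrm (\<lambda>z. Q s z - Q t z))\<^sup>2"
      using quartic_remainder_le[OF pp[of t] ppair_diff[OF pp[of s] pp[of t]], of S] S(2)[of t] S(2)[of s] s
      by (auto simp: r_def abs_le_iff)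
    moreover have "r t = 0" by (simp add: r_def)
    ultimately show "norm (r s - r t) \<le> 3 * S\<^sup>2 * (nrm (\<lambda>z. Q s z - Q t z))\<^sup>2" by simp
  qed simp
  moreover have "((\<lambda>s. 2 * Re (inner_per (Q s) (cub (Q t)))) has_vector_derivative
      2 * Re (rhs p \<kappa> (Q t) (D t) (cub (Q t)) (\<lambda>z. 2 * of_real ((cmod (Q t z))\<^sup>2) * D t z + (Q t z)\<^sup>2 * cnj (D t z)))) (at t)"
    by (intro has_vector_derivative_mult_right bounded_linear.has_vector_derivative[OF bounded_linear_Re] derivative_ip ppair_cub pp)
  ultimately have "((\<lambda>s. quartic (Q t) - 2 * Re (inner_per (Q t) (cub (Q t))) + 2 * Re (inner_per (Q s) (cub (Q t))) + r s) has_vector_derivative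
      0 + 2 * (4 * \<kappa>\<^sup>2 * Im (cross (Q t) (D t))) + 0) (at t)"
    unfolding Re_rhs_cub[OF pp] by (intro has_vector_derivative_add has_vector_derivative_const)
  then show ?thesis unfolding eq[symmetric] by (simp add: mult.assoc)
qed

text \<open>The order two in \<open>h\<close>: as \<open>nrm (Q t)\<close> is conserved, the squared
  norm of the difference quotient is a function of the real part of the correlation and therefore
  differentiable in time. Its rate \<open>- 2 * Im (flux h Q) / h\<^sup>2\<close>, times
  \<open>4 * \<kappa>\<^sup>2\<close>, cancels that of \<open>quartic\<close> in the limit.\<close>

lemma energy_conserved: "4 * \<kappa>\<^sup>2 * (nrm (D t))\<^sup>2 + quartic (Q t) = 4 * \<kappa>\<^sup>2 * (nrm (D 0))\<^sup>2 + quartic (Q 0)"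
proof -
  define G where "G n t = 4 * \<kappa>\<^sup>2 * ((2 * (nrm (Q 0))\<^sup>2 - 2 * Re (inner_per (Q t) (\<lambda>z. Q t (z + step n)))) / (step n)\<^sup>2) + quartic (Q t)" for n t
  define G' where "G' n t = 4 * \<kappa>\<^sup>2 * ((0 - 2 * Im (flux (step n) (Q t))) / (step n)\<^sup>2) + 8 * \<kappa>\<^sup>2 * Im (cross (Q t) (D t))" for n t
  have G'_eq: "G' n t = 8 * \<kappa>\<^sup>2 * (Im (cross (Q t) (D t)) - Im (flux (step n) (Q t)) / (step n)\<^sup>2)" for n t
    by (simp add: G'_def algebra_simps)
  have G_eq: "G n t = 4 * \<kappa>\<^sup>2 * (nrm (dq (step n) (Q t)))\<^sup>2 + quartic (Q t)" for n t
  proof -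
    note sp = ppair_shift[OF pp, of t "step n"]
    note L = L2 ppair_L2[OF sp] ppair_L2[OF ppair_diff[OF sp pp]]
    have d: "dq (step n) (Q t) = (\<lambda>z. of_real (inverse (step n)) * (Q t (z + step n) - Q t z))"
      by (simp add: dq_def fun_eq_iff divide_inverse mult.commute)
    have "nrm (\<lambda>z. Q t (z + step n)) = nrm (Q t)"
      using ppair_per[OF pp] by (intro nrm_shift L2) auto
    then have s: "inner_per (\<lambda>z. Q t (z + step n)) (\<lambda>z. Q t (z + step n)) = of_real ((nrm (Q t))\<^sup>2)" by (simp add: ip_self)
    have "complex_of_real ((nrm (\<lambda>z. Q t (z + step n) - Q t z))\<^sup>2) = inner_per (\<lambda>z. Q t (z + step n) - Q t z) (\<lambda>z. Q t (z + step n) - Q t z)"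
      by (simp add: ip_self)
    also have "\<dots> = of_real (2 * (nrm (Q t))\<^sup>2) - (inner_per (Q t) (\<lambda>z. Q t (z + step n)) + cnj (inner_per (Q t) (\<lambda>z. Q t (z + step n))))"
      unfolding ip_cnj by (subst ip_diff_left[OF L(4,1,6)], subst (1 2) ip_diff_right) (simp_all add: L s ip_self)
    also have "\<dots> = of_real (2 * (nrm (Q 0))\<^sup>2 - 2 * Re (inner_per (Q t) (\<lambda>z. Q t (z + step n))))"
      unfolding complex_add_cnj norm_conserved[of t] by simp
    finally have "(nrm (\<lambda>z. Q t (z + step n) - Q t z))\<^sup>2 = 2 * (nrm (Q 0))\<^sup>2 - 2 * Re (inner_per (Q t) (\<lambda>z. Q t (z + step n)))"
      unfolding of_real_eq_iff .
    then show ?thesis unfolding d l2_cmult norm_of_real G_def using step[of n]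
      by (simp add: power_mult_distrib divide_inverse mult.commute power_inverse)
  qed
  show ?thesis
  proof (rule limit_conserved[of G G' "\<lambda>t. 4 * \<kappa>\<^sup>2 * (nrm (D t))\<^sup>2 + quartic (Q t)"])
    fix n t
    have "((\<lambda>s. Re (inner_per (Q s) (\<lambda>z. Q s (z + step n)))) has_vector_derivative Re (- \<i> * flux (step n) (Q t))) (at t)"
      by (rule bounded_linear.has_vector_derivative[OF bounded_linear_Re derivative_correlation])
    then have "((\<lambda>s. Re (inner_per (Q s) (\<lambda>z. Q s (z + step n)))) has_vector_derivative Im (flux (step n) (Q t))) (at t)" by simp
    then show "(G n has_vector_derivative G' n t) (at t)" unfolding G_def[abs_def] G'_def
      by (intro has_vector_derivative_add has_vector_derivative_mult_right has_vector_derivative_divide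
          has_vector_derivative_diff has_vector_derivative_const derivative_quartic)
  next
    fix a b
    obtain S where S: "S \<ge> 1" "\<And>t. t \<in> {a..b} \<Longrightarrow> nrm (D t) \<le> S \<and> (\<forall>z. cmod (Q t z) \<le> S)" using uniform_bound[of a b] by blast
    have "\<bar>G' n t\<bar> \<le> 8 * \<kappa>\<^sup>2 * (S\<^sup>2 * S\<^sup>2 + (S\<^sup>2 * (2 * S)\<^sup>2 + 2 * 1 * S * S * (2 * S)\<^sup>2))" if "t \<in> {a..b}" for n t
    proof -
      have S': "nrm (D t) \<le> S" "\<And>z. cmod (Q t z) \<le> S" using S(2)[OF that] by auto
      note c = ppairD(1)[OF pp[of t], of UNIV]
      have d2: "(nrm (dq (step n) (Q t)))\<^sup>2 \<le> (2 * S)\<^sup>2"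
        using nrm_dq_D[of n t] S' by (intro power_mono l2_nonneg) simp
      have "\<bar>Im (cross (Q t) (D t))\<bar> \<le> S\<^sup>2 * S\<^sup>2"
        by (rule order_trans[OF abs_Im_le_cmod order_trans[OF cross_le[OF c S'(2) L2(2)] mult_left_mono[OF power_mono[OF S'(1) l2_nonneg]]]]) simp
      moreover have "\<bar>Im (cross (Q t) (dq (step n) (Q t)))\<bar> \<le> S\<^sup>2 * (2 * S)\<^sup>2"
        by (rule order_trans[OF abs_Im_le_cmod order_trans[OF cross_le[OF c S'(2) L2_dq[OF c]] mult_left_mono[OF d2]]]) simp
      moreover have "\<bar>Im (flux (step n) (Q t)) / (step n)\<^sup>2 - Im (cross (Q t) (dq (step n) (Q t)))\<bar> \<le> 2 * 1 * S * S * (2 * S)\<^sup>2"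
      proof (rule order_trans[OF Im_flux_approx[OF pp S'(2) step]])
        show "2 * sqrt (step n) * nrm (D t) * S * (nrm (dq (step n) (Q t)))\<^sup>2 \<le> 2 * 1 * S * S * (2 * S)\<^sup>2"
          using S(1) S' step[of n] by (intro mult_mono[OF mult_mono[OF mult_mono[OF mult_left_mono]]] d2) (auto simp: l2_nonneg)
      qed
      ultimately have "\<bar>Im (cross (Q t) (D t)) - Im (flux (step n) (Q t)) / (step n)\<^sup>2\<bar> \<le> S\<^sup>2 * S\<^sup>2 + (S\<^sup>2 * (2 * S)\<^sup>2 + 2 * 1 * S * S * (2 * S)\<^sup>2)"
        by linarith
      then show ?thesis unfolding G'_eq abs_mult by (simp add: mult_left_mono)
    qed
    then show "\<exists>B. \<forall>n. \<forall>t\<in>{a..b}. \<bar>G' n t\<bar> \<le> B" by blast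
  next
    fix t
    have "(\<lambda>n. Im (flux (step n) (Q t)) / (step n)\<^sup>2) \<longlonglongrightarrow> Im (cross (Q t) (D t))"
      by (rule filterlim_compose[OF Im_flux_tendsto[OF pp] filterlim_step])
    then have "(\<lambda>n. 8 * \<kappa>\<^sup>2 * (Im (cross (Q t) (D t)) - Im (flux (step n) (Q t)) / (step n)\<^sup>2)) \<longlonglongrightarrow> 8 * \<kappa>\<^sup>2 * (Im (cross (Q t) (D t)) - Im (cross (Q t) (D t)))"
      by (intro tendsto_intros)
    then show "(\<lambda>n. G' n t) \<longlonglongrightarrow> 0" by (simp add: G'_eq)
    have "((\<lambda>h. nrm (dq h (Q t))) \<longlongrightarrow> nrm (D t)) (at_right 0)"
      by (intro nrm_tendsto L2 L2_dq[OF ppairD(1)[OF pp]] nrm_dq_tendsto[OF pp])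
    from filterlim_compose[OF this filterlim_step]
    show "(\<lambda>n. G n t) \<longlonglongrightarrow> 4 * \<kappa>\<^sup>2 * (nrm (D t))\<^sup>2 + quartic (Q t)"
      unfolding G_eq by (intro tendsto_intros)
  qed
qed

end

section \<open>Orbital stability of coercive profiles\<close>

lemma vector_lipschitz:
  fixes f :: "real \<Rightarrow> 'a::real_normed_vector"
  assumes "convex S" "\<And>x. x \<in> S \<Longrightarrow> (f has_vector_derivative f' x) (at x)" "\<And>x. x \<in> S \<Longrightarrow> norm (f' x) \<le> B"
    and "x \<in> S" "y \<in> S"
  shows "norm (f x - f y) \<le> B * \<bar>x - y\<bar>"
proof -
  have "norm (f x - f y) \<le> B * norm (x - y)"
  proof (rule differentiable_bound[OF assms(1) _ _ assms(4,5), where f' = "\<lambda>x h. h *\<^sub>R f' x"])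
    fix x assume x: "x \<in> S"
    show "(f has_derivative (\<lambda>h. h *\<^sub>R f' x)) (at x within S)"
      using assms(2)[OF x] by (simp add: has_vector_derivative_def has_derivative_at_withinI)
    show "onorm (\<lambda>h. h *\<^sub>R f' x) \<le> B"
      using mult_right_mono[OF assms(3)[OF x] abs_ge_zero] by (intro onorm_le) (simp add: mult.commute)
  qed
  then show ?thesis by simp
qed

lemma taylor_remainder_2:
  fixes F :: "real \<Rightarrow> 'a::real_normed_vector"
  assumes F: "\<And>s. (F has_vector_derivative F1 s) (at s)" "\<And>s. (F1 has_vector_derivative F2 s) (at s)"
    and B: "\<And>s. norm (F2 s) \<le> B"
  shows "norm (F s - F 0 - s *\<^sub>R F1 0) \<le> B * s\<^sup>2"
proof -
  have B0: "B \<ge> 0" using B[of 0] norm_ge_zero order_trans by blast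
  define G where "G x = F x - x *\<^sub>R F1 0" for x
  have dG: "(G has_vector_derivative F1 x - 1 *\<^sub>R F1 0) (at x)" for x
    unfolding G_def[abs_def]
    by (intro has_vector_derivative_diff F(1) bounded_linear.has_vector_derivative[OF bounded_linear_scaleR_left] has_vector_derivative_id)
  have "norm (G s - G 0) \<le> (B * \<bar>s\<bar>) * \<bar>s - 0\<bar>"
  proof (rule vector_lipschitz[OF convex_closed_segment[of 0 s] dG])
    fix x assume x: "x \<in> closed_segment 0 s"
    have "norm (F1 x - F1 0) \<le> B * \<bar>x - 0\<bar>" by (rule vector_lipschitz[OF convex_UNIV F(2) B]) auto
    also have "\<dots> \<le> B * \<bar>s\<bar>" using x B0 by (intro mult_left_mono) (auto simp: closed_segment_eq_real_ivl split: if_splits)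
    finally show "norm (F1 x - 1 *\<^sub>R F1 0) \<le> B * \<bar>s\<bar>" by simp
  qed auto
  then show ?thesis by (simp add: G_def algebra_simps power2_eq_square)
qed

lemma norm_X_le_sup:
  assumes u: "ppair u g" and B: "\<And>z. cmod (u z) \<le> B" "\<And>z. cmod (g z) \<le> B"
  shows "norm_X u \<le> 2 * sqrt (2 * pi) * B"
proof -
  have B0: "B \<ge> 0" using B(1)[of 0] norm_ge_zero order_trans by blast
  have "nrm u \<le> B * sqrt (2 * pi)" "nrm g \<le> B * sqrt (2 * pi)"
    using l2_le_sup[of _ 0 "2 * pi" B] ppair_L2[OF u] B B0 by auto
  then show ?thesis using norm_X_le[OF u] by (simp add: algebra_simps)
qed

lemma nrm_add_sq:
  assumes "f \<in> L2_loc" "g \<in> L2_loc"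
  shows "(nrm (\<lambda>z. f z + g z))\<^sup>2 = (nrm f)\<^sup>2 + 2 * Re (inner_per g f) + (nrm g)\<^sup>2"
proof -
  have "complex_of_real ((nrm (\<lambda>z. f z + g z))\<^sup>2) = inner_per f f + (inner_per g f + cnj (inner_per g f)) + inner_per g g"
    unfolding ip_self[symmetric] ip_cnj by (simp add: ip_add_left ip_add_right assms L2_loc_add)
  also have "\<dots> = complex_of_real ((nrm f)\<^sup>2 + 2 * Re (inner_per g f) + (nrm g)\<^sup>2)"
    unfolding complex_add_cnj by (simp add: ip_self)
  finally show ?thesis unfolding of_real_eq_iff .
qed

lemma quartic_phase_shift:
  assumes u: "ppair u g" and l: "cmod l = 1"
  shows "quartic (\<lambda>z. l * u (z + h)) = quartic u"
proof -
  have c: "continuous_on UNIV u" by (rule ppairD(1)[OF u])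
  have "quartic (\<lambda>z. l * u (z + h)) = (LBINT z:{0..2*pi}. (\<lambda>z. (cmod (u z))^4 / 2) (z + h))"
    by (simp add: quartic_def norm_mult l)
  also have "\<dots> = quartic u" unfolding quartic_def
  proof (rule integral_AE_period_shift)
    show "(\<lambda>z. (cmod (u z))^4 / 2) \<in> borel_measurable borel"
      using borel_measurable_continuous_onI[OF c] by measurable
    show "set_integrable lborel {a..b} (\<lambda>z. (cmod (u z))^4 / 2)" for a b
      by (intro set_integrable_continuous continuous_intros c) auto
  qed (auto simp: ppair_per[OF u])
  finally show ?thesis .
qed

lemma derivative_phase_shift:
  fixes f f' :: "real \<Rightarrow> complex" and d e :: real
  assumes f: "\<And>z. (f has_vector_derivative f' z) (at z)"
  shows "((\<lambda>s. exp (\<i> * of_real (e * s)) * f (z + d * s)) has_vector_derivative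
    exp (\<i> * of_real (e * s)) * (of_real d * f' (z + d * s) + \<i> * of_real e * f (z + d * s))) (at s)"
proof -
  have 1: "((\<lambda>s. exp (\<i> * of_real (e * s))) has_vector_derivative \<i> * of_real e * exp (\<i> * of_real (e * s))) (at s)"
  proof -
    have "((\<lambda>w. exp (\<i> * (of_real e * w))) has_field_derivative \<i> * of_real e * exp (\<i> * (of_real e * of_real s))) (at (of_real s))"
      by (auto intro!: derivative_eq_intros)
    from has_vector_derivative_real_field[OF this] show ?thesis by simp
  qed
  have "((\<lambda>s. z + d * s) has_real_derivative d) (at s)" by (auto intro!: derivative_eq_intros)
  then have "((\<lambda>s. z + d * s) has_vector_derivative d) (at s)" by (simp add: has_real_derivative_iff_has_vector_derivative)
  from vector_diff_chain_at[OF this f]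
  have 2: "((\<lambda>s. f (z + d * s)) has_vector_derivative d *\<^sub>R f' (z + d * s)) (at s)" by (simp add: o_def)
  show ?thesis using has_vector_derivative_mult[OF 1 2] by (simp add: algebra_simps scaleR_conv_of_real)
qed

text \<open>Energy plus multiples of momentum and mass. The derivative is a separate argument so
  that any representative can be supplied.\<close>

definition Lam :: "real \<Rightarrow> real \<Rightarrow> real \<Rightarrow> (real \<Rightarrow> complex) \<Rightarrow> (real \<Rightarrow> complex) \<Rightarrow> real" where
  "Lam \<kappa> a b u g = 4 * \<kappa>\<^sup>2 * (nrm g)\<^sup>2 + quartic u + a * Im (inner_per g u) + b * (nrm u)\<^sup>2"

text \<open>Half the second variation of \<open>Lam\<close> at \<open>P\<close>; the cubic nonlinearity contributes
  \<open>|P|\<^sup>2 |v|\<^sup>2 + 2 (Re (cnj P v))\<^sup>2 = 2 |P v|\<^sup>2 + Re ((cnj P v)\<^sup>2)\<close>.\<close>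

definition Hess :: "real \<Rightarrow> real \<Rightarrow> real \<Rightarrow> (real \<Rightarrow> complex) \<Rightarrow> (real \<Rightarrow> complex) \<Rightarrow> (real \<Rightarrow> complex) \<Rightarrow> real" where
  "Hess \<kappa> a b P v k = 4 * \<kappa>\<^sup>2 * (nrm k)\<^sup>2 + (2 * (nrm (\<lambda>z. P z * v z))\<^sup>2 + Re (cross P v)) + a * Im (inner_per k v) + b * (nrm v)\<^sup>2"

text \<open>Three derivatives, because the orbit is expanded to second order in the norm of
  \<open>X\<close>, which itself takes one derivative.\<close>

locale smooth_profile =
  fixes P P1 P2 P3 :: "real \<Rightarrow> complex" and K :: real
  assumes dP: "\<And>z. (P has_vector_derivative P1 z) (at z)" and dP1: "\<And>z. (P1 has_vector_derivative P2 z) (at z)"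
    and dP2: "\<And>z. (P2 has_vector_derivative P3 z) (at z)" and per: "\<And>z. P (z + 2 * pi) = P z"
    and K: "\<And>z. cmod (P z) \<le> K" "\<And>z. cmod (P1 z) \<le> K" "\<And>z. cmod (P2 z) \<le> K" "\<And>z. cmod (P3 z) \<le> K"
begin

lemma K_nonneg: "K \<ge> 0" using K(1)[of 0] norm_ge_zero order_trans by blast

lemma cont: "continuous_on A P" "continuous_on A P1" "continuous_on A P2"
  using dP dP1 dP2 by (auto intro!: continuous_at_imp_continuous_on has_vector_derivative_continuous)

lemma per1: "P1 (z + 2 * pi) = P1 z"
proof (rule vector_derivative_unique_at)
  show "(P has_vector_derivative P1 (z + 2 * pi)) (at z)"
    using has_vector_derivative_shift[of P "P1 (z + 2 * pi)" z "2 * pi"] dP per by simp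
qed (rule dP)

lemma pP: "ppair P P1" and pP1: "ppair P1 P2"
  using wpair_C1[OF dP cont(2)] wpair_C1[OF dP1 cont(3)] per per1 by (auto simp: ppair_def)

lemma LP: "P \<in> L2_loc" "P1 \<in> L2_loc" "P2 \<in> L2_loc" "cub P \<in> L2_loc"
  using ppair_L2[OF pP] ppair_L2[OF pP1] ppair_L2(1)[OF ppair_cub[OF pP]] by auto

definition orb where "orb \<phi> \<xi> z = exp (\<i> * of_real \<phi>) * P (z - \<xi>)"

lemma orb_pair: "ppair (orb \<phi> \<xi>) (\<lambda>z. exp (\<i> * of_real \<phi>) * P1 (z - \<xi>))"
  using ppair_cmult[OF ppair_shift[OF pP, of "- \<xi>"]] by (simp add: orb_def[abs_def])

lemma orb_00: "orb 0 0 = P" by (simp add: orb_def fun_eq_iff)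

lemma orbit_tangent:
  fixes d e s :: real
  shows "norm_X (\<lambda>z. orb (e * s) (- d * s) z - P z - of_real s * (of_real d * P1 z + \<i> * of_real e * P z))
    \<le> 2 * sqrt (2 * pi) * (K * (\<bar>d\<bar> + \<bar>e\<bar>)\<^sup>2 * s\<^sup>2)" (is "norm_X ?f \<le> _")
proof (rule norm_X_le_sup)
  have gen: "cmod (exp (\<i> * of_real (e * s)) * f (z + d * s) - f z - of_real s * (of_real d * f1 z + \<i> * of_real e * f z)) \<le> K * (\<bar>d\<bar> + \<bar>e\<bar>)\<^sup>2 * s\<^sup>2"
    if f: "\<And>z. (f has_vector_derivative f1 z) (at z)" "\<And>z. (f1 has_vector_derivative f2 z) (at z)"
      and b: "\<And>z. cmod (f z) \<le> K" "\<And>z. cmod (f1 z) \<le> K" "\<And>z. cmod (f2 z) \<le> K" for f f1 f2 z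
  proof -
    define g where "g z = of_real d * f1 z + \<i> * of_real e * f z" for z
    define g1 where "g1 z = of_real d * f2 z + \<i> * of_real e * f1 z" for z
    have dg: "(g has_vector_derivative g1 z) (at z)" for z
      unfolding g_def[abs_def] g1_def by (intro has_vector_derivative_add has_vector_derivative_mult_right f)
    have gK: "cmod (of_real d * x + \<i> * of_real e * y) \<le> (\<bar>d\<bar> + \<bar>e\<bar>) * M" if "cmod x \<le> M" "cmod y \<le> M" for x y M
    proof -
      have "cmod (of_real d * x + \<i> * of_real e * y) \<le> cmod (of_real d * x) + cmod (\<i> * of_real e * y)" by (rule norm_triangle_ineq)
      also have "\<dots> = \<bar>d\<bar> * cmod x + \<bar>e\<bar> * cmod y" by (simp add: norm_mult)
      also have "\<dots> \<le> \<bar>d\<bar> * M + \<bar>e\<bar> * M" using that by (intro add_mono mult_left_mono) auto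
      finally show ?thesis by (simp add: algebra_simps)
    qed
    have "cmod (exp (\<i> * of_real (e * s)) * f (z + d * s) - exp (\<i> * of_real (e * 0)) * f (z + d * 0)
      - s *\<^sub>R (exp (\<i> * of_real (e * 0)) * g (z + d * 0))) \<le> (\<bar>d\<bar> + \<bar>e\<bar>) * ((\<bar>d\<bar> + \<bar>e\<bar>) * K) * s\<^sup>2"
    proof (rule taylor_remainder_2)
      show "((\<lambda>s. exp (\<i> * of_real (e * s)) * f (z + d * s)) has_vector_derivative exp (\<i> * of_real (e * s)) * g (z + d * s)) (at s)" for s
        unfolding g_def by (rule derivative_phase_shift[OF f(1)])
      show "((\<lambda>s. exp (\<i> * of_real (e * s)) * g (z + d * s)) has_vector_derivative
        exp (\<i> * of_real (e * s)) * (of_real d * g1 (z + d * s) + \<i> * of_real e * g (z + d * s))) (at s)" for s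
        by (rule derivative_phase_shift[OF dg])
      show "cmod (exp (\<i> * of_real (e * s)) * (of_real d * g1 (z + d * s) + \<i> * of_real e * g (z + d * s))) \<le> (\<bar>d\<bar> + \<bar>e\<bar>) * ((\<bar>d\<bar> + \<bar>e\<bar>) * K)" for s
        unfolding norm_mult norm_exp_i_times mult_1_left
        by (intro gK; unfold g_def g1_def; intro gK b)
    qed
    then show ?thesis by (simp add: g_def scaleR_conv_of_real power2_eq_square mult_ac)
  qed
  note p = ppair_diff[OF ppair_diff[OF orb_pair[of "e * s" "- d * s"] pP] ppair_cmult[OF ppair_add[OF ppair_cmult[OF pP1, of "of_real d"] ppair_cmult[OF pP, of "\<i> * of_real e"]], of "of_real s"]]
  show "ppair ?f (\<lambda>z. exp (\<i> * of_real (e * s)) * P1 (z - - d * s) - P1 z - of_real s * (of_real d * P2 z + \<i> * of_real e * P1 z))"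
    by (rule p)
  show "cmod (?f z) \<le> K * (\<bar>d\<bar> + \<bar>e\<bar>)\<^sup>2 * s\<^sup>2" for z
    using gen[OF dP dP1 K(1,2,3), of z] by (simp add: orb_def)
  show "cmod (exp (\<i> * of_real (e * s)) * P1 (z - - d * s) - P1 z - of_real s * (of_real d * P2 z + \<i> * of_real e * P1 z)) \<le> K * (\<bar>d\<bar> + \<bar>e\<bar>)\<^sup>2 * s\<^sup>2" for z
    using gen[OF dP1 dP2 K(2,3,4), of z] by simp
qed

text \<open>With the tangent vector \<open>T\<close>, a step \<open>s\<close> along the orbit turns
  \<open>v\<close> into \<open>v - s T\<close> up to order \<open>s^2\<close>, and
  \<open>v - s T\<close> is the convex combination \<open>(1 - s) v + s (v - T)\<close>. Convexity
  of the norm, division by \<open>s\<close> and the limit at 0 give the claim. This takes the place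
  of orthogonality conditions on modulation parameters.\<close>

lemma nearest_imp_tangent_nearest:
  assumes v: "ppair v k" and min: "\<And>\<phi> \<xi>. norm_X v \<le> norm_X (\<lambda>z. v z + P z - orb \<phi> \<xi> z)"
  shows "norm_X v \<le> norm_X (\<lambda>z. v z - (of_real d * P1 z + \<i> * of_real e * P z))" (is "_ \<le> norm_X ?w")
proof -
  define T where "T z = of_real d * P1 z + \<i> * of_real e * P z" for z
  have pT: "ppair T (\<lambda>z. of_real d * P2 z + \<i> * of_real e * P1 z)"
    unfolding T_def by (intro ppair_add ppair_cmult pP pP1)
  note pw = ppair_diff[OF v pT]
  define B where "B = 2 * sqrt (2 * pi) * (K * (\<bar>d\<bar> + \<bar>e\<bar>)\<^sup>2)"
  have "norm_X v \<le> norm_X (\<lambda>z. v z - T z) + B * s" if s: "0 < s" "s \<le> 1" for s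
  proof -
    define f where "f z = orb (e * s) (- d * s) z - P z - of_real s * T z" for z
    note pf = ppair_diff[OF ppair_diff[OF orb_pair[of "e * s" "- d * s"] pP] ppair_cmult[OF pT, of "of_real s"]]
    have f: "norm_X f \<le> B * s\<^sup>2" using orbit_tangent[of e s d] unfolding f_def T_def B_def by (simp add: mult.assoc)
    have eq: "(\<lambda>z. v z + P z - orb (e * s) (- d * s) z) = (\<lambda>z. (of_real (1 - s) * v z + of_real s * (v z - T z)) - f z)"
      by (simp add: f_def fun_eq_iff algebra_simps)
    have "norm_X v \<le> norm_X (\<lambda>z. (of_real (1 - s) * v z + of_real s * (v z - T z)) - f z)"
      using min[of "e * s" "- d * s"] unfolding eq .
    also have "\<dots> \<le> norm_X (\<lambda>z. of_real (1 - s) * v z + of_real s * (v z - T z)) + norm_X f"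
      unfolding f_def by (rule norm_X_triangle_diff[OF ppair_add[OF ppair_cmult[OF v] ppair_cmult[OF pw]] pf])
    also have "norm_X (\<lambda>z. of_real (1 - s) * v z + of_real s * (v z - T z)) \<le> norm_X (\<lambda>z. of_real (1 - s) * v z) + norm_X (\<lambda>z. of_real s * (v z - T z))"
      by (rule norm_X_triangle[OF ppair_cmult[OF v] ppair_cmult[OF pw]])
    also have "\<dots> = (1 - s) * norm_X v + s * norm_X (\<lambda>z. v z - T z)"
      unfolding norm_X_cmult[OF v] norm_X_cmult[OF pw] norm_of_real using s by simp
    finally have "norm_X v \<le> (1 - s) * norm_X v + s * norm_X (\<lambda>z. v z - T z) + B * s\<^sup>2" using f by simp
    then have "s * norm_X v \<le> s * (norm_X (\<lambda>z. v z - T z) + B * s)" by (simp add: algebra_simps power2_eq_square)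
    then show ?thesis using s by simp
  qed
  moreover have "((\<lambda>s. norm_X (\<lambda>z. v z - T z) + B * s) \<longlongrightarrow> norm_X (\<lambda>z. v z - T z) + B * 0) (at_right 0)"
    by (intro tendsto_intros)
  moreover have "\<forall>\<^sub>F s in at_right (0::real). 0 < s \<and> s \<le> 1"
    unfolding eventually_at_right_field by (intro exI[of _ 1]) auto
  ultimately have "norm_X v \<le> norm_X (\<lambda>z. v z - T z) + B * 0"
    by (intro tendsto_lowerbound) (auto elim: eventually_mono)
  then show ?thesis by (simp add: T_def)
qed

lemma orbit_lipschitz:
  "norm_X (\<lambda>z. orb \<phi> \<xi> z - orb \<phi>' \<xi>' z) \<le> 2 * sqrt (2 * pi) * (K * (\<bar>\<phi> - \<phi>'\<bar> + \<bar>\<xi> - \<xi>'\<bar>))"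
proof (rule norm_X_le_sup[OF ppair_diff[OF orb_pair orb_pair]])
  have gen: "cmod (exp (\<i> * of_real \<phi>) * f (z - \<xi>) - exp (\<i> * of_real \<phi>') * f (z - \<xi>')) \<le> K * (\<bar>\<phi> - \<phi>'\<bar> + \<bar>\<xi> - \<xi>'\<bar>)"
    if f: "\<And>z. (f has_vector_derivative f1 z) (at z)" and b: "\<And>z. cmod (f z) \<le> K" "\<And>z. cmod (f1 z) \<le> K" for f f1 z
  proof -
    have l: "cmod (exp (\<i> * of_real \<phi>) - exp (\<i> * of_real \<phi>')) \<le> 1 * \<bar>\<phi> - \<phi>'\<bar>"
    proof (rule vector_lipschitz[OF convex_UNIV])
      fix s :: real
      show "((\<lambda>s. exp (\<i> * of_real s)) has_vector_derivative \<i> * exp (\<i> * of_real s)) (at s)"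
        using derivative_phase_shift[of "\<lambda>_. 1" "\<lambda>_. 0" 1 0 0 s] by (simp add: mult.commute)
    qed (auto simp: norm_mult)
    have "cmod (f (z - \<xi>) - f (z - \<xi>')) \<le> K * \<bar>(z - \<xi>) - (z - \<xi>')\<bar>"
      by (rule vector_lipschitz[OF convex_UNIV f b(2)]) auto
    then have l2: "cmod (f (z - \<xi>) - f (z - \<xi>')) \<le> K * \<bar>\<xi> - \<xi>'\<bar>" by (simp add: abs_minus_commute)
    have "exp (\<i> * of_real \<phi>) * f (z - \<xi>) - exp (\<i> * of_real \<phi>') * f (z - \<xi>')
      = (exp (\<i> * of_real \<phi>) - exp (\<i> * of_real \<phi>')) * f (z - \<xi>) + exp (\<i> * of_real \<phi>') * (f (z - \<xi>) - f (z - \<xi>'))"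
      by (simp add: algebra_simps)
    also have "cmod \<dots> \<le> cmod (exp (\<i> * of_real \<phi>) - exp (\<i> * of_real \<phi>')) * cmod (f (z - \<xi>)) + cmod (f (z - \<xi>) - f (z - \<xi>'))"
      by (rule order_trans[OF norm_triangle_ineq]) (simp add: norm_mult)
    also have "\<dots> \<le> (1 * \<bar>\<phi> - \<phi>'\<bar>) * K + K * \<bar>\<xi> - \<xi>'\<bar>"
      by (intro add_mono mult_mono l l2 b) auto
    finally show ?thesis by (simp add: algebra_simps)
  qed
  show "cmod (orb \<phi> \<xi> z - orb \<phi>' \<xi>' z) \<le> K * (\<bar>\<phi> - \<phi>'\<bar> + \<bar>\<xi> - \<xi>'\<bar>)" for z
    unfolding orb_def by (rule gen[OF dP K(1,2)])
  show "cmod (exp (\<i> * of_real \<phi>) * P1 (z - \<xi>) - exp (\<i> * of_real \<phi>') * P1 (z - \<xi>')) \<le> K * (\<bar>\<phi> - \<phi>'\<bar> + \<bar>\<xi> - \<xi>'\<bar>)" for z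
    by (rule gen[OF dP1 K(2,3)])
qed

end

section \<open>Second-order expansion of the conserved functional\<close>

context smooth_profile
begin

lemma nrm_P_mult_le: "v \<in> L2_loc \<Longrightarrow> nrm (\<lambda>z. P z * v z) \<le> K * nrm v"
proof -
  assume v: "v \<in> L2_loc"
  have "nrm (\<lambda>z. P z * v z) \<le> nrm (\<lambda>z. complex_of_real K * v z)"
  proof (rule l2_mono[OF L2_loc_mult_continuous[OF cont(1) v] L2_loc_cmult[OF v]])
    fix z show "cmod (P z * v z) \<le> cmod (complex_of_real K * v z)"
      unfolding norm_mult norm_of_real using K(1)[of z] by (intro mult_right_mono) auto
  qed
  then show ?thesis unfolding l2_cmult norm_of_real using K_nonneg by simp
qed

lemma Hess_le:
  assumes v: "ppair v k"
  shows "\<bar>Hess \<kappa> a b P v k\<bar> \<le> (4 * \<kappa>\<^sup>2 + 3 * K\<^sup>2 + \<bar>a\<bar> + \<bar>b\<bar>) * (norm_X v)\<^sup>2"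
proof -
  note L = ppair_L2[OF v] and n = nrm_le_norm_X[OF v]
  have q: "(nrm v)\<^sup>2 \<le> (norm_X v)\<^sup>2" "(nrm k)\<^sup>2 \<le> (norm_X v)\<^sup>2" using n by (auto intro!: power_mono simp: l2_nonneg)
  have 1: "(nrm (\<lambda>z. P z * v z))\<^sup>2 \<le> K\<^sup>2 * (norm_X v)\<^sup>2"
    using power_mono[OF order_trans[OF nrm_P_mult_le[OF L(1)] mult_left_mono[OF n(1) K_nonneg]] l2_nonneg, of 2] by (simp add: power_mult_distrib)
  have 2: "\<bar>Re (cross P v)\<bar> \<le> K\<^sup>2 * (norm_X v)\<^sup>2"
    by (rule order_trans[OF abs_Re_le_cmod order_trans[OF cross_le[OF cont(1) K(1) L(1)] mult_left_mono[OF q(1)]]]) simp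
  have 3: "\<bar>Im (inner_per k v)\<bar> \<le> (norm_X v)\<^sup>2"
    using order_trans[OF abs_Im_le_cmod order_trans[OF ip_bound[OF L(2,1)] mult_mono[OF n(2,1)]]] norm_X_nonneg l2_nonneg
    by (simp add: power2_eq_square)
  have 4: "\<bar>a * Im (inner_per k v)\<bar> \<le> \<bar>a\<bar> * (norm_X v)\<^sup>2" "\<bar>b * (nrm v)\<^sup>2\<bar> \<le> \<bar>b\<bar> * (norm_X v)\<^sup>2"
    "4 * \<kappa>\<^sup>2 * (nrm k)\<^sup>2 \<le> 4 * \<kappa>\<^sup>2 * (norm_X v)\<^sup>2"
    unfolding abs_mult using 3 q by (auto intro!: mult_left_mono)
  have 5: "0 \<le> 4 * \<kappa>\<^sup>2 * (nrm k)\<^sup>2" "0 \<le> (nrm (\<lambda>z. P z * v z))\<^sup>2" by auto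
  have "\<bar>Hess \<kappa> a b P v k\<bar> \<le> 4 * \<kappa>\<^sup>2 * (norm_X v)\<^sup>2 + (2 * (K\<^sup>2 * (norm_X v)\<^sup>2) + K\<^sup>2 * (norm_X v)\<^sup>2) + \<bar>a\<bar> * (norm_X v)\<^sup>2 + \<bar>b\<bar> * (norm_X v)\<^sup>2"
    unfolding Hess_def using 1 2 4 5 by linarith
  then show ?thesis by (simp add: algebra_simps)
qed

text \<open>Needed to pass from continuously differentiable perturbations, for which coercivity is
  shown, to all of \<open>X\<close>.\<close>

lemma Hess_tendsto:
  assumes v: "ppair v k" and w: "\<And>n. ppair (w n) (w' n)"
    and lim: "((\<lambda>n. norm_X (\<lambda>z. w n z - v z)) \<longlongrightarrow> 0) net"
  shows "((\<lambda>n. Hess \<kappa> a b P (w n) (w' n)) \<longlongrightarrow> Hess \<kappa> a b P v k) net"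
    "((\<lambda>n. inner_per (w n) P) \<longlongrightarrow> inner_per v P) net" "((\<lambda>n. inner_per P1 (w n)) \<longlongrightarrow> inner_per P1 v) net"
proof -
  note Lv = ppair_L2[OF v] and Lw = ppair_L2[OF w]
  have n0: "((\<lambda>n. nrm (\<lambda>z. w n z - v z)) \<longlongrightarrow> 0) net" "((\<lambda>n. nrm (\<lambda>z. w' n z - k z)) \<longlongrightarrow> 0) net"
    by (rule Lim_null_comparison[OF always_eventually lim], use nrm_le_norm_X[OF ppair_diff[OF w v]] l2_nonneg in auto)+
  have P0: "((\<lambda>n. nrm (\<lambda>z. P z * w n z - P z * v z)) \<longlongrightarrow> 0) net"
  proof (rule Lim_null_comparison[OF always_eventually tendsto_mult_right_zero[OF n0(1)]], rule allI)
    fix n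
    have "(\<lambda>z. P z * w n z - P z * v z) = (\<lambda>z. P z * (w n z - v z))" by (simp add: algebra_simps)
    then show "norm (nrm (\<lambda>z. P z * w n z - P z * v z)) \<le> K * nrm (\<lambda>z. w n z - v z)"
      using nrm_P_mult_le[OF L2_loc_diff[OF Lw(1)[of n] Lv(1)]] by (simp add: l2_nonneg)
  qed
  have s: "((\<lambda>n. nrm (\<lambda>z. w n z + v z)) \<longlongrightarrow> nrm (\<lambda>z. v z + v z)) net"
    using n0(1) by (intro nrm_tendsto L2_loc_add Lw Lv) simp
  have c: "((\<lambda>n. cross P (w n)) \<longlongrightarrow> cross P v) net"
  proof (rule Lim_null[THEN iffD2], rule Lim_null_comparison[OF always_eventually], rule allI)
    show "norm (cross P (w n) - cross P v) \<le> K\<^sup>2 * (nrm (\<lambda>z. w n z - v z) * nrm (\<lambda>z. w n z + v z))" for n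
      by (rule cross_diff_le[OF cont(1) K(1) Lw(1) Lv(1)])
    show "((\<lambda>n. K\<^sup>2 * (nrm (\<lambda>z. w n z - v z) * nrm (\<lambda>z. w n z + v z))) \<longlongrightarrow> 0) net"
      using tendsto_mult_right_zero[OF tendsto_mult[OF n0(1) s, simplified]] by simp
  qed
  show "((\<lambda>n. Hess \<kappa> a b P (w n) (w' n)) \<longlongrightarrow> Hess \<kappa> a b P v k) net" unfolding Hess_def
    by (intro tendsto_add tendsto_mult_left tendsto_power tendsto_Re tendsto_Im c
        nrm_tendsto ip_tendsto Lv Lw n0 P0 L2_loc_mult_continuous cont)
  show "((\<lambda>n. inner_per (w n) P) \<longlongrightarrow> inner_per v P) net" "((\<lambda>n. inner_per P1 (w n)) \<longlongrightarrow> inner_per P1 v) net"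
    by (intro ip_tendsto Lv Lw n0 LP; simp add: l2_def)+
qed

text \<open>The cubic and quartic terms in \<open>v\<close> of the quartic energy at
  \<open>P + v\<close>.\<close>

definition remainder where
  "remainder v = (LBINT z:{0..2*pi}. 2 * Re (v z * cnj (P z)) * (cmod (v z))\<^sup>2 + (cmod (v z))^4 / 2)"

lemma remainder_le:
  assumes v: "ppair v k" and m: "\<And>z. cmod (v z) \<le> m" "m \<le> 1"
  shows "\<bar>remainder v\<bar> \<le> (2 * K + 1) * m * (nrm v)\<^sup>2"
proof -
  note c = cont(1) ppairD(1)[OF v]
  have m0: "m \<ge> 0" using m(1)[of 0] norm_ge_zero order_trans by blast
  have i: "set_integrable lborel {0..2*pi} (\<lambda>z. 2 * Re (v z * cnj (P z)) * (cmod (v z))\<^sup>2 + (cmod (v z))^4 / 2)"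
    "set_integrable lborel {0..2*pi} (\<lambda>z. (2 * K + 1) * m * (cmod (v z))\<^sup>2)"
    by (intro set_integrable_continuous continuous_intros c; simp)+
  have "\<bar>remainder v\<bar> \<le> (LBINT z:{0..2*pi}. norm (2 * Re (v z * cnj (P z)) * (cmod (v z))\<^sup>2 + (cmod (v z))^4 / 2))"
    unfolding remainder_def using set_integral_norm_le[OF i(1)] by simp
  also have "\<dots> \<le> (LBINT z:{0..2*pi}. (2 * K + 1) * m * (cmod (v z))\<^sup>2)"
  proof (intro set_integral_mono i set_integrable_norm)
    fix z
    have "\<bar>Re (v z * cnj (P z))\<bar> \<le> m * K"
      using abs_Re_le_cmod[of "v z * cnj (P z)"] mult_mono[OF m(1)[of z] K(1)[of z] m0 norm_ge_zero] by (simp add: norm_mult del: times_complex.sel)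
    then have 1: "\<bar>2 * Re (v z * cnj (P z)) * (cmod (v z))\<^sup>2\<bar> \<le> 2 * (m * K) * (cmod (v z))\<^sup>2"
      unfolding abs_mult by (simp add: mult_right_mono)
    have "(cmod (v z))\<^sup>2 \<le> m\<^sup>2" using m(1) by (intro power_mono) auto
    also have "m\<^sup>2 \<le> m" using m(2) m0 by (simp add: power2_eq_square mult_left_le)
    finally have "(cmod (v z))\<^sup>2 * (cmod (v z))\<^sup>2 \<le> m * (cmod (v z))\<^sup>2" by (rule mult_right_mono) simp
    then have 2: "(cmod (v z))^4 \<le> m * (cmod (v z))\<^sup>2" by (simp flip: power_add)
    have "(2 * K + 1) * m * (cmod (v z))\<^sup>2 = 2 * (m * K) * (cmod (v z))\<^sup>2 + m * (cmod (v z))\<^sup>2" by (simp add: algebra_simps)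
    moreover have "0 \<le> (cmod (v z))^4" by simp
    ultimately show "norm (2 * Re (v z * cnj (P z)) * (cmod (v z))\<^sup>2 + (cmod (v z))^4 / 2) \<le> (2 * K + 1) * m * (cmod (v z))\<^sup>2"
      unfolding real_norm_def using 1 2 by linarith
  qed
  also have "\<dots> = (2 * K + 1) * m * (nrm v)\<^sup>2" by (simp add: l2_sq)
  finally show ?thesis .
qed

lemma quartic_second_order:
  assumes v: "ppair v k"
  shows "quartic (\<lambda>z. P z + v z) = quartic P + 2 * Re (inner_per v (cub P))
    + (2 * (nrm (\<lambda>z. P z * v z))\<^sup>2 + Re (cross P v)) + remainder v"
proof -
  note c = cont(1) ppairD(1)[OF v]
  have i: "set_integrable lborel {0..2*pi} (\<lambda>z. 2 * (cmod (P z * v z))\<^sup>2)" "set_integrable lborel {0..2*pi} (\<lambda>z. Re ((cnj (P z) * v z)\<^sup>2))"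
    "set_integrable lborel {0..2*pi} (\<lambda>z. 2 * Re (v z * cnj (P z)) * (cmod (v z))\<^sup>2 + (cmod (v z))^4 / 2)"
    by (intro set_integrable_continuous continuous_intros c; simp)+
  have "(cmod (w))\<^sup>2 * (cmod d)\<^sup>2 + ((cmod (w + d))\<^sup>2 - (cmod w)\<^sup>2)\<^sup>2 / 2
      = (2 * (cmod (w * d))\<^sup>2 + Re ((cnj w * d)\<^sup>2)) + (2 * Re (d * cnj w) * (cmod d)\<^sup>2 + (cmod d)^4 / 2)" for w d :: complex
  proof -
    define x y where "x = Re (d * cnj w)" and "y = Im (d * cnj w)"
    have e: "(cmod (w + d))\<^sup>2 - (cmod w)\<^sup>2 = 2 * x + (cmod d)\<^sup>2"
      unfolding x_def cmod_power2 by (simp add: power2_eq_square algebra_simps)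
    have f: "(cmod w)\<^sup>2 * (cmod d)\<^sup>2 = x\<^sup>2 + y\<^sup>2" "(cmod (w * d))\<^sup>2 = x\<^sup>2 + y\<^sup>2"
      unfolding x_def y_def norm_mult power_mult_distrib cmod_power2 by (simp_all add: power2_eq_square algebra_simps)
    have g: "Re ((cnj w * d)\<^sup>2) = x\<^sup>2 - y\<^sup>2" unfolding x_def y_def by (simp add: power2_eq_square algebra_simps)
    have h: "(cmod d)^4 = ((cmod d)\<^sup>2)\<^sup>2" by simp
    show ?thesis unfolding e f g h x_def[symmetric] by (simp add: power2_eq_square field_simps)
  qed
  then have "(LBINT z:{0..2*pi}. (cmod (P z))\<^sup>2 * (cmod (v z))\<^sup>2 + ((cmod (P z + v z))\<^sup>2 - (cmod (P z))\<^sup>2)\<^sup>2 / 2)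
    = (LBINT z:{0..2*pi}. (2 * (cmod (P z * v z))\<^sup>2 + Re ((cnj (P z) * v z)\<^sup>2)) + (2 * Re (v z * cnj (P z)) * (cmod (v z))\<^sup>2 + (cmod (v z))^4 / 2))"
    by presburger
  also have "\<dots> = (2 * (nrm (\<lambda>z. P z * v z))\<^sup>2 + Re (cross P v)) + remainder v"
    unfolding remainder_def set_integral_add(2)[OF set_integral_add(1)[OF i(1,2)] i(3)] set_integral_add(2)[OF i(1,2)]
      cross_def set_integral_Re[OF cross_integrable[OF cont(1) ppair_L2(1)[OF v]]] by (simp add: l2_sq)
  finally show ?thesis using quartic_diff[OF pP v] by simp
qed

lemma momentum_second_order:
  assumes v: "ppair v k"
  shows "Im (inner_per (\<lambda>z. P1 z + k z) (\<lambda>z. P z + v z)) = Im (inner_per P1 P) + 2 * Im (inner_per P1 v) + Im (inner_per k v)"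
proof -
  have "Im (inner_per k P) = Im (inner_per P1 v)"
    unfolding inner_per_by_parts[OF v pP] ip_cnj[symmetric, of P1] by simp
  then show ?thesis by (simp add: ip_add_left ip_add_right LP ppair_L2[OF v] L2_loc_add)
qed

text \<open>The first-order terms are the pairing of \<open>v\<close> with the left-hand side of
  \<open>EL\<close>, which vanishes.\<close>

lemma Lam_second_order:
  assumes EL: "\<And>z. - 4 * of_real (\<kappa>\<^sup>2) * P2 z + cub P z - \<i> * of_real a * P1 z + of_real b * P z = 0"
    and v: "ppair v k"
  shows "Lam \<kappa> a b (\<lambda>z. P z + v z) (\<lambda>z. P1 z + k z) = Lam \<kappa> a b P P1 + Hess \<kappa> a b P v k + remainder v"
proof -
  note Lv = ppair_L2[OF v]
  define L where "L = (\<lambda>z. ((of_real (- 4 * \<kappa>\<^sup>2) * P2 z + cub P z) + (- (\<i> * of_real a)) * P1 z) + of_real b * P z)"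
  have "L = (\<lambda>z. 0)" using EL by (simp add: L_def fun_eq_iff)
  then have "inner_per v L = 0" by (simp add: inner_per_def)
  moreover have "inner_per v L = ((cnj (of_real (- 4 * \<kappa>\<^sup>2)) * inner_per v P2 + inner_per v (cub P)) + cnj (- (\<i> * of_real a)) * inner_per v P1) + cnj (of_real b) * inner_per v P"
    unfolding L_def by (subst ip_add_right ip_cmult_right; (intro LP Lv L2_loc_add L2_loc_cmult)?)+ simp
  moreover have "Im (inner_per P1 v) = - Im (inner_per v P1)" unfolding ip_cnj[symmetric, of P1] by simp
  moreover have "Re (inner_per k P1) = - Re (inner_per v P2)" unfolding inner_per_by_parts[OF v pP1] by simp
  ultimately have crit: "4 * \<kappa>\<^sup>2 * Re (inner_per k P1) + Re (inner_per v (cub P)) + a * Im (inner_per P1 v) + b * Re (inner_per v P) = 0"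
    by (simp add: complex_eq_iff)
  have "Lam \<kappa> a b (\<lambda>z. P z + v z) (\<lambda>z. P1 z + k z) - (Lam \<kappa> a b P P1 + Hess \<kappa> a b P v k + remainder v)
    = 2 * (4 * \<kappa>\<^sup>2 * Re (inner_per k P1) + Re (inner_per v (cub P)) + a * Im (inner_per P1 v) + b * Re (inner_per v P))"
    unfolding Lam_def Hess_def nrm_add_sq[OF LP(2) Lv(2)] nrm_add_sq[OF LP(1) Lv(1)] quartic_second_order[OF v] momentum_second_order[OF v]
    by (simp add: algebra_simps)
  then show ?thesis using crit by simp
qed

end

text \<open>The multipliers \<open>a\<close> and \<open>b\<close> of momentum and mass make
  \<open>P\<close> a critical point. Coercivity is demanded for continuously differentiable
  perturbations, since it is obtained by ODE arguments.\<close>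

locale coercive_profile = smooth_profile +
  fixes \<kappa> a b c C :: real
  assumes EL: "\<And>z. - 4 * of_real (\<kappa>\<^sup>2) * P2 z + cub P z - \<i> * of_real a * P1 z + of_real b * P z = 0"
    and c: "c > 0" and C: "C \<ge> 0"
    and coer: "\<And>v v'. (\<And>x. (v has_vector_derivative v' x) (at x)) \<Longrightarrow> continuous_on UNIV v' \<Longrightarrow> (\<And>x. v (x + 2 * pi) = v x) \<Longrightarrow>
      \<exists>d e. c * (norm_X (\<lambda>z. v z - (of_real d * P1 z + \<i> * of_real e * P z)))\<^sup>2
        \<le> Hess \<kappa> a b P v v' + C * ((Re (inner_per v P))\<^sup>2 + (Im (inner_per P1 v))\<^sup>2)"
begin

text \<open>Approximation by \<open>C1_dense\<close>. The hypothesis \<open>near\<close> turns the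
  distance to the tangent space into the full norm, up to the approximation error
  \<open>E n\<close>.\<close>

lemma coercive_at_nearest:
  assumes v: "ppair v k" and near: "\<And>d e. norm_X v \<le> norm_X (\<lambda>z. v z - (of_real d * P1 z + \<i> * of_real e * P z))"
  shows "c * (norm_X v)\<^sup>2 \<le> Hess \<kappa> a b P v k + C * ((Re (inner_per v P))\<^sup>2 + (Im (inner_per P1 v))\<^sup>2)"
proof -
  have "\<forall>n. \<exists>w. \<exists>w'. (\<forall>x. (w has_vector_derivative w' x) (at x)) \<and> continuous_on UNIV w' \<and> (\<forall>x. w (x + 2 * pi) = w x)
    \<and> ppair w w' \<and> norm_X (\<lambda>x. v x - w x) < inverse (real (Suc n))"
    using C1_dense[OF v] by simp
  then obtain w w' where w: "\<And>n x. (w n has_vector_derivative w' n x) (at x)" "\<And>n. continuous_on UNIV (w' n)"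
    "\<And>n x. w n (x + 2 * pi) = w n x" "\<And>n. ppair (w n) (w' n)" "\<And>n. norm_X (\<lambda>x. v x - w n x) < inverse (real (Suc n))"
    by metis
  define E where "E n = norm_X (\<lambda>x. v x - w n x)" for n
  have E0: "E \<longlonglongrightarrow> 0"
    by (rule Lim_null_comparison[OF always_eventually LIMSEQ_inverse_real_of_nat])
      (use w(5) norm_X_nonneg in \<open>auto simp: E_def intro: less_imp_le\<close>)
  have lim: "(\<lambda>n. norm_X (\<lambda>z. w n z - v z)) \<longlonglongrightarrow> 0"
    using E0 unfolding E_def by (simp add: norm_X_commute[OF v w(4)])
  \<comment> \<open>The truncation at 0 is there because the lower bound is squared.\<close>
  have le: "c * (max 0 (norm_X v - E n))\<^sup>2 \<le> Hess \<kappa> a b P (w n) (w' n) + C * ((Re (inner_per (w n) P))\<^sup>2 + (Im (inner_per P1 (w n)))\<^sup>2)" for n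
  proof -
    obtain d e where de: "c * (norm_X (\<lambda>z. w n z - (of_real d * P1 z + \<i> * of_real e * P z)))\<^sup>2
        \<le> Hess \<kappa> a b P (w n) (w' n) + C * ((Re (inner_per (w n) P))\<^sup>2 + (Im (inner_per P1 (w n)))\<^sup>2)"
      using coer[OF w(1,2,3)] by blast
    define T where "T z = of_real d * P1 z + \<i> * of_real e * P z" for z
    have pT: "ppair T (\<lambda>z. of_real d * P2 z + \<i> * of_real e * P1 z)"
      unfolding T_def by (intro ppair_add ppair_cmult pP pP1)
    have "norm_X v \<le> norm_X (\<lambda>z. v z - T z)" using near[of d e] by (simp add: T_def)
    also have "(\<lambda>z. v z - T z) = (\<lambda>z. (v z - w n z) + (w n z - T z))" by (simp add: fun_eq_iff)
    also have "norm_X \<dots> \<le> E n + norm_X (\<lambda>z. w n z - T z)"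
      unfolding E_def by (rule norm_X_triangle[OF ppair_diff[OF v w(4)] ppair_diff[OF w(4) pT]])
    finally have "max 0 (norm_X v - E n) \<le> norm_X (\<lambda>z. w n z - T z)" using norm_X_nonneg by simp
    then have "c * (max 0 (norm_X v - E n))\<^sup>2 \<le> c * (norm_X (\<lambda>z. w n z - T z))\<^sup>2"
      using c by (intro mult_left_mono power_mono) auto
    then show ?thesis using de by (simp add: T_def)
  qed
  have "(\<lambda>n. c * (max 0 (norm_X v - E n))\<^sup>2) \<longlonglongrightarrow> c * (max 0 (norm_X v - 0))\<^sup>2"
    by (intro tendsto_intros E0)
  moreover have "(\<lambda>n. Hess \<kappa> a b P (w n) (w' n) + C * ((Re (inner_per (w n) P))\<^sup>2 + (Im (inner_per P1 (w n)))\<^sup>2))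
    \<longlonglongrightarrow> Hess \<kappa> a b P v k + C * ((Re (inner_per v P))\<^sup>2 + (Im (inner_per P1 v))\<^sup>2)"
    by (intro tendsto_intros Hess_tendsto[OF v w(4) lim])
  ultimately have "c * (max 0 (norm_X v - 0))\<^sup>2 \<le> Hess \<kappa> a b P v k + C * ((Re (inner_per v P))\<^sup>2 + (Im (inner_per P1 v))\<^sup>2)"
    by (rule LIMSEQ_le) (use le in blast)
  then show ?thesis using norm_X_nonneg[of v] by simp
qed

text \<open>The penalties replace the constraints of fixed mass and momentum.\<close>

definition V where
  "V u g = Lam \<kappa> a b u g - Lam \<kappa> a b P P1 + C * (((nrm u)\<^sup>2 - (nrm P)\<^sup>2)\<^sup>2 + (Im (inner_per g u) - Im (inner_per P1 P))\<^sup>2)"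

lemma V_eq:
  assumes v: "ppair v k"
  shows "V (\<lambda>z. P z + v z) (\<lambda>z. P1 z + k z) = Hess \<kappa> a b P v k + remainder v
    + C * ((2 * Re (inner_per v P) + (nrm v)\<^sup>2)\<^sup>2 + (2 * Im (inner_per P1 v) + Im (inner_per k v))\<^sup>2)"
  unfolding V_def Lam_second_order[OF EL v] momentum_second_order[OF v] nrm_add_sq[OF LP(1) ppair_L2(1)[OF v]]
  by (simp add: algebra_simps)

lemma V_upper: "\<exists>B>0. \<forall>v k. ppair v k \<longrightarrow> (1 + 2 * pi) * norm_X v \<le> 1 \<longrightarrow> V (\<lambda>z. P z + v z) (\<lambda>z. P1 z + k z) \<le> B * (norm_X v)\<^sup>2"
proof -
  define B0 where "B0 = (4 * \<kappa>\<^sup>2 + 3 * K\<^sup>2 + \<bar>a\<bar> + \<bar>b\<bar>) + (2 * K + 1) + C * ((2 * nrm P + 1)\<^sup>2 + (2 * nrm P1 + 1)\<^sup>2)"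
  have "V (\<lambda>z. P z + v z) (\<lambda>z. P1 z + k z) \<le> B0 * (norm_X v)\<^sup>2" if v: "ppair v k" and s: "(1 + 2 * pi) * norm_X v \<le> 1" for v k
  proof -
    note n = nrm_le_norm_X[OF v] and Lv = ppair_L2[OF v]
    have x1: "norm_X v \<le> 1" using s mult_nonneg_nonneg[OF norm_X_nonneg[of v] pi_ge_zero] by (simp add: algebra_simps)
    have m: "cmod (v z) \<le> 1" for z using sup_le_norm_X[OF v, of z] s by simp
    have q: "(nrm v)\<^sup>2 \<le> (norm_X v)\<^sup>2" using n by (auto intro!: power_mono simp: l2_nonneg)
    have q': "(norm_X v)\<^sup>2 \<le> norm_X v" using x1 norm_X_nonneg[of v] by (simp add: power2_eq_square mult_left_le)
    have r: "remainder v \<le> (2 * K + 1) * (norm_X v)\<^sup>2"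
    proof -
      have "0 \<le> 2 * K + 1" using K_nonneg by linarith
      then show ?thesis using remainder_le[OF v m] mult_left_mono[OF q, of "2 * K + 1"] by simp
    qed
    have "\<bar>Re (inner_per v P)\<bar> \<le> norm_X v * nrm P"
      using order_trans[OF abs_Re_le_cmod order_trans[OF ip_bound[OF Lv(1) LP(1)] mult_right_mono[OF n(1) l2_nonneg]]] .
    then have "\<bar>2 * Re (inner_per v P) + (nrm v)\<^sup>2\<bar> \<le> (2 * nrm P + 1) * norm_X v"
      using q q' add_nonneg_nonneg[OF norm_X_nonneg[of v] zero_le_power2[of "nrm v"]] by (simp add: algebra_simps abs_le_iff)
    then have 1: "(2 * Re (inner_per v P) + (nrm v)\<^sup>2)\<^sup>2 \<le> (2 * nrm P + 1)\<^sup>2 * (norm_X v)\<^sup>2"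
      using power_mono[OF _ abs_ge_zero, of _ _ 2] by (fastforce simp: power_mult_distrib)
    have "\<bar>Im (inner_per P1 v)\<bar> \<le> nrm P1 * norm_X v"
      using order_trans[OF abs_Im_le_cmod order_trans[OF ip_bound[OF LP(2) Lv(1)] mult_left_mono[OF n(1) l2_nonneg]]] .
    moreover have "\<bar>Im (inner_per k v)\<bar> \<le> norm_X v"
      using order_trans[OF abs_Im_le_cmod order_trans[OF ip_bound[OF Lv(2,1)] mult_mono[OF n(2,1) norm_X_nonneg l2_nonneg]]] q'
      by (simp add: power2_eq_square)
    ultimately have "\<bar>2 * Im (inner_per P1 v) + Im (inner_per k v)\<bar> \<le> (2 * nrm P1 + 1) * norm_X v"
      by (simp add: algebra_simps abs_le_iff)
    then have 2: "(2 * Im (inner_per P1 v) + Im (inner_per k v))\<^sup>2 \<le> (2 * nrm P1 + 1)\<^sup>2 * (norm_X v)\<^sup>2"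
      using power_mono[OF _ abs_ge_zero, of _ _ 2] by (fastforce simp: power_mult_distrib)
    have "C * ((2 * Re (inner_per v P) + (nrm v)\<^sup>2)\<^sup>2 + (2 * Im (inner_per P1 v) + Im (inner_per k v))\<^sup>2)
      \<le> C * ((2 * nrm P + 1)\<^sup>2 * (norm_X v)\<^sup>2 + (2 * nrm P1 + 1)\<^sup>2 * (norm_X v)\<^sup>2)"
      using 1 2 C by (intro mult_left_mono add_mono)
    then show ?thesis unfolding V_eq[OF v] B0_def using r Hess_le[OF v, of \<kappa> a b] by (simp add: algebra_simps abs_le_iff)
  qed
  moreover have "B0 * x\<^sup>2 \<le> max 1 B0 * x\<^sup>2" for x :: real by (rule mult_right_mono) auto
  ultimately show ?thesis by (intro exI[of _ "max 1 B0"]) (auto intro: order_trans)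
qed

lemma V_lower:
  "\<exists>\<delta>0>0. \<forall>v k. ppair v k \<longrightarrow> (\<forall>d e. norm_X v \<le> norm_X (\<lambda>z. v z - (of_real d * P1 z + \<i> * of_real e * P z))) \<longrightarrow>
    norm_X v \<le> \<delta>0 \<longrightarrow> c / 2 * (norm_X v)\<^sup>2 \<le> V (\<lambda>z. P z + v z) (\<lambda>z. P1 z + k z)"
proof -
  \<comment> \<open>\<open>A * x * x\<^sup>2\<close> bounds the remainder together with the
    fourth-order part of the penalties; \<open>\<delta>0\<close> is chosen so that this uses up at
    most half of the coercivity.\<close>
  define A where "A = (2 * K + 1) * (1 + 2 * pi) + C"
  have A: "A > 0" unfolding A_def using K_nonneg C pi_gt_zero
    by (intro add_pos_nonneg[OF mult_pos_pos[of "2 * K + 1" "1 + 2 * pi"]]) linarith+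
  define \<delta>0 where "\<delta>0 = min (1 / (1 + 2 * pi)) (c / (2 * A))"
  have \<delta>0: "\<delta>0 > 0" "(1 + 2 * pi) * \<delta>0 \<le> 1" "A * \<delta>0 \<le> c / 2" "\<delta>0 \<le> 1"
  proof -
    show "\<delta>0 > 0" unfolding \<delta>0_def using c A pi_gt_zero by (auto intro: divide_pos_pos add_pos_pos)
    have "(1 + 2 * pi) * \<delta>0 \<le> (1 + 2 * pi) * (1 / (1 + 2 * pi))" unfolding \<delta>0_def by (intro mult_left_mono) auto
    moreover have "1 + 2 * pi \<noteq> 0" using pi_gt_zero by linarith
    then have "(1 + 2 * pi) * (1 / (1 + 2 * pi)) = 1" by simp
    ultimately show "(1 + 2 * pi) * \<delta>0 \<le> 1" by simp
    have "A * \<delta>0 \<le> A * (c / (2 * A))" unfolding \<delta>0_def using A by (intro mult_left_mono) auto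
    then show "A * \<delta>0 \<le> c / 2" using A by simp
    have "1 / (1 + 2 * pi) \<le> 1" using pi_gt_zero by (subst divide_le_eq_1_pos) linarith+
    then show "\<delta>0 \<le> 1" by (simp add: \<delta>0_def)
  qed
  have "c / 2 * (norm_X v)\<^sup>2 \<le> V (\<lambda>z. P z + v z) (\<lambda>z. P1 z + k z)"
    if v: "ppair v k" and near: "\<And>d e. norm_X v \<le> norm_X (\<lambda>z. v z - (of_real d * P1 z + \<i> * of_real e * P z))" and s: "norm_X v \<le> \<delta>0" for v k
  proof -
    define x where "x = norm_X v"
    have x0: "x \<ge> 0" by (simp add: x_def norm_X_nonneg)
    note n = nrm_le_norm_X[OF v, folded x_def] and Lv = ppair_L2[OF v]
    have x1: "x \<le> 1" using s \<delta>0(4) by (simp add: x_def)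
    have m: "cmod (v z) \<le> (1 + 2 * pi) * x" for z using sup_le_norm_X[OF v] by (simp add: x_def)
    have "(1 + 2 * pi) * x \<le> (1 + 2 * pi) * \<delta>0" using s unfolding x_def by (intro mult_left_mono) auto
    then have m1: "(1 + 2 * pi) * x \<le> 1" using \<delta>0(2) by simp
    have q: "(nrm v)\<^sup>2 \<le> x\<^sup>2" using n by (auto intro!: power_mono simp: l2_nonneg)
    have r: "- remainder v \<le> (2 * K + 1) * (1 + 2 * pi) * x * x\<^sup>2"
    proof -
      have "- remainder v \<le> (2 * K + 1) * ((1 + 2 * pi) * x) * (nrm v)\<^sup>2" using remainder_le[OF v m m1] by simp
      also have "\<dots> \<le> (2 * K + 1) * ((1 + 2 * pi) * x) * x\<^sup>2" using q K_nonneg x0 by (intro mult_left_mono) auto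
      finally show ?thesis by (simp add: mult.assoc)
    qed
    have x4: "(x\<^sup>2)\<^sup>2 \<le> x * x\<^sup>2"
    proof -
      have "x\<^sup>2 \<le> x" using x1 x0 by (simp add: power2_eq_square mult_left_le)
      then have "x\<^sup>2 * x\<^sup>2 \<le> x * x\<^sup>2" by (rule mult_right_mono) simp
      then show ?thesis by (simp add: power2_eq_square)
    qed
    \<comment> \<open>Replaces the linearised constraints in \<open>coer\<close> by the actual
      deviations of mass and momentum, which contain a quadratic term \<open>r\<close>.\<close>
    have half: "y\<^sup>2 \<le> (2 * y + r)\<^sup>2 + (x\<^sup>2)\<^sup>2 / 2" if "\<bar>r\<bar> \<le> x\<^sup>2" for y r :: real
    proof -
      have "r\<^sup>2 \<le> (x\<^sup>2)\<^sup>2" using power_mono[OF that abs_ge_zero, of 2] by simp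
      moreover have "(2 * y + r)\<^sup>2 + r\<^sup>2 / 2 - y\<^sup>2 = 3 * (y + 2 / 3 * r)\<^sup>2 + r\<^sup>2 / 6" by (simp add: power2_eq_square field_simps)
      ultimately show ?thesis using zero_le_power2[of "y + 2 / 3 * r"] zero_le_power2[of r] by linarith
    qed
    have 1: "(Re (inner_per v P))\<^sup>2 \<le> (2 * Re (inner_per v P) + (nrm v)\<^sup>2)\<^sup>2 + (x\<^sup>2)\<^sup>2 / 2"
      using q by (intro half) simp
    have "\<bar>Im (inner_per k v)\<bar> \<le> x\<^sup>2"
      using order_trans[OF abs_Im_le_cmod order_trans[OF ip_bound[OF Lv(2,1)] mult_mono[OF n(2,1) x0 l2_nonneg]]]
      by (simp add: power2_eq_square)
    then have 2: "(Im (inner_per P1 v))\<^sup>2 \<le> (2 * Im (inner_per P1 v) + Im (inner_per k v))\<^sup>2 + (x\<^sup>2)\<^sup>2 / 2"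
      by (rule half)
    have "c * x\<^sup>2 \<le> Hess \<kappa> a b P v k + C * ((Re (inner_per v P))\<^sup>2 + (Im (inner_per P1 v))\<^sup>2)"
      unfolding x_def by (rule coercive_at_nearest[OF v near])
    also have "\<dots> \<le> Hess \<kappa> a b P v k + C * (((2 * Re (inner_per v P) + (nrm v)\<^sup>2)\<^sup>2 + (x\<^sup>2)\<^sup>2 / 2) + ((2 * Im (inner_per P1 v) + Im (inner_per k v))\<^sup>2 + (x\<^sup>2)\<^sup>2 / 2))"
      using 1 2 C by (intro add_left_mono mult_left_mono add_mono)
    also have "\<dots> = V (\<lambda>z. P z + v z) (\<lambda>z. P1 z + k z) - remainder v + C * (x\<^sup>2)\<^sup>2" unfolding V_eq[OF v] by (simp add: algebra_simps)
    also have "\<dots> \<le> V (\<lambda>z. P z + v z) (\<lambda>z. P1 z + k z) + ((2 * K + 1) * (1 + 2 * pi) * x * x\<^sup>2 + C * (x * x\<^sup>2))"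
      using r mult_left_mono[OF x4 C] by simp
    also have "(2 * K + 1) * (1 + 2 * pi) * x * x\<^sup>2 + C * (x * x\<^sup>2) = (A * x) * x\<^sup>2" by (simp add: A_def algebra_simps)
    also have "\<dots> \<le> c / 2 * x\<^sup>2"
      using order_trans[OF mult_left_mono[OF s less_imp_le[OF A]] \<delta>0(3)] by (intro mult_right_mono) (auto simp: x_def)
    finally show ?thesis by (simp add: x_def)
  qed
  then show ?thesis using \<delta>0(1) by blast
qed

end

section \<open>Distance to the orbit and the continuity argument\<close>

context smooth_profile
begin

definition box :: "(real \<times> real) set" where "box = {0..2*pi} \<times> {0..2*pi}"

definition dst where "dst u = (INF (\<phi>, \<xi>) \<in> box. norm_X (\<lambda>z. u z - orb \<phi> \<xi> z))"

lemma orb_representative: "\<exists>\<phi>'\<in>{0..2*pi}. \<exists>\<xi>'\<in>{0..2*pi}. orb \<phi> \<xi> = orb \<phi>' \<xi>'"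
proof -
  have "exp (\<i> * of_real (x + 2 * pi)) = exp (\<i> * of_real x)" for x
    by (simp add: distrib_left exp_add) (metis exp_two_pi_i mult.commute mult.left_commute mult.right_neutral)
  then obtain \<phi>' where \<phi>': "\<phi>' \<in> {0..2*pi}" "exp (\<i> * of_real \<phi>) = exp (\<i> * of_real \<phi>')"
    using periodic_representative[of "\<lambda>x. exp (\<i> * of_real x)" \<phi>] by blast
  have "(\<lambda>z. P (z - (x + 2 * pi))) = (\<lambda>z. P (z - x))" for x
    using per[of "z - (x + 2 * pi)" for z] by (simp add: fun_eq_iff algebra_simps)
  then obtain \<xi>' where \<xi>': "\<xi>' \<in> {0..2*pi}" "(\<lambda>z. P (z - \<xi>)) = (\<lambda>z. P (z - \<xi>'))"
    using periodic_representative[of "\<lambda>x z. P (z - x)" \<xi>] by blast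
  have "orb \<phi> \<xi> = orb \<phi>' \<xi>'" using \<phi>'(2) fun_cong[OF \<xi>'(2)] by (simp add: orb_def fun_eq_iff)
  then show ?thesis using \<phi>'(1) \<xi>'(1) by blast
qed

text \<open>The orbit is a Lipschitz image of a compact box. By \<open>orb_representative\<close>
  the minimum over the box is one over all real parameters, as
  \<open>nearest_imp_tangent_nearest\<close> requires.\<close>

lemma dst_attained:
  assumes u: "ppair u g"
  shows "\<exists>\<phi> \<xi>. dst u = norm_X (\<lambda>z. u z - orb \<phi> \<xi> z)" "dst u \<le> norm_X (\<lambda>z. u z - orb \<phi> \<xi> z)"
proof -
  define f where "f = (\<lambda>(\<phi>, \<xi>). norm_X (\<lambda>z. u z - orb \<phi> \<xi> z))"
  define L where "L = 2 * (2 * sqrt (2 * pi) * K)"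
  have le: "f x \<le> f y + L * dist x y" for x y
  proof -
    obtain \<phi> \<xi> \<phi>' \<xi>' where xy: "x = (\<phi>, \<xi>)" "y = (\<phi>', \<xi>')" by (cases x, cases y) auto
    have "(\<lambda>z. u z - orb \<phi> \<xi> z) = (\<lambda>z. (u z - orb \<phi>' \<xi>' z) + (orb \<phi>' \<xi>' z - orb \<phi> \<xi> z))" by (simp add: fun_eq_iff)
    then have "f x \<le> f y + norm_X (\<lambda>z. orb \<phi>' \<xi>' z - orb \<phi> \<xi> z)"
      using norm_X_triangle[OF ppair_diff[OF u orb_pair] ppair_diff[OF orb_pair orb_pair], of \<phi>' \<xi>' \<phi>' \<xi>' \<phi> \<xi>]
      by (simp add: f_def xy)
    also have "norm_X (\<lambda>z. orb \<phi>' \<xi>' z - orb \<phi> \<xi> z) \<le> 2 * sqrt (2 * pi) * (K * (\<bar>\<phi>' - \<phi>\<bar> + \<bar>\<xi>' - \<xi>\<bar>))" by (rule orbit_lipschitz)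
    also have "\<dots> \<le> 2 * sqrt (2 * pi) * (K * (dist x y + dist x y))"
      using dist_fst_le[of y x] dist_snd_le[of y x] K_nonneg unfolding xy
      by (intro mult_left_mono add_mono) (auto simp: dist_real_def dist_commute)
    finally show ?thesis by (simp add: L_def)
  qed
  have "L-lipschitz_on box f"
  proof (rule lipschitz_onI)
    fix x y :: "real \<times> real"
    show "dist (f x) (f y) \<le> L * dist x y" using le[of x y] le[of y x] by (simp add: dist_real_def dist_commute abs_le_iff)
  qed (simp add: L_def K_nonneg)
  then have "continuous_on box f" by (rule lipschitz_on_continuous_on)
  moreover have "compact box" "box \<noteq> {}" unfolding box_def by (auto intro: compact_Times)
  ultimately obtain x where x: "x \<in> box" "\<And>y. y \<in> box \<Longrightarrow> f x \<le> f y" using continuous_attains_inf[of box f] by blast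
  have eq: "dst u = f x"
    unfolding dst_def using x by (intro cInf_eq_minimum) (auto simp: f_def)
  then show "\<exists>\<phi> \<xi>. dst u = norm_X (\<lambda>z. u z - orb \<phi> \<xi> z)" by (cases x) (auto simp: f_def)
  obtain \<phi>' \<xi>' where "\<phi>' \<in> {0..2*pi}" "\<xi>' \<in> {0..2*pi}" "orb \<phi> \<xi> = orb \<phi>' \<xi>'" using orb_representative by blast
  then show "dst u \<le> norm_X (\<lambda>z. u z - orb \<phi> \<xi> z)" using x(2)[of "(\<phi>', \<xi>')"] by (simp add: eq f_def box_def)
qed

lemma dst_lipschitz:
  assumes u: "ppair u g" and v: "ppair v k"
  shows "\<bar>dst u - dst v\<bar> \<le> norm_X (\<lambda>z. u z - v z)"
proof -
  have "dst u \<le> dst v + norm_X (\<lambda>z. u z - v z)" if u: "ppair u g" and v: "ppair v k" for u g v k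
  proof -
    obtain \<phi> \<xi> where e: "dst v = norm_X (\<lambda>z. v z - orb \<phi> \<xi> z)" using dst_attained(1)[OF v] by blast
    have "dst u \<le> norm_X (\<lambda>z. u z - orb \<phi> \<xi> z)" by (rule dst_attained(2)[OF u])
    also have "(\<lambda>z. u z - orb \<phi> \<xi> z) = (\<lambda>z. (v z - orb \<phi> \<xi> z) + (u z - v z))" by (simp add: fun_eq_iff)
    also have "norm_X \<dots> \<le> dst v + norm_X (\<lambda>z. u z - v z)"
      unfolding e by (rule norm_X_triangle[OF ppair_diff[OF v orb_pair] ppair_diff[OF u v]])
    finally show ?thesis .
  qed
  from this[OF u v] this[OF v u] show ?thesis by (simp add: norm_X_commute[OF v u] abs_le_iff)
qed

lemma norm_X_orb_shift:
  assumes u: "ppair u g"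
  shows "norm_X (\<lambda>z. exp (- (\<i> * of_real \<alpha>)) * u (z + h) - orb \<phi> \<xi> z) = norm_X (\<lambda>z. u z - orb (\<phi> + \<alpha>) (\<xi> + h) z)"
proof -
  note p = ppair_diff[OF u orb_pair[of "\<phi> + \<alpha>" "\<xi> + h"]]
  have "exp (- (\<i> * of_real \<alpha>)) * u (z + h) - orb \<phi> \<xi> z = exp (- (\<i> * of_real \<alpha>)) * (u (z + h) - orb (\<phi> + \<alpha>) (\<xi> + h) (z + h))" for z
    by (simp add: orb_def distrib_left exp_add exp_minus field_simps)
  then have "norm_X (\<lambda>z. exp (- (\<i> * of_real \<alpha>)) * u (z + h) - orb \<phi> \<xi> z)
    = cmod (exp (- (\<i> * of_real \<alpha>))) * norm_X (\<lambda>z. u (z + h) - orb (\<phi> + \<alpha>) (\<xi> + h) (z + h))"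
    using norm_X_cmult[OF ppair_shift[OF p, of h]] by simp
  also have "cmod (exp (- (\<i> * of_real \<alpha>))) = 1" using norm_exp_i_times[of "- \<alpha>"] by simp
  finally show ?thesis using norm_X_shift[OF p, of h] by simp
qed

end

context coercive_profile
begin

lemma V_phase_shift:
  assumes u: "ppair u g" and l: "cmod l = 1"
  shows "V (\<lambda>z. l * u (z + h)) (\<lambda>z. l * g (z + h)) = V u g"
proof -
  note L = ppair_L2[OF u]
  have per: "AE z in lborel. u (z + 2 * pi) = u z" using ppair_per[OF u] by simp
  have "inner_per (\<lambda>z. l * g (z + h)) (\<lambda>z. l * u (z + h)) = of_real ((cmod l)\<^sup>2) * inner_per (\<lambda>z. g (z + h)) (\<lambda>z. u (z + h))"
    unfolding complex_norm_square ip_cmult_left ip_cmult_right by simp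
  also have "\<dots> = inner_per g u" using ip_shift[OF L(2,1) ppair_AE[OF u] per] l by simp
  finally show ?thesis unfolding V_def Lam_def l2_cmult
    by (simp add: l nrm_shift[OF L(1) per] nrm_shift[OF L(2) ppair_AE[OF u]] quartic_phase_shift[OF u l])
qed

text \<open>\<open>V\<close> is invariant under rotations and translations, so the nearest point of
  the orbit may be moved to \<open>P\<close>. The difference is then nearest among tangent
  directions, and \<open>V_lower\<close> applies.\<close>

lemma dst_controlled_by_V:
  "\<exists>\<delta>0>0. \<forall>u g. ppair u g \<longrightarrow> dst u \<le> \<delta>0 \<longrightarrow> c / 2 * (dst u)\<^sup>2 \<le> V u g"
proof -
  obtain \<delta>0 where \<delta>0: "\<delta>0 > 0" and lower: "\<And>v k. ppair v k \<Longrightarrow> (\<And>d e. norm_X v \<le> norm_X (\<lambda>z. v z - (of_real d * P1 z + \<i> * of_real e * P z))) \<Longrightarrow>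
    norm_X v \<le> \<delta>0 \<Longrightarrow> c / 2 * (norm_X v)\<^sup>2 \<le> V (\<lambda>z. P z + v z) (\<lambda>z. P1 z + k z)"
    using V_lower by blast
  have "c / 2 * (dst u)\<^sup>2 \<le> V u g" if u: "ppair u g" and s: "dst u \<le> \<delta>0" for u g
  proof -
    obtain \<alpha> h where e: "dst u = norm_X (\<lambda>z. u z - orb \<alpha> h z)" using dst_attained(1)[OF u] by blast
    define l where "l = exp (- (\<i> * of_real \<alpha>))"
    have l: "cmod l = 1" using norm_exp_i_times[of "- \<alpha>"] by (simp add: l_def)
    define v k where "v z = l * u (z + h) - P z" and "k z = l * g (z + h) - P1 z" for z
    have v: "ppair v k" unfolding v_def[abs_def] k_def[abs_def] by (intro ppair_diff ppair_cmult ppair_shift u pP)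
    have ev: "norm_X v = dst u"
      using norm_X_orb_shift[OF u, of \<alpha> h 0 0] by (simp add: v_def[abs_def] l_def e orb_00)
    have "norm_X v \<le> norm_X (\<lambda>z. v z - (of_real d * P1 z + \<i> * of_real e * P z))" for d e
    proof (rule nearest_imp_tangent_nearest[OF v])
      fix \<phi> \<xi>
      have "norm_X (\<lambda>z. v z + P z - orb \<phi> \<xi> z) = norm_X (\<lambda>z. u z - orb (\<phi> + \<alpha>) (\<xi> + h) z)"
        using norm_X_orb_shift[OF u, of \<alpha> h \<phi> \<xi>] by (simp add: v_def l_def)
      then show "norm_X v \<le> norm_X (\<lambda>z. v z + P z - orb \<phi> \<xi> z)" using dst_attained(2)[OF u] by (simp add: ev)
    qed
    from lower[OF v this] s
    have "c / 2 * (norm_X v)\<^sup>2 \<le> V (\<lambda>z. P z + v z) (\<lambda>z. P1 z + k z)" by (simp add: ev)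
    also have "\<dots> = V u g" using V_phase_shift[OF u l, of h] by (simp add: v_def k_def)
    finally show ?thesis by (simp add: ev)
  qed
  then show ?thesis using \<delta>0 by blast
qed

lemma V_conserved:
  assumes "nls_solution p \<kappa> Q"
  shows "V (Q t) (weak_deriv (Q t)) = V (Q 0) (weak_deriv (Q 0))"
proof -
  interpret nls_solution p \<kappa> Q by fact
  show ?thesis using energy_conserved[of t] norm_conserved[of t] momentum_conserved[of t]
    unfolding V_def Lam_def D_def by simp
qed

theorem orbital_stability:
  "\<exists>C0>0. \<exists>\<epsilon>>0. \<forall>R. norm_X R \<le> \<epsilon> \<longrightarrow> (\<forall>p Q. solves_NLS_in_X p \<kappa> Q \<and> Q 0 = (\<lambda>z. P z + R z) \<longrightarrow> (\<forall>t. dst (Q t) \<le> C0 * norm_X R))"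
proof -
  obtain B where B: "B > 0" and upper: "\<And>v k. ppair v k \<Longrightarrow> (1 + 2 * pi) * norm_X v \<le> 1 \<Longrightarrow> V (\<lambda>z. P z + v z) (\<lambda>z. P1 z + k z) \<le> B * (norm_X v)\<^sup>2"
    using V_upper by blast
  obtain \<delta>0 where \<delta>0: "\<delta>0 > 0" and lower: "\<And>u g. ppair u g \<Longrightarrow> dst u \<le> \<delta>0 \<Longrightarrow> c / 2 * (dst u)\<^sup>2 \<le> V u g"
    using dst_controlled_by_V by blast
  define C0 where "C0 = sqrt (2 * B / c)"
  have C0: "C0 > 0" "C0\<^sup>2 = 2 * B / c" using B c by (auto simp: C0_def)
  \<comment> \<open>The three bounds bring \<open>R\<close> into the range of
    \<open>V_upper\<close>, let the distance start at no more than \<open>\<delta>0\<close>, and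
    keep \<open>C0 * norm_X R\<close> at no more than \<open>\<delta>0 / 2\<close>.\<close>
  define \<epsilon> where "\<epsilon> = min (1 / (1 + 2 * pi)) (min \<delta>0 (\<delta>0 / (2 * C0)))"
  have \<epsilon>: "\<epsilon> > 0" unfolding \<epsilon>_def using \<delta>0 C0 pi_gt_zero by (auto intro!: divide_pos_pos add_pos_pos)
  have "dst (Q t) \<le> C0 * norm_X R"
    if R: "norm_X R \<le> \<epsilon>" and Q: "solves_NLS_in_X p \<kappa> Q" "Q 0 = (\<lambda>z. P z + R z)" for R p Q t
  proof -
    interpret sol: nls_solution p \<kappa> Q by standard (rule Q(1))
    note pQ = sol.pp
    have R0: "norm_X R \<ge> 0" by (rule norm_X_nonneg)
    have "norm_X R \<le> 1 / (1 + 2 * pi)" using R by (simp add: \<epsilon>_def)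
    then have "norm_X R * (1 + 2 * pi) \<le> 1" using pi_gt_zero by (subst (asm) pos_le_divide_eq) linarith+
    then have R1: "(1 + 2 * pi) * norm_X R \<le> 1" by (simp add: mult.commute)
    have pR: "ppair R (\<lambda>z. sol.D 0 z - P1 z)" using ppair_diff[OF pQ[of 0] pP] by (simp add: Q(2))
    have VB: "V (Q t) (sol.D t) \<le> B * (norm_X R)\<^sup>2" for t
      using upper[OF pR R1] V_conserved[OF sol.nls_solution_axioms, of t] by (simp add: Q(2)[symmetric] sol.D_def)
    have key: "dst (Q t) \<le> C0 * norm_X R" if "dst (Q t) \<le> \<delta>0" for t
    proof (rule power2_le_imp_le)
      have "c / 2 * (dst (Q t))\<^sup>2 \<le> B * (norm_X R)\<^sup>2" using lower[OF pQ that] VB[of t] by linarith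
      then show "(dst (Q t))\<^sup>2 \<le> (C0 * norm_X R)\<^sup>2"
        unfolding power_mult_distrib C0 using c by (simp add: field_simps)
    qed (use C0 R0 in simp)
    have "dst (Q 0) \<le> norm_X (\<lambda>z. Q 0 z - orb 0 0 z)" by (rule dst_attained(2)[OF pQ])
    then have d0: "dst (Q 0) \<le> norm_X R" by (simp add: orb_00 Q(2))
    have cont: "continuous_on UNIV (\<lambda>t. dst (Q t))"
    proof (intro continuous_at_imp_continuous_on ballI)
      fix t
      have "((\<lambda>s. dst (Q s) - dst (Q t)) \<longlongrightarrow> 0) (at t)"
        by (rule Lim_null_comparison[OF always_eventually sol.tendsto_Q]) (use dst_lipschitz[OF pQ pQ] in auto)
      then show "isCont (\<lambda>t. dst (Q t)) t" by (simp add: isCont_def LIM_zero_iff)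
    qed
    \<comment> \<open>The distance is continuous in time and cannot take the value
      \<open>\<delta>0\<close>, since \<open>key\<close> would improve it to at most
      \<open>\<delta>0 / 2\<close>.\<close>
    have "dst (Q t) \<le> \<delta>0"
    proof (rule ccontr)
      assume "\<not> dst (Q t) \<le> \<delta>0"
      moreover have "dst (Q 0) \<le> \<delta>0" using d0 R by (simp add: \<epsilon>_def)
      moreover have "connected (range (\<lambda>t. dst (Q t)))" by (rule connected_continuous_image[OF cont connected_UNIV])
      ultimately have "\<delta>0 \<in> range (\<lambda>t. dst (Q t))"
        by (meson connectedD_interval linear rangeI)
      then obtain s where s: "dst (Q s) = \<delta>0" by auto
      have "C0 * norm_X R \<le> C0 * (\<delta>0 / (2 * C0))" using R C0 by (intro mult_left_mono) (auto simp: \<epsilon>_def)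
      then show False using key[of s] s \<delta>0 C0 by simp
    qed
    then show ?thesis by (rule key)
  qed
  then show ?thesis using C0(1) \<epsilon> by blast
qed

end

section \<open>Coercivity of the periodic waves\<close>

lemma periodic_bounded:
  fixes f :: "real \<Rightarrow> complex"
  assumes "continuous_on UNIV f" "\<And>z. f (z + 2 * pi) = f z"
  shows "\<exists>K. \<forall>z. cmod (f z) \<le> K"
proof -
  have "bounded (f ` {0..2*pi})"
    using assms(1) by (intro compact_imp_bounded compact_continuous_image) (auto intro: continuous_on_subset)
  then obtain K where "\<forall>x\<in>f ` {0..2*pi}. cmod x \<le> K" unfolding bounded_iff by blast
  then have "\<And>z. z \<in> {0..2*pi} \<Longrightarrow> cmod (f z) \<le> K" by blast
  then show ?thesis using periodic_representative[of f, OF assms(2)] by metis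
qed

lemma smooth_profileI:
  assumes d: "\<And>z. (P has_vector_derivative P1 z) (at z)" "\<And>z. (P1 has_vector_derivative P2 z) (at z)"
    "\<And>z. (P2 has_vector_derivative P3 z) (at z)" and c: "continuous_on UNIV P3" and per: "\<And>z. P (z + 2 * pi) = P z"
  shows "\<exists>K. smooth_profile P P1 P2 P3 K"
proof -
  have per': "P1 (z + 2 * pi) = P1 z" "P2 (z + 2 * pi) = P2 z" "P3 (z + 2 * pi) = P3 z" for z
  proof -
    have 1: "P1 (z + 2 * pi) = P1 z" for z using quasiperiodic_derivative[OF d(1), of "2 * pi" 1] per by simp
    have 2: "P2 (z + 2 * pi) = P2 z" for z using quasiperiodic_derivative[OF d(2), of "2 * pi" 1] 1 by simp
    show "P1 (z + 2 * pi) = P1 z" "P2 (z + 2 * pi) = P2 z" by (rule 1 2)+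
    show "P3 (z + 2 * pi) = P3 z" using quasiperiodic_derivative[OF d(3), of "2 * pi" 1] 2 by simp
  qed
  have cont: "continuous_on UNIV P" "continuous_on UNIV P1" "continuous_on UNIV P2"
    using d by (auto intro!: continuous_at_imp_continuous_on has_vector_derivative_continuous)
  obtain K0 K1 K2 K3 where K: "\<And>z. cmod (P z) \<le> K0" "\<And>z. cmod (P1 z) \<le> K1" "\<And>z. cmod (P2 z) \<le> K2" "\<And>z. cmod (P3 z) \<le> K3"
    using periodic_bounded[OF cont(1) per] periodic_bounded[OF cont(2) per'(1)] periodic_bounded[OF cont(3) per'(2)]
      periodic_bounded[OF c per'(3)] by metis
  have "smooth_profile P P1 P2 P3 (max (max K0 K1) (max K2 K3))"
    by standard (use d per K in \<open>auto intro: order_trans simp: le_max_iff_disj\<close>)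
  then show ?thesis by blast
qed

lemma cub_derivative:
  assumes u: "\<And>z. (u has_vector_derivative g z) (at z)"
  shows "(cub u has_vector_derivative 2 * of_real ((cmod (u z))\<^sup>2) * g z + (u z)\<^sup>2 * cnj (g z)) (at z)"
proof -
  have "cub u = (\<lambda>z. u z * u z * cnj (u z))"
    unfolding fun_eq_iff cub_def complex_norm_square by (simp add: mult_ac)
  moreover have "2 * of_real ((cmod (u z))\<^sup>2) * g z + (u z)\<^sup>2 * cnj (g z) = u z * u z * cnj (g z) + (u z * g z + g z * u z) * cnj (u z)"
    unfolding complex_norm_square by (simp add: power2_eq_square algebra_simps)
  ultimately show ?thesis
    using has_vector_derivative_mult[OF has_vector_derivative_mult[OF u u] has_vector_derivative_cnj[OF u], of z] by simp
qed

text \<open>\<open>P1\<close> is read off from the classical derivative \<open>W'\<close>, and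
  \<open>P2\<close> is defined by solving the profile equation in the variable \<open>z\<close> for
  it, so that the last claim holds by construction; \<open>P3\<close> is the derivative of that
  expression.\<close>

lemma (in wave) profile_exists:
  fixes p k :: real and P :: "real \<Rightarrow> complex"
  assumes k: "k > 0" and per: "\<And>z. P (z + 2 * pi) = P z" and WP: "\<And>x. W x = exp (\<i> * of_real (p * x)) * P (2 * k * x)"
  shows "\<exists>P1 P2 P3 K. smooth_profile P P1 P2 P3 K \<and>
    (\<forall>x. W' x = exp (\<i> * of_real (p * x)) * (\<i> * of_real p * P (2 * k * x) + of_real (2 * k) * P1 (2 * k * x))) \<and>
    (\<forall>z. - 4 * of_real (k\<^sup>2) * P2 z + cub P z - \<i> * of_real (4 * k * p) * P1 z + of_real (p\<^sup>2 - 1) * P z = 0)"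
proof -
  define c where "c = 1 / (2 * k)"
  have c: "c * (2 * k) = 1" "2 * k * (c * z) = z" for z using k by (auto simp: c_def)
  define E where "E z = exp (\<i> * of_real (- (p * c) * z))" for z
  have E: "exp (\<i> * of_real (p * (c * z))) * E z = 1" for z
    unfolding E_def exp_add[symmetric] by simp
  have P_eq: "P z = E z * W (c * z)" for z
    using E[of z] WP[of "c * z"] unfolding c(2) by (simp add: mult.assoc mult.left_commute[of "E z"])
  define P1 where "P1 z = E z * (of_real c * W' (c * z) - \<i> * of_real (p * c) * W (c * z))" for z
  define P2 where "P2 z = of_real (c\<^sup>2) * (cub P z - \<i> * of_real (4 * k * p) * P1 z + of_real (p\<^sup>2 - 1) * P z)" for z
  define P3 where "P3 z = of_real (c\<^sup>2) * ((2 * of_real ((cmod (P z))\<^sup>2) * P1 z + (P z)\<^sup>2 * cnj (P1 z)) - \<i> * of_real (4 * k * p) * P2 z + of_real (p\<^sup>2 - 1) * P1 z)" for z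
  have dP: "(P has_vector_derivative P1 z) (at z)" for z
  proof -
    have "(\<lambda>z. E z * W (c * z)) = P" using P_eq by auto
    then show ?thesis using derivative_phase_shift[OF dW, of "- (p * c)" 0 c z] by (simp add: E_def P1_def)
  qed
  have dP1: "(P1 has_vector_derivative P2 z) (at z)" for z
  proof -
    define g where "g x = of_real c * W' x - \<i> * of_real (p * c) * W x" for x
    define g1 where "g1 x = of_real c * (((cmod (W x))\<^sup>2 - 1) *\<^sub>R W x) - \<i> * of_real (p * c) * W' x" for x
    have dg: "(g has_vector_derivative g1 x) (at x)" for x
      unfolding g_def[abs_def] g1_def by (intro has_vector_derivative_diff has_vector_derivative_mult_right dW dW')
    have "(\<lambda>z. E z * g (c * z)) = P1" by (auto simp: P1_def g_def)
    then have "(P1 has_vector_derivative E z * (of_real c * g1 (c * z) + \<i> * of_real (- (p * c)) * g (c * z))) (at z)"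
      using derivative_phase_shift[OF dg, of "- (p * c)" 0 c z] by (simp add: E_def)
    moreover have "E z * (of_real c * g1 (c * z) + \<i> * of_real (- (p * c)) * g (c * z)) = P2 z"
    proof -
      have m: "cmod (P z) = cmod (W (c * z))" unfolding P_eq by (simp add: norm_mult E_def)
      have ck: "of_real (4 * k * p) * P1 z = E z * (of_real (2 * p) * (W' (c * z) - \<i> * of_real p * W (c * z)))"
      proof -
        have "of_real (4 * k * p) * P1 z = of_real (2 * p * (c * (2 * k))) * (E z * (W' (c * z) - \<i> * of_real p * W (c * z)))"
          by (simp add: P1_def algebra_simps)
        then show ?thesis unfolding c(1) by (simp add: mult_ac)
      qed
      show ?thesis
        unfolding P2_def cub_def m mult.assoc[of \<i>] ck unfolding P_eq g_def g1_def
        by (simp add: scaleR_conv_of_real algebra_simps power2_eq_square)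
    qed
    ultimately show ?thesis by simp
  qed
  have dP2: "(P2 has_vector_derivative P3 z) (at z)" for z
  proof -
    have "((\<lambda>z. of_real (c\<^sup>2) * (cub P z - \<i> * of_real (4 * k * p) * P1 z + of_real (p\<^sup>2 - 1) * P z)) has_vector_derivative P3 z) (at z)"
      unfolding P3_def by (rule has_vector_derivative_mult_right[OF has_vector_derivative_add[OF has_vector_derivative_diff[OF
          cub_derivative[OF dP] has_vector_derivative_mult_right[OF dP1]] has_vector_derivative_mult_right[OF dP]]])
    then show ?thesis unfolding P2_def[symmetric] .
  qed
  have cont: "continuous_on UNIV P" "continuous_on UNIV P1" "continuous_on UNIV P2"
    using dP dP1 dP2 by (auto intro!: continuous_at_imp_continuous_on has_vector_derivative_continuous)
  have "continuous_on UNIV P3" unfolding P3_def by (intro continuous_intros cont)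
  then obtain K where "smooth_profile P P1 P2 P3 K" using smooth_profileI[OF dP dP1 dP2 _ per] by blast
  moreover have "W' x = exp (\<i> * of_real (p * x)) * (\<i> * of_real p * P (2 * k * x) + of_real (2 * k) * P1 (2 * k * x))" for x
  proof (rule vector_derivative_unique_at[OF dW])
    have "W = (\<lambda>x. exp (\<i> * of_real (p * x)) * P (0 + 2 * k * x))" using WP by auto
    then show "(W has_vector_derivative exp (\<i> * of_real (p * x)) * (\<i> * of_real p * P (2 * k * x) + of_real (2 * k) * P1 (2 * k * x))) (at x)"
      using derivative_phase_shift[OF dP, of p 0 "2 * k" x] by (simp add: add.commute)
  qed
  moreover have "- 4 * of_real (k\<^sup>2) * P2 z + cub P z - \<i> * of_real (4 * k * p) * P1 z + of_real (p\<^sup>2 - 1) * P z = 0" for z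
  proof -
    have "4 * k\<^sup>2 * c\<^sup>2 = 1" using k by (simp add: c_def power_divide)
    then have "4 * complex_of_real (k\<^sup>2) * of_real (c\<^sup>2) = 1" by (metis of_real_1 of_real_mult of_real_numeral)
    then have "4 * of_real (k\<^sup>2) * P2 z = cub P z - \<i> * of_real (4 * k * p) * P1 z + of_real (p\<^sup>2 - 1) * P z"
      unfolding P2_def mult.assoc[symmetric] by simp
    then show ?thesis by (simp add: algebra_simps)
  qed
  ultimately show ?thesis by blast
qed

text \<open>The zero function is critical for all multipliers; with \<open>a = 0\<close> and
  \<open>b = 1\<close> the form is equivalent to the squared norm.\<close>

lemma coercive_profile_zero:
  assumes k: "k \<noteq> 0"
  shows "\<exists>c. coercive_profile (\<lambda>_. 0) (\<lambda>_. 0) (\<lambda>_. 0) (\<lambda>_. 0) 0 k 0 1 c 0"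
proof (intro exI)
  show "coercive_profile (\<lambda>_. 0) (\<lambda>_. 0) (\<lambda>_. 0) (\<lambda>_. 0) 0 k 0 1 (min 1 (4 * k\<^sup>2)) 0"
  proof
    fix v v' :: "real \<Rightarrow> complex" assume v: "\<And>x. (v has_vector_derivative v' x) (at x)" "continuous_on UNIV v'" "\<And>x. v (x + 2 * pi) = v x"
    have pv: "ppair v v'" using wpair_C1[OF v(1,2)] v(3) by (simp add: ppair_def)
    have "min 1 (4 * k\<^sup>2) * ((nrm v)\<^sup>2 + (nrm v')\<^sup>2) \<le> 4 * k\<^sup>2 * (nrm v')\<^sup>2 + (nrm v)\<^sup>2"
      using mult_right_mono[of "min 1 (4 * k\<^sup>2)" 1 "(nrm v)\<^sup>2"] mult_right_mono[of "min 1 (4 * k\<^sup>2)" "4 * k\<^sup>2" "(nrm v')\<^sup>2"]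
      by (simp add: distrib_left)
    then show "\<exists>d e. min 1 (4 * k\<^sup>2) * (norm_X (\<lambda>z. v z - (of_real d * 0 + \<i> * of_real e * 0)))\<^sup>2
      \<le> Hess k 0 1 (\<lambda>_. 0) v v' + 0 * ((Re (inner_per v (\<lambda>_. 0)))\<^sup>2 + (Im (inner_per (\<lambda>_. 0) v))\<^sup>2)"
      by (simp add: norm_X_eq[OF pv] Hess_def cross_def l2_def[of _ _ "\<lambda>_. 0"])
  qed (use k in \<open>auto simp: cub_def\<close>)
qed

text \<open>A plane wave is critical for a whole line of multipliers, and these complete the square:
  the derivative terms become \<open>4 * k\<^sup>2\<close> times the squared norm of
  \<open>g = v' - \<i> * m * v\<close>, the rest \<open>2 * Y\<close>, quadratic in the radial part
  \<open>Re f\<close>. The tangential part \<open>Im f\<close> is controlled by \<open>g\<close> up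
  to its value at 0, which a rotation removes; so \<open>C = 0\<close> is enough.\<close>

lemma coercive_profile_constant_modulus:
  assumes prof: "smooth_profile P P1 P2 P3 K" and k: "k > 0" and \<rho>: "\<rho> > 0"
    and mod: "\<And>z. cmod (P z) = \<rho>" and P1: "\<And>z. P1 z = \<i> * of_real m * P z"
  shows "\<exists>c. coercive_profile P P1 P2 P3 K k (- 8 * k\<^sup>2 * m) (4 * k\<^sup>2 * m\<^sup>2 - \<rho>\<^sup>2) c 0"
proof -
  interpret smooth_profile P P1 P2 P3 K by fact
  have i_m_i: "\<i> * of_real m * \<i> * w = - (of_real m * w)" for w by (simp add: complex_eq_iff)
  have P2: "P2 z = - of_real (m\<^sup>2) * P z" for z
  proof (rule vector_derivative_unique_at[OF dP1])
    have "((\<lambda>z. \<i> * of_real m * P z) has_vector_derivative \<i> * of_real m * P1 z) (at z)"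
      by (rule has_vector_derivative_mult_right[OF dP])
    then show "(P1 has_vector_derivative - of_real (m\<^sup>2) * P z) (at z)"
      unfolding fun_eq_iff[THEN iffD2, OF allI[OF P1]] by (simp add: power2_eq_square mult.assoc[symmetric] i_m_i)
  qed
  define A where "A = (1 + 2 * m\<^sup>2) * (1 / \<rho>\<^sup>2 + 4 * pi\<^sup>2) + 2"
  have A: "A > 0" unfolding A_def by (intro add_nonneg_pos mult_nonneg_nonneg) auto
  define c where "c = min (4 * k\<^sup>2) 1 / A"
  have c: "c > 0" unfolding c_def using A k by simp
  have "coercive_profile P P1 P2 P3 K k (- 8 * k\<^sup>2 * m) (4 * k\<^sup>2 * m\<^sup>2 - \<rho>\<^sup>2) c 0"
  proof
    fix z
    show "- 4 * of_real (k\<^sup>2) * P2 z + cub P z - \<i> * of_real (- 8 * k\<^sup>2 * m) * P1 z + of_real (4 * k\<^sup>2 * m\<^sup>2 - \<rho>\<^sup>2) * P z = 0"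
      unfolding P2 P1 cub_def mod by (simp add: algebra_simps power2_eq_square)
  next
    fix v v' :: "real \<Rightarrow> complex" assume v: "\<And>x. (v has_vector_derivative v' x) (at x)" "continuous_on UNIV v'" "\<And>x. v (x + 2 * pi) = v x"
    have pv: "ppair v v'" using wpair_C1[OF v(1,2)] v(3) by (simp add: ppair_def)
    note Lv = ppair_L2[OF pv]
    define g where "g z = v' z - \<i> * of_real m * v z" for z
    have Lg: "g \<in> L2_loc" unfolding g_def[abs_def] by (intro L2_loc_diff L2_loc_cmult Lv)
    define f where "f z = cnj (P z) * v z" for z
    define Y where "Y = (LBINT z:{0..2*pi}. (Re (f z))\<^sup>2)"
    have cf: "continuous_on UNIV f" unfolding f_def[abs_def] by (intro continuous_intros cont ppairD[OF pv])
    have Y0: "Y \<ge> 0" unfolding Y_def by (rule set_integral_nonneg') simp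
    have Hess: "Hess k (- 8 * k\<^sup>2 * m) (4 * k\<^sup>2 * m\<^sup>2 - \<rho>\<^sup>2) P v v' = 4 * k\<^sup>2 * (nrm g)\<^sup>2 + 2 * Y"
    proof -
      have "(nrm g)\<^sup>2 = (nrm v')\<^sup>2 + 2 * Re (inner_per (\<lambda>z. (- (\<i> * of_real m)) * v z) v') + (nrm (\<lambda>z. (- (\<i> * of_real m)) * v z))\<^sup>2"
        using nrm_add_sq[OF Lv(2) L2_loc_cmult[OF Lv(1)], of "- (\<i> * of_real m)"] by (simp add: g_def[abs_def])
      also have "inner_per (\<lambda>z. (- (\<i> * of_real m)) * v z) v' = (- (\<i> * of_real m)) * cnj (inner_per v' v)"
        unfolding ip_cmult_left ip_cnj by simp
      also have "Re \<dots> = - m * Im (inner_per v' v)" by simp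
      also have "(nrm (\<lambda>z. (- (\<i> * of_real m)) * v z))\<^sup>2 = m\<^sup>2 * (nrm v)\<^sup>2"
        unfolding l2_cmult by (simp add: norm_mult power_mult_distrib)
      finally have 1: "(nrm g)\<^sup>2 = (nrm v')\<^sup>2 - 2 * m * Im (inner_per v' v) + m\<^sup>2 * (nrm v)\<^sup>2" by simp
      have Pv: "nrm (\<lambda>z. P z * v z) = \<rho> * nrm v"
        using \<rho> by (simp add: l2_def norm_mult mod power_mult_distrib real_sqrt_mult)
      have "\<rho>\<^sup>2 * (nrm v)\<^sup>2 + Re (cross P v) = 2 * Y"
      proof -
        have i: "set_integrable lborel {0..2*pi} (\<lambda>z. \<rho>\<^sup>2 * (cmod (v z))\<^sup>2)" "set_integrable lborel {0..2*pi} (\<lambda>z. Re ((f z)\<^sup>2))"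
          by (intro set_integrable_continuous continuous_intros cf ppairD[OF pv])+
        have "\<rho>\<^sup>2 * (nrm v)\<^sup>2 + Re (cross P v) = (LBINT z:{0..2*pi}. \<rho>\<^sup>2 * (cmod (v z))\<^sup>2) + (LBINT z:{0..2*pi}. Re ((f z)\<^sup>2))"
          unfolding cross_def f_def set_integral_Re[OF cross_integrable[OF cont(1) Lv(1)]] by (simp add: l2_sq)
        also have "\<dots> = (LBINT z:{0..2*pi}. \<rho>\<^sup>2 * (cmod (v z))\<^sup>2 + Re ((f z)\<^sup>2))"
          by (rule set_integral_add(2)[OF i, symmetric])
        also have "\<dots> = (LBINT z:{0..2*pi}. 2 * (Re (f z))\<^sup>2)"
        proof (rule arg_cong[where f = "set_lebesgue_integral _ _"], rule ext)
          fix z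
          have "\<rho>\<^sup>2 * (cmod (v z))\<^sup>2 = (cmod (f z))\<^sup>2" by (simp add: f_def norm_mult mod power_mult_distrib)
          then show "\<rho>\<^sup>2 * (cmod (v z))\<^sup>2 + Re ((f z)\<^sup>2) = 2 * (Re (f z))\<^sup>2"
            by (simp only: cmod_power2) (simp add: power2_eq_square)
        qed
        finally show ?thesis by (simp add: Y_def)
      qed
      then show ?thesis unfolding Hess_def 1 Pv by (simp add: power_mult_distrib algebra_simps)
    qed
    \<comment> \<open>Makes the component of \<open>u\<close> along \<open>\<i> * P\<close> vanish
      at 0.\<close>
    define e where "e = Im (f 0) / \<rho>\<^sup>2"
    define u where "u z = v z - (of_real 0 * P1 z + \<i> * of_real e * P z)" for z
    define u' where "u' z = v' z - (of_real 0 * P2 z + \<i> * of_real e * P1 z)" for z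
    have pu: "ppair u u'" unfolding u_def u'_def by (intro ppair_diff ppair_add ppair_cmult pv pP pP1)
    have gu: "g z = u' z - \<i> * of_real m * u z" for z
      by (simp add: g_def u_def u'_def P1 algebra_simps)
    have df: "(f has_vector_derivative cnj (P z) * g z) (at z)" for z
    proof -
      have "(f has_vector_derivative cnj (P z) * v' z + cnj (P1 z) * v z) (at z)"
        unfolding f_def[abs_def] by (rule has_vector_derivative_mult[OF has_vector_derivative_cnj[OF dP] v(1)])
      then show ?thesis by (simp add: g_def P1 algebra_simps)
    qed
    have wf: "wpair f (\<lambda>z. cnj (P z) * g z)"
      by (rule wpair_C1[OF df]) (unfold g_def, intro continuous_intros cont v ppairD[OF pv])
    have mean: "(Im (f z) - Im (f 0))\<^sup>2 \<le> \<rho>\<^sup>2 * (2 * pi * (nrm g)\<^sup>2)" if z: "z \<in> {0..2*pi}" for z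
    proof -
      have Lf: "(\<lambda>z. cnj (P z) * g z) \<in> L2_loc" by (rule wpairD(2)[OF wf])
      have "\<bar>Im (f z) - Im (f 0)\<bar> \<le> cmod (f z - f 0)" using abs_Im_le_cmod[of "f z - f 0"] by simp
      also have "f z - f 0 = (LBINT x:{0..z}. cnj (P x) * g x)" using z by (intro wpairD(3)[OF wf]) auto
      also have "cmod \<dots> \<le> (LBINT x:{0..z}. cmod (cnj (P x) * g x))"
        by (rule set_integral_norm_le[OF L2_loc_integrable[OF Lf]])
      also have "\<dots> \<le> l2 0 z (\<lambda>z. cnj (P z) * g z) * sqrt (z - 0)" using z by (intro L1_le_l2 Lf) auto
      also have "\<dots> \<le> nrm (\<lambda>z. cnj (P z) * g z) * sqrt (2 * pi)"
        using z by (intro mult_mono l2_subset Lf) (auto simp: l2_nonneg)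
      also have "nrm (\<lambda>z. cnj (P z) * g z) = \<rho> * nrm g"
        using \<rho> by (simp add: l2_def norm_mult mod power_mult_distrib real_sqrt_mult)
      finally have "(Im (f z) - Im (f 0))\<^sup>2 \<le> (\<rho> * nrm g * sqrt (2 * pi))\<^sup>2"
        using power_mono[OF _ abs_ge_zero, of _ _ 2] by fastforce
      then show ?thesis by (simp add: power_mult_distrib mult_ac)
    qed
    have "\<rho>\<^sup>2 * (nrm u)\<^sup>2 \<le> Y + 2 * pi * (\<rho>\<^sup>2 * (2 * pi * (nrm g)\<^sup>2))"
    proof -
      have i: "set_integrable lborel {0..2*pi} (\<lambda>z. \<rho>\<^sup>2 * (cmod (u z))\<^sup>2)" "set_integrable lborel {0..2*pi} (\<lambda>z. (Re (f z))\<^sup>2)"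
        "set_integrable lborel {0..2*pi} (\<lambda>_. \<rho>\<^sup>2 * (2 * pi * (nrm g)\<^sup>2))"
        by (intro set_integrable_continuous continuous_intros cf ppairD[OF pu])+
      have "\<rho>\<^sup>2 * (nrm u)\<^sup>2 = (LBINT z:{0..2*pi}. \<rho>\<^sup>2 * (cmod (u z))\<^sup>2)" by (simp add: l2_sq)
      also have "\<dots> \<le> (LBINT z:{0..2*pi}. (Re (f z))\<^sup>2 + \<rho>\<^sup>2 * (2 * pi * (nrm g)\<^sup>2))"
      proof (intro set_integral_mono set_integral_add i)
        fix z assume z: "z \<in> {0..2*pi}"
        have "cnj (P z) * u z = f z - \<i> * of_real e * of_real ((cmod (P z))\<^sup>2)"
          unfolding complex_norm_square by (simp add: f_def u_def algebra_simps)
        also have "\<dots> = f z - \<i> * of_real (Im (f 0))" using \<rho> by (simp add: mod e_def)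
        finally have "(cmod (cnj (P z) * u z))\<^sup>2 = (Re (f z))\<^sup>2 + (Im (f z) - Im (f 0))\<^sup>2" by (simp add: cmod_power2)
        then show "\<rho>\<^sup>2 * (cmod (u z))\<^sup>2 \<le> (Re (f z))\<^sup>2 + \<rho>\<^sup>2 * (2 * pi * (nrm g)\<^sup>2)"
          using mean[OF z] by (simp add: norm_mult mod power_mult_distrib)
      qed
      also have "\<dots> = Y + 2 * pi * (\<rho>\<^sup>2 * (2 * pi * (nrm g)\<^sup>2))"
        unfolding Y_def set_integral_add(2)[OF i(2,3)] by (simp add: set_lebesgue_integral_def)
      finally show ?thesis .
    qed
    then have nu: "(nrm u)\<^sup>2 \<le> Y / \<rho>\<^sup>2 + 4 * pi\<^sup>2 * (nrm g)\<^sup>2"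
      using \<rho> by (simp add: field_simps power2_eq_square)
    have nu': "(nrm u')\<^sup>2 \<le> 2 * (nrm g)\<^sup>2 + 2 * m\<^sup>2 * (nrm u)\<^sup>2"
    proof -
      have "u' = (\<lambda>z. g z + (\<i> * of_real m) * u z)" by (simp add: gu)
      then have "nrm u' \<le> nrm g + nrm (\<lambda>z. (\<i> * of_real m) * u z)"
        using l2_triangle[OF Lg L2_loc_cmult[OF ppair_L2(1)[OF pu]]] by metis
      also have "nrm (\<lambda>z. (\<i> * of_real m) * u z) = \<bar>m\<bar> * nrm u" unfolding l2_cmult by (simp add: norm_mult)
      finally have "(nrm u')\<^sup>2 \<le> (nrm g + \<bar>m\<bar> * nrm u)\<^sup>2" by (rule power_mono[OF _ l2_nonneg])
      also have "\<dots> \<le> 2 * (nrm g)\<^sup>2 + 2 * (\<bar>m\<bar> * nrm u)\<^sup>2"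
        using zero_le_power2[of "nrm g - \<bar>m\<bar> * nrm u"] by (simp add: power2_eq_square algebra_simps)
      finally show ?thesis by (simp add: power_mult_distrib)
    qed
    have "(norm_X u)\<^sup>2 = (nrm u)\<^sup>2 + (nrm u')\<^sup>2" unfolding norm_X_eq[OF pu] by simp
    also have "\<dots> \<le> (1 + 2 * m\<^sup>2) * (nrm u)\<^sup>2 + 2 * (nrm g)\<^sup>2" using nu' by (simp add: algebra_simps)
    also have "\<dots> \<le> (1 + 2 * m\<^sup>2) * (Y / \<rho>\<^sup>2 + 4 * pi\<^sup>2 * (nrm g)\<^sup>2) + 2 * (nrm g)\<^sup>2"
      using nu by (intro add_right_mono mult_left_mono) auto
    also have "\<dots> \<le> A * ((nrm g)\<^sup>2 + Y)"
    proof -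
      have "A * ((nrm g)\<^sup>2 + Y) - ((1 + 2 * m\<^sup>2) * (Y / \<rho>\<^sup>2 + 4 * pi\<^sup>2 * (nrm g)\<^sup>2) + 2 * (nrm g)\<^sup>2)
        = (1 + 2 * m\<^sup>2) * ((nrm g)\<^sup>2 / \<rho>\<^sup>2 + 4 * pi\<^sup>2 * Y) + 2 * Y" by (simp add: A_def algebra_simps add_divide_distrib)
      also have "\<dots> \<ge> 0" using Y0 by (intro add_nonneg_nonneg mult_nonneg_nonneg) auto
      finally show ?thesis by simp
    qed
    finally have "c * (norm_X u)\<^sup>2 \<le> c * (A * ((nrm g)\<^sup>2 + Y))" using c by (intro mult_left_mono) auto
    also have "\<dots> = min (4 * k\<^sup>2) 1 * (nrm g)\<^sup>2 + min (4 * k\<^sup>2) 1 * Y" using A by (simp add: c_def distrib_left)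
    also have "\<dots> \<le> 4 * k\<^sup>2 * (nrm g)\<^sup>2 + 1 * Y" using Y0 by (intro add_mono mult_right_mono) auto
    also have "\<dots> \<le> 4 * k\<^sup>2 * (nrm g)\<^sup>2 + 2 * Y" using Y0 by simp
    finally have "c * (norm_X u)\<^sup>2 \<le> Hess k (- 8 * k\<^sup>2 * m) (4 * k\<^sup>2 * m\<^sup>2 - \<rho>\<^sup>2) P v v'" unfolding Hess .
    then show "\<exists>d e. c * (norm_X (\<lambda>z. v z - (of_real d * P1 z + \<i> * of_real e * P z)))\<^sup>2
      \<le> Hess k (- 8 * k\<^sup>2 * m) (4 * k\<^sup>2 * m\<^sup>2 - \<rho>\<^sup>2) P v v' + 0 * ((Re (inner_per v P))\<^sup>2 + (Im (inner_per P1 v))\<^sup>2)"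
      unfolding u_def[abs_def] by (intro exI[of _ 0] exI[of _ e]) simp
  qed (use c in auto)
  then show ?thesis by blast
qed

lemma integral_rescaled_period:
  fixes G :: "real \<Rightarrow> real"
  assumes G: "continuous_on UNIV G" and per: "\<And>z. G (z + 2 * pi) = G z" and k: "k > 0"
  shows "integral {0..pi / k} (\<lambda>x. G (2 * k * (x + x0))) = (LBINT z:{0..2*pi}. G z) / (2 * k)"
proof -
  obtain F where F: "\<And>x. (F has_vector_derivative G x) (at x)" using continuous_antiderivative[OF G] by blast
  have "((\<lambda>c. F (c + 2 * pi) - F c) has_vector_derivative 0) (at c within UNIV)" for c
    using has_vector_derivative_diff[OF has_vector_derivative_shift[OF F] F, of "2 * pi" c] by (simp add: per)
  from has_vector_derivative_zero_constant[OF convex_UNIV this]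
  obtain C where "\<And>c. F (c + 2 * pi) - F c = C" by auto
  then have const: "F (c + 2 * pi) - F c = F (2 * pi) - F 0" for c by (metis add_0)
  have "((\<lambda>x. F (2 * k * (x + x0)) / (2 * k)) has_vector_derivative G (2 * k * (x + x0))) (at x)" for x
  proof -
    have "((\<lambda>x. 2 * k * (x + x0)) has_vector_derivative 2 * k) (at x)"
      by (auto intro!: derivative_eq_intros simp flip: has_real_derivative_iff_has_vector_derivative)
    from vector_diff_chain_at[OF this F]
    have "((\<lambda>x. F (2 * k * (x + x0))) has_vector_derivative 2 * k * G (2 * k * (x + x0))) (at x)" by (simp add: o_def)
    from has_vector_derivative_divide[OF this, of "2 * k"] show ?thesis using k by simp
  qed
  then have "((\<lambda>x. G (2 * k * (x + x0))) has_integral (F (2 * k * (pi / k + x0)) / (2 * k) - F (2 * k * (0 + x0)) / (2 * k))) {0..pi / k}"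
    using k by (intro fundamental_theorem_of_calculus) (auto intro: has_vector_derivative_at_within)
  then have "integral {0..pi / k} (\<lambda>x. G (2 * k * (x + x0))) = (F (2 * k * x0 + 2 * pi) - F (2 * k * x0)) / (2 * k)"
    using k by (simp add: integral_unique diff_divide_distrib distrib_left add.commute)
  also have "F (2 * k * x0 + 2 * pi) - F (2 * k * x0) = integral {0..2*pi} G"
    unfolding const using F by (intro integral_unique[symmetric] fundamental_theorem_of_calculus) (auto intro: has_vector_derivative_at_within)
  also have "\<dots> = (LBINT z:{0..2*pi}. G z)"
    by (rule set_borel_integral_eq_integral(2)[symmetric, OF set_integrable_continuous[OF G]])
  finally show ?thesis .
qed

text \<open>The substitution \<open>z = 2 * k * (x + x0)\<close> maps the period
  \<open>pi / k\<close> of the modulus to \<open>2 * pi\<close>, and \<open>x0\<close> puts a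
  minimum of the modulus at 0. Multiplication by the phase factor turns periodic perturbations into
  ones with the multiplier of the wave; the Hessian keeps its value up to the factor
  \<open>2 * k\<close>, while the constraints are mixed by the derivative of the phase.\<close>

lemma coercive_profile_oscillating:
  assumes prof: "smooth_profile P P1 P2 P3 K" and wv: "wave W W'" and k: "k > 0"
    and WP: "\<And>x. W x = exp (\<i> * of_real (p * x)) * P (2 * k * x)"
    and W'P: "\<And>x. W' x = exp (\<i> * of_real (p * x)) * (\<i> * of_real p * P (2 * k * x) + of_real (2 * k) * P1 (2 * k * x))"
    and EL: "\<And>z. - 4 * of_real (k\<^sup>2) * P2 z + cub P z - \<i> * of_real (4 * k * p) * P1 z + of_real (p\<^sup>2 - 1) * P z = 0"
    and nonconst: "\<And>\<rho>. \<exists>x. cmod (W x) \<noteq> \<rho>" and minper: "\<And>S. 0 < S \<Longrightarrow> S < pi / k \<Longrightarrow> \<exists>x. cmod (W (x + S)) \<noteq> cmod (W x)"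
  shows "\<exists>c C. coercive_profile P P1 P2 P3 K k (4 * k * p) (p\<^sup>2 - 1) c C"
proof -
  interpret smooth_profile P P1 P2 P3 K by fact
  interpret W: wave W W' by fact
  have modW: "cmod (W x) = cmod (P (2 * k * x))" for x by (simp add: WP norm_mult)
  define T where "T = pi / k"
  have T: "T > 0" "2 * k * T = 2 * pi" using k by (auto simp: T_def)
  have "\<exists>z0\<in>{0..2*pi}. \<forall>z\<in>{0..2*pi}. cmod (P z0) \<le> cmod (P z)"
    by (intro continuous_attains_inf compact_Icc continuous_on_norm cont) auto
  then obtain z0 where z0: "\<And>z. z \<in> {0..2*pi} \<Longrightarrow> cmod (P z0) \<le> cmod (P z)" by blast
  have z0_min: "cmod (P z0) \<le> cmod (P z)" for z
    using periodic_representative[of P, OF per, of z] z0 by metis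
  define x0 where "x0 = z0 / (2 * k)"
  have kx0: "2 * k * x0 = z0" using k by (simp add: x0_def)
  define lam where "lam = exp (\<i> * of_real (p * T))"
  have lam: "cmod lam = 1" by (simp add: lam_def)
  define W0 where "W0 x = W (x + x0)" for x
  define W0' where "W0' x = W' (x + x0)" for x
  interpret O: oscillating_wave W0 W0' T lam
  proof
    show "(W0 has_vector_derivative W0' x) (at x)" for x
      unfolding W0_def[abs_def] W0'_def by (rule has_vector_derivative_shift[OF W.dW])
    show dW0': "(W0' has_vector_derivative ((cmod (W0 x))\<^sup>2 - 1) *\<^sub>R W0 x) (at x)" for x
      unfolding W0_def W0'_def[abs_def] by (rule has_vector_derivative_shift[OF W.dW'])
    show "W0 (x + T) = lam * W0 x" for x
    proof -
      have "2 * k * (x + T + x0) = 2 * k * (x + x0) + 2 * pi" unfolding T(2)[symmetric] by (simp add: algebra_simps)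
      then have "P (2 * k * (x + T + x0)) = P (2 * k * (x + x0))" using per by metis
      moreover have "exp (\<i> * of_real (p * (x + T + x0))) = lam * exp (\<i> * of_real (p * (x + x0)))"
        unfolding lam_def exp_add[symmetric] by (simp add: algebra_simps)
      ultimately show ?thesis by (simp add: W0_def WP mult.assoc)
    qed
    interpret W0: wave W0 W0' by standard fact+
    have s: "W0.s x = (cmod (W (x + x0)))\<^sup>2" for x by (simp add: W0.s_def W0_def)
    show "W0.s 0 \<le> W0.s x" for x
      unfolding s modW using z0_min[of "2 * k * (x + x0)"] kx0 by (intro power_mono) auto
    show "\<exists>x. W0.s x \<noteq> W0.s 0"
    proof -
      obtain x where "cmod (W x) \<noteq> cmod (W x0)" using nonconst by blast
      then show ?thesis unfolding s by (intro exI[of _ "x - x0"]) simp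
    qed
    show "\<exists>x. W0.s (x + R) \<noteq> W0.s x" if R: "0 < R" "R < T" for R
    proof -
      obtain x where "cmod (W (x + R)) \<noteq> cmod (W x)" using minper[OF R[unfolded T_def]] by blast
      then show ?thesis unfolding s by (intro exI[of _ "x - x0"]) (simp add: algebra_simps)
    qed
  qed (rule T(1), rule lam)
  obtain c0 C0 where c0: "c0 > 0" and C0: "C0 \<ge> 0" and coercive: "\<And>v v'. O.C1q v v' \<Longrightarrow>
    \<exists>d e. c0 * O.nrm2 (\<lambda>x. v x - O.Fam 0 0 d e x) (\<lambda>x. v' x - O.Fam' 0 0 d e x) \<le> O.Hb v v' v v' + C0 * ((O.N1 v)\<^sup>2 + (O.M2 v)\<^sup>2)"
    using O.coercive by metis
  define M where "M = 1 + (2 + 2 * p\<^sup>2) / (4 * k\<^sup>2)"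
  have M: "M \<ge> 1" unfolding M_def using k by simp
  define c where "c = c0 / M"
  \<comment> \<open>With the pairings \<open>\<alpha>\<close> and \<open>\<beta>\<close> introduced
    below, the moments are \<open>\<alpha>\<close> and
    \<open>- p * \<alpha> - 2 * k * \<beta>\<close> over \<open>2 * k\<close>; the bracket bounds
    the sum of the squares of these numerators by
    \<open>\<alpha>\<^sup>2 + \<beta>\<^sup>2\<close>.\<close>
  define C where "C = C0 / (2 * k) * (1 + 2 * p\<^sup>2 + 8 * k\<^sup>2)"
  have cC: "c > 0" "C \<ge> 0" using c0 C0 M k by (auto simp: c_def C_def)
  have "coercive_profile P P1 P2 P3 K k (4 * k * p) (p\<^sup>2 - 1) c C"
  proof
    fix v v' :: "real \<Rightarrow> complex"
    assume v: "\<And>x. (v has_vector_derivative v' x) (at x)" "continuous_on UNIV v'" "\<And>x. v (x + 2 * pi) = v x"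
    have pv: "ppair v v'" using wpair_C1[OF v(1,2)] v(3) by (simp add: ppair_def)
    note Lv = ppair_L2[OF pv]
    have cv: "continuous_on UNIV v" by (rule ppairD[OF pv])
    have per_v': "v' (z + 2 * pi) = v' z" for z using quasiperiodic_derivative[OF v(1), of "2 * pi" 1] v(3) by simp
    have per_P2: "P2 (z + 2 * pi) = P2 z" for z using quasiperiodic_derivative[OF dP1, of "2 * pi" 1] per1 by simp
    define E where "E x = exp (\<i> * of_real (p * (x + x0)))" for x
    have E: "cmod (E x) = 1" for x by (simp add: E_def)
    define \<zeta> where "\<zeta> x = 2 * k * (x + x0)" for x
    define y where "y x = E x * v (\<zeta> x)" for x
    define y' where "y' x = E x * (\<i> * of_real p * v (\<zeta> x) + of_real (2 * k) * v' (\<zeta> x))" for x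
    have W0: "W0 x = E x * P (\<zeta> x)" and W0': "W0' x = E x * (\<i> * of_real p * P (\<zeta> x) + of_real (2 * k) * P1 (\<zeta> x))" for x
      by (simp_all add: W0_def W0'_def WP W'P E_def \<zeta>_def)
    have \<zeta>T: "\<zeta> (x + T) = \<zeta> x + 2 * pi" for x
      unfolding T(2)[symmetric] \<zeta>_def by (simp add: algebra_simps)
    have ET: "E (x + T) = lam * E x" for x unfolding E_def lam_def exp_add[symmetric] by (simp add: algebra_simps)
    have "O.C1q y y'"
      unfolding O.C1q_def
    proof (intro conjI allI)
      show "(y has_vector_derivative y' x) (at x)" for x
        using has_vector_derivative_shift[OF derivative_phase_shift[OF v(1), of p 0 "2 * k" "x + x0"]]
        by (simp add: y_def[abs_def] y'_def E_def \<zeta>_def add.commute)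
      have cz: "continuous_on UNIV (\<lambda>x. v (\<zeta> x))" "continuous_on UNIV (\<lambda>x. v' (\<zeta> x))"
        unfolding \<zeta>_def by (rule continuous_on_compose2[OF cv] continuous_on_compose2[OF v(2)]; auto intro!: continuous_intros)+
      show "continuous_on UNIV y'" unfolding y'_def[abs_def] E_def by (intro continuous_intros cz)
      show "y (x + T) = lam * y x" for x by (simp add: y_def ET \<zeta>T v(3) mult.assoc)
    qed
    from coercive[OF this] obtain d e where
      co: "c0 * O.nrm2 (\<lambda>x. y x - O.Fam 0 0 d e x) (\<lambda>x. y' x - O.Fam' 0 0 d e x) \<le> O.Hb y y' y y' + C0 * ((O.N1 y)\<^sup>2 + (O.M2 y)\<^sup>2)"
      by blast
    define \<alpha> \<beta> where "\<alpha> = Re (inner_per v P)" and "\<beta> = Im (inner_per P1 v)"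
    note cP = cont[of UNIV]
    have Hb: "O.Hb y y' y y' = Hess k (4 * k * p) (p\<^sup>2 - 1) P v v' / (2 * k)"
    proof -
      define G1 where "G1 z = 4 * k\<^sup>2 * (cmod (v' z))\<^sup>2" for z
      define G2 where "G2 z = 2 * (cmod (P z * v z))\<^sup>2" for z
      define G3 where "G3 z = Re ((cnj (P z) * v z)\<^sup>2)" for z
      define G4 where "G4 z = 4 * k * p * Im (v' z * cnj (v z))" for z
      define G5 where "G5 z = (p\<^sup>2 - 1) * (cmod (v z))\<^sup>2" for z
      define G where "G z = (((G1 z + G2 z) + G3 z) + G4 z) + G5 z" for z
      have c: "continuous_on UNIV G1" "continuous_on UNIV G2" "continuous_on UNIV G3" "continuous_on UNIV G4" "continuous_on UNIV G5"
        unfolding G1_def G2_def G3_def G4_def G5_def by (intro continuous_intros cv v(2) cP)+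
      note i = set_integrable_continuous[OF c(1), of 0 "2 * pi"] set_integrable_continuous[OF c(2), of 0 "2 * pi"]
        set_integrable_continuous[OF c(3), of 0 "2 * pi"] set_integrable_continuous[OF c(4), of 0 "2 * pi"] set_integrable_continuous[OF c(5), of 0 "2 * pi"]
      have cG: "continuous_on UNIV G" unfolding G_def by (intro continuous_on_add c)
      have "y' x \<bullet> y' x + (O.s x - 1) * (y x \<bullet> y x) + 2 * (W0 x \<bullet> y x) * (W0 x \<bullet> y x) = G (\<zeta> x)" for x
      proof -
        have s: "O.s x = (cmod (P (\<zeta> x)))\<^sup>2" by (simp add: O.s_def W0 norm_mult E)
        show ?thesis unfolding s y_def y'_def W0 inner_mult_unit[OF E] G_def G1_def G2_def G3_def G4_def G5_def cmod_power2
          by (simp add: inner_complex_def power2_eq_square algebra_simps)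
      qed
      then have "O.Hb y y' y y' = integral {0..pi / k} (\<lambda>x. G (2 * k * (x + x0)))"
        unfolding O.Hb_def by (simp add: T_def \<zeta>_def)
      also have "\<dots> = (LBINT z:{0..2*pi}. G z) / (2 * k)"
        by (rule integral_rescaled_period[OF cG _ k]) (simp add: G_def G1_def G2_def G3_def G4_def G5_def per v(3) per_v')
      also have "(LBINT z:{0..2*pi}. G z) = (LBINT z:{0..2*pi}. G1 z) + (LBINT z:{0..2*pi}. G2 z) + (LBINT z:{0..2*pi}. G3 z)
          + (LBINT z:{0..2*pi}. G4 z) + (LBINT z:{0..2*pi}. G5 z)"
        unfolding G_def by (simp only: set_integral_add i)
      also have "\<dots> = Hess k (4 * k * p) (p\<^sup>2 - 1) P v v'"
        unfolding Hess_def G1_def G2_def G3_def G4_def G5_def cross_def l2_sq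
          set_integral_Re[OF cross_integrable[OF cP(1) Lv(1), unfolded]] inner_per_def set_integral_Im[OF ip_int[OF Lv(2,1)]]
        by simp
      finally show ?thesis .
    qed
    have N1: "O.N1 y = \<alpha> / (2 * k)"
    proof -
      define G where "G z = Re (v z * cnj (P z))" for z
      have cG: "continuous_on UNIV G" unfolding G_def by (intro continuous_intros cv cP)
      have "W0 x \<bullet> y x = G (\<zeta> x)" for x
        unfolding y_def W0 inner_mult_unit[OF E] G_def by (simp add: inner_complex_def algebra_simps)
      then have "O.N1 y = integral {0..pi / k} (\<lambda>x. G (2 * k * (x + x0)))" unfolding O.N1_def by (simp add: T_def \<zeta>_def)
      also have "\<dots> = (LBINT z:{0..2*pi}. G z) / (2 * k)"
        by (rule integral_rescaled_period[OF cG _ k]) (simp add: G_def per v(3))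
      finally show ?thesis unfolding G_def \<alpha>_def ip_Re[OF Lv(1) LP(1)] .
    qed
    have M2: "O.M2 y = (- p * \<alpha> - 2 * k * \<beta>) / (2 * k)"
    proof -
      define G1 where "G1 z = - p * Re (v z * cnj (P z))" for z
      define G2 where "G2 z = 2 * k * Im (P1 z * cnj (v z))" for z
      have c: "continuous_on UNIV G1" "continuous_on UNIV G2" unfolding G1_def G2_def by (intro continuous_intros cv cP)+
      have cG: "continuous_on UNIV (\<lambda>z. G1 z - G2 z)" by (intro continuous_on_diff c)
      have "(\<i> * W0' x) \<bullet> y x = G1 (\<zeta> x) - G2 (\<zeta> x)" for x
      proof -
        have "\<i> * W0' x = E x * (\<i> * (\<i> * of_real p * P (\<zeta> x) + of_real (2 * k) * P1 (\<zeta> x)))" by (simp add: W0')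
        then show ?thesis unfolding y_def G1_def G2_def
          by (simp only: inner_mult_unit[OF E]) (simp add: inner_complex_def algebra_simps)
      qed
      then have "O.M2 y = integral {0..pi / k} (\<lambda>x. G1 (2 * k * (x + x0)) - G2 (2 * k * (x + x0)))" unfolding O.M2_def by (simp add: T_def \<zeta>_def)
      also have "\<dots> = (LBINT z:{0..2*pi}. G1 z - G2 z) / (2 * k)"
        by (rule integral_rescaled_period[OF cG _ k]) (simp add: G1_def G2_def per v(3) per1)
      also have "(LBINT z:{0..2*pi}. G1 z - G2 z) = (LBINT z:{0..2*pi}. G1 z) - (LBINT z:{0..2*pi}. G2 z)"
        by (rule set_integral_diff(2)[OF set_integrable_continuous[OF c(1)] set_integrable_continuous[OF c(2)]])
      also have "\<dots> = - p * \<alpha> - 2 * k * \<beta>"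
        unfolding G1_def G2_def \<alpha>_def ip_Re[OF Lv(1) LP(1)]
        unfolding \<beta>_def inner_per_def set_integral_Im[OF ip_int[OF LP(2) Lv(1)]]
        by (simp only: set_integral_mult_right)
      finally show ?thesis .
    qed
    \<comment> \<open>\<open>d * W0' + e * \<i> * W0\<close> is the phase factor times
      \<open>2 * k * d * P1 + \<i> * (e + d * p) * P\<close>: a translation of the wave also rotates
      the profile.\<close>
    define d' e' where "d' = 2 * k * d" and "e' = e + d * p"
    define u where "u z = v z - (of_real d' * P1 z + \<i> * of_real e' * P z)" for z
    define u' where "u' z = v' z - (of_real d' * P2 z + \<i> * of_real e' * P1 z)" for z
    have pu: "ppair u u'" unfolding u_def u'_def by (intro ppair_diff ppair_add ppair_cmult pv pP pP1)
    define g where "g z = \<i> * of_real p * u z + of_real (2 * k) * u' z" for z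
    have Lg: "g \<in> L2_loc" unfolding g_def[abs_def] by (intro L2_loc_add L2_loc_cmult ppair_L2[OF pu])
    have cu: "continuous_on UNIV u" "continuous_on UNIV u'" unfolding u_def[abs_def] u'_def[abs_def] by (intro continuous_intros cv v(2) cP)+
    have nrm2: "O.nrm2 (\<lambda>x. y x - O.Fam 0 0 d e x) (\<lambda>x. y' x - O.Fam' 0 0 d e x) = ((nrm u)\<^sup>2 + (nrm g)\<^sup>2) / (2 * k)"
    proof -
      define G1 where "G1 z = (cmod (u z))\<^sup>2" for z
      define G2 where "G2 z = (cmod (g z))\<^sup>2" for z
      have c: "continuous_on UNIV G1" "continuous_on UNIV G2" unfolding G1_def G2_def g_def by (intro continuous_intros cu)+
      have cG: "continuous_on UNIV (\<lambda>z. G1 z + G2 z)" by (intro continuous_on_add c)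
      have 1: "y x - O.Fam 0 0 d e x = E x * u (\<zeta> x)" for x
        by (simp add: O.Fam_def y_def W0 W0' u_def d'_def e'_def scaleR_conv_of_real algebra_simps)
      have 2: "y' x - O.Fam' 0 0 d e x = E x * g (\<zeta> x)" for x
      proof -
        have s: "O.s x = (cmod (P (\<zeta> x)))\<^sup>2" by (simp add: O.s_def W0 norm_mult E)
        have eq: "cub P (\<zeta> x) = 4 * of_real (k\<^sup>2) * P2 (\<zeta> x) + \<i> * of_real (4 * k * p) * P1 (\<zeta> x) - of_real (p\<^sup>2 - 1) * P (\<zeta> x)"
          using EL[of "\<zeta> x"] by (simp add: algebra_simps add_eq_0_iff)
        have "(O.s x - 1) *\<^sub>R W0 x = E x * (cub P (\<zeta> x) - P (\<zeta> x))"
          unfolding s W0 cub_def by (simp add: scaleR_conv_of_real algebra_simps)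
        also have "\<dots> = E x * (4 * of_real (k\<^sup>2) * P2 (\<zeta> x) + \<i> * of_real (4 * k * p) * P1 (\<zeta> x) - of_real (p\<^sup>2) * P (\<zeta> x))"
          unfolding eq by (simp add: algebra_simps)
        finally have W0'': "(O.s x - 1) *\<^sub>R W0 x = E x * (4 * of_real (k\<^sup>2) * P2 (\<zeta> x) + \<i> * of_real (4 * k * p) * P1 (\<zeta> x) - of_real (p\<^sup>2) * P (\<zeta> x))" .
        show ?thesis unfolding O.Fam'_def W0''
          by (simp add: y'_def W0' g_def u_def u'_def d'_def e'_def scaleR_conv_of_real power2_eq_square algebra_simps)
      qed
      have "(y x - O.Fam 0 0 d e x) \<bullet> (y x - O.Fam 0 0 d e x) + (y' x - O.Fam' 0 0 d e x) \<bullet> (y' x - O.Fam' 0 0 d e x) = G1 (\<zeta> x) + G2 (\<zeta> x)" for x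
        unfolding 1 2 inner_mult_unit[OF E] G1_def G2_def by (simp add: power2_norm_eq_inner)
      then have "O.nrm2 (\<lambda>x. y x - O.Fam 0 0 d e x) (\<lambda>x. y' x - O.Fam' 0 0 d e x) = integral {0..pi / k} (\<lambda>x. G1 (2 * k * (x + x0)) + G2 (2 * k * (x + x0)))"
        unfolding O.nrm2_def by (simp add: T_def \<zeta>_def)
      also have "\<dots> = (LBINT z:{0..2*pi}. G1 z + G2 z) / (2 * k)"
        by (rule integral_rescaled_period[OF cG _ k]) (simp add: G1_def G2_def g_def u_def u'_def per v(3) per1 per_v' per_P2)
      also have "(LBINT z:{0..2*pi}. G1 z + G2 z) = (nrm u)\<^sup>2 + (nrm g)\<^sup>2"
        unfolding set_integral_add(2)[OF set_integrable_continuous[OF c(1)] set_integrable_continuous[OF c(2)]] by (simp add: G1_def[abs_def] G2_def[abs_def] l2_sq)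
      finally show ?thesis .
    qed
    have nX: "(norm_X u)\<^sup>2 \<le> M * ((nrm u)\<^sup>2 + (nrm g)\<^sup>2)"
    proof -
      have "2 * k * nrm u' = nrm (\<lambda>z. of_real (2 * k) * u' z)" unfolding l2_cmult norm_of_real using k by simp
      also have "(\<lambda>z. of_real (2 * k) * u' z) = (\<lambda>z. g z - \<i> * of_real p * u z)" by (simp add: g_def)
      also have "nrm \<dots> \<le> nrm g + nrm (\<lambda>z. \<i> * of_real p * u z)" by (rule l2_triangle_diff[OF Lg L2_loc_cmult[OF ppair_L2(1)[OF pu]]])
      also have "nrm (\<lambda>z. \<i> * of_real p * u z) = \<bar>p\<bar> * nrm u" unfolding l2_cmult by (simp add: norm_mult)
      finally have "(2 * k * nrm u')\<^sup>2 \<le> (nrm g + \<bar>p\<bar> * nrm u)\<^sup>2" using k by (intro power_mono) (auto simp: l2_nonneg)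
      also have "\<dots> \<le> 2 * (nrm g)\<^sup>2 + 2 * (\<bar>p\<bar> * nrm u)\<^sup>2"
        using zero_le_power2[of "nrm g - \<bar>p\<bar> * nrm u"] by (simp add: power2_eq_square algebra_simps)
      also have "\<dots> \<le> (2 + 2 * p\<^sup>2) * ((nrm u)\<^sup>2 + (nrm g)\<^sup>2)" by (simp add: power_mult_distrib algebra_simps)
      finally have "(nrm u')\<^sup>2 \<le> (2 + 2 * p\<^sup>2) / (4 * k\<^sup>2) * ((nrm u)\<^sup>2 + (nrm g)\<^sup>2)"
        using k by (simp add: field_simps power_mult_distrib)
      moreover have "(norm_X u)\<^sup>2 = (nrm u)\<^sup>2 + (nrm u')\<^sup>2" unfolding norm_X_eq[OF pu] by simp
      moreover have "0 \<le> (nrm g)\<^sup>2" by simp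
      ultimately show ?thesis unfolding M_def distrib_right mult_1_left by linarith
    qed
    have "c * (norm_X u)\<^sup>2 \<le> c0 / M * (M * ((nrm u)\<^sup>2 + (nrm g)\<^sup>2))"
      unfolding c_def using nX c0 M by (intro mult_left_mono) auto
    also have "\<dots> = 2 * k * (c0 * (((nrm u)\<^sup>2 + (nrm g)\<^sup>2) / (2 * k)))" using M k by simp
    also have "\<dots> \<le> 2 * k * (Hess k (4 * k * p) (p\<^sup>2 - 1) P v v' / (2 * k) + C0 * ((\<alpha> / (2 * k))\<^sup>2 + ((- p * \<alpha> - 2 * k * \<beta>) / (2 * k))\<^sup>2))"
      using co k unfolding Hb N1 M2 nrm2 by (intro mult_left_mono) auto
    also have "\<dots> = Hess k (4 * k * p) (p\<^sup>2 - 1) P v v' + C0 / (2 * k) * (\<alpha>\<^sup>2 + (- p * \<alpha> - 2 * k * \<beta>)\<^sup>2)"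
      using k by (simp add: power_divide field_simps power2_eq_square)
    also have "\<dots> \<le> Hess k (4 * k * p) (p\<^sup>2 - 1) P v v' + C0 / (2 * k) * ((1 + 2 * p\<^sup>2 + 8 * k\<^sup>2) * (\<alpha>\<^sup>2 + \<beta>\<^sup>2))"
    proof (intro add_left_mono mult_left_mono)
      have "\<alpha>\<^sup>2 + (- p * \<alpha> - 2 * k * \<beta>)\<^sup>2 + (p * \<alpha> - 2 * k * \<beta>)\<^sup>2 = \<alpha>\<^sup>2 + 2 * (p\<^sup>2 * \<alpha>\<^sup>2) + 8 * (k\<^sup>2 * \<beta>\<^sup>2)" by (simp add: power2_eq_square algebra_simps)
      moreover have "(1 + 2 * p\<^sup>2 + 8 * k\<^sup>2) * (\<alpha>\<^sup>2 + \<beta>\<^sup>2) = \<alpha>\<^sup>2 + 2 * (p\<^sup>2 * \<alpha>\<^sup>2) + 8 * (k\<^sup>2 * \<beta>\<^sup>2) + (\<beta>\<^sup>2 + 2 * (p\<^sup>2 * \<beta>\<^sup>2) + 8 * (k\<^sup>2 * \<alpha>\<^sup>2))" by (simp add: algebra_simps)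
      moreover have "0 \<le> \<beta>\<^sup>2 + 2 * (p\<^sup>2 * \<beta>\<^sup>2) + 8 * (k\<^sup>2 * \<alpha>\<^sup>2)" by simp
      ultimately show "\<alpha>\<^sup>2 + (- p * \<alpha> - 2 * k * \<beta>)\<^sup>2 \<le> (1 + 2 * p\<^sup>2 + 8 * k\<^sup>2) * (\<alpha>\<^sup>2 + \<beta>\<^sup>2)"
        using zero_le_power2[of "p * \<alpha> - 2 * k * \<beta>"] by linarith
    qed (use C0 k in simp)
    finally show "\<exists>d e. c * (norm_X (\<lambda>z. v z - (of_real d * P1 z + \<i> * of_real e * P z)))\<^sup>2
      \<le> Hess k (4 * k * p) (p\<^sup>2 - 1) P v v' + C * ((Re (inner_per v P))\<^sup>2 + (Im (inner_per P1 v))\<^sup>2)"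
      unfolding u_def[abs_def] C_def \<alpha>_def \<beta>_def by (intro exI[of _ d'] exI[of _ e']) (simp add: mult.assoc)
  qed (use cC EL in auto)
  then show ?thesis by blast
qed

theorem theorem1:
  fixes W Qper :: "real \<Rightarrow> complex" and p k :: real
  assumes "stationary_NLS W"
    and "k > 0"
    and "Qper \<in> H1_per"
    and "\<forall>x. W x = exp (\<i> * of_real (p * x)) * Qper (2 * k * x)"
    and "\<not> (\<lambda>x. cmod (W x)) constant_on UNIV \<longrightarrow>
           (\<exists>T. minimal_period (\<lambda>x. cmod (W x)) T \<and> k = pi / T)"
  shows "\<exists>C0>0. \<exists>\<epsilon>0>0. \<forall>R\<in>H1_per. norm_X R \<le> \<epsilon>0 \<longrightarrow>
    (\<forall>(U :: real \<Rightarrow> real \<Rightarrow> complex) (Q :: real \<Rightarrow> real \<Rightarrow> complex).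
       solves_NLS_in_X p k Q \<and>
       (\<forall>x t. U x t = exp (\<i> * of_real (p * x - t)) * Q t (2 * k * x)) \<and>
       (\<forall>x. U x 0 = exp (\<i> * of_real (p * x)) * (Qper (2 * k * x) + R (2 * k * x))) \<longrightarrow>
       (\<forall>t. (INF (\<phi>, \<xi>) \<in> {0..2*pi} \<times> {0..2*pi}.
                norm_X (\<lambda>z. Q t z - exp (\<i> * of_real \<phi>) * Qper (z - \<xi>)))
             \<le> C0 * norm_X R))"
proof -
  note k = assms(2)
  have WP: "W x = exp (\<i> * of_real (p * x)) * Qper (2 * k * x)" for x using assms(4) by blast
  have per: "Qper (z + 2 * pi) = Qper z" for z using assms(3) by (simp add: H1_per_def)
  obtain W' W'' where W: "\<And>x. (W has_vector_derivative W' x) (at x)" "\<And>x. (W' has_vector_derivative W'' x) (at x)"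
    "\<And>x. W'' x + W x - of_real ((cmod (W x))\<^sup>2) * W x = 0"
    using assms(1) unfolding stationary_NLS_def by metis
  have W'': "W'' x = ((cmod (W x))\<^sup>2 - 1) *\<^sub>R W x" for x
    using W(3)[of x] by (simp add: scaleR_conv_of_real algebra_simps add_eq_0_iff)
  interpret wave W W' by standard (use W(1,2) W'' in auto)
  obtain P1 P2 P3 K where prof: "smooth_profile Qper P1 P2 P3 K"
    and W'P: "\<And>x. W' x = exp (\<i> * of_real (p * x)) * (\<i> * of_real p * Qper (2 * k * x) + of_real (2 * k) * P1 (2 * k * x))"
    and EL: "\<And>z. - 4 * of_real (k\<^sup>2) * P2 z + cub Qper z - \<i> * of_real (4 * k * p) * P1 z + of_real (p\<^sup>2 - 1) * Qper z = 0"
    using profile_exists[OF k per WP] by metis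
  have rescale: "2 * k * (z / (2 * k)) = z" for z using k by simp
  have modW: "cmod (W (z / (2 * k))) = cmod (Qper z)" for z unfolding WP rescale by (simp add: norm_mult)
  have "\<exists>P1 P2 P3 K a b c C. coercive_profile Qper P1 P2 P3 K k a b c C"
  proof (cases "(\<lambda>x. cmod (W x)) constant_on UNIV")
    case True
    then obtain \<rho> where \<rho>: "\<And>x. cmod (W x) = \<rho>" unfolding constant_on_def by auto
    have mod: "cmod (Qper z) = \<rho>" for z using \<rho> modW by metis
    show ?thesis
    proof (cases "\<rho> = 0")
      case True
      then have "Qper = (\<lambda>_. 0)" using mod by auto
      moreover obtain c where "coercive_profile (\<lambda>_. 0) (\<lambda>_. 0) (\<lambda>_. 0) (\<lambda>_. 0) 0 k 0 1 c 0"
        using coercive_profile_zero[of k] k by auto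
      ultimately show ?thesis by metis
    next
      case False
      then have \<rho>0: "\<rho> > 0" using mod[of 0] by (metis norm_ge_zero order_le_less)
      \<comment> \<open>Constant modulus makes \<open>W \<bullet> W'\<close> vanish, so that
        \<open>cnj W * W'\<close> is purely imaginary with imaginary part \<open>J\<close>.\<close>
      have "W' x = \<i> * of_real (J / \<rho>\<^sup>2) * W x" for x
      proof -
        have "s = (\<lambda>_. \<rho>\<^sup>2)" by (simp add: s_def \<rho> fun_eq_iff)
        then have "(s has_real_derivative 0) (at x)" by simp
        then have "ds x = 0" using ds DERIV_unique by blast
        then have "cnj (W x) * W' x = \<i> * of_real J"
          using J_eq[of x] by (simp add: ds_def inner_complex_def complex_eq_iff)
        then have "of_real (\<rho>\<^sup>2) * W' x = \<i> * of_real J * W x"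
          using complex_norm_square[of "W x"] unfolding \<rho> by (metis mult.assoc mult.commute)
        then show ?thesis using False by (simp add: field_simps)
      qed
      then obtain j where W': "\<And>x. W' x = \<i> * of_real j * W x" by blast
      have "P1 z = \<i> * of_real ((j - p) / (2 * k)) * Qper z" for z
      proof -
        define x e where "x = z / (2 * k)" and "e = exp (\<i> * of_real (p * x))"
        have "e * (\<i> * of_real p * Qper z + of_real (2 * k) * P1 z) = \<i> * of_real j * (e * Qper z)"
          using W'P[of x] W'[of x] WP[of x] rescale[of z] by (simp add: x_def[symmetric] e_def[symmetric])
        then have "e * (of_real (2 * k) * P1 z) = e * (\<i> * of_real (j - p) * Qper z)"
          by (simp add: algebra_simps)
        then have "of_real (2 * k) * P1 z = \<i> * of_real (j - p) * Qper z" by (simp add: e_def)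
        moreover have "P1 z = of_real (1 / (2 * k)) * (of_real (2 * k) * P1 z)" using k by simp
        ultimately show ?thesis using k by (simp add: field_simps)
      qed
      from coercive_profile_constant_modulus[OF prof k \<rho>0 mod this] show ?thesis by blast
    qed
  next
    case False
    then obtain T where T: "minimal_period (\<lambda>x. cmod (W x)) T" "k = pi / T" using assms(5) by blast
    then have T': "T = pi / k" by (simp add: minimal_period_def)
    have "\<exists>c C. coercive_profile Qper P1 P2 P3 K k (4 * k * p) (p\<^sup>2 - 1) c C"
    proof (rule coercive_profile_oscillating[OF prof wave_axioms k WP W'P EL])
      show "\<exists>x. cmod (W x) \<noteq> \<rho>" for \<rho> using False unfolding constant_on_def by auto
      show "\<exists>x. cmod (W (x + S)) \<noteq> cmod (W x)" if "0 < S" "S < pi / k" for S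
        using T(1) that unfolding minimal_period_def T' by blast
    qed
    then show ?thesis by blast
  qed
  then obtain P1 P2 P3 K a b c C where "coercive_profile Qper P1 P2 P3 K k a b c C" by blast
  then interpret coercive_profile Qper P1 P2 P3 K k a b c C .
  obtain C0 \<epsilon> where C0: "C0 > 0" "\<epsilon> > 0" and stable: "\<And>R p Q t. norm_X R \<le> \<epsilon> \<Longrightarrow> solves_NLS_in_X p k Q \<Longrightarrow> Q 0 = (\<lambda>z. Qper z + R z) \<Longrightarrow> dst (Q t) \<le> C0 * norm_X R"
    using orbital_stability by blast
  have "(INF (\<phi>, \<xi>) \<in> {0..2*pi} \<times> {0..2*pi}. norm_X (\<lambda>z. Q t z - exp (\<i> * of_real \<phi>) * Qper (z - \<xi>))) \<le> C0 * norm_X R"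
    if R: "norm_X R \<le> \<epsilon>" and Q: "solves_NLS_in_X p k Q" and U: "\<And>x t. U x t = exp (\<i> * of_real (p * x - t)) * Q t (2 * k * x)"
      "\<And>x. U x 0 = exp (\<i> * of_real (p * x)) * (Qper (2 * k * x) + R (2 * k * x))" for R U Q t
  proof -
    \<comment> \<open>At time 0 the phase factors of the two expressions for \<open>U\<close> agree,
      and \<open>x = z / (2 * k)\<close> reaches every \<open>z\<close>.\<close>
    have "Q 0 z = Qper z + R z" for z
      using U(1)[of "z / (2 * k)" 0] U(2)[of "z / (2 * k)"] unfolding rescale by simp
    then have "dst (Q t) \<le> C0 * norm_X R" by (intro stable[OF R Q]) auto
    then show ?thesis unfolding dst_def box_def orb_def .
  qed
  then show ?thesis using C0 by blast
qed

end
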